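(* Let $f\in L^2(\mathbb{R}^2)$ be such that $\operatorname{supp} f$ is a compact subset of $\mathbb{R}^2\setminus B_1$ and $\int_{\mathbb{R}^2}f=0$. For $0<\delta<1$ let $u_\delta\in W^1(\mathbb{R}^2)$ be the unique solution converging to $0$ as $|x|\to\infty$ to $$\operatorname{div}(\varepsilon_\delta\nabla u_\delta)=f\ \text{ in }\mathbb{R}^2.$$ Then: 1. (Case 1) If $f$ is compatible, then, for $0<\delta<1$, $$u_\delta=U:=\begin{cases} w\circ F-w(0) & \text{in }\mathbb{R}^2\setminus B_1,\\ -w(0) & \text{in }B_1,\end{cases}$$ where $w\in H^1(B_1)$ is the solution to the Cauchy problem $\Delta w=F_*f$ in $B_1$, $\partial_\nu w=w=0$ on $\partial B_1$. 2. (Case 2) If $f$ is not compatible, then $$0<\liminf_{\delta\to0_+}\delta^2\int_O|\nabla u_\delta|^2\,dx\le\limsup_{\delta\to0_+}\delta^2\int_O|\nabla u_\delta|^2\,dx<+\infty$$ for any nonempty open subset $O$ of $\mathbb{R}^2$.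
   Context: Functions are complex-valued. $B_r$ denotes the ball in $\mathbb{R}^2$ centred at the origin of radius $r>0$. $$W^1(\mathbb{R}^2)=\Big\{u\in L^2_{loc}(\mathbb{R}^2):\ \nabla u\in[L^2(\mathbb{R}^2)]^2\ \text{ and }\ \frac{u}{|x|\log(2+|x|)}\in L^2(\mathbb{R}^2)\Big\}.$$ For a diffeomorphism $T$ from $D_1$ onto $D_2$, with $x=T^{-1}(y)$ and $J(x)=|\det DT(x)|$, set $$T_*a(y)=\frac{DT(x)\,a(x)\,DT(x)^{T}}{J(x)},\qquad T_*f(y)=\frac{f(x)}{J(x)}$$ for matrix-valued $a\in[L^\infty(D_1)]^{2\times2}$ and $f\in L^2(D_1)$. Let $F(x)=x/|x|^2$ be the Kelvin transform with respect to $\partial B_1$, mapping $\mathbb{R}^2\setminus B_1$ onto $\bar B_1\setminus\{0\}$. (For $f$ with compact support, $F_*f$ vanishes near the origin.) For $0\le\delta<1$ set $\varepsilon_\delta=(F^{-1})_*I$ for $|x|>1$ and $\varepsilon_\delta=-1+i\delta$ for $|x|<1$; in dimension two $(F^{-1})_*I=I$, so $$\varepsilon_\delta(x)=\begin{cases}1 & \text{if }|x|>1,\\ -1+i\delta & \text{if }|x|<1.\end{cases}$$ Compatibility: $f\in L^2(\mathbb{R}^2)$ with $\operatorname{supp} f\subset\mathbb{R}^2\setminus B_1$ is said to be compatible if and only if there exists a solution $w\in H^1(B_1)$ to the Cauchy problem $$\Delta w=F_*f\ \text{ in }B_1,\qquad \partial_\nu w=w=0\ \text{ on }\partial B_1,$$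 where $\nu$ is the unit normal on $\partial B_1$. Otherwise $f$ is not compatible. *)

theory Defs
  imports "HOL-Analysis.Analysis"
begin

definition grad :: "(real^'n \<Rightarrow> complex) \<Rightarrow> real^'n \<Rightarrow> complex^'n" where
  "grad f x = (\<chi> i. frechet_derivative f (at x) (axis i 1))"

primrec Ck :: "nat \<Rightarrow> (real^'n \<Rightarrow> complex) \<Rightarrow> bool" where
  "Ck 0 f \<longleftrightarrow> continuous_on UNIV f"
| "Ck (Suc k) f \<longleftrightarrow> (\<forall>x. f differentiable (at x)) \<and> (\<forall>i. Ck k (\<lambda>x. grad f x $ i))"

definition test_function :: "(real^'n) set \<Rightarrow> (real^'n \<Rightarrow> complex) \<Rightarrow> bool" where
  "test_function D \<phi> \<longleftrightarrow>
     (\<forall>k. Ck k \<phi>) \<and> compact (closure {x. \<phi> x \<noteq> 0}) \<and> closure {x. \<phi> x \<noteq> 0} \<subseteq> D"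

text \<open>Elements of Lebesgue and Sobolev spaces are represented by functions on the whole space,
  of which only the values almost everywhere on the domain \<open>D\<close> matter.\<close>

definition L2 :: "(real^'n) set \<Rightarrow> (real^'n \<Rightarrow> 'b::euclidean_space) \<Rightarrow> bool" where
  "L2 D u \<longleftrightarrow> u \<in> borel_measurable (lebesgue_on D) \<and>
     integrable (lebesgue_on D) (\<lambda>x. (norm (u x))\<^sup>2)"

definition L2_loc :: "(real^'n) set \<Rightarrow> (real^'n \<Rightarrow> 'b::euclidean_space) \<Rightarrow> bool" where
  "L2_loc D u \<longleftrightarrow> (\<forall>K. compact K \<and> K \<subseteq> D \<longrightarrow> L2 K u)"

definition L1_loc :: "(real^'n) set \<Rightarrow> (real^'n \<Rightarrow> 'b::euclidean_space) \<Rightarrow> bool" where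
  "L1_loc D u \<longleftrightarrow> (\<forall>K. compact K \<and> K \<subseteq> D \<longrightarrow> u absolutely_integrable_on K)"

definition has_weak_gradient ::
    "(real^'n) set \<Rightarrow> (real^'n \<Rightarrow> complex) \<Rightarrow> (real^'n \<Rightarrow> complex^'n) \<Rightarrow> bool" where
  "has_weak_gradient D u G \<longleftrightarrow> L1_loc D u \<and> L1_loc D G \<and>
     (\<forall>\<phi> i. test_function D \<phi> \<longrightarrow>
        (LINT x|lebesgue_on D. u x * grad \<phi> x $ i) = - (LINT x|lebesgue_on D. G x $ i * \<phi> x))"

definition weakly_differentiable :: "(real^'n) set \<Rightarrow> (real^'n \<Rightarrow> complex) \<Rightarrow> bool" where
  "weakly_differentiable D u \<longleftrightarrow> (\<exists>G. has_weak_gradient D u G)"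

text \<open>On an open set \<open>D\<close> the weak gradient is unique almost everywhere, so the choice below is
  immaterial.\<close>

definition wgrad ::
    "(real^'n) set \<Rightarrow> (real^'n \<Rightarrow> complex) \<Rightarrow> real^'n \<Rightarrow> complex^'n" where
  "wgrad D u = (SOME G. has_weak_gradient D u G)"

definition H1 :: "(real^'n) set \<Rightarrow> (real^'n \<Rightarrow> complex) \<Rightarrow> bool" where
  "H1 D u \<longleftrightarrow> L2 D u \<and> weakly_differentiable D u \<and> L2 D (wgrad D u)"

text \<open>\<open>H1_0 D\<close> is the closure of the test functions in \<open>H1 D\<close>.\<close>

definition H1_0 :: "(real^'n) set \<Rightarrow> (real^'n \<Rightarrow> complex) \<Rightarrow> bool" where
  "H1_0 D u \<longleftrightarrow> H1 D u \<and>
     (\<exists>\<phi> :: nat \<Rightarrow> real^'n \<Rightarrow> complex. (\<forall>n. test_function D (\<phi> n)) \<and>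
        (\<lambda>n. LINT x|lebesgue_on D. (norm (\<phi> n x - u x))\<^sup>2) \<longlonglongrightarrow> 0 \<and>
        (\<lambda>n. LINT x|lebesgue_on D. (norm (grad (\<phi> n) x - wgrad D u x))\<^sup>2) \<longlonglongrightarrow> 0)"

text \<open>The weight \<open>1 / (|x| log (2 + |x|))\<close> is a growth condition at infinity. It is imposed away
  from the origin only: close to the origin it is not square integrable in the plane, and
  imposing it there would exclude every function that is continuous and nonzero at the origin
  (constants, for instance). Local square integrability is a separate requirement.\<close>

definition W1 :: "(real^2 \<Rightarrow> complex) \<Rightarrow> bool" where
  "W1 u \<longleftrightarrow> L2_loc UNIV u \<and> weakly_differentiable UNIV u \<and> L2 UNIV (wgrad UNIV u) \<and>
     L2 (- ball 0 1) (\<lambda>x. u x / of_real (norm x * ln (2 + norm x)))"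

definition ess_supp :: "(real^'n \<Rightarrow> complex) \<Rightarrow> (real^'n) set" where
  "ess_supp f = - \<Union>{V. open V \<and> (AE x in lebesgue. x \<in> V \<longrightarrow> f x = 0)}"

definition tends_to_0_at_infinity :: "(real^'n \<Rightarrow> complex) \<Rightarrow> bool" where
  "tends_to_0_at_infinity u \<longleftrightarrow>
     (\<forall>e>0. \<exists>R. AE x in lebesgue. norm x > R \<longrightarrow> norm (u x) < e)"

text \<open>\<open>c\<close> is the value at \<open>a\<close> of a representative of \<open>u\<close> that is continuous near \<open>a\<close>.\<close>

definition has_value_at :: "(real^'n \<Rightarrow> complex) \<Rightarrow> real^'n \<Rightarrow> complex \<Rightarrow> bool" where
  "has_value_at u a c \<longleftrightarrow> (\<exists>r>0. \<exists>v. continuous_on (ball a r) v \<and>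
     (AE x in lebesgue. x \<in> ball a r \<longrightarrow> u x = v x) \<and> v a = c)"

text \<open>The pairing of vectors is bilinear (no complex conjugation).\<close>

definition cdot :: "complex^'n \<Rightarrow> complex^'n \<Rightarrow> complex" where
  "cdot v w = (\<Sum>i\<in>UNIV. v $ i * w $ i)"

text \<open>\<open>div v = h\<close> in \<open>D\<close>, in the sense of distributions.\<close>

definition weak_div ::
    "(real^'n) set \<Rightarrow> (real^'n \<Rightarrow> complex^'n) \<Rightarrow> (real^'n \<Rightarrow> complex) \<Rightarrow> bool" where
  "weak_div D v h \<longleftrightarrow> (\<forall>\<phi>. test_function D \<phi> \<longrightarrow>
     (LINT x|lebesgue_on D. cdot (v x) (grad \<phi> x)) = - (LINT x|lebesgue_on D. h x * \<phi> x))"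

text \<open>For a square integrable field \<open>v\<close> with \<open>div v = h\<close> square integrable, the normal trace of \<open>v\<close>
  on the boundary of \<open>D\<close> is defined by Green's formula: it is the functional that maps the trace
  of \<open>\<phi>\<close> in \<open>H1 D\<close> to the integral of \<open>v \<bullet> \<nabla>\<phi> + h \<phi>\<close> over \<open>D\<close>. The following says that it is zero.\<close>

definition normal_trace_0 ::
    "(real^'n) set \<Rightarrow> (real^'n \<Rightarrow> complex^'n) \<Rightarrow> (real^'n \<Rightarrow> complex) \<Rightarrow> bool" where
  "normal_trace_0 D v h \<longleftrightarrow> (\<forall>\<phi>. H1 D \<phi> \<longrightarrow>
     (LINT x|lebesgue_on D. cdot (v x) (wgrad D \<phi> x) + h x * \<phi> x) = 0)"

text \<open>The push-forward \<open>T\<^sub>* f\<close> of a function \<open>f\<close> on \<open>D\<close>, extended by zero outside \<open>T ` D\<close>.\<close>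

definition push_fun ::
    "(real^'n) set \<Rightarrow> (real^'n \<Rightarrow> real^'n) \<Rightarrow> (real^'n \<Rightarrow> complex) \<Rightarrow> real^'n \<Rightarrow> complex" where
  "push_fun D T f y =
     (if y \<in> T ` D
      then let x = inv_into D T y in f x / of_real \<bar>det (jacobian T (at x))\<bar>
      else 0)"

definition kelvin :: "real^2 \<Rightarrow> real^2" where
  "kelvin x = x /\<^sub>R (norm x)\<^sup>2"

definition kelvin_push :: "(real^2 \<Rightarrow> complex) \<Rightarrow> real^2 \<Rightarrow> complex" where
  "kelvin_push f = push_fun (- ball 0 1) kelvin f"

definition eps :: "real \<Rightarrow> real^2 \<Rightarrow> complex" where
  "eps \<delta> x = (if norm x < 1 then -1 + \<i> * of_real \<delta> else 1)"

definition is_solution :: "real \<Rightarrow> (real^2 \<Rightarrow> complex) \<Rightarrow> (real^2 \<Rightarrow> complex) \<Rightarrow> bool" where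
  "is_solution \<delta> f u \<longleftrightarrow> W1 u \<and> tends_to_0_at_infinity u \<and>
     weak_div UNIV (\<lambda>x. eps \<delta> x *s wgrad UNIV u x) f"

text \<open>\<open>w\<close> solves \<open>\<Delta>w = F\<^sub>* f\<close> in the unit disk with zero Dirichlet data (membership in \<open>H1_0\<close>) and
  zero Neumann data on the unit circle.\<close>

definition cauchy_solution :: "(real^2 \<Rightarrow> complex) \<Rightarrow> (real^2 \<Rightarrow> complex) \<Rightarrow> bool" where
  "cauchy_solution f w \<longleftrightarrow>
     H1 (ball 0 1) w \<and>
     weak_div (ball 0 1) (wgrad (ball 0 1) w) (kelvin_push f) \<and>
     normal_trace_0 (ball 0 1) (wgrad (ball 0 1) w) (kelvin_push f) \<and>
     H1_0 (ball 0 1) w"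

definition compatible :: "(real^2 \<Rightarrow> complex) \<Rightarrow> bool" where
  "compatible f \<longleftrightarrow> (\<exists>w. cauchy_solution f w)"

definition energy :: "(real^2) set \<Rightarrow> (real^2 \<Rightarrow> complex) \<Rightarrow> ennreal" where
  "energy A u = (\<integral>\<^sup>+x\<in>A. ennreal ((norm (wgrad UNIV u x))\<^sup>2) \<partial>lebesgue)"

end

(*
  Let F be the Kelvin transform, V a solution of Laplace V = f on the plane that tends to 0 at
  infinity, and K the even reflection of V in the unit circle minus V(0). Then
    u_delta = V + (2 / (i delta) - 1) K.
  Conversely, subtracting a multiple of its own reflection from u_delta removes the jump of the
  coefficient, so that V need not be constructed: it is built from any one u_delta, and by Weyl's
  lemma and Liouville's theorem it does not depend on delta. If w solves the Cauchy problem, then V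
  is w o F - w(0) outside the disk and -w(0) inside, so K = 0. In general delta grad u_delta
  converges in L^2 to -2 i grad K. If that limit vanishes on an open set, then V is constant in the
  disk by unique continuation, and (V - V(0)) o F extended by zero solves the Cauchy problem.
*)

theory Submission
  imports Defs "HOL-Complex_Analysis.Conformal_Mappings"
begin

text \<open>No traces are taken on the circle. A test function is split into its even and odd parts
  under the Kelvin transform: the even part has zero radial derivative on the circle, which removes
  the boundary values of the solution from Green's formula, and the odd part vanishes there, which
  removes the flux. Both formulas come from cutoffs inside the disk. The factor 2 / (i delta) - 1
  arises as follows. With kappa = i delta / 2 the coefficient in the disk is -1 + 2 kappa, and
  reflection reverses the normal derivative; subtracting 1 - kappa times the reflection therefore
  leaves the flux kappa times the inner normal derivative on both sides. The other obstacle is the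
  origin, the image of infinity. Transported equations are first obtained for test functions
  vanishing near it, and then extended by cutoffs whose Dirichlet energy stays bounded in the plane.
  The gradients of V and K are square integrable because V and K are linear combinations of the
  solutions for two values of delta.\<close>

section \<open>Classical gradients of complex-valued functions\<close>

text \<open>An equation for \<open>grad\<close> alone says nothing about differentiability, since
  \<open>frechet_derivative\<close> is an arbitrary choice where no derivative exists. This
  predicate carries differentiability and the value together.\<close>

definition has_grad :: "(real^'n \<Rightarrow> complex) \<Rightarrow> complex^'n \<Rightarrow> real^'n \<Rightarrow> bool" where
  "has_grad f g x \<longleftrightarrow> (f has_derivative (\<lambda>h. \<Sum>i\<in>UNIV. (h $ i) *\<^sub>R (g $ i))) (at x)"

lemma grad_eqI: "has_grad f g x \<Longrightarrow> grad f x = g"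
  unfolding has_grad_def grad_def
  by (simp add: frechet_derivative_at[symmetric] vec_eq_iff axis_def if_distribR if_distrib[of "\<lambda>c. c *\<^sub>R _"] cong: if_cong)

lemma has_grad_imp_differentiable: "has_grad f g x \<Longrightarrow> f differentiable (at x)"
  unfolding has_grad_def by (auto simp: differentiable_def)

lemma linear_eq_sum_axis:
  fixes L :: "real^'n \<Rightarrow> 'b::real_vector"
  assumes "linear L"
  shows "L h = (\<Sum>i\<in>UNIV. (h $ i) *\<^sub>R L (axis i 1))"
proof -
  have "h = (\<Sum>i\<in>UNIV. (h $ i) *\<^sub>R axis i 1)"
    using basis_expansion[of h] by (simp add: scalar_mult_eq_scaleR)
  then have "L h = L (\<Sum>i\<in>UNIV. (h $ i) *\<^sub>R axis i 1)"
    by simp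
  also have "\<dots> = (\<Sum>i\<in>UNIV. (h $ i) *\<^sub>R L (axis i 1))"
    using assms by (simp add: linear_sum linear_scale)
  finally show ?thesis .
qed

lemma differentiable_imp_has_grad:
  assumes "f differentiable (at x)"
  shows "has_grad f (grad f x) x"
proof -
  have d: "(f has_derivative frechet_derivative f (at x)) (at x)"
    using assms frechet_derivative_works by blast
  then have "linear (frechet_derivative f (at x))"
    using has_derivative_linear by blast
  then have "frechet_derivative f (at x) = (\<lambda>h. \<Sum>i\<in>UNIV. (h $ i) *\<^sub>R (grad f x $ i))"
    by (intro ext) (simp only: grad_def vec_lambda_beta linear_eq_sum_axis[symmetric])
  with d show ?thesis unfolding has_grad_def by simp
qed

lemma has_grad_const: "has_grad (\<lambda>x. c) 0 x"
  unfolding has_grad_def by simp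

lemma has_grad_coord: "has_grad (\<lambda>x::real^'n. of_real (x $ i)) (axis i 1) x"
proof -
  have "(\<Sum>j\<in>UNIV. (h $ j) *\<^sub>R ((axis i 1 :: complex^'n) $ j)) = of_real (h $ i)" for h :: "real^'n"
    by (simp add: axis_def if_distrib cong: if_cong) (simp add: scaleR_conv_of_real)
  then show ?thesis unfolding has_grad_def
    by (auto intro!: bounded_linear_imp_has_derivative bounded_linear_compose[OF bounded_linear_of_real] bounded_linear_vec_nth)
qed

lemma has_grad_add: "has_grad f a x \<Longrightarrow> has_grad g b x \<Longrightarrow> has_grad (\<lambda>x. f x + g x) (a + b) x"
  unfolding has_grad_def
  by (drule (1) has_derivative_add) (simp add: scaleR_add_right sum.distrib)

lemma has_grad_diff: "has_grad f a x \<Longrightarrow> has_grad g b x \<Longrightarrow> has_grad (\<lambda>x. f x - g x) (a - b) x"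
  unfolding has_grad_def
  by (drule (1) has_derivative_diff) (simp add: scaleR_diff_right sum_subtractf)

lemma has_grad_mult:
  "has_grad f a x \<Longrightarrow> has_grad g b x \<Longrightarrow> has_grad (\<lambda>x. f x * g x) (f x *s b + g x *s a) x"
  unfolding has_grad_def
  by (drule (1) has_derivative_mult)
     (auto elim!: has_derivative_eq_rhs simp: scaleR_add_right sum.distrib sum_distrib_left sum_distrib_right algebra_simps)

text \<open>The inner function is real but its gradient is given as a complex vector. Uniqueness of
  the derivative of the imaginary part, which is 0, shows that the derivative takes real values, so
  the real chain rule applies and its result is cast back.\<close>

lemma has_grad_compose_real:
  assumes "has_grad (\<lambda>x. of_real (q x)) g x" "(p has_real_derivative d) (at (q x))"
  shows "has_grad (\<lambda>x. of_real (p (q x))) (of_real d *s g) x"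
proof -
  have "((\<lambda>x. Re (of_real (q x))) has_derivative (\<lambda>h. Re (\<Sum>i\<in>UNIV. (h $ i) *\<^sub>R (g $ i)))) (at x)"
    using assms(1) unfolding has_grad_def by (rule bounded_linear.has_derivative[OF bounded_linear_Re])
  then have q: "(q has_derivative (\<lambda>h. Re (\<Sum>i\<in>UNIV. (h $ i) *\<^sub>R (g $ i)))) (at x)" by simp
  have "((\<lambda>x. Im (of_real (q x))) has_derivative (\<lambda>h. Im (\<Sum>i\<in>UNIV. (h $ i) *\<^sub>R (g $ i)))) (at x)"
    using assms(1) unfolding has_grad_def by (rule bounded_linear.has_derivative[OF bounded_linear_Im])
  then have "(\<lambda>h. Im (\<Sum>i\<in>UNIV. (h $ i) *\<^sub>R (g $ i))) = (\<lambda>h. 0)"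
    using has_derivative_unique[OF _ has_derivative_const] by fastforce
  then have *: "of_real (Re (\<Sum>i\<in>UNIV. (h $ i) *\<^sub>R (g $ i))) = (\<Sum>i\<in>UNIV. (h $ i) *\<^sub>R (g $ i))" for h
    by (metis (no_types, lifting) complex_eq_iff complex_of_real_def complex.sel)
  have "((\<lambda>x. p (q x)) has_derivative (\<lambda>h. Re (\<Sum>i\<in>UNIV. (h $ i) *\<^sub>R (g $ i)) * d)) (at x)"
    using has_derivative_compose[OF q assms(2)[unfolded has_field_derivative_def]]
    by (simp add: mult.commute)
  then have "((\<lambda>x. of_real (p (q x))) has_derivative (\<lambda>h. of_real (Re (\<Sum>i\<in>UNIV. (h $ i) *\<^sub>R (g $ i)) * d) :: complex)) (at x)"
    by (rule bounded_linear.has_derivative[OF bounded_linear_of_real])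
  then show ?thesis unfolding has_grad_def of_real_mult *
    by (simp add: sum_distrib_left mult.commute scaleR_conv_of_real mult.left_commute)
qed

lemma has_grad_affine:
  fixes f :: "real^'n \<Rightarrow> complex"
  assumes "has_grad f g (a *\<^sub>R x + b)"
  shows "has_grad (\<lambda>x. f (a *\<^sub>R x + b)) (of_real a *s g) x"
proof -
  have "((\<lambda>x. a *\<^sub>R x + b) has_derivative (\<lambda>h. a *\<^sub>R h)) (at x)"
    by (auto intro!: derivative_eq_intros)
  from has_derivative_compose[OF this assms[unfolded has_grad_def]]
  show ?thesis unfolding has_grad_def
    by (auto elim!: has_derivative_eq_rhs simp: scaleR_conv_of_real[where 'a=complex] mult.left_commute mult.commute)
qed

subsection \<open>Smooth functions\<close>

lemma Ck_has_grad: "Ck (Suc k) f \<Longrightarrow> has_grad f (grad f x) x"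
  by (simp add: differentiable_imp_has_grad)

lemma Ck_SucI:
  assumes "\<And>x. has_grad f (g x) x" "\<And>i. Ck k (\<lambda>x. g x $ i)"
  shows "Ck (Suc k) f"
  using assms grad_eqI[OF assms(1)] by (auto intro: has_grad_imp_differentiable)

lemma Ck_SucD: "Ck (Suc k) f \<Longrightarrow> Ck k f"
proof (induction k arbitrary: f)
  case 0
  then show ?case
    by (auto intro!: continuous_at_imp_continuous_on differentiable_imp_continuous_within)
next
  case (Suc k)
  then show ?case
    using Suc.prems Suc.IH unfolding Ck.simps(2)[of "Suc k"] Ck.simps(2)[of k f] by blast
qed

lemma Ck_const: "Ck k (\<lambda>x. c)"
  by (induction k arbitrary: c) (auto intro!: Ck_SucI has_grad_const simp del: Ck.simps(2))

lemma Ck_coord: "Ck k (\<lambda>x::real^'n. of_real (x $ i))"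
proof (cases k)
  case 0
  then show ?thesis by (auto intro!: continuous_intros)
next
  case (Suc n)
  then show ?thesis using Ck_SucI[OF has_grad_coord Ck_const] by metis
qed

lemma Ck_add: "Ck k f \<Longrightarrow> Ck k g \<Longrightarrow> Ck k (\<lambda>x. f x + g x)"
proof (induction k arbitrary: f g)
  case 0
  then show ?case by (auto intro!: continuous_intros)
next
  case (Suc k)
  show ?case
    by (rule Ck_SucI[OF has_grad_add[OF Ck_has_grad[OF Suc.prems(1)] Ck_has_grad[OF Suc.prems(2)]]])
       (use Suc in simp)
qed

lemma Ck_mult: "Ck k f \<Longrightarrow> Ck k g \<Longrightarrow> Ck k (\<lambda>x. f x * g x)"
proof (induction k arbitrary: f g)
  case 0
  then show ?case by (auto intro!: continuous_intros)
next
  case (Suc k)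
  have "Ck k (\<lambda>x. f x * grad g x $ i + g x * grad f x $ i)" for i
    using Suc.prems Ck_SucD[OF Suc.prems(1)] Ck_SucD[OF Suc.prems(2)]
    by (intro Ck_add Suc.IH) auto
  then show ?case
    by (intro Ck_SucI[OF has_grad_mult[OF Ck_has_grad[OF Suc.prems(1)] Ck_has_grad[OF Suc.prems(2)]]])
      simp
qed

lemma Ck_sum: "finite I \<Longrightarrow> (\<And>i. i \<in> I \<Longrightarrow> Ck k (f i)) \<Longrightarrow> Ck k (\<lambda>x. \<Sum>i\<in>I. f i x)"
  by (induction I rule: finite_induct) (auto intro: Ck_const Ck_add)

lemma Ck_affine: "Ck k f \<Longrightarrow> Ck k (\<lambda>x::real^'n. f (a *\<^sub>R x + b))"
proof (induction k arbitrary: f)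
  case 0
  then show ?case by (auto intro!: continuous_on_compose2[of UNIV f] continuous_intros)
next
  case (Suc k)
  have "Ck k (\<lambda>x. (of_real a *s grad f (a *\<^sub>R x + b)) $ i)" for i
    using Suc by (auto intro!: Ck_mult Ck_const)
  then show ?case
    by (intro Ck_SucI[OF has_grad_affine[OF Ck_has_grad[OF Suc.prems]]])
qed

text \<open>The closed support lies in every compact set outside which the function vanishes, so any
  such set inside \<open>D\<close> can stand for it. This is the form in which supports are handled
  from here on.\<close>

lemma test_function_iff:
  fixes \<phi> :: "real^'n \<Rightarrow> complex"
  shows "test_function D \<phi> \<longleftrightarrow> (\<forall>k. Ck k \<phi>) \<and> (\<exists>K. compact K \<and> K \<subseteq> D \<and> (\<forall>x. x \<notin> K \<longrightarrow> \<phi> x = 0))"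
proof
  assume L: "test_function D \<phi>"
  then show "(\<forall>k. Ck k \<phi>) \<and> (\<exists>K. compact K \<and> K \<subseteq> D \<and> (\<forall>x. x \<notin> K \<longrightarrow> \<phi> x = 0))"
    unfolding test_function_def
    by (auto intro!: exI[of _ "closure {x. \<phi> x \<noteq> 0}"] simp: subsetD[OF closure_subset])
      (metis (mono_tags) closure_subset mem_Collect_eq subsetD)
next
  assume "(\<forall>k. Ck k \<phi>) \<and> (\<exists>K. compact K \<and> K \<subseteq> D \<and> (\<forall>x. x \<notin> K \<longrightarrow> \<phi> x = 0))"
  then obtain K where K: "compact K" "K \<subseteq> D" "\<forall>x. x \<notin> K \<longrightarrow> \<phi> x = 0" "\<forall>k. Ck k \<phi>"
    by blast
  then have "closure {x. \<phi> x \<noteq> 0} \<subseteq> K"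
    by (intro closure_minimal) (auto simp: compact_imp_closed)
  moreover have "compact (closure {x. \<phi> x \<noteq> 0})"
    using \<open>compact K\<close> calculation by (metis closed_closure compact_Int_closed inf.absorb2)
  ultimately show "test_function D \<phi>"
    using K unfolding test_function_def by auto
qed

lemma test_functionE:
  assumes "test_function D \<phi>"
  obtains K where "compact K" "K \<subseteq> D" "\<And>x. x \<notin> K \<Longrightarrow> \<phi> x = 0" "\<And>k. Ck k \<phi>"
  using assms unfolding test_function_iff by blast

lemma grad_zero_outside:
  assumes "closed K" "\<And>x. x \<notin> K \<Longrightarrow> \<phi> x = 0" "x \<notin> K"
  shows "grad \<phi> x = 0"
proof -
  have "has_grad \<phi> 0 x"
    using has_derivative_transform_within_open[of "\<lambda>x. 0" "\<lambda>h. 0" x UNIV "-K" \<phi>] assms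
    unfolding has_grad_def by (simp add: open_Compl)
  then show ?thesis by (rule grad_eqI)
qed

lemma test_function_grad:
  assumes "test_function D \<phi>" shows "test_function D (\<lambda>x. grad \<phi> x $ i)"
proof -
  obtain K where K: "compact K" "K \<subseteq> D" "\<And>x. x \<notin> K \<Longrightarrow> \<phi> x = 0" "\<And>k. Ck k \<phi>"
    using assms by (rule test_functionE) blast
  then have "grad \<phi> x = 0" if "x \<notin> K" for x
    using that by (intro grad_zero_outside[of K]) (auto simp: compact_imp_closed)
  moreover have "Ck k (\<lambda>x. grad \<phi> x $ i)" for k
    using K(4)[of "Suc k"] by simp
  ultimately show ?thesis unfolding test_function_iff using K by (intro conjI allI exI[of _ K]) auto
qed

lemma test_function_continuous: "test_function D \<phi> \<Longrightarrow> continuous_on UNIV \<phi>"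
  unfolding test_function_def by (metis Ck.simps(1))

lemma test_function_has_grad: "test_function D \<phi> \<Longrightarrow> has_grad \<phi> (grad \<phi> x) x"
  unfolding test_function_def by (metis Ck_has_grad)

lemma test_function_subset: "test_function D \<phi> \<Longrightarrow> D \<subseteq> E \<Longrightarrow> test_function E \<phi>"
  unfolding test_function_def by blast

lemma continuous_compact_support_bounded:
  fixes \<phi> :: "'a::metric_space \<Rightarrow> 'b::real_normed_vector"
  assumes "continuous_on UNIV \<phi>" "compact K" "\<And>x. x \<notin> K \<Longrightarrow> \<phi> x = 0"
  obtains C where "C > 0" "\<And>x. norm (\<phi> x) \<le> C"
proof -
  have "bounded (\<phi> ` K)"
    using assms by (intro compact_imp_bounded compact_continuous_image) (auto intro: continuous_on_subset)
  then obtain C where C: "C > 0" "\<And>x. x \<in> K \<Longrightarrow> norm (\<phi> x) \<le> C"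
    unfolding bounded_pos by blast
  show ?thesis
    by (rule that[of C]) (use C assms(3) in \<open>force+\<close>)
qed

lemma test_function_bounded:
  assumes "test_function D \<phi>" obtains C where "C > 0" "\<And>x. norm (\<phi> x) \<le> C"
proof -
  obtain K where "compact K" "\<And>x. x \<notin> K \<Longrightarrow> \<phi> x = 0"
    using assms by (rule test_functionE) blast
  with test_function_continuous[OF assms] show ?thesis
    using that by (rule continuous_compact_support_bounded) blast
qed

lemma test_function_grad_bounded:
  fixes \<phi> :: "real^'n \<Rightarrow> complex"
  assumes "test_function D \<phi>" obtains C where "C > 0" "\<And>x i. norm (grad \<phi> x $ i) \<le> C"
proof -
  have "\<exists>C. \<forall>x. norm (grad \<phi> x $ i) \<le> C" for i
    using test_function_bounded[OF test_function_grad[OF assms]] by metis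
  then obtain C where C: "\<And>i x. norm (grad \<phi> x $ i) \<le> C i" by metis
  have "norm (grad \<phi> x $ i) \<le> (\<Sum>i\<in>UNIV. \<bar>C i\<bar>) + 1" for x i
  proof -
    have "C i \<le> (\<Sum>i\<in>UNIV. \<bar>C i\<bar>)"
      by (rule order_trans[OF abs_ge_self]) (rule member_le_sum, auto)
    with C[of x i] show ?thesis by linarith
  qed
  moreover have "(\<Sum>i\<in>UNIV. \<bar>C i\<bar>) + 1 > 0" by (meson abs_ge_zero add_nonneg_pos sum_nonneg zero_less_one)
  ultimately show ?thesis using that by blast
qed

subsection \<open>A smooth bump\<close>

text \<open>Up to the index \<open>k\<close> this is the classical function exp(-1/t), extended by
  0. The powers of 1/t are included so that the family is closed under differentiation
  (\<open>flat_deriv\<close>) and smoothness becomes an induction.\<close>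

definition flat :: "nat \<Rightarrow> real \<Rightarrow> real" where
  "flat k t = (if t \<le> 0 then 0 else exp (- (1 / t)) / t ^ k)"

text \<open>On the right, the substitution s = 1/t turns this into the decay of s^k exp(-s) at
  infinity; on the left the function is 0.\<close>

lemma flat_tendsto_0: "(flat k \<longlongrightarrow> 0) (at 0)"
proof -
  have "((\<lambda>t. (inverse t) ^ k / exp (inverse t)) \<longlongrightarrow> 0) (at_right (0::real))"
    by (rule filterlim_compose[OF tendsto_power_div_exp_0 filterlim_inverse_at_top_right])
  moreover have "eventually (\<lambda>t. (inverse t) ^ k / exp (inverse t) = flat k t) (at_right 0)"
    using eventually_at_right_less[of 0]
    by eventually_elim (auto simp: flat_def exp_minus field_simps)
  ultimately have "(flat k \<longlongrightarrow> 0) (at_right 0)"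
    using tendsto_cong by fastforce
  moreover have "(flat k \<longlongrightarrow> 0) (at_left 0)"
  proof -
    have "eventually (\<lambda>t. flat k t = 0) (at_left 0)"
      by (auto simp: flat_def eventually_at_filter)
    then show ?thesis by (simp add: tendsto_eventually)
  qed
  ultimately show ?thesis by (simp add: filterlim_split_at)
qed

lemma flat_deriv: "(flat k has_real_derivative (flat (k + 2) t - real k * flat (Suc k) t)) (at t)"
proof -
  consider "t < 0" | "t = 0" | "t > 0" by linarith
  then show ?thesis
  proof cases
    case 1
    then have "(flat k has_real_derivative 0) (at t)"
      by (intro has_field_derivative_transform_within[OF DERIV_const[of 0], of "-t"]) (auto simp: dist_real_def flat_def)
    then show ?thesis using 1 by (simp add: flat_def)
  next
    case 2
    \<comment> \<open>For h different from 0 the difference quotient of \<open>flat k\<close> at 0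
      is \<open>flat (Suc k) h\<close>, so the limit already known for the next index gives
      derivative 0.\<close>
    have "((\<lambda>h. flat k h / h) \<longlongrightarrow> 0) (at 0)"
      by (rule Lim_transform_eventually[OF flat_tendsto_0[of "Suc k"]])
        (auto simp: flat_def eventually_at_filter)
    then show ?thesis using 2 by (simp add: DERIV_def flat_def)
  next
    case 3
    have "((\<lambda>t. exp (- (1 / t)) * inverse t ^ k) has_real_derivative
        exp (- (1 / t)) * (1 / t\<^sup>2) * inverse t ^ k - exp (- (1 / t)) * (real k * inverse t ^ (k - 1) * (1 / t\<^sup>2))) (at t)"
    proof -
      have i: "(inverse has_real_derivative - (1 / t\<^sup>2)) (at t)"
        using 3 by (auto intro!: derivative_eq_intros simp: power2_eq_square field_simps)
      have p: "((\<lambda>t. inverse t ^ k) has_real_derivative (real k * (- (1 / t\<^sup>2) * inverse t ^ (k - 1)))) (at t)"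
        using DERIV_power[OF i, of k] by simp
      have e: "((\<lambda>t. exp (- (1 / t))) has_real_derivative exp (- (1 / t)) * (1 / t\<^sup>2)) (at t)"
        using 3 by (auto intro!: derivative_eq_intros simp: power2_eq_square field_simps)
      show ?thesis using DERIV_mult[OF e p] by (simp add: algebra_simps)
    qed
    moreover have "exp (- (1 / t)) * (1 / t\<^sup>2) * inverse t ^ k - exp (- (1 / t)) * (real k * inverse t ^ (k - 1) * (1 / t\<^sup>2))
        = flat (k + 2) t - real k * flat (Suc k) t"
      using 3 by (cases k) (simp_all add: flat_def field_simps power2_eq_square)
    moreover have "(\<lambda>t::real. exp (- (1 / t)) * inverse t ^ k) = (\<lambda>t. exp (- (1 / t)) / t ^ k)"
      by (simp add: field_simps)
    ultimately have "((\<lambda>t. exp (- (1 / t)) / t ^ k) has_real_derivative (flat (k + 2) t - real k * flat (Suc k) t)) (at t)"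
      by simp
    then show ?thesis
      by (rule has_field_derivative_transform_within[where d = t]) (use 3 in \<open>auto simp: dist_real_def flat_def\<close>)
  qed
qed

lemma flat_continuous: "continuous_on UNIV (flat k)"
  using flat_deriv DERIV_isCont by (fastforce intro!: continuous_at_imp_continuous_on)

lemma flat_nonneg: "flat k t \<ge> 0"
  by (auto simp: flat_def)

definition rbump :: "nat \<Rightarrow> real^'n \<Rightarrow> real" where
  "rbump k x = flat k (1 - (norm x)\<^sup>2)"

lemma has_grad_norm_sq: "has_grad (\<lambda>x::real^'n. of_real ((norm x)\<^sup>2)) (\<chi> i. of_real (2 * x $ i)) x"
proof -
  have "((\<lambda>x. x \<bullet> x) has_derivative (\<lambda>h. 2 * (x \<bullet> h))) (at x)"
    by (auto intro!: derivative_eq_intros simp: inner_commute)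
  then have "((\<lambda>x. of_real (x \<bullet> x)) has_derivative (\<lambda>h. of_real (2 * (x \<bullet> h)) :: complex)) (at x)"
    by (rule bounded_linear.has_derivative[OF bounded_linear_of_real])
  moreover have "of_real (2 * (x \<bullet> h)) = (\<Sum>i\<in>UNIV. h $ i *\<^sub>R ((\<chi> i. complex_of_real (2 * x $ i)) $ i))" for h
    by (simp add: inner_vec_def sum_distrib_left scaleR_conv_of_real algebra_simps)
  ultimately show ?thesis unfolding has_grad_def power2_norm_eq_inner by simp
qed

lemma has_grad_rbump:
  fixes x :: "real^'n"
  shows "has_grad (\<lambda>x. of_real (rbump k x))
     (\<chi> i. of_real ((rbump (k + 2) x - real k * rbump (Suc k) x) * (- 2 * x $ i))) x"
proof -
  have *: "has_grad (\<lambda>x. of_real (1 - (norm x)\<^sup>2)) (0 - (\<chi> i. of_real (2 * x $ i))) x"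
    using has_grad_diff[OF has_grad_const has_grad_norm_sq, of 1 x] by simp
  have "has_grad (\<lambda>x. of_real (rbump k x))
     (of_real (rbump (k + 2) x - real k * rbump (Suc k) x) *s (0 - (\<chi> i. of_real (2 * x $ i)))) x"
    unfolding rbump_def by (rule has_grad_compose_real[OF * flat_deriv])
  moreover have "(of_real (rbump (k + 2) x - real k * rbump (Suc k) x) *s (0 - (\<chi> i. of_real (2 * x $ i))))
     = (\<chi> i. complex_of_real ((rbump (k + 2) x - real k * rbump (Suc k) x) * (- 2 * x $ i)))"
    by (simp add: vec_eq_iff algebra_simps)
  ultimately show ?thesis by simp
qed

text \<open>The components of the gradient are coordinates times combinations of
  \<open>rbump (k + 2)\<close> and \<open>rbump (Suc k)\<close>, so the induction must run over all
  \<open>k\<close> at once.\<close>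

lemma Ck_rbump: "Ck n (\<lambda>x::real^'n. of_real (rbump k x))"
proof (induction n arbitrary: k)
  case 0
  show ?case unfolding rbump_def
    by (auto intro!: continuous_intros continuous_on_compose2[OF flat_continuous])
next
  case (Suc n)
  have "Ck n (\<lambda>x::real^'n. (of_real (rbump (k + 2) x) + - of_real (real k) * of_real (rbump (Suc k) x)) * (-2 * of_real (x $ i)))" for i
    by (intro Ck_mult Ck_add Suc.IH Ck_const Ck_coord)
  then show ?case by (intro Ck_SucI[OF has_grad_rbump]) simp
qed

lemma rbump_zero: "norm x \<ge> 1 \<Longrightarrow> rbump k x = 0"
  by (simp add: rbump_def flat_def)

lemma rbump_nonneg: "rbump k x \<ge> 0"
  by (simp add: rbump_def flat_nonneg)

lemma rbump_continuous: "continuous_on UNIV (rbump k)"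
  unfolding rbump_def by (auto intro!: continuous_intros continuous_on_compose2[OF flat_continuous])

section \<open>Affine substitution in Lebesgue integrals\<close>

text \<open>This is the coordinatewise scaling formula with all factors equal to \<open>c\<close>;
  the product of the factors becomes a power of the dimension.\<close>

lemma lebesgue_affine_density:
  fixes t :: "'a::euclidean_space"
  assumes "c \<noteq> 0"
  shows "lebesgue = density (distr lebesgue lebesgue (\<lambda>x. t + c *\<^sub>R x)) (\<lambda>_. ennreal (\<bar>c\<bar>^DIM('a)))"
  using lebesgue_affine_euclidean[where c="\<lambda>_::'a. c" and t=t] assms
  unfolding scaleR_scaleR[symmetric] scaleR_sum_right[symmetric] euclidean_representation prod_constant by simp

lemma lebesgue_affine_measurable':
  fixes t :: "'a::euclidean_space"
  assumes "c \<noteq> 0"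
  shows "(\<lambda>x. t + c *\<^sub>R x) \<in> lebesgue \<rightarrow>\<^sub>M lebesgue"
  using lebesgue_affine_measurable[where c="\<lambda>_::'a. c" and t=t] assms
  unfolding scaleR_scaleR[symmetric] scaleR_sum_right[symmetric] euclidean_representation by simp

lemma nn_integral_lebesgue_affine:
  fixes t :: "'a::euclidean_space"
  assumes "c \<noteq> 0" and f: "f \<in> borel_measurable lebesgue"
  shows "(\<integral>\<^sup>+x. f (t + c *\<^sub>R x) \<partial>lebesgue) = (\<integral>\<^sup>+x. f x \<partial>lebesgue) / ennreal (\<bar>c\<bar>^DIM('a))"
proof -
  note m = lebesgue_affine_measurable'[OF \<open>c \<noteq> 0\<close>, of t]
  have "(\<integral>\<^sup>+x. f x \<partial>lebesgue) = ennreal (\<bar>c\<bar>^DIM('a)) * (\<integral>\<^sup>+x. f (t + c *\<^sub>R x) \<partial>lebesgue)"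
    using f by (subst lebesgue_affine_density[OF \<open>c \<noteq> 0\<close>, of t])
      (simp add: nn_integral_density nn_integral_distr[OF m] nn_integral_cmult measurable_compose[OF m])
  moreover have "(\<integral>\<^sup>+x. f (t + c *\<^sub>R x) \<partial>lebesgue) * ennreal (\<bar>c\<bar>^DIM('a)) / ennreal (\<bar>c\<bar>^DIM('a)) = (\<integral>\<^sup>+x. f (t + c *\<^sub>R x) \<partial>lebesgue)"
    using \<open>c \<noteq> 0\<close> by (intro ennreal_mult_divide_eq) auto
  ultimately show ?thesis by (simp add: mult.commute)
qed

lemma integrable_lebesgue_affine_imp:
  fixes t :: "'a::euclidean_space" and f :: "'a \<Rightarrow> 'b::{banach, second_countable_topology}"
  assumes "c \<noteq> 0" "integrable lebesgue f"
  shows "integrable lebesgue (\<lambda>x. f (t + c *\<^sub>R x))"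
proof (rule integrableI_bounded)
  have f: "f \<in> borel_measurable lebesgue" using assms by auto
  then show "(\<lambda>x. f (t + c *\<^sub>R x)) \<in> borel_measurable lebesgue"
    by (rule measurable_compose[OF lebesgue_affine_measurable'[OF \<open>c \<noteq> 0\<close>]])
  have "(\<integral>\<^sup>+x. ennreal (norm (f x)) \<partial>lebesgue) < \<infinity>"
    using assms(2) by (simp add: integrable_iff_bounded)
  then show "(\<integral>\<^sup>+x. ennreal (norm (f (t + c *\<^sub>R x))) \<partial>lebesgue) < \<infinity>"
    using nn_integral_lebesgue_affine[of c "\<lambda>x. ennreal (norm (f x))" t] f \<open>c \<noteq> 0\<close>
    by (simp add: ennreal_divide_eq_top_iff less_top[symmetric])
qed

lemma integrable_lebesgue_affine:
  fixes t :: "'a::euclidean_space" and f :: "'a \<Rightarrow> 'b::{banach, second_countable_topology}"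
  assumes "c \<noteq> 0"
  shows "integrable lebesgue (\<lambda>x. f (t + c *\<^sub>R x)) \<longleftrightarrow> integrable lebesgue f"
proof
  assume "integrable lebesgue (\<lambda>x. f (t + c *\<^sub>R x))"
  from integrable_lebesgue_affine_imp[OF _ this, of "inverse c" "- (t /\<^sub>R c)"] assms
  show "integrable lebesgue f" by (simp add: scaleR_right_distrib scaleR_right_diff_distrib)
qed (rule integrable_lebesgue_affine_imp[OF assms])

lemma integral_lebesgue_affine:
  fixes t :: "'a::euclidean_space" and f :: "'a \<Rightarrow> 'b::{banach, second_countable_topology}"
  assumes "c \<noteq> 0"
  shows "(LINT x|lebesgue. f (t + c *\<^sub>R x)) = (LINT x|lebesgue. f x) /\<^sub>R \<bar>c\<bar>^DIM('a)"
proof (cases "integrable lebesgue f")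
  case True
  then have f: "f \<in> borel_measurable lebesgue" by auto
  note m = lebesgue_affine_measurable'[OF \<open>c \<noteq> 0\<close>, of t]
  have "(LINT x|lebesgue. f x) = \<bar>c\<bar>^DIM('a) *\<^sub>R (LINT x|lebesgue. f (t + c *\<^sub>R x))"
    using f by (subst lebesgue_affine_density[OF \<open>c \<noteq> 0\<close>, of t])
      (simp add: integral_density integral_distr[OF m] measurable_compose[OF m])
  then show ?thesis using assms by simp
next
  \<comment> \<open>Without integrability both integrals are 0 by convention.\<close>
  case False
  then show ?thesis using assms by (simp add: integrable_lebesgue_affine not_integrable_integral_eq)
qed

lemma continuous_lebesgue_measurable:
  fixes f :: "'a::euclidean_space \<Rightarrow> 'b::topological_space"
  shows "continuous_on UNIV f \<Longrightarrow> f \<in> borel_measurable lebesgue"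
  by (rule measurable_completion) (simp add: borel_measurable_continuous_onI)

lemma integrable_mult_bounded:
  fixes u g :: "'a \<Rightarrow> complex"
  assumes "integrable M u" "g \<in> borel_measurable M" "\<And>x. norm (g x) \<le> C"
  shows "integrable M (\<lambda>x. u x * g x)"
proof (rule Bochner_Integration.integrable_bound)
  show "integrable M (\<lambda>x. C * norm (u x))" using assms(1) by simp
  show "(\<lambda>x. u x * g x) \<in> borel_measurable M" using assms by measurable
  have "norm (u x * g x) \<le> norm (C * norm (u x))" for x
    using mult_right_mono[OF assms(3)[of x], of "norm (u x)"]
    by (simp add: norm_mult mult.commute order_trans[OF _ abs_ge_self])
  then show "AE x in M. norm (u x * g x) \<le> norm (C * norm (u x))" by simp
qed

lemma compact_support_integrable:
  fixes f :: "'a::euclidean_space \<Rightarrow> 'b::euclidean_space"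
  assumes "continuous_on UNIV f" "compact K" "\<And>x. x \<notin> K \<Longrightarrow> f x = 0"
  shows "integrable lebesgue f"
proof -
  have "integrable lborel (\<lambda>x. indicator K x *\<^sub>R f x)"
    using assms by (intro borel_integrable_compact) (auto intro: continuous_on_subset)
  moreover have "(\<lambda>x. indicator K x *\<^sub>R f x) = f"
    using assms(3) by (auto simp: fun_eq_iff indicator_def)
  ultimately show ?thesis
    using integrable_completion[of f lborel] assms(1) by (simp add: borel_measurable_continuous_onI)
qed

section \<open>Differentiation under the integral sign\<close>

text \<open>The mean value inequality bounds the difference quotients by \<open>w\<close>, and the
  remainder by \<open>2 * w\<close>. Dominated convergence is then applied along an arbitrary
  sequence of increments.\<close>

lemma has_derivative_integral:
  fixes k :: "'a::{real_normed_vector,perfect_space} \<Rightarrow> 'b \<Rightarrow> 'c::{banach, second_countable_topology}"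
  assumes "r > 0"
    and int: "\<And>z. z \<in> ball x r \<Longrightarrow> integrable M (k z)"
    and der: "\<And>z y. z \<in> ball x r \<Longrightarrow> y \<in> space M \<Longrightarrow> ((\<lambda>z. k z y) has_derivative k' z y) (at z)"
    and bnd: "\<And>z y h. z \<in> ball x r \<Longrightarrow> y \<in> space M \<Longrightarrow> norm (k' z y h) \<le> w y * norm h"
    and w: "integrable M w"
    and int': "\<And>h. integrable M (\<lambda>y. k' x y h)"
  shows "((\<lambda>z. LINT y|M. k z y) has_derivative (\<lambda>h. LINT y|M. k' x y h)) (at x)"
proof -
  have lin: "linear (k' x y)" if "y \<in> space M" for y
    using der[of x y] that \<open>r > 0\<close> by (auto intro: has_derivative_linear)
  have bl: "bounded_linear (\<lambda>h. LINT y|M. k' x y h)"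
  proof (rule bounded_linear_intro)
    fix a b c
    have "(LINT y|M. k' x y (a + b)) = (LINT y|M. k' x y a + k' x y b)"
      by (rule Bochner_Integration.integral_cong) (auto simp: linear_add[OF lin])
    then show "(LINT y|M. k' x y (a + b)) = (LINT y|M. k' x y a) + (LINT y|M. k' x y b)"
      by (simp add: int')
    have "(LINT y|M. k' x y (c *\<^sub>R a)) = (LINT y|M. c *\<^sub>R k' x y a)"
      by (rule Bochner_Integration.integral_cong) (auto simp: linear_scale[OF lin])
    then show "(LINT y|M. k' x y (c *\<^sub>R a)) = c *\<^sub>R (LINT y|M. k' x y a)" by simp
    have "norm (LINT y|M. k' x y a) \<le> (LINT y|M. w y * norm a)"
      by (rule order_trans[OF integral_norm_bound integral_mono]) (use int' w bnd \<open>r > 0\<close> in auto)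
    then show "norm (LINT y|M. k' x y a) \<le> norm a * (LINT y|M. w y)" by (simp add: mult.commute)
  qed
  have "((\<lambda>h. norm ((LINT y|M. k (x + h) y) - (LINT y|M. k x y) - (LINT y|M. k' x y h)) / norm h) \<longlongrightarrow> 0) (at 0)"
    unfolding tendsto_at_iff_sequentially o_def
  proof (intro allI impI)
    fix X :: "nat \<Rightarrow> 'a" assume X: "\<forall>i. X i \<in> UNIV - {0}" "X \<longlonglongrightarrow> 0"
    then have "eventually (\<lambda>n. norm (X n) < r) sequentially"
      using \<open>r > 0\<close> by (metis tendsto_norm_zero order_tendstoD(2))
    then obtain N where N: "\<And>n. n \<ge> N \<Longrightarrow> norm (X n) < r"
      by (auto simp: eventually_sequentially)
    \<comment> \<open>Dropping finitely many terms keeps all increments inside the ball on which the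
      hypotheses hold.\<close>
    define Y where "Y n = X (n + N)" for n
    have Y: "norm (Y n) < r" "Y n \<noteq> 0" for n using N X by (auto simp: Y_def)
    have Y0: "Y \<longlonglongrightarrow> 0" unfolding Y_def using X(2) by (rule LIMSEQ_ignore_initial_segment)
    have inb: "x + Y n \<in> ball x r" "x \<in> ball x r" for n
      using Y \<open>r > 0\<close> by (auto simp: dist_norm)
    let ?d = "\<lambda>n y. (k (x + Y n) y - k x y - k' x y (Y n)) /\<^sub>R norm (Y n)"
    have lim: "(\<lambda>n. LINT y|M. ?d n y) \<longlonglongrightarrow> (LINT y|M. 0)"
    proof (rule integral_dominated_convergence[where w = "\<lambda>y. 2 * w y"])
      show "?d n \<in> borel_measurable M" for n
        using int[OF inb(1)] int[OF inb(2)] int' by auto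
      show "integrable M (\<lambda>y. 2 * w y)" using w by simp
      show "AE y in M. (\<lambda>n. ?d n y) \<longlonglongrightarrow> 0"
      proof (rule AE_I2)
        fix y assume "y \<in> space M"
        then have "((\<lambda>h. norm (k (x + h) y - k x y - k' x y h) / norm h) \<longlongrightarrow> 0) (at 0)"
          using der[OF inb(2)] by (simp add: has_derivative_at)
        then have "(\<lambda>n. norm (k (x + Y n) y - k x y - k' x y (Y n)) / norm (Y n)) \<longlonglongrightarrow> 0"
          using Y Y0 unfolding tendsto_at_iff_sequentially o_def by auto
        then show "(\<lambda>n. ?d n y) \<longlonglongrightarrow> 0"
          by (intro tendsto_norm_zero_cancel[of "\<lambda>n. ?d n y"]) (simp add: divide_inverse mult.commute)
      qed
      show "AE y in M. norm (?d n y) \<le> 2 * w y" for n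
      proof (rule AE_I2)
        fix y assume y: "y \<in> space M"
        have "norm (k (x + Y n) y - k x y) \<le> w y * norm (x + Y n - x)"
        proof (rule differentiable_bound[OF convex_ball[of x r]])
          show "((\<lambda>z. k z y) has_derivative k' z y) (at z within ball x r)" if "z \<in> ball x r" for z
            using der[OF that y] by (rule has_derivative_at_withinI)
          show "onorm (k' z y) \<le> w y" if "z \<in> ball x r" for z
            by (intro onorm_le bnd[OF that y])
        qed (use inb in auto)
        moreover have "norm (k' x y (Y n)) \<le> w y * norm (Y n)" using bnd[OF inb(2) y] .
        ultimately have "norm (k (x + Y n) y - k x y - k' x y (Y n)) \<le> 2 * w y * norm (Y n)"
          using norm_triangle_ineq4[of "k (x + Y n) y - k x y" "k' x y (Y n)"] by simp
        then have "norm (k (x + Y n) y - k x y - k' x y (Y n)) / norm (Y n) \<le> 2 * w y"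
          using Y(2)[of n] by (simp add: pos_divide_le_eq)
        then show "norm (?d n y) \<le> 2 * w y"
          by (simp add: divide_inverse mult.commute)
      qed
    qed simp
    have eq: "(LINT y|M. ?d n y) = ((LINT y|M. k (x + Y n) y) - (LINT y|M. k x y) - (LINT y|M. k' x y (Y n))) /\<^sub>R norm (Y n)" for n
      using int[OF inb(1)] int[OF inb(2)] int' by simp
    have "(\<lambda>n. norm (((LINT y|M. k (x + Y n) y) - (LINT y|M. k x y) - (LINT y|M. k' x y (Y n))) /\<^sub>R norm (Y n))) \<longlonglongrightarrow> 0"
      using lim unfolding eq Bochner_Integration.integral_zero by (rule tendsto_norm_zero)
    then have "(\<lambda>n. norm ((LINT y|M. k (x + Y n) y) - (LINT y|M. k x y) - (LINT y|M. k' x y (Y n))) / norm (Y n)) \<longlonglongrightarrow> 0"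
      by (simp add: divide_inverse mult.commute)
    then show "(\<lambda>n. norm ((LINT y|M. k (x + X n) y) - (LINT y|M. k x y) - (LINT y|M. k' x y (X n))) / norm (X n)) \<longlonglongrightarrow> 0"
      unfolding Y_def by (rule LIMSEQ_offset)
  qed
  with bl show ?thesis by (simp add: has_derivative_at)
qed

subsection \<open>Convolution with a test function\<close>

definition conv :: "(real^'n \<Rightarrow> complex) \<Rightarrow> (real^'n \<Rightarrow> complex) \<Rightarrow> real^'n \<Rightarrow> complex" where
  "conv u k x = (LINT y|lebesgue. u y * k (x - y))"

lemma conv_integrable:
  assumes "integrable lebesgue u" "test_function D k"
  shows "integrable lebesgue (\<lambda>y. u y * k (x - y))"
proof -
  obtain C where "\<And>x. norm (k x) \<le> C" using test_function_bounded[OF assms(2)] by metis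
  moreover have "(\<lambda>y. k (x - y)) \<in> borel_measurable lebesgue"
    by (rule continuous_lebesgue_measurable,
        rule continuous_on_compose2[OF test_function_continuous[OF assms(2)]]) (auto intro!: continuous_intros)
  ultimately show ?thesis using assms(1) by (intro integrable_mult_bounded)
qed

text \<open>All derivatives fall on the kernel, whose gradient is bounded, so a constant multiple of
  |u| dominates and integrability of \<open>u\<close> is enough.\<close>

lemma has_grad_conv:
  fixes u k :: "real^'n \<Rightarrow> complex"
  assumes "integrable lebesgue u" "test_function D k"
  shows "has_grad (conv u k) (\<chi> i. conv u (\<lambda>x. grad k x $ i) x) x"
proof -
  obtain C where C: "C > 0" "\<And>x i. norm (grad k x $ i) \<le> C" using test_function_grad_bounded[OF assms(2)] by metis
  note int = conv_integrable[OF assms(1) test_function_grad[OF assms(2)]]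
  have "(conv u k has_derivative (\<lambda>h. LINT y|lebesgue. u y * (\<Sum>i\<in>UNIV. (h $ i) *\<^sub>R (grad k (x - y) $ i)))) (at x)"
    unfolding conv_def[abs_def]
  proof (rule has_derivative_integral[where r = 1 and w = "\<lambda>y. norm (u y) * (real CARD('n) * C)"
        and k' = "\<lambda>x y h. u y * (\<Sum>i\<in>UNIV. (h $ i) *\<^sub>R (grad k (x - y) $ i))"])
    show "((\<lambda>z. u y * k (z - y)) has_derivative (\<lambda>h. u y * (\<Sum>i\<in>UNIV. h $ i *\<^sub>R grad k (z - y) $ i))) (at z)" for z y
      using has_grad_affine[of k "grad k (z - y)" 1 z "-y"] test_function_has_grad[OF assms(2)]
      unfolding has_grad_def by (auto intro!: has_derivative_mult_right)
    show "norm (u y * (\<Sum>i\<in>UNIV. h $ i *\<^sub>R grad k (z - y) $ i)) \<le> norm (u y) * (real CARD('n) * C) * norm h" for z y h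
    proof -
      have "norm (\<Sum>i\<in>UNIV. h $ i *\<^sub>R grad k (z - y) $ i) \<le> (\<Sum>i\<in>(UNIV::'n set). norm h * C)"
        by (rule order_trans[OF norm_sum], rule sum_mono)
          (use C in \<open>auto intro!: mult_mono component_le_norm_cart\<close>)
      then have "norm (u y) * norm (\<Sum>i\<in>UNIV. h $ i *\<^sub>R grad k (z - y) $ i) \<le> norm (u y) * (\<Sum>i\<in>(UNIV::'n set). norm h * C)"
        by (rule mult_left_mono) simp
      then show ?thesis by (simp add: norm_mult algebra_simps)
    qed
    show "integrable lebesgue (\<lambda>y. norm (u y) * (real CARD('n) * C))"
      using assms(1) by simp
    show "integrable lebesgue (\<lambda>y. u y * (\<Sum>i\<in>UNIV. h $ i *\<^sub>R grad k (x - y) $ i))" for h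
      using int by (simp add: sum_distrib_left)
  qed (use conv_integrable[OF assms] in auto)
  moreover have "(LINT y|lebesgue. u y * (\<Sum>i\<in>UNIV. (h $ i) *\<^sub>R (grad k (x - y) $ i)))
    = (\<Sum>i\<in>UNIV. (h $ i) *\<^sub>R ((\<chi> i. conv u (\<lambda>x. grad k x $ i) x) $ i))" for h
    using int by (simp add: sum_distrib_left conv_def)
  ultimately show ?thesis unfolding has_grad_def by simp
qed

text \<open>The partial derivatives of a test function are test functions, so the induction runs
  with the kernel arbitrary.\<close>

lemma Ck_conv:
  fixes u :: "real^'n \<Rightarrow> complex"
  assumes "integrable lebesgue u"
  shows "test_function D k \<Longrightarrow> Ck n (conv u k)"
proof (induction n arbitrary: k)
  case 0
  have "isCont (conv u k) x" for x
    using has_grad_conv[OF assms 0, of x] unfolding has_grad_def by (rule has_derivative_continuous)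
  then show ?case by (simp add: continuous_at_imp_continuous_on)
next
  case (Suc n)
  show ?case
    by (rule Ck_SucI[OF has_grad_conv[OF assms Suc.prems]])
      (use Suc.IH[OF test_function_grad[OF Suc.prems]] in simp)
qed

subsection \<open>Mollification\<close>

lemma integrable_rbump: "integrable lebesgue (rbump k :: real^'n \<Rightarrow> real)"
  by (rule compact_support_integrable[OF rbump_continuous compact_cball[of 0 1]])
     (simp add: rbump_zero)

text \<open>The normalising constant depends on the dimension only, which is a type here; hence the
  \<open>itself\<close> argument.\<close>

definition mass :: "'n::finite itself \<Rightarrow> real" where
  "mass _ = (LINT x|lebesgue. rbump 2 (x :: real^'n))"

text \<open>If the integral were 0, the bump would vanish almost everywhere, hence on a closed set
  of full measure, hence at the origin, where it is exp(-1).\<close>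

lemma mass_pos: "mass TYPE('n::finite) > 0"
proof -
  have "mass TYPE('n) \<noteq> 0"
  proof
    assume "mass TYPE('n) = 0"
    then have "AE x in lebesgue. rbump 2 (x::real^'n) = 0"
      using integral_nonneg_eq_0_iff_AE[OF integrable_rbump[where 'n='n]] by (simp add: mass_def rbump_nonneg)
    then have "(0::real^'n) \<in> {x. rbump 2 x = 0}"
      by (intro mem_closed_if_AE_lebesgue)
        (auto intro!: closed_Collect_eq continuous_on_const rbump_continuous)
    then show False by (simp add: rbump_def flat_def)
  qed
  moreover have "mass TYPE('n) \<ge> 0" unfolding mass_def by (simp add: rbump_nonneg)
  ultimately show ?thesis by simp
qed

text \<open>The index 2 is chosen because the gradient of \<open>rbump 0\<close> is -2x times
  \<open>rbump 2\<close>. Thus x times this kernel has an explicit compactly supported potential,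
  which is what Weyl's lemma below runs on.\<close>

definition eta :: "real^'n \<Rightarrow> real" where "eta x = rbump 2 x / mass TYPE('n)"

lemma eta_nonneg: "eta x \<ge> 0"
  by (simp add: eta_def rbump_nonneg less_imp_le[OF mass_pos])

lemma eta_zero: "norm x \<ge> 1 \<Longrightarrow> eta x = 0"
  by (simp add: eta_def rbump_zero)

lemma integrable_eta: "integrable lebesgue (eta :: real^'n \<Rightarrow> real)"
  unfolding eta_def[abs_def] by (simp add: integrable_rbump)

lemma integral_eta: "(LINT x|lebesgue. eta (x::real^'n)) = 1"
  unfolding eta_def[abs_def] using mass_pos[where 'n='n] by (simp add: mass_def)

lemma eta_continuous: "continuous_on UNIV (eta :: real^'n \<Rightarrow> real)"
  unfolding eta_def[abs_def] using mass_pos[where 'n='n]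
  by (intro continuous_intros rbump_continuous) auto

definition eta_scaled :: "real \<Rightarrow> real^'n \<Rightarrow> complex" where
  "eta_scaled s x = of_real (eta (x /\<^sub>R s) / s ^ CARD('n))"

lemma eta_scaled_zero: "s > 0 \<Longrightarrow> norm x \<ge> s \<Longrightarrow> eta_scaled s x = 0"
  by (simp add: eta_scaled_def eta_zero field_simps)

lemma test_function_eta_scaled:
  assumes "s > 0" "cball 0 s \<subseteq> D" shows "test_function D (eta_scaled s :: real^'n \<Rightarrow> complex)"
  unfolding test_function_iff
proof (intro conjI allI exI[of _ "cball 0 s"] impI)
  fix k
  have "Ck k (\<lambda>x::real^'n. of_real (1 / (mass TYPE('n) * s ^ CARD('n))) * of_real (rbump 2 (inverse s *\<^sub>R x + 0)))"
    by (intro Ck_mult Ck_const Ck_affine[OF Ck_rbump])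
  then show "Ck k (eta_scaled s :: real^'n \<Rightarrow> complex)"
    unfolding eta_scaled_def[abs_def] eta_def by simp
qed (use assms in \<open>auto intro!: eta_scaled_zero\<close>)

text \<open>The scale enters only through the argument of \<open>g\<close>, so that all estimates
  are averages against one fixed probability weight. \<open>mol_eq_conv\<close> turns it into the
  usual convolution, which supplies smoothness.\<close>

definition mol :: "real \<Rightarrow> (real^'n \<Rightarrow> complex) \<Rightarrow> real^'n \<Rightarrow> complex" where
  "mol s g x = (LINT z|lebesgue. of_real (eta z) * g (x - s *\<^sub>R z))"

lemma mol_eq_conv:
  fixes g :: "real^'n \<Rightarrow> complex"
  assumes "s > 0" shows "mol s g x = conv g (eta_scaled s) x"
proof -
  have "(LINT z|lebesgue. (\<lambda>y. g y * eta_scaled s (x - y)) (x + (-s) *\<^sub>R z)) = conv g (eta_scaled s) x /\<^sub>R s ^ CARD('n)"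
    unfolding conv_def by (subst integral_lebesgue_affine) (use assms in auto)
  moreover have "(LINT z|lebesgue. (\<lambda>y. g y * eta_scaled s (x - y)) (x + (-s) *\<^sub>R z)) = mol s g x /\<^sub>R s ^ CARD('n)"
    unfolding mol_def integral_scaleR_right[symmetric]
    using assms by (intro Bochner_Integration.integral_cong) (auto simp: eta_scaled_def scaleR_conv_of_real[where 'a=complex] field_simps)
  ultimately show ?thesis using assms by simp
qed

lemma AE_lebesgue_affine:
  fixes t :: "'a::euclidean_space"
  assumes "c \<noteq> 0" "AE x in lebesgue. P x"
  shows "AE x in lebesgue. P (t + c *\<^sub>R x)"
proof -
  obtain N where N: "N \<in> null_sets lebesgue" "{x. \<not> P x} \<subseteq> N"
    using assms(2) by (auto simp: eventually_ae_filter)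
  then have m: "indicator N \<in> borel_measurable lebesgue" by auto
  have "(\<integral>\<^sup>+x. indicator N (t + c *\<^sub>R x) \<partial>lebesgue) = 0"
    using N by (subst nn_integral_lebesgue_affine[OF assms(1) m]) (auto simp: nn_integral_indicator null_setsD1 null_setsD2)
  then have "AE x in lebesgue. indicator N (t + c *\<^sub>R x) = (0::ennreal)"
    by (subst (asm) nn_integral_0_iff_AE) (use measurable_compose[OF lebesgue_affine_measurable'[OF assms(1)] m] in auto)
  then show ?thesis
    by eventually_elim (use N(2) in \<open>auto simp: indicator_def split: if_splits\<close>)
qed

subsection \<open>Continuity of affine substitutions in the mean\<close>

definition mean_continuous :: "('a::euclidean_space \<Rightarrow> 'b::{banach, second_countable_topology}) \<Rightarrow> bool" where
  "mean_continuous f \<longleftrightarrow> (\<forall>c h. c \<longlonglongrightarrow> 1 \<longrightarrow> h \<longlonglongrightarrow> 0 \<longrightarrow> (\<forall>n. c n \<noteq> 0) \<longrightarrow>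
     (\<lambda>n::nat. LINT x|lebesgue. norm (f (h n + c n *\<^sub>R x) - f x)) \<longlonglongrightarrow> 0)"

text \<open>A three-term estimate. The substituted error is the error times the reciprocal Jacobian
  factor, which is eventually below 2 because \<open>c\<close> tends to 1.\<close>

lemma mean_continuous_approx:
  fixes f :: "'a::euclidean_space \<Rightarrow> 'b::{banach, second_countable_topology}"
  assumes f: "integrable lebesgue f"
    and approx: "\<And>e. e > 0 \<Longrightarrow> \<exists>g. integrable lebesgue g \<and> mean_continuous g \<and> (LINT x|lebesgue. norm (f x - g x)) < e"
  shows "mean_continuous f"
  unfolding mean_continuous_def
proof (intro allI impI)
  fix c :: "nat \<Rightarrow> real" and h :: "nat \<Rightarrow> 'a"
  assume c: "c \<longlonglongrightarrow> 1" and h: "h \<longlonglongrightarrow> 0" and c0: "\<forall>n. c n \<noteq> 0"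
  have aff: "integrable lebesgue (\<lambda>x. k (h n + c n *\<^sub>R x))" if "integrable lebesgue k" for k :: "'a \<Rightarrow> 'b" and n
    using that c0 by (simp add: integrable_lebesgue_affine)
  show "(\<lambda>n. LINT x|lebesgue. norm (f (h n + c n *\<^sub>R x) - f x)) \<longlonglongrightarrow> 0"
  proof (rule LIMSEQ_I)
    fix r :: real assume "r > 0"
    \<comment> \<open>A quarter suffices: the substituted error counts at most twice, and the plain
      error and the difference for \<open>g\<close> count once each.\<close>
    then obtain g where g: "integrable lebesgue g" "mean_continuous g" "(LINT x|lebesgue. norm (f x - g x)) < r / 4"
      using approx[of "r / 4"] by auto
    have "(\<lambda>n. inverse (\<bar>c n\<bar> ^ DIM('a))) \<longlonglongrightarrow> inverse (\<bar>1\<bar> ^ DIM('a))"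
      using c by (intro tendsto_intros) auto
    then have "eventually (\<lambda>n. inverse (\<bar>c n\<bar> ^ DIM('a)) < 2) sequentially"
      by (rule order_tendstoD) simp
    moreover have "eventually (\<lambda>n. (LINT x|lebesgue. norm (g (h n + c n *\<^sub>R x) - g x)) < r / 4) sequentially"
      using \<open>r > 0\<close> by (intro order_tendstoD(2)[OF g(2)[unfolded mean_continuous_def, rule_format, OF c h c0[rule_format]]]) simp
    ultimately have "eventually (\<lambda>n. norm ((LINT x|lebesgue. norm (f (h n + c n *\<^sub>R x) - f x)) - 0) < r) sequentially"
    proof eventually_elim
      case (elim n)
      let ?I = "LINT x|lebesgue. norm (f x - g x)"
      have "(LINT x|lebesgue. norm (f (h n + c n *\<^sub>R x) - f x))
        \<le> (LINT x|lebesgue. norm (f (h n + c n *\<^sub>R x) - g (h n + c n *\<^sub>R x)) + norm (g (h n + c n *\<^sub>R x) - g x) + norm (f x - g x))"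
      proof (rule integral_mono)
        fix x
        show "norm (f (h n + c n *\<^sub>R x) - f x) \<le> norm (f (h n + c n *\<^sub>R x) - g (h n + c n *\<^sub>R x)) + norm (g (h n + c n *\<^sub>R x) - g x) + norm (f x - g x)"
          using norm_triangle_ineq4[of "(f (h n + c n *\<^sub>R x) - g (h n + c n *\<^sub>R x)) + (g (h n + c n *\<^sub>R x) - g x)" "f x - g x"]
            norm_triangle_ineq[of "f (h n + c n *\<^sub>R x) - g (h n + c n *\<^sub>R x)" "g (h n + c n *\<^sub>R x) - g x"]
          by simp
      qed (use f g aff in auto)
      also have "\<dots> = (LINT x|lebesgue. (\<lambda>x. norm (f x - g x)) (h n + c n *\<^sub>R x)) + (LINT x|lebesgue. norm (g (h n + c n *\<^sub>R x) - g x)) + ?I"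
        using f g aff by simp
      also have "(LINT x|lebesgue. (\<lambda>x. norm (f x - g x)) (h n + c n *\<^sub>R x)) = inverse (\<bar>c n\<bar> ^ DIM('a)) * ?I"
        using c0 by (subst integral_lebesgue_affine) auto
      also have "\<dots> \<le> 2 * ?I"
        using elim(1) by (intro mult_right_mono) auto
      finally have "(LINT x|lebesgue. norm (f (h n + c n *\<^sub>R x) - f x)) < r"
        using g(3) elim(2) by simp
      then show ?case by simp
    qed
    then show "\<exists>no. \<forall>n\<ge>no. norm ((LINT x|lebesgue. norm (f (h n + c n *\<^sub>R x) - f x)) - 0) < r"
      by (simp add: eventually_sequentially)
  qed
qed

lemma mean_continuous_add:
  fixes f g :: "'a::euclidean_space \<Rightarrow> 'b::{banach, second_countable_topology}"
  assumes "integrable lebesgue f" "mean_continuous f" "integrable lebesgue g" "mean_continuous g"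
  shows "mean_continuous (\<lambda>x. f x + g x)"
  unfolding mean_continuous_def
proof (intro allI impI)
  fix c :: "nat \<Rightarrow> real" and h :: "nat \<Rightarrow> 'a"
  assume c: "c \<longlonglongrightarrow> 1" and h: "h \<longlonglongrightarrow> 0" and c0: "\<forall>n. c n \<noteq> 0"
  have aff: "integrable lebesgue (\<lambda>x. k (h n + c n *\<^sub>R x))" if "integrable lebesgue k" for k :: "'a \<Rightarrow> 'b" and n
    using that c0 by (simp add: integrable_lebesgue_affine)
  show "(\<lambda>n. LINT x|lebesgue. norm (f (h n + c n *\<^sub>R x) + g (h n + c n *\<^sub>R x) - (f x + g x))) \<longlonglongrightarrow> 0"
  proof (rule tendsto_sandwich[OF always_eventually always_eventually tendsto_const])
    show "(\<lambda>n. (LINT x|lebesgue. norm (f (h n + c n *\<^sub>R x) - f x)) + (LINT x|lebesgue. norm (g (h n + c n *\<^sub>R x) - g x))) \<longlonglongrightarrow> 0"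
      using assms c h c0 unfolding mean_continuous_def by (intro tendsto_add_zero) auto
    show "\<forall>n. (LINT x|lebesgue. norm (f (h n + c n *\<^sub>R x) + g (h n + c n *\<^sub>R x) - (f x + g x)))
       \<le> (LINT x|lebesgue. norm (f (h n + c n *\<^sub>R x) - f x)) + (LINT x|lebesgue. norm (g (h n + c n *\<^sub>R x) - g x))"
    proof
      fix n
      have "(LINT x|lebesgue. norm (f (h n + c n *\<^sub>R x) + g (h n + c n *\<^sub>R x) - (f x + g x)))
        \<le> (LINT x|lebesgue. norm (f (h n + c n *\<^sub>R x) - f x) + norm (g (h n + c n *\<^sub>R x) - g x))"
        by (rule integral_mono) (use assms aff in \<open>auto simp: norm_diff_triangle_ineq\<close>)
      also have "\<dots> = (LINT x|lebesgue. norm (f (h n + c n *\<^sub>R x) - f x)) + (LINT x|lebesgue. norm (g (h n + c n *\<^sub>R x) - g x))"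
        using assms aff by simp
      finally show "(LINT x|lebesgue. norm (f (h n + c n *\<^sub>R x) + g (h n + c n *\<^sub>R x) - (f x + g x)))
       \<le> (LINT x|lebesgue. norm (f (h n + c n *\<^sub>R x) - f x)) + (LINT x|lebesgue. norm (g (h n + c n *\<^sub>R x) - g x))" .
    qed
  qed simp
qed

text \<open>The integrals of \<open>indicator U\<close> before and after the substitution agree in the limit, and
  openness of \<open>U\<close> makes the positive part of the difference tend to zero pointwise.\<close>

lemma mean_continuous_indicator_open:
  fixes U :: "'a::euclidean_space set"
  assumes U: "open U" "emeasure lebesgue U < \<infinity>"
  shows "mean_continuous (indicator U :: 'a \<Rightarrow> real)"
  unfolding mean_continuous_def
proof (intro allI impI)
  fix c :: "nat \<Rightarrow> real" and h :: "nat \<Rightarrow> 'a"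
  assume c: "c \<longlonglongrightarrow> 1" and h: "h \<longlonglongrightarrow> 0" and c0: "\<forall>n. c n \<noteq> 0"
  let ?i = "indicator U :: 'a \<Rightarrow> real"
  have i: "integrable lebesgue ?i"
    using U by (simp add: integrable_real_indicator)
  then have aff: "integrable lebesgue (\<lambda>x. ?i (h n + c n *\<^sub>R x))" for n
    using c0 by (simp add: integrable_lebesgue_affine)
  have "(\<lambda>n. LINT x|lebesgue. max 0 (?i x - ?i (h n + c n *\<^sub>R x))) \<longlonglongrightarrow> (LINT x|(lebesgue::'a measure). (0::real))"
  proof (rule integral_dominated_convergence[where w = ?i])
    show "AE x in lebesgue. (\<lambda>n. max 0 (?i x - ?i (h n + c n *\<^sub>R x))) \<longlonglongrightarrow> 0"
    proof (rule AE_I2)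
      fix x :: 'a
      show "(\<lambda>n. max 0 (?i x - ?i (h n + c n *\<^sub>R x))) \<longlonglongrightarrow> 0"
      proof (cases "x \<in> U")
        case True
        have "(\<lambda>n. h n + c n *\<^sub>R x) \<longlonglongrightarrow> 0 + 1 *\<^sub>R x"
          using c h by (intro tendsto_intros)
        then have "eventually (\<lambda>n. h n + c n *\<^sub>R x \<in> U) sequentially"
          using True U(1) by (simp add: topological_tendstoD)
        then show ?thesis
          by (rule tendsto_eventually[OF eventually_mono]) (simp add: indicator_def)
      next
        case False
        then show ?thesis by simp
      qed
    qed
    show "AE x in lebesgue. norm (max 0 (?i x - ?i (h n + c n *\<^sub>R x))) \<le> ?i x" for n
      by (auto simp: indicator_def)
  qed (use i aff in auto)
  then have 1: "(\<lambda>n. 2 * (LINT x|lebesgue. max 0 (?i x - ?i (h n + c n *\<^sub>R x)))) \<longlonglongrightarrow> 0"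
    by (simp add: tendsto_mult_right_zero)
  have "(\<lambda>n. (LINT x|lebesgue. ?i x) / \<bar>c n\<bar> ^ DIM('a) - (LINT x|lebesgue. ?i x)) \<longlonglongrightarrow> (LINT x|lebesgue. ?i x) / \<bar>1\<bar> ^ DIM('a) - (LINT x|lebesgue. ?i x)"
    using c by (intro tendsto_intros) auto
  from tendsto_add[OF 1 this]
  have "(\<lambda>n. 2 * (LINT x|lebesgue. max 0 (?i x - ?i (h n + c n *\<^sub>R x))) + ((LINT x|lebesgue. ?i x) / \<bar>c n\<bar> ^ DIM('a) - (LINT x|lebesgue. ?i x))) \<longlonglongrightarrow> 0"
    by simp
  moreover have "(LINT x|lebesgue. norm (?i (h n + c n *\<^sub>R x) - ?i x)) =
     2 * (LINT x|lebesgue. max 0 (?i x - ?i (h n + c n *\<^sub>R x))) + ((LINT x|lebesgue. ?i x) / \<bar>c n\<bar> ^ DIM('a) - (LINT x|lebesgue. ?i x))" for n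
  proof -
    have "(LINT x|lebesgue. norm (?i (h n + c n *\<^sub>R x) - ?i x)) =
      (LINT x|lebesgue. 2 * max 0 (?i x - ?i (h n + c n *\<^sub>R x)) + (?i (h n + c n *\<^sub>R x) - ?i x))"
      by (intro Bochner_Integration.integral_cong) (auto simp: indicator_def)
    also have "\<dots> = 2 * (LINT x|lebesgue. max 0 (?i x - ?i (h n + c n *\<^sub>R x))) + ((LINT x|lebesgue. ?i (h n + c n *\<^sub>R x)) - (LINT x|lebesgue. ?i x))"
      using i aff by (subst Bochner_Integration.integral_add) (auto intro!: integrable_max)
    also have "(LINT x|lebesgue. ?i (h n + c n *\<^sub>R x)) = (LINT x|lebesgue. ?i x) / \<bar>c n\<bar> ^ DIM('a)"
      using c0 by (subst integral_lebesgue_affine) (auto simp: divide_inverse mult.commute)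
    finally show ?thesis .
  qed
  ultimately show "(\<lambda>n. LINT x|lebesgue. norm (?i (h n + c n *\<^sub>R x) - ?i x)) \<longlonglongrightarrow> 0"
    by simp
qed

text \<open>Outer regularity supplies an open superset whose excess has small measure, which reduces
  the claim to open sets.\<close>

lemma mean_continuous_indicator:
  fixes A :: "'a::euclidean_space set"
  assumes A: "A \<in> sets lebesgue" "emeasure lebesgue A < \<infinity>"
  shows "mean_continuous (indicator A :: 'a \<Rightarrow> real)"
proof (rule mean_continuous_approx)
  show "integrable lebesgue (indicator A :: 'a \<Rightarrow> real)"
    using A by (simp add: integrable_real_indicator)
  fix e :: real assume "e > 0"
  then obtain U where U: "open U" "A \<subseteq> U" "U - A \<in> lmeasurable" "emeasure lebesgue (U - A) < ennreal e"
    using sets_lebesgue_outer_open[OF A(1)] by metis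
  have "emeasure lebesgue U \<le> emeasure lebesgue (A \<union> (U - A))"
    by (rule emeasure_mono) (use U A in auto)
  also have "\<dots> \<le> emeasure lebesgue A + emeasure lebesgue (U - A)"
    by (rule emeasure_subadditive) (use U A in auto)
  also have "\<dots> < \<infinity>"
  proof -
    have "emeasure lebesgue (U - A) < \<infinity>" using U(3) by (rule fmeasurableD2[THEN less_top[THEN iffD1], folded infinity_ennreal_def])
    with A(2) show ?thesis by (simp only: infinity_ennreal_def ennreal_add_less_top simp_thms)
  qed
  finally have fin: "emeasure lebesgue U < \<infinity>" .
  have "(LINT x|lebesgue. norm (indicator A x - indicator U x :: real)) = (LINT x|lebesgue. indicator (U - A) x)"
    using U(2) by (intro Bochner_Integration.integral_cong) (auto simp: indicator_def)
  also have "\<dots> = measure lebesgue (U - A)" by simp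
  also have "\<dots> < e" using U(3,4) \<open>e > 0\<close>
    by (simp add: emeasure_eq_measure2 ennreal_less_iff)
  finally show "\<exists>g. integrable lebesgue g \<and> mean_continuous g \<and> (LINT x|lebesgue. norm (indicator A x - g x :: real)) < e"
    using U(1) fin mean_continuous_indicator_open[OF U(1) fin]
    by (intro exI[of _ "indicator U"]) (auto simp: integrable_real_indicator)
qed

text \<open>Indicators generate all integrable functions by sums and dominated limits. In the limit
  step the approximants are bounded by 2|f|, so 3|f| dominates the error.\<close>

lemma integrable_imp_mean_continuous:
  fixes f :: "'a::euclidean_space \<Rightarrow> 'b::{banach, second_countable_topology}"
  assumes "integrable lebesgue f" shows "mean_continuous f"
  using assms
proof (induction rule: integrable_induct)
  case (base A c)
  show ?case
    unfolding mean_continuous_def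
  proof (intro allI impI)
    fix d :: "nat \<Rightarrow> real" and h :: "nat \<Rightarrow> 'a"
    assume "d \<longlonglongrightarrow> 1" "h \<longlonglongrightarrow> 0" "\<forall>n. d n \<noteq> 0"
    then have "(\<lambda>n. norm c * (LINT x|lebesgue. norm (indicator A (h n + d n *\<^sub>R x) - indicator A x :: real))) \<longlonglongrightarrow> 0"
      using mean_continuous_indicator[OF base(1)] base(2) unfolding mean_continuous_def
      by (intro tendsto_mult_right_zero) auto
    moreover have "norm (indicator A y *\<^sub>R c - indicator A x *\<^sub>R c) = norm c * norm (indicator A y - indicator A x :: real)" for x y
      by (simp add: scaleR_diff_left[symmetric])
    ultimately show "(\<lambda>n. LINT x|lebesgue. norm (indicator A (h n + d n *\<^sub>R x) *\<^sub>R c - indicator A x *\<^sub>R c)) \<longlonglongrightarrow> 0"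
      by simp
  qed
next
  case (add f g)
  then show ?case by (intro mean_continuous_add)
next
  case (lim f s)
  show ?case
  proof (rule mean_continuous_approx)
    fix e :: real assume "e > 0"
    have "(\<lambda>i. LINT x|lebesgue. norm (f x - s i x)) \<longlonglongrightarrow> (LINT x|(lebesgue::'a measure). (0::real))"
    proof (rule integral_dominated_convergence[where w = "\<lambda>x. 3 * norm (f x)"])
      show "AE x in lebesgue. (\<lambda>i. norm (f x - s i x)) \<longlonglongrightarrow> 0"
      proof (rule AE_I2)
        fix x :: 'a assume "x \<in> space lebesgue"
        then have "(\<lambda>i. s i x) \<longlonglongrightarrow> f x" using lim by auto
        then have "(\<lambda>i. norm (f x - s i x)) \<longlonglongrightarrow> norm (f x - f x)"
          by (intro tendsto_intros)
        then show "(\<lambda>i. norm (f x - s i x)) \<longlonglongrightarrow> 0" by simp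
      qed
      show "AE x in lebesgue. norm (norm (f x - s i x)) \<le> 3 * norm (f x)" for i
      proof (rule AE_I2)
        fix x :: 'a assume "x \<in> space lebesgue"
        then have "norm (s i x) \<le> 2 * norm (f x)" using lim by auto
        then show "norm (norm (f x - s i x)) \<le> 3 * norm (f x)"
          using norm_triangle_ineq4[of "f x" "s i x"] by simp
      qed
    qed (use lim in auto)
    then have "eventually (\<lambda>i. (LINT x|lebesgue. norm (f x - s i x)) < e) sequentially"
      using \<open>e > 0\<close> by (intro order_tendstoD(2)) auto
    then obtain i where "(LINT x|lebesgue. norm (f x - s i x)) < e"
      by (auto simp: eventually_sequentially)
    then show "\<exists>g. integrable lebesgue g \<and> mean_continuous g \<and> (LINT x|lebesgue. norm (f x - g x)) < e"
      using lim by blast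
  qed (use lim in auto)
qed

section \<open>Convergence of mollifications in mean and in square mean\<close>

lemma mol_integrable:
  fixes g :: "real^'n \<Rightarrow> complex"
  assumes "integrable lebesgue g" "s \<noteq> 0"
  shows "integrable lebesgue (\<lambda>z. of_real (eta z) * g (y - s *\<^sub>R z))"
proof -
  obtain C where "\<And>x::real^'n. norm (eta x) \<le> C"
    using continuous_compact_support_bounded[OF eta_continuous compact_cball[of 0 1]] eta_zero
    by (metis mem_cball_0 nle_le)
  then have C: "norm (complex_of_real (eta x)) \<le> C" for x :: "real^'n" by simp
  have "integrable lebesgue (\<lambda>z. g (y + (-s) *\<^sub>R z))"
    using assms by (subst integrable_lebesgue_affine) auto
  moreover have "(\<lambda>x::real^'n. complex_of_real (eta x)) \<in> borel_measurable lebesgue"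
    by (intro continuous_lebesgue_measurable continuous_intros eta_continuous)
  ultimately have "integrable lebesgue (\<lambda>z. g (y + (-s) *\<^sub>R z) * of_real (eta z))"
    using C by (rule integrable_mult_bounded)
  then show ?thesis by (simp add: mult.commute)
qed

lemma norm_mol_diff_le:
  fixes g :: "real^'n \<Rightarrow> complex"
  assumes g: "integrable lebesgue g" and s: "s \<noteq> 0"
  shows "integrable lebesgue (\<lambda>z. eta z * norm (g (y - s *\<^sub>R z) - w))"
    and "norm (mol s g y - w) \<le> (LINT z|lebesgue. eta z * norm (g (y - s *\<^sub>R z) - w))"
proof -
  note i1 = mol_integrable[OF g s, of y]
  have i2: "integrable lebesgue (\<lambda>z::real^'n. of_real (eta z) * w)"
    using integrable_eta[where 'n='n] by simp
  have i3: "integrable lebesgue (\<lambda>z. of_real (eta z) * (g (y - s *\<^sub>R z) - w))"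
    using Bochner_Integration.integrable_diff[OF i1 i2] by (simp add: algebra_simps)
  have "(LINT z|lebesgue. of_real (eta (z::real^'n)) * w) = w"
    using integral_eta[where 'n='n] by simp
  then have eq: "mol s g y - w = (LINT z|lebesgue. of_real (eta z) * (g (y - s *\<^sub>R z) - w))"
    unfolding mol_def right_diff_distrib Bochner_Integration.integral_diff[OF i1 i2] by simp
  have "norm (of_real (eta z) * (g (y - s *\<^sub>R z) - w)) = eta z * norm (g (y - s *\<^sub>R z) - w)" for z
    by (simp add: norm_mult eta_nonneg)
  with integrable_norm[OF i3] show "integrable lebesgue (\<lambda>z. eta z * norm (g (y - s *\<^sub>R z) - w))"
    by simp
  show "norm (mol s g y - w) \<le> (LINT z|lebesgue. eta z * norm (g (y - s *\<^sub>R z) - w))"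
    unfolding eq using integral_norm_bound[of lebesgue "\<lambda>z. of_real (eta z) * (g (y - s *\<^sub>R z) - w)"]
    by (simp add: norm_mult eta_nonneg)
qed

text \<open>Jensen's inequality for the probability weight \<open>eta\<close>. For p = 2 it is the
  nonnegativity of a variance; stated in \<open>ennreal\<close>, it also covers a divergent
  right-hand side.\<close>

lemma norm_mol_diff_power_le:
  fixes g :: "real^'n \<Rightarrow> complex"
  assumes g: "integrable lebesgue g" and s: "s \<noteq> 0" and p: "p = 1 \<or> p = 2"
  shows "ennreal (norm (mol s g y - w) ^ p) \<le> (\<integral>\<^sup>+z. ennreal (eta z * norm (g (y - s *\<^sub>R z) - w) ^ p) \<partial>lebesgue)"
proof -
  define F where "F z = norm (g (y - s *\<^sub>R z) - w)" for z
  define a where "a = (LINT z|lebesgue. eta z * F z)"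
  note i = norm_mol_diff_le(1)[OF g s, of y w, folded F_def]
  have le: "norm (mol s g y - w) \<le> a" using norm_mol_diff_le(2)[OF g s, of y w] by (simp add: a_def F_def)
  then have a0: "a \<ge> 0" by (rule order_trans[OF norm_ge_zero])
  show ?thesis
  proof (cases "p = 1")
    case True
    have "ennreal a = (\<integral>\<^sup>+z. ennreal (eta z * F z) \<partial>lebesgue)"
      unfolding a_def using i by (intro nn_integral_eq_integral[symmetric]) (auto simp: eta_nonneg F_def)
    with ennreal_leI[OF le] show ?thesis by (simp add: F_def \<open>p = 1\<close>)
  next
    case False
    with p have p: "p = 2" by simp
    show ?thesis
    proof (cases "integrable lebesgue (\<lambda>z. eta z * F z ^ 2)")
      case True
      \<comment> \<open>The variance of \<open>F\<close> about its mean \<open>a\<close>; expanding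
        it uses that \<open>eta\<close> has integral 1.\<close>
      have "0 \<le> (LINT z|lebesgue. eta z * (F z - a)\<^sup>2)"
        by (simp add: eta_nonneg)
      also have "\<dots> = (LINT z|lebesgue. eta z * F z ^ 2 - 2 * a * (eta z * F z) + a\<^sup>2 * eta z)"
        by (simp add: power2_diff algebra_simps power2_eq_square)
      also have "\<dots> = (LINT z|lebesgue. eta z * F z ^ 2) - 2 * a * a + a\<^sup>2"
        using True i integrable_eta[where 'n='n] integral_eta[where 'n='n] by (simp add: a_def)
      finally have "a\<^sup>2 \<le> (LINT z|lebesgue. eta z * F z ^ 2)" by (simp add: power2_eq_square)
      then have le2: "norm (mol s g y - w) ^ 2 \<le> (LINT z|lebesgue. eta z * F z ^ 2)"
        using power_mono[OF le norm_ge_zero, of 2] by linarith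
      moreover have "ennreal (LINT z|lebesgue. eta z * F z ^ 2) = (\<integral>\<^sup>+z. ennreal (eta z * F z ^ 2) \<partial>lebesgue)"
        using True by (intro nn_integral_eq_integral[symmetric]) (auto simp: eta_nonneg)
      ultimately show ?thesis using ennreal_leI[OF le2] unfolding p F_def by simp
    next
      \<comment> \<open>Here the nonnegative measurable integrand is not integrable, so the
        right-hand side is infinite.\<close>
      case False
      have "(\<lambda>z. g (y + (-s) *\<^sub>R z)) \<in> borel_measurable lebesgue"
        using s by (intro measurable_compose[OF lebesgue_affine_measurable' borel_measurable_integrable[OF g]]) auto
      then have "(\<lambda>z. eta z * F z ^ 2) \<in> borel_measurable lebesgue"
        using borel_measurable_integrable[OF integrable_eta[where 'n='n]] unfolding F_def by simp
      with False have "(\<integral>\<^sup>+z. ennreal (norm (eta z * F z ^ 2)) \<partial>lebesgue) = \<infinity>"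
        by (auto simp: integrable_iff_bounded less_top[symmetric])
      then show ?thesis unfolding p F_def by (simp add: eta_nonneg)
    qed
  qed
qed

text \<open>Tonelli's theorem is applied to the product of two copies of \<open>lborel\<close>,
  where the integrand has to be Borel measurable in both variables; for that the function is
  replaced by a Borel representative.\<close>

lemma borel_version:
  fixes g :: "real^'n \<Rightarrow> complex"
  assumes "g \<in> borel_measurable lebesgue"
  obtains g' where "g' \<in> borel_measurable borel" "AE x in lebesgue. g x = g' x"
proof -
  obtain a where a: "a \<in> borel_measurable lborel" "AE x in lborel. Re (g x) = a x"
    using completion_ex_borel_measurable_real[of "\<lambda>x. Re (g x)" lborel] assms by auto
  obtain b where b: "b \<in> borel_measurable lborel" "AE x in lborel. Im (g x) = b x"
    using completion_ex_borel_measurable_real[of "\<lambda>x. Im (g x)" lborel] assms by auto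
  show ?thesis
  proof
    have "(\<lambda>x. complex_of_real (a x) + \<i> * complex_of_real (b x)) \<in> borel_measurable lborel"
      using a b by measurable
    then show "(\<lambda>x. complex_of_real (a x) + \<i> * complex_of_real (b x)) \<in> borel_measurable borel" by simp
    have "AE x in lborel. g x = complex_of_real (a x) + \<i> * complex_of_real (b x)"
      using a(2) b(2) by eventually_elim (metis complex_eq)
    then show "AE x in lebesgue. g x = complex_of_real (a x) + \<i> * complex_of_real (b x)"
      by (rule AE_completion)
  qed
qed

lemma mol_cong_AE:
  fixes g :: "real^'n \<Rightarrow> complex"
  assumes "AE x in lebesgue. g x = g' x" "g \<in> borel_measurable lebesgue" "g' \<in> borel_measurable lebesgue" "s \<noteq> 0"
  shows "mol s g y = mol s g' y"
  unfolding mol_def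
proof (rule integral_cong_AE)
  have *: "(\<lambda>z. h (y + (-s) *\<^sub>R z)) \<in> borel_measurable lebesgue" if "h \<in> borel_measurable lebesgue" for h :: "real^'n \<Rightarrow> complex"
    using assms(4) by (intro measurable_compose[OF lebesgue_affine_measurable' that]) auto
  have e: "(\<lambda>x::real^'n. complex_of_real (eta x)) \<in> borel_measurable lebesgue"
    by (intro continuous_lebesgue_measurable continuous_intros eta_continuous)
  show "(\<lambda>z. of_real (eta z) * g (y - s *\<^sub>R z)) \<in> borel_measurable lebesgue"
    "(\<lambda>z. of_real (eta z) * g' (y - s *\<^sub>R z)) \<in> borel_measurable lebesgue"
    using *[OF assms(2)] *[OF assms(3)] e by auto
  have "AE z in lebesgue. g (y + (-s) *\<^sub>R z) = g' (y + (-s) *\<^sub>R z)"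
    using assms(4) by (intro AE_lebesgue_affine[OF _ assms(1)]) auto
  then show "AE z in lebesgue. of_real (eta z) * g (y - s *\<^sub>R z) = of_real (eta z) * g' (y - s *\<^sub>R z)"
    by eventually_elim simp
qed

text \<open>Jensen's inequality at each point, followed by an exchange of the two
  integrations.\<close>

lemma nn_integral_mol_diff_le:
  fixes g :: "real^'n \<Rightarrow> complex"
  assumes g: "integrable lebesgue g" "g \<in> borel_measurable borel" and s: "s \<noteq> 0" and p: "p = 1 \<or> p = 2"
  shows "(\<integral>\<^sup>+x. ennreal (norm (mol s g (c *\<^sub>R x) - g x) ^ p) \<partial>lebesgue)
     \<le> (\<integral>\<^sup>+z. ennreal (eta z) * (\<integral>\<^sup>+x. ennreal (norm (g (- (s *\<^sub>R z) + c *\<^sub>R x) - g x) ^ p) \<partial>lebesgue) \<partial>lebesgue)"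
proof -
  have [measurable]: "(eta :: real^'n \<Rightarrow> real) \<in> borel_measurable borel"
    by (rule borel_measurable_continuous_onI[OF eta_continuous])
  note [measurable] = g(2)
  have "(\<integral>\<^sup>+x. ennreal (norm (mol s g (c *\<^sub>R x) - g x) ^ p) \<partial>lebesgue)
    \<le> (\<integral>\<^sup>+x. (\<integral>\<^sup>+z. ennreal (eta z * norm (g (- (s *\<^sub>R z) + c *\<^sub>R x) - g x) ^ p) \<partial>lborel) \<partial>lborel)"
    using norm_mol_diff_power_le[OF g(1) s p] by (auto simp: nn_integral_completion intro!: nn_integral_mono)
  also have "\<dots> = (\<integral>\<^sup>+z. (\<integral>\<^sup>+x. ennreal (eta z * norm (g (- (s *\<^sub>R z) + c *\<^sub>R x) - g x) ^ p) \<partial>lborel) \<partial>lborel)"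
    by (rule lborel_pair.Fubini'[symmetric]) measurable
  also have "\<dots> = (\<integral>\<^sup>+z. ennreal (eta z) * (\<integral>\<^sup>+x. ennreal (norm (g (- (s *\<^sub>R z) + c *\<^sub>R x) - g x) ^ p) \<partial>lborel) \<partial>lborel)"
    by (simp add: ennreal_mult eta_nonneg nn_integral_cmult)
  finally show ?thesis by (simp add: nn_integral_completion)
qed

text \<open>It carries square integrable real functions to integrable ones and, by the next lemma,
  controls squared differences; continuity in square mean is thus deduced from continuity in
  mean.\<close>

definition signed_square :: "real \<Rightarrow> real" where "signed_square t = t * \<bar>t\<bar>"

text \<open>For equal signs |a - b| is at most |a + b|, and the product of the two is the difference
  of squares. For opposite signs the right-hand side is twice a^2 + b^2.\<close>

lemma signed_square_diff: "(a - b)\<^sup>2 \<le> 2 * \<bar>signed_square a - signed_square b\<bar>"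
proof -
  have nonneg: "(a - b)\<^sup>2 \<le> 2 * \<bar>a * a - b * b\<bar>" if "a \<ge> 0" "b \<ge> 0" for a b :: real
  proof -
    have "(a - b)\<^sup>2 = \<bar>a - b\<bar> * \<bar>a - b\<bar>" by (simp add: power2_eq_square)
    also have "\<dots> \<le> \<bar>a - b\<bar> * \<bar>a + b\<bar>" using that by (intro mult_left_mono) auto
    also have "\<dots> = \<bar>a * a - b * b\<bar>" by (simp add: abs_mult[symmetric] algebra_simps)
    also have "\<dots> \<le> 2 * \<bar>a * a - b * b\<bar>"
      using mult_right_mono[of 1 2 "\<bar>a * a - b * b\<bar>"] by simp
    finally show ?thesis .
  qed
  have mixed: "(a - b)\<^sup>2 \<le> 2 * (a * a + b * b)" for a b :: real
    using zero_le_power2[of "a + b"] by (simp add: power2_eq_square algebra_simps)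
  consider "a \<ge> 0" "b \<ge> 0" | "a \<le> 0" "b \<le> 0" | "a \<ge> 0" "b \<le> 0" | "a \<le> 0" "b \<ge> 0" by linarith
  then show ?thesis
  proof cases
    case 1 then show ?thesis using nonneg[of a b] by (simp add: signed_square_def)
  next
    case 2 then show ?thesis using nonneg[of "-a" "-b"] by (simp add: signed_square_def power2_commute abs_minus_commute)
  next
    case 3
    have "0 \<le> a * a + b * b" by simp
    with 3 mixed[of a b] show ?thesis by (simp add: signed_square_def)
  next
    case 4
    have "0 \<le> a * a + b * b" by simp
    then have "\<bar>- (a * a) - b * b\<bar> = a * a + b * b" by linarith
    with 4 mixed[of a b] show ?thesis by (simp add: signed_square_def)
  qed
qed

lemma nn_integral_tendsto_0_imp_integral:
  fixes F :: "nat \<Rightarrow> 'a \<Rightarrow> real"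
  assumes "\<And>n. F n \<in> borel_measurable M" "\<And>n x. 0 \<le> F n x" "(\<lambda>n. \<integral>\<^sup>+x. ennreal (F n x) \<partial>M) \<longlonglongrightarrow> 0"
  shows "(\<lambda>n. LINT x|M. F n x) \<longlonglongrightarrow> 0"
proof -
  have "(\<lambda>n. enn2real (\<integral>\<^sup>+x. ennreal (F n x) \<partial>M)) \<longlonglongrightarrow> 0"
    by (rule tendsto_enn2real) (use assms(3) in simp_all)
  then show ?thesis using assms(1,2) by (simp add: integral_eq_nn_integral)
qed

text \<open>For p = 2 the claim is reduced to the case of integrable functions, applied to the
  signed squares of the real and the imaginary part.\<close>

lemma affine_difference_tendsto_0:
  fixes g :: "real^'n \<Rightarrow> complex"
  assumes g: "integrable lebesgue g" "integrable lebesgue (\<lambda>x. norm (g x) ^ p)" and p: "p = 1 \<or> p = 2"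
    and c: "c \<longlonglongrightarrow> 1" "\<And>n. c n \<noteq> 0" and h: "h \<longlonglongrightarrow> 0"
  shows "(\<lambda>n::nat. \<integral>\<^sup>+x. ennreal (norm (g (h n + c n *\<^sub>R x) - g x) ^ p) \<partial>lebesgue) \<longlonglongrightarrow> 0"
proof (cases "p = 1")
  case True
  have aff: "integrable lebesgue (\<lambda>x. g (h n + c n *\<^sub>R x))" for n
    using g c by (simp add: integrable_lebesgue_affine)
  have "(\<lambda>n. LINT x|lebesgue. norm (g (h n + c n *\<^sub>R x) - g x)) \<longlonglongrightarrow> 0"
    using integrable_imp_mean_continuous[OF g(1)] c h unfolding mean_continuous_def by blast
  then have "(\<lambda>n. ennreal (LINT x|lebesgue. norm (g (h n + c n *\<^sub>R x) - g x))) \<longlonglongrightarrow> ennreal 0"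
    by (rule tendsto_ennrealI)
  moreover have "(\<integral>\<^sup>+x. ennreal (norm (g (h n + c n *\<^sub>R x) - g x) ^ p) \<partial>lebesgue) = ennreal (LINT x|lebesgue. norm (g (h n + c n *\<^sub>R x) - g x))" for n
    unfolding True power_one_right using g(1) aff by (intro nn_integral_eq_integral) auto
  ultimately show ?thesis by simp
next
  case False
  with p have p: "p = 2" by simp
  let ?y = "\<lambda>n x. h n + c n *\<^sub>R x"
  define q1 where "q1 x = signed_square (Re (g x))" for x
  define q2 where "q2 x = signed_square (Im (g x))" for x
  have m: "g \<in> borel_measurable lebesgue" using g(1) by auto
  have q: "integrable lebesgue q1" "integrable lebesgue q2"
  proof -
    have [measurable]: "signed_square \<in> borel_measurable borel" unfolding signed_square_def[abs_def] by measurable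
    have "q1 \<in> borel_measurable lebesgue" "q2 \<in> borel_measurable lebesgue"
      unfolding q1_def[abs_def] q2_def[abs_def] signed_square_def using m by measurable
    moreover have "\<bar>signed_square (Re w)\<bar> \<le> norm w ^ 2" "\<bar>signed_square (Im w)\<bar> \<le> norm w ^ 2" for w
      by (simp_all add: signed_square_def abs_mult cmod_power2 power2_eq_square[symmetric])
    ultimately show "integrable lebesgue q1" "integrable lebesgue q2"
      using g(2) unfolding p q1_def[abs_def] q2_def[abs_def]
      by (auto intro!: Bochner_Integration.integrable_bound[OF g(2)[unfolded p]])
  qed
  have aff: "integrable lebesgue (\<lambda>x. q1 (?y n x))" "integrable lebesgue (\<lambda>x. q2 (?y n x))" for n
    using q c by (simp_all add: integrable_lebesgue_affine)
  define B where "B n = 2 * (LINT x|lebesgue. norm (q1 (?y n x) - q1 x)) + 2 * (LINT x|lebesgue. norm (q2 (?y n x) - q2 x))" for n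
  have "B \<longlonglongrightarrow> 2 * 0 + 2 * 0"
    unfolding B_def
    using integrable_imp_mean_continuous[OF q(1)] integrable_imp_mean_continuous[OF q(2)] c h unfolding mean_continuous_def
    by (intro tendsto_intros) auto
  then have B: "(\<lambda>n. ennreal (B n)) \<longlonglongrightarrow> 0"
    using tendsto_ennrealI by fastforce
  have "(\<integral>\<^sup>+x. ennreal (norm (g (?y n x) - g x) ^ p) \<partial>lebesgue) \<le> ennreal (B n)" for n
  proof -
    have "(\<integral>\<^sup>+x. ennreal (norm (g (?y n x) - g x) ^ p) \<partial>lebesgue)
      \<le> (\<integral>\<^sup>+x. ennreal (2 * norm (q1 (?y n x) - q1 x) + 2 * norm (q2 (?y n x) - q2 x)) \<partial>lebesgue)"
    proof (rule nn_integral_mono, rule ennreal_leI)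
      fix x
      show "norm (g (?y n x) - g x) ^ p \<le> 2 * norm (q1 (?y n x) - q1 x) + 2 * norm (q2 (?y n x) - q2 x)"
        using signed_square_diff[of "Re (g (?y n x))" "Re (g x)"] signed_square_diff[of "Im (g (?y n x))" "Im (g x)"]
        by (simp add: p q1_def q2_def cmod_power2)
    qed
    also have "\<dots> = ennreal (LINT x|lebesgue. 2 * norm (q1 (?y n x) - q1 x) + 2 * norm (q2 (?y n x) - q2 x))"
      using q aff by (intro nn_integral_eq_integral) auto
    also have "\<dots> = ennreal (B n)" unfolding B_def using q aff by simp
    finally show ?thesis .
  qed
  then show ?thesis
    by (intro tendsto_sandwich[OF _ _ tendsto_const B]) auto
qed

text \<open>For fixed \<open>z\<close> the inner integral compares \<open>g\<close> with a translate
  by -s_n z dilated by c_n, and tends to 0. Dominated convergence in \<open>z\<close> then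
  finishes.\<close>

lemma nn_integral_mol_tendsto_0:
  fixes g :: "real^'n \<Rightarrow> complex"
  assumes g: "integrable lebesgue g" "integrable lebesgue (\<lambda>x. norm (g x) ^ p)" "g \<in> borel_measurable borel" and p: "p = 1 \<or> p = 2"
    and c: "c \<longlonglongrightarrow> 1" "\<And>n. c n \<noteq> 0" and s: "s \<longlonglongrightarrow> 0" "\<And>n. s n \<noteq> 0"
  shows "(\<lambda>n::nat. \<integral>\<^sup>+x. ennreal (norm (mol (s n) g (c n *\<^sub>R x) - g x) ^ p) \<partial>lebesgue) \<longlonglongrightarrow> 0"
proof -
  define N where "N n z = (\<integral>\<^sup>+x. ennreal (norm (g (- (s n *\<^sub>R z) + c n *\<^sub>R x) - g x) ^ p) \<partial>lebesgue)" for n and z :: "real^'n"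
  define M where "M = (LINT x|lebesgue. norm (g x) ^ p)"
  have M0: "M \<ge> 0" by (simp add: M_def)
  have [measurable]: "(eta :: real^'n \<Rightarrow> real) \<in> borel_measurable borel"
    by (rule borel_measurable_continuous_onI[OF eta_continuous])
  note [measurable] = g(3)
  have meas: "N n \<in> borel_measurable lebesgue" for n
    unfolding N_def[abs_def] nn_integral_completion by (rule measurable_completion) measurable
  have "(\<lambda>n. inverse (\<bar>c n\<bar> ^ CARD('n))) \<longlonglongrightarrow> inverse (\<bar>1\<bar> ^ CARD('n))"
    using c by (intro tendsto_intros) auto
  then have "Bseq (\<lambda>n. inverse (\<bar>c n\<bar> ^ CARD('n)))"
    by (intro convergent_imp_Bseq) (auto simp: convergent_def)
  then obtain K where K: "K > 0" "\<And>n. inverse (\<bar>c n\<bar> ^ CARD('n)) \<le> K"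
    by (auto simp: Bseq_def)
  \<comment> \<open>A bound independent of \<open>n\<close> and \<open>z\<close>: translations do
    not change the integral, and the Jacobian factors are bounded by \<open>K\<close> because
    \<open>c\<close> converges to 1.\<close>
  have N_le: "N n z \<le> ennreal (2 * (K + 1) * M)" for n z
  proof -
    have i: "integrable lebesgue (\<lambda>x. norm (g (- (s n *\<^sub>R z) + c n *\<^sub>R x)) ^ p)"
      by (rule integrable_lebesgue_affine_imp[OF c(2) g(2)])
    have "N n z \<le> (\<integral>\<^sup>+x. ennreal (2 * norm (g (- (s n *\<^sub>R z) + c n *\<^sub>R x)) ^ p + 2 * norm (g x) ^ p) \<partial>lebesgue)"
      unfolding N_def
    proof (rule nn_integral_mono, rule ennreal_leI)
      fix x
      have "norm (a - b) ^ p \<le> 2 * norm a ^ p + 2 * norm b ^ p" for a b :: complex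
      proof -
        have "norm (a - b) ^ p \<le> (norm a + norm b) ^ p" by (intro power_mono norm_triangle_ineq4) simp
        also have "\<dots> \<le> 2 * norm a ^ p + 2 * norm b ^ p"
          using p zero_le_power2[of "norm a - norm b"] by (auto simp: power2_eq_square algebra_simps)
        finally show ?thesis .
      qed
      then show "norm (g (- (s n *\<^sub>R z) + c n *\<^sub>R x) - g x) ^ p \<le> 2 * norm (g (- (s n *\<^sub>R z) + c n *\<^sub>R x)) ^ p + 2 * norm (g x) ^ p" .
    qed
    also have "\<dots> = ennreal (LINT x|lebesgue. 2 * norm (g (- (s n *\<^sub>R z) + c n *\<^sub>R x)) ^ p + 2 * norm (g x) ^ p)"
      using i g by (intro nn_integral_eq_integral) auto
    also have "(LINT x|lebesgue. 2 * norm (g (- (s n *\<^sub>R z) + c n *\<^sub>R x)) ^ p + 2 * norm (g x) ^ p) = 2 * (LINT x|lebesgue. (\<lambda>x. norm (g x) ^ p) (- (s n *\<^sub>R z) + c n *\<^sub>R x)) + 2 * M"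
      using i g unfolding M_def by simp
    also have "\<dots> = 2 * (inverse (\<bar>c n\<bar> ^ CARD('n)) * M) + 2 * M"
      using c by (subst integral_lebesgue_affine) (auto simp: M_def)
    also have "\<dots> \<le> 2 * (K * M) + 2 * M"
      using K M0 by (intro add_mono mult_left_mono mult_right_mono) auto
    finally show ?thesis by (simp add: algebra_simps ennreal_leI)
  qed
  have "(\<lambda>n. \<integral>\<^sup>+z. ennreal (eta z) * N n z \<partial>lebesgue) \<longlonglongrightarrow> (\<integral>\<^sup>+z. 0 \<partial>(lebesgue :: (real^'n) measure))"
  proof (rule nn_integral_dominated_convergence[where w = "\<lambda>z. ennreal (eta z) * ennreal (2 * (K + 1) * M)"])
    show "(\<lambda>z. ennreal (eta z) * N n z) \<in> borel_measurable lebesgue" for n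
      using meas[of n] borel_measurable_integrable[OF integrable_eta[where 'n='n]] by measurable
    show "AE z in lebesgue. ennreal (eta z) * N n z \<le> ennreal (eta z) * ennreal (2 * (K + 1) * M)" for n
      using N_le by (auto intro!: mult_left_mono)
    have "(\<integral>\<^sup>+z. ennreal (eta (z::real^'n)) \<partial>lebesgue) = ennreal 1"
      using integral_eta[where 'n='n] nn_integral_eq_integral[OF integrable_eta[where 'n='n]] by (simp add: eta_nonneg)
    then show "(\<integral>\<^sup>+z. ennreal (eta (z::real^'n)) * ennreal (2 * (K + 1) * M) \<partial>lebesgue) < \<infinity>"
      using borel_measurable_integrable[OF integrable_eta[where 'n='n]]
      by (subst nn_integral_multc) auto
    show "AE z in lebesgue. (\<lambda>n. ennreal (eta z) * N n z) \<longlonglongrightarrow> 0"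
    proof (rule AE_I2)
      fix z :: "real^'n"
      have "(\<lambda>n. - (s n *\<^sub>R z)) \<longlonglongrightarrow> - (0 *\<^sub>R z)" using s by (intro tendsto_intros)
      then have "(\<lambda>n. N n z) \<longlonglongrightarrow> 0"
        unfolding N_def by (intro affine_difference_tendsto_0[OF g(1,2) p c]) simp
      from ennreal_tendsto_cmult[OF _ this, of "ennreal (eta z)"]
      show "(\<lambda>n. ennreal (eta z) * N n z) \<longlonglongrightarrow> 0" by simp
    qed
  qed (use borel_measurable_integrable[OF integrable_eta[where 'n='n]] in auto)
  then have lim: "(\<lambda>n. \<integral>\<^sup>+z. ennreal (eta z) * N n z \<partial>lebesgue) \<longlonglongrightarrow> 0" by simp
  show ?thesis
    by (rule tendsto_sandwich[OF _ _ tendsto_const lim])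
      (use nn_integral_mol_diff_le[OF g(1,3) s(2) p] in \<open>auto simp: N_def\<close>)
qed

lemma continuous_mol:
  fixes g :: "real^'n \<Rightarrow> complex"
  assumes "integrable lebesgue g" "s > 0"
  shows "continuous_on UNIV (mol s g)"
proof -
  have "mol s g = conv g (eta_scaled s)" using mol_eq_conv[OF assms(2)] by auto
  then show ?thesis
    using Ck_conv[OF assms(1) test_function_eta_scaled[OF assms(2) subset_UNIV], of 0] by simp
qed

lemma mol_tendsto:
  fixes g :: "real^'n \<Rightarrow> complex"
  assumes g: "integrable lebesgue g" "integrable lebesgue (\<lambda>x. norm (g x) ^ p)" and p: "p = 1 \<or> p = 2"
    and c: "c \<longlonglongrightarrow> 1" "\<And>n. c n \<noteq> 0" and s: "s \<longlonglongrightarrow> 0" "\<And>n. s n > 0"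
  shows "(\<lambda>n::nat. LINT x|lebesgue. norm (mol (s n) g (c n *\<^sub>R x) - g x) ^ p) \<longlonglongrightarrow> 0"
proof (rule nn_integral_tendsto_0_imp_integral)
  have m: "g \<in> borel_measurable lebesgue" using g(1) by auto
  obtain g' where g': "g' \<in> borel_measurable borel" "AE x in lebesgue. g x = g' x"
    using borel_version[OF m] by blast
  have m': "g' \<in> borel_measurable lebesgue" using g'(1) by (simp add: measurable_completion)
  have s0: "s n \<noteq> 0" for n using s(2)[of n] by simp
  have "integrable lebesgue g'" "integrable lebesgue (\<lambda>x. norm (g' x) ^ p)"
  proof -
    show "integrable lebesgue g'" using g'(2) g(1) integrable_cong_AE[OF m m' g'(2)] by simp
    have "AE x in lebesgue. norm (g x) ^ p = norm (g' x) ^ p" using g'(2) by eventually_elim simp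
    then show "integrable lebesgue (\<lambda>x. norm (g' x) ^ p)"
      using g(2) integrable_cong_AE[of "\<lambda>x. norm (g x) ^ p" lebesgue "\<lambda>x. norm (g' x) ^ p"] m m' by simp
  qed
  from nn_integral_mol_tendsto_0[OF this g'(1) p c s(1) s0]
  have "(\<lambda>n. \<integral>\<^sup>+x. ennreal (norm (mol (s n) g' (c n *\<^sub>R x) - g' x) ^ p) \<partial>lebesgue) \<longlonglongrightarrow> 0" .
  moreover have "(\<integral>\<^sup>+x. ennreal (norm (mol (s n) g' (c n *\<^sub>R x) - g' x) ^ p) \<partial>lebesgue) = (\<integral>\<^sup>+x. ennreal (norm (mol (s n) g (c n *\<^sub>R x) - g x) ^ p) \<partial>lebesgue)" for n
  proof -
    have "mol (s n) g y = mol (s n) g' y" for y by (rule mol_cong_AE[OF g'(2) m m' s0])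
    note eq = this
    have "AE x in lebesgue. ennreal (norm (mol (s n) g' (c n *\<^sub>R x) - g' x) ^ p) = ennreal (norm (mol (s n) g (c n *\<^sub>R x) - g x) ^ p)"
      using g'(2) by eventually_elim (simp add: eq)
    then show ?thesis by (rule nn_integral_cong_AE)
  qed
  ultimately show "(\<lambda>n. \<integral>\<^sup>+x. ennreal (norm (mol (s n) g (c n *\<^sub>R x) - g x) ^ p) \<partial>lebesgue) \<longlonglongrightarrow> 0"
    by simp
  show "(\<lambda>x. norm (mol (s n) g (c n *\<^sub>R x) - g x) ^ p) \<in> borel_measurable lebesgue" for n
  proof -
    have "(\<lambda>x. mol (s n) g (c n *\<^sub>R x)) \<in> borel_measurable lebesgue"
      by (rule continuous_lebesgue_measurable, rule continuous_on_compose2[OF continuous_mol[OF g(1) s(2)]])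
        (auto intro!: continuous_intros)
    with m show ?thesis by measurable
  qed
qed simp

subsection \<open>Weak derivatives\<close>

lemma LINT_lebesgue_on_eq:
  fixes h :: "'a::euclidean_space \<Rightarrow> 'b::{banach, second_countable_topology}"
  assumes "D \<in> sets lebesgue" "\<And>x. x \<notin> D \<Longrightarrow> h x = 0"
  shows "(LINT x|lebesgue_on D. h x) = (LINT x|lebesgue. h x)"
proof -
  have "(LINT x|lebesgue_on D. h x) = (LINT x|lebesgue. indicator D x *\<^sub>R h x)"
    using assms by (subst integral_restrict_space) auto
  also have "(\<lambda>x. indicator D x *\<^sub>R h x) = h" using assms(2) by (auto simp: indicator_def)
  finally show ?thesis .
qed

lemma L1_loc_integrable:
  fixes u :: "real^'n \<Rightarrow> complex"
  assumes "L1_loc D u" "\<phi> \<in> borel_measurable lebesgue" "compact K" "K \<subseteq> D"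
    "\<And>x. x \<notin> K \<Longrightarrow> \<phi> x = 0" "\<And>x. norm (\<phi> x) \<le> C"
  shows "integrable lebesgue (\<lambda>x. u x * \<phi> x)"
proof -
  have "integrable lebesgue (\<lambda>x. indicator K x *\<^sub>R u x)"
    using assms unfolding L1_loc_def set_integrable_def by blast
  then have "integrable lebesgue (\<lambda>x. (indicator K x *\<^sub>R u x) * \<phi> x)"
    using assms(2,6) by (rule integrable_mult_bounded)
  moreover have "(indicator K x *\<^sub>R u x) * \<phi> x = u x * \<phi> x" for x
    using assms(5)[of x] by (auto simp: indicator_def)
  ultimately show ?thesis by simp
qed

lemma L1_loc_component:
  fixes G :: "real^'n \<Rightarrow> complex^'m"
  assumes "L1_loc D G" shows "L1_loc D (\<lambda>x. G x $ i)"
proof -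
  have "set_integrable lebesgue K (\<lambda>x. G x $ i)" if "set_integrable lebesgue K G" for K
  proof -
    have "integrable lebesgue (\<lambda>x. (indicator K x *\<^sub>R G x) $ i)"
      using that unfolding set_integrable_def by (rule integrable_bounded_linear[OF bounded_linear_vec_nth])
    then show ?thesis unfolding set_integrable_def by simp
  qed
  then show ?thesis using assms unfolding L1_loc_def by blast
qed

lemma L1_loc_componentwise:
  fixes G :: "real^'n \<Rightarrow> complex^'m"
  assumes "\<And>i. L1_loc D (\<lambda>x. G x $ i)" shows "L1_loc D G"
  unfolding L1_loc_def
proof (intro allI impI)
  fix K assume K: "compact K \<and> K \<subseteq> D"
  have "integrable lebesgue (\<lambda>x. \<Sum>i\<in>UNIV. axis i (indicator K x *\<^sub>R (G x $ i)))"
  proof (rule Bochner_Integration.integrable_sum)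
    fix i
    have "bounded_linear (\<lambda>c::complex. axis i c :: complex^'m)"
      unfolding linear_conv_bounded_linear[symmetric] by (intro linearI) (auto simp: vec_eq_iff axis_def)
    moreover have "integrable lebesgue (\<lambda>x. indicator K x *\<^sub>R (G x $ i))"
      using assms[of i] K unfolding L1_loc_def set_integrable_def by blast
    ultimately show "integrable lebesgue (\<lambda>x. axis i (indicator K x *\<^sub>R (G x $ i)) :: complex^'m)"
      by (rule integrable_bounded_linear)
  qed
  moreover have "(\<Sum>i\<in>UNIV. axis i (indicator K x *\<^sub>R (G x $ i))) = indicator K x *\<^sub>R G x" for x
    by (auto simp: vec_eq_iff axis_def)
  ultimately show "G absolutely_integrable_on K" unfolding set_integrable_def by simp
qed

text \<open>Products with the cutoffs at the circle and Kelvin pull-backs are only known to have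
  finite smoothness here, so the weak identities must be extended from test functions to this
  class.\<close>

definition Ckc :: "nat \<Rightarrow> (real^'n) set \<Rightarrow> (real^'n \<Rightarrow> complex) \<Rightarrow> bool" where
  "Ckc k D \<phi> \<longleftrightarrow> Ck k \<phi> \<and> (\<exists>K. compact K \<and> K \<subseteq> D \<and> (\<forall>x. x \<notin> K \<longrightarrow> \<phi> x = 0))"

lemma test_function_imp_Ckc: "test_function D \<phi> \<Longrightarrow> Ckc k D \<phi>"
  unfolding Ckc_def test_function_iff by blast

lemma Ckc_subset: "Ckc k D \<phi> \<Longrightarrow> D \<subseteq> E \<Longrightarrow> Ckc k E \<phi>"
  unfolding Ckc_def by blast

text \<open>The function is controlled on the open set \<open>S\<close> and is 0 off the compact
  \<open>K\<close>; the two open sets cover the space, so the gradient is continuous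
  everywhere.\<close>

lemma Ckc_1I:
  fixes f :: "real^'n \<Rightarrow> complex"
  assumes S: "open S" and K: "compact K" "K \<subseteq> S" "K \<subseteq> D" and f: "\<And>x. x \<notin> K \<Longrightarrow> f x = 0"
    and g: "\<And>x. x \<in> S \<Longrightarrow> has_grad f (g x) x" "\<And>i. continuous_on S (\<lambda>x. g x $ i)"
  shows "Ckc 1 D f"
proof -
  have 0: "has_grad f 0 x" if "x \<notin> K" for x
    using has_derivative_transform_within_open[of "\<lambda>x. 0" "\<lambda>h. 0" x UNIV "-K" f] that f K(1)
    unfolding has_grad_def by (simp add: open_Compl compact_imp_closed)
  have "f differentiable at x" for x
    using 0[of x] g(1)[of x] K(2) by (cases "x \<in> K") (auto intro: has_grad_imp_differentiable)
  moreover have "continuous_on UNIV (\<lambda>x. grad f x $ i)" for i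
  proof -
    have "continuous_on S (\<lambda>x. grad f x $ i)"
      using g(2)[of i] grad_eqI[OF g(1)] by (simp cong: continuous_on_cong)
    moreover have "continuous_on (-K) (\<lambda>x. grad f x $ i)"
      using grad_eqI[OF 0] by (intro continuous_on_eq[OF continuous_on_const[of _ 0]]) simp
    ultimately have "continuous_on (S \<union> -K) (\<lambda>x. grad f x $ i)"
      using S K(1) by (intro continuous_on_open_Un) (auto simp: open_Compl compact_imp_closed)
    moreover have "S \<union> -K = UNIV" using K(2) by auto
    ultimately show ?thesis by simp
  qed
  ultimately show ?thesis using K f unfolding Ckc_def by (auto simp: One_nat_def)
qed

lemma Ckc_1E:
  fixes \<phi> :: "real^'n \<Rightarrow> complex"
  assumes "Ckc 1 D \<phi>"
  obtains K C where "compact K" "K \<subseteq> D" "\<And>x. x \<notin> K \<Longrightarrow> \<phi> x = 0" "\<And>x. x \<notin> K \<Longrightarrow> grad \<phi> x = 0"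
    "C > 0" "\<And>x. norm (\<phi> x) \<le> C" "\<And>x i. norm (grad \<phi> x $ i) \<le> C"
    "continuous_on UNIV \<phi>" "\<And>i. continuous_on UNIV (\<lambda>x. grad \<phi> x $ i)" "\<And>x. has_grad \<phi> (grad \<phi> x) x"
proof -
  obtain K where K: "compact K" "K \<subseteq> D" "\<And>x. x \<notin> K \<Longrightarrow> \<phi> x = 0" and C1: "Ck (Suc 0) \<phi>"
    using assms unfolding Ckc_def One_nat_def by blast
  have c: "continuous_on UNIV \<phi>" using Ck_SucD[OF C1] by simp
  have cg: "continuous_on UNIV (\<lambda>x. grad \<phi> x $ i)" for i using C1 by simp
  have g0: "grad \<phi> x = 0" if "x \<notin> K" for x
    using grad_zero_outside[of K \<phi> x] K that by (simp add: compact_imp_closed)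
  obtain C0 where C0: "C0 > 0" "\<And>x. norm (\<phi> x) \<le> C0"
    using continuous_compact_support_bounded[OF c K(1) K(3)] by blast
  have "\<exists>C. \<forall>x. norm (grad \<phi> x $ i) \<le> C" for i
    using continuous_compact_support_bounded[OF cg K(1)] g0 by (metis zero_index)
  then obtain Ci where Ci: "\<And>i x. norm (grad \<phi> x $ i) \<le> Ci i" by metis
  have "norm (grad \<phi> x $ i) \<le> C0 + (\<Sum>i\<in>UNIV. \<bar>Ci i\<bar>)" for x i
  proof -
    have "Ci i \<le> (\<Sum>i\<in>UNIV. \<bar>Ci i\<bar>)"
      by (rule order_trans[OF abs_ge_self]) (rule member_le_sum, auto)
    with Ci[of x i] C0(1) show ?thesis by linarith
  qed
  moreover have "norm (\<phi> x) \<le> C0 + (\<Sum>i\<in>UNIV. \<bar>Ci i\<bar>)" for x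
    using C0(2)[of x] sum_nonneg[of UNIV "\<lambda>i. \<bar>Ci i\<bar>"] by (auto intro: order_trans)
  moreover have "C0 + (\<Sum>i\<in>UNIV. \<bar>Ci i\<bar>) > 0" using C0(1) by (simp add: add_pos_nonneg sum_nonneg)
  ultimately show ?thesis using K c cg g0 Ck_has_grad[OF C1] that by blast
qed

text \<open>The integral of a translate does not depend on the translation; differentiating it in
  direction \<open>i\<close> at 0 gives the claim without iterated integrals.\<close>

lemma integral_grad_eq_0:
  fixes \<phi> :: "real^'n \<Rightarrow> complex"
  assumes "Ckc 1 UNIV \<phi>"
  shows "(LINT x|lebesgue. grad \<phi> x $ i) = 0"
proof -
  obtain K C where K: "compact K" "\<And>x. x \<notin> K \<Longrightarrow> \<phi> x = 0" "\<And>x. x \<notin> K \<Longrightarrow> grad \<phi> x = 0"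
    "C > 0" "\<And>x i. norm (grad \<phi> x $ i) \<le> C"
    "continuous_on UNIV \<phi>" "\<And>i. continuous_on UNIV (\<lambda>x. grad \<phi> x $ i)" "\<And>x. has_grad \<phi> (grad \<phi> x) x"
    using Ckc_1E[OF assms] by metis
  obtain R where R: "R > 0" "K \<subseteq> cball 0 R"
    using compact_imp_bounded[OF K(1)] unfolding bounded_pos by (metis mem_cball_0 subsetI)
  let ?e = "axis i 1 :: real^'n"
  have int: "integrable lebesgue \<phi>"
    by (rule compact_support_integrable[OF K(6) K(1) K(2)])
  have intg: "integrable lebesgue (\<lambda>x. grad \<phi> x $ i)"
    by (rule compact_support_integrable[OF K(7) K(1)]) (simp add: K(3))
  have shift: "integrable lebesgue (\<lambda>y. \<phi> (t *\<^sub>R ?e + y))" "(LINT y|lebesgue. \<phi> (t *\<^sub>R ?e + y)) = (LINT y|lebesgue. \<phi> y)" for t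
    using integrable_lebesgue_affine[of 1 \<phi> "t *\<^sub>R ?e"] integral_lebesgue_affine[of 1 \<phi> "t *\<^sub>R ?e"] int by simp_all
  have "((\<lambda>t. LINT y|lebesgue. \<phi> (t *\<^sub>R ?e + y)) has_derivative (\<lambda>h. LINT y|lebesgue. h *\<^sub>R (grad \<phi> (0 *\<^sub>R ?e + y) $ i))) (at 0)"
  \<comment> \<open>Translations by less than 1 keep all supports inside the ball of radius R +
    1.\<close>
  proof (rule has_derivative_integral[where r = 1 and w = "\<lambda>y. C * indicator (cball 0 (R + 1)) y" and k' = "\<lambda>t y h. h *\<^sub>R (grad \<phi> (t *\<^sub>R ?e + y) $ i)"])
    show "((\<lambda>t. \<phi> (t *\<^sub>R ?e + y)) has_derivative (\<lambda>h. h *\<^sub>R (grad \<phi> (t *\<^sub>R ?e + y) $ i))) (at t)" for t y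
    proof -
      have "((\<lambda>t. t *\<^sub>R ?e + y) has_derivative (\<lambda>h. h *\<^sub>R ?e)) (at t)"
        by (auto intro!: derivative_eq_intros)
      from has_derivative_compose[OF this K(8)[unfolded has_grad_def]]
      show ?thesis by (simp add: axis_def if_distrib if_distribR cong: if_cong)
    qed
    show "norm (h *\<^sub>R (grad \<phi> (t *\<^sub>R ?e + y) $ i)) \<le> C * indicator (cball 0 (R + 1)) y * norm h" if "t \<in> ball 0 1" for t h y
    proof (cases "t *\<^sub>R ?e + y \<in> K")
      case True
      then have "norm (t *\<^sub>R ?e + y) \<le> R" using R by auto
      then have "norm y \<le> R + 1"
        using norm_triangle_ineq4[of "t *\<^sub>R ?e + y" "t *\<^sub>R ?e"] that by (simp add: norm_axis_1)
      then show ?thesis using mult_left_mono[OF K(5)[of "t *\<^sub>R ?e + y" i], of "\<bar>h\<bar>"] by (simp add: mult.commute)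
    next
      case False
      then show ?thesis using K(3,4) by (simp add: mult_nonneg_nonneg)
    qed
    show "integrable lebesgue (\<lambda>y::real^'n. C * indicator (cball 0 (R + 1)) y)"
      using emeasure_lborel_cball_finite[of "0 :: real^'n" "R + 1"] by (simp add: integrable_real_indicator)
  qed (use shift intg in auto)
  then have "((\<lambda>t. LINT y|lebesgue. \<phi> y) has_derivative (\<lambda>h::real. LINT y|lebesgue. h *\<^sub>R (grad \<phi> y $ i))) (at 0)"
    by (simp add: shift)
  then have "(\<lambda>h::real. LINT y|lebesgue. h *\<^sub>R (grad \<phi> y $ i)) = (\<lambda>h. 0)"
    using has_derivative_unique has_derivative_const by blast
  from fun_cong[OF this, of 1] show ?thesis by simp
qed

text \<open>The product with a test function is compactly supported in \<open>D\<close> and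
  continuously differentiable, so the integrals of its partial derivatives vanish; the product rule
  does the rest.\<close>

lemma has_weak_gradient_C1:
  fixes f :: "real^'n \<Rightarrow> complex"
  assumes D: "open D" and g: "\<And>x. x \<in> D \<Longrightarrow> has_grad f (g x) x" "\<And>i. continuous_on D (\<lambda>x. g x $ i)"
  shows "has_weak_gradient D f g"
  unfolding has_weak_gradient_def
proof (intro conjI allI impI)
  have f: "continuous_on D f"
    using g(1) by (intro continuous_at_imp_continuous_on ballI) (auto simp: has_grad_def dest: has_derivative_continuous)
  have loc: "L1_loc D h" if "continuous_on D h" for h :: "real^'n \<Rightarrow> complex"
    unfolding L1_loc_def set_integrable_def
  proof (intro allI impI)
    fix K assume "compact K \<and> K \<subseteq> D"
    then have "integrable lborel (\<lambda>x. indicator K x *\<^sub>R h x)"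
      using that by (intro borel_integrable_compact) (auto intro: continuous_on_subset)
    then show "integrable lebesgue (\<lambda>x. indicator K x *\<^sub>R h x)"
      using integrable_completion[of _ lborel] by (metis borel_measurable_integrable)
  qed
  show "L1_loc D f" by (rule loc[OF f])
  show "L1_loc D g" by (rule L1_loc_componentwise[OF loc[OF g(2)]])
  fix \<phi> i assume \<phi>: "test_function D \<phi>"
  obtain K where K: "compact K" "K \<subseteq> D" "\<And>x. x \<notin> K \<Longrightarrow> \<phi> x = 0"
    using test_functionE[OF \<phi>] by metis
  have cg: "continuous_on UNIV (\<lambda>x. grad \<phi> x $ i)" for i
    using test_function_continuous[OF test_function_grad[OF \<phi>]] .
  have c: "continuous_on UNIV \<phi>" by (rule test_function_continuous[OF \<phi>])
  have p: "has_grad (\<lambda>x. f x * \<phi> x) (f x *s grad \<phi> x + \<phi> x *s g x) x" if "x \<in> D" for x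
    by (rule has_grad_mult[OF g(1)[OF that] test_function_has_grad[OF \<phi>]])
  have C: "Ckc 1 UNIV (\<lambda>x. f x * \<phi> x)"
  proof (rule Ckc_1I[OF D K(1,2) subset_UNIV _ p])
    show "continuous_on D (\<lambda>x. (f x *s grad \<phi> x + \<phi> x *s g x) $ i)" for i
      using g(2)[of i] f continuous_on_subset[OF cg, of D i] continuous_on_subset[OF c, of D]
      by (auto intro!: continuous_intros)
  qed (use K in auto)
  have z: "grad \<phi> x = 0" if "x \<notin> K" for x
    using grad_zero_outside[of K \<phi> x] K that by (simp add: compact_imp_closed)
  have i1: "integrable lebesgue (\<lambda>x. f x * grad \<phi> x $ i)"
  proof -
    obtain B where "\<And>x. norm (grad \<phi> x $ i) \<le> B" using test_function_grad_bounded[OF \<phi>] by metis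
    then show ?thesis
      using z by (intro L1_loc_integrable[OF loc[OF f] continuous_lebesgue_measurable[OF cg] K(1,2)]) auto
  qed
  have i2: "integrable lebesgue (\<lambda>x. g x $ i * \<phi> x)"
  proof -
    obtain B where "\<And>x. norm (\<phi> x) \<le> B" using test_function_bounded[OF \<phi>] by metis
    then show ?thesis
      using K by (intro L1_loc_integrable[OF loc[OF g(2)] continuous_lebesgue_measurable[OF c] K(1,2)]) auto
  qed
  have "grad (\<lambda>x. f x * \<phi> x) x $ i = f x * grad \<phi> x $ i + g x $ i * \<phi> x" for x
  proof (cases "x \<in> D")
    case True
    then show ?thesis using grad_eqI[OF p] by simp
  next
    case False
    then have "x \<notin> K" using K by auto
    then show ?thesis
      using grad_zero_outside[of K "\<lambda>x. f x * \<phi> x" x] K z by (simp add: compact_imp_closed)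
  qed
  with integral_grad_eq_0[OF C, of i] i1 i2
  have "(LINT x|lebesgue. f x * grad \<phi> x $ i) = - (LINT x|lebesgue. g x $ i * \<phi> x)"
    by (simp add: add_eq_0_iff)
  moreover have "x \<notin> K" if "x \<notin> D" for x using that K by auto
  ultimately show "(LINT x|lebesgue_on D. f x * grad \<phi> x $ i) = - (LINT x|lebesgue_on D. g x $ i * \<phi> x)"
    using D K z by (subst (1 2) LINT_lebesgue_on_eq) auto
qed

text \<open>The reflected and translated kernel is supported in \<open>cball x s\<close>, hence a
  test function on \<open>D\<close>. The derivative, first placed on the kernel, moves to
  \<open>u\<close> by the definition of the weak gradient, and the cut at the boundary of
  \<open>D\<close> is not seen.\<close>

lemma grad_mol:
  fixes u :: "real^'n \<Rightarrow> complex"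
  assumes w: "has_weak_gradient D u G" and D: "open D"
    and int: "integrable lebesgue (\<lambda>x. indicator D x *\<^sub>R u x)" "integrable lebesgue (\<lambda>x. indicator D x *\<^sub>R (G x $ i))"
    and s: "s > 0" "cball x s \<subseteq> D"
  shows "grad (mol s (\<lambda>x. indicator D x *\<^sub>R u x)) x $ i = mol s (\<lambda>x. indicator D x *\<^sub>R (G x $ i)) x"
proof -
  let ?k = "eta_scaled s :: real^'n \<Rightarrow> complex"
  have k: "test_function (cball 0 s) ?k" by (rule test_function_eta_scaled[OF s(1)]) simp
  define \<phi> where "\<phi> y = ?k ((-1) *\<^sub>R y + x)" for y
  have g\<phi>: "grad \<phi> y = - grad ?k (x - y)" for y
  proof -
    have "has_grad \<phi> (of_real (-1) *s grad ?k ((-1) *\<^sub>R y + x)) y"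
      unfolding \<phi>_def[abs_def] by (rule has_grad_affine[OF test_function_has_grad[OF k]])
    from grad_eqI[OF this] show ?thesis by (simp add: vec_eq_iff)
  qed
  have \<phi>: "test_function D \<phi>"
    unfolding test_function_iff
  proof (intro conjI allI exI[of _ "cball x s"] impI)
    show "Ck j \<phi>" for j
      using k unfolding \<phi>_def[abs_def] test_function_iff by (intro Ck_affine) blast
    show "\<phi> y = 0" if "y \<notin> cball x s" for y
      using that eta_scaled_zero[OF s(1), of "x - y"] by (simp add: \<phi>_def dist_norm)
  qed (use s in auto)
  have sets: "D \<in> sets lebesgue" using D by simp
  have "mol s (\<lambda>x. indicator D x *\<^sub>R u x) = conv (\<lambda>x. indicator D x *\<^sub>R u x) ?k"
    using mol_eq_conv[OF s(1)] by auto
  then have "grad (mol s (\<lambda>x. indicator D x *\<^sub>R u x)) x $ i = conv (\<lambda>x. indicator D x *\<^sub>R u x) (\<lambda>x. grad ?k x $ i) x"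
    using grad_eqI[OF has_grad_conv[OF int(1) k]] by simp
  also have "\<dots> = - (LINT y|lebesgue. indicator D y *\<^sub>R (u y * grad \<phi> y $ i))"
    unfolding conv_def g\<phi> by simp
  also have "\<dots> = - (LINT y|lebesgue_on D. u y * grad \<phi> y $ i)"
    using sets by (subst integral_restrict_space) auto
  also have "\<dots> = (LINT y|lebesgue_on D. G y $ i * \<phi> y)"
    using w \<phi> unfolding has_weak_gradient_def by simp
  also have "\<dots> = (LINT y|lebesgue. indicator D y *\<^sub>R (G y $ i * \<phi> y))"
    using sets by (subst integral_restrict_space) auto
  also have "\<dots> = conv (\<lambda>x. indicator D x *\<^sub>R (G x $ i)) ?k x"
    unfolding conv_def \<phi>_def by simp
  also have "\<dots> = mol s (\<lambda>x. indicator D x *\<^sub>R (G x $ i)) x" by (rule mol_eq_conv[OF s(1), symmetric])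
  finally show ?thesis .
qed

lemma norm_mol_le:
  fixes g :: "real^'n \<Rightarrow> complex"
  assumes "integrable lebesgue g" "s \<noteq> 0" "\<And>z. norm z \<le> 1 \<Longrightarrow> norm (g (x - s *\<^sub>R z) - w) \<le> C"
  shows "norm (mol s g x - w) \<le> C"
proof -
  have "norm (mol s g x - w) \<le> (LINT z|lebesgue. eta z * norm (g (x - s *\<^sub>R z) - w))"
    by (rule norm_mol_diff_le[OF assms(1,2)])
  also have "\<dots> \<le> (LINT z|lebesgue. eta (z::real^'n) * C)"
  proof (rule integral_mono[OF norm_mol_diff_le(1)[OF assms(1,2)]])
    show "integrable lebesgue (\<lambda>z::real^'n. eta z * C)" using integrable_eta[where 'n='n] by simp
    show "eta z * norm (g (x - s *\<^sub>R z) - w) \<le> eta z * C" for z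
      using assms(3)[of z] eta_zero[of z] eta_nonneg[of z] by (cases "norm z \<le> 1") (auto intro: mult_left_mono)
  qed
  also have "\<dots> = C" using integral_eta[where 'n='n] by simp
  finally show ?thesis .
qed

lemma mol_tendsto_pointwise:
  fixes g :: "real^'n \<Rightarrow> complex"
  assumes "integrable lebesgue g" "isCont g x" "s \<longlonglongrightarrow> 0" "\<And>n::nat. s n > 0"
  shows "(\<lambda>n. mol (s n) g x) \<longlonglongrightarrow> g x"
proof (rule LIMSEQ_I)
  fix r :: real assume "r > 0"
  then obtain d where d: "d > 0" "\<And>y. dist y x < d \<Longrightarrow> dist (g y) (g x) < r / 2"
    using assms(2) unfolding continuous_at_eps_delta by (metis half_gt_zero dist_commute)
  have "eventually (\<lambda>n. s n < d) sequentially" using assms(3) d(1) by (rule order_tendstoD)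
  then have "eventually (\<lambda>n. norm (mol (s n) g x - g x) < r) sequentially"
  proof eventually_elim
    case (elim n)
    have "norm (mol (s n) g x - g x) \<le> r / 2"
    proof (rule norm_mol_le[OF assms(1)])
      show "s n \<noteq> 0" using assms(4)[of n] by simp
      fix z :: "real^'n" assume "norm z \<le> 1"
      then have "norm (s n *\<^sub>R z) \<le> s n" using assms(4)[of n] mult_left_mono[of "norm z" 1 "s n"] by simp
      then have "dist (x - s n *\<^sub>R z) x < d" using elim by (simp add: dist_norm)
      then show "norm (g (x - s n *\<^sub>R z) - g x) \<le> r / 2" using d(2) by (simp add: dist_norm less_imp_le)
    qed
    then show ?case using \<open>r > 0\<close> by simp
  qed
  then show "\<exists>no. \<forall>n\<ge>no. norm (mol (s n) g x - g x) < r" by (simp add: eventually_sequentially)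
qed

lemma test_function_mol:
  fixes g :: "real^'n \<Rightarrow> complex"
  assumes "integrable lebesgue g" "s > 0" "compact K" "K \<subseteq> D" "\<And>x z. x \<notin> K \<Longrightarrow> norm z \<le> 1 \<Longrightarrow> g (x - s *\<^sub>R z) = 0"
  shows "test_function D (mol s g)"
  unfolding test_function_iff
proof (intro conjI allI exI[of _ K] impI)
  have "mol s g = conv g (eta_scaled s)" using mol_eq_conv[OF assms(2)] by auto
  then show "Ck k (mol s g)" for k
    using Ck_conv[OF assms(1) test_function_eta_scaled[OF assms(2) subset_UNIV]] by simp
  show "mol s g x = 0" if "x \<notin> K" for x
    using norm_mol_le[OF assms(1), of s x 0 0] assms(2,5) that by simp
qed (use assms in auto)

text \<open>Mollifications at scales below the distance \<open>r\<close> from the support to the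
  complement of \<open>D\<close> all live in one compact neighbourhood. Averages inherit the bounds,
  and continuity gives convergence at every point, for values and gradients.\<close>

lemma Ckc_1_approx:
  fixes \<phi> :: "real^'n \<Rightarrow> complex"
  assumes "Ckc 1 D \<phi>" "open D"
  obtains K C and \<phi>n :: "nat \<Rightarrow> real^'n \<Rightarrow> complex" where "compact K" "K \<subseteq> D" "\<And>n x. x \<notin> K \<Longrightarrow> \<phi>n n x = 0" "\<And>x. x \<notin> K \<Longrightarrow> \<phi> x = 0"
    "\<And>n. test_function D (\<phi>n n)" "\<And>n x. norm (\<phi>n n x) \<le> C" "\<And>n x i. norm (grad (\<phi>n n) x $ i) \<le> C"
    "\<And>x. (\<lambda>n. \<phi>n n x) \<longlonglongrightarrow> \<phi> x" "\<And>x i. (\<lambda>n. grad (\<phi>n n) x $ i) \<longlonglongrightarrow> grad \<phi> x $ i"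
proof -
  obtain K C where K: "compact K" "K \<subseteq> D" "\<And>x. x \<notin> K \<Longrightarrow> \<phi> x = 0" "\<And>x. x \<notin> K \<Longrightarrow> grad \<phi> x = 0"
    "C > 0" "\<And>x. norm (\<phi> x) \<le> C" "\<And>x i. norm (grad \<phi> x $ i) \<le> C"
    "continuous_on UNIV \<phi>" "\<And>i. continuous_on UNIV (\<lambda>x. grad \<phi> x $ i)" "\<And>x. has_grad \<phi> (grad \<phi> x) x"
    using Ckc_1E[OF assms(1)] by metis
  obtain r where r: "r > 0" "(\<Union>x\<in>K. cball x r) \<subseteq> D"
    using compact_subset_open_imp_cball_epsilon_subset[OF K(1) assms(2) K(2)] by metis
  define K' where "K' = (\<Union>x\<in>K. cball x r)"
  have K'eq: "K' = (\<lambda>(x,y). x + y) ` (K \<times> cball 0 r)"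
    unfolding K'_def by (force simp: image_iff dist_norm norm_minus_commute)
  have K': "compact K'" unfolding K'eq
    by (intro compact_continuous_image compact_Times K(1) compact_cball) (auto intro!: continuous_intros simp: case_prod_beta)
  have KK': "K \<subseteq> K'" using r(1) unfolding K'_def by force
  define s where "s n = r / real (Suc n)" for n
  have s: "s n > 0" "s n \<le> r" for n using r(1) by (auto simp: s_def field_simps)
  have s0: "s \<longlonglongrightarrow> 0" unfolding s_def[abs_def] using LIMSEQ_Suc[OF lim_const_over_n[of r]] by simp
  have int: "integrable lebesgue \<phi>"
    by (rule compact_support_integrable[OF K(8,1,3)])
  have intg: "integrable lebesgue (\<lambda>x. grad \<phi> x $ i)" for i
    by (rule compact_support_integrable[OF K(9,1)]) (simp add: K(4))
  have wg: "has_weak_gradient UNIV \<phi> (grad \<phi>)"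
    by (rule has_weak_gradient_C1) (use K in auto)
  have g: "grad (mol (s n) \<phi>) x $ i = mol (s n) (\<lambda>x. grad \<phi> x $ i) x" for n x i
    using grad_mol[OF wg open_UNIV _ _ s(1), of i x n] int intg by simp
  show ?thesis
  proof (rule that[of K' "\<lambda>n. mol (s n) \<phi>" C])
    have out: "x - s n *\<^sub>R z \<notin> K" if "x \<notin> K'" "norm z \<le> 1" for x z n
    proof
      assume a: "x - s n *\<^sub>R z \<in> K"
      have "norm (s n *\<^sub>R z) \<le> r" using s[of n] mult_mono[of "s n" r "norm z" 1] that by simp
      then have "x \<in> cball (x - s n *\<^sub>R z) r" by (simp add: dist_norm norm_minus_commute)
      with a that(1) show False unfolding K'_def by blast
    qed
    show tf: "test_function D (mol (s n) \<phi>)" for n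
      using out K r by (intro test_function_mol[OF int s(1) K']) (auto simp: K'_def[symmetric])
    show "mol (s n) \<phi> x = 0" if "x \<notin> K'" for n x
      using norm_mol_le[OF int, of "s n" x 0 0] s(1)[of n] out[OF that] K(3) by simp
    show "norm (mol (s n) \<phi> x) \<le> C" for n x
      using norm_mol_le[OF int, of "s n" x 0 C] s(1)[of n] K(6) by simp
    show "norm (grad (mol (s n) \<phi>) x $ i) \<le> C" for n x i
      using norm_mol_le[OF intg, of "s n" x i 0 C] s(1)[of n] K(7) unfolding g by simp
    show "(\<lambda>n. mol (s n) \<phi> x) \<longlonglongrightarrow> \<phi> x" for x
      using K(8) by (intro mol_tendsto_pointwise int s0 s) (simp add: continuous_on_eq_continuous_at)
    show "(\<lambda>n. grad (mol (s n) \<phi>) x $ i) \<longlonglongrightarrow> grad \<phi> x $ i" for x i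
      unfolding g using K(9) by (intro mol_tendsto_pointwise intg s0 s) (simp add: continuous_on_eq_continuous_at)
    show "\<phi> x = 0" if "x \<notin> K'" for x using that KK' K(3) by blast
  qed (use K' r in \<open>auto simp: K'_def[symmetric]\<close>)
qed

text \<open>By Lindelof's theorem countably many of the neighbourhoods suffice, so the exceptional
  sets add up to a null set.\<close>

lemma AE_local:
  fixes D :: "'a::second_countable_topology set"
  assumes "\<And>a. a \<in> D \<Longrightarrow> \<exists>V. open V \<and> a \<in> V \<and> (AE x in M. x \<in> V \<longrightarrow> P x)"
  shows "AE x in M. x \<in> D \<longrightarrow> P x"
proof -
  let ?F = "{V. open V \<and> (AE x in M. x \<in> V \<longrightarrow> P x)}"
  obtain F where F: "F \<subseteq> ?F" "countable F" "\<Union>F = \<Union>?F"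
    using Lindelof[of ?F] by blast
  have "AE x in M. \<forall>V\<in>F. x \<in> V \<longrightarrow> P x"
    using F(1,2) by (subst AE_ball_countable) auto
  moreover have "D \<subseteq> \<Union>F" unfolding F(3) using assms by blast
  ultimately show ?thesis by (auto elim!: eventually_mono)
qed

lemma L1_loc_integrable_mult:
  fixes u :: "real^'n \<Rightarrow> complex"
  assumes "L1_loc D u" "continuous_on UNIV \<phi>" "compact K" "K \<subseteq> D" "\<And>x. x \<notin> K \<Longrightarrow> \<phi> x = 0"
  shows "integrable lebesgue (\<lambda>x. u x * \<phi> x)"
proof -
  obtain C where "\<And>x. norm (\<phi> x) \<le> C"
    using continuous_compact_support_bounded[OF assms(2,3,5)] by metis
  then show ?thesis using assms by (intro L1_loc_integrable[OF assms(1) continuous_lebesgue_measurable]) auto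
qed

lemma L1_loc_tendsto:
  fixes u :: "real^'n \<Rightarrow> complex"
  assumes u: "L1_loc D u" and K: "compact K" "K \<subseteq> D" "\<And>n x. x \<notin> K \<Longrightarrow> \<phi>n n x = 0"
    and b: "\<And>n x. norm (\<phi>n n x) \<le> C" and lim: "\<And>x. (\<lambda>n. \<phi>n n x) \<longlonglongrightarrow> \<phi> x" and m: "\<And>n. \<phi>n n \<in> borel_measurable lebesgue"
  shows "(\<lambda>n::nat. LINT x|lebesgue. u x * \<phi>n n x) \<longlonglongrightarrow> (LINT x|lebesgue. u x * \<phi> x)"
proof -
  have i: "integrable lebesgue (\<lambda>x. indicator K x *\<^sub>R u x)"
    using u K unfolding L1_loc_def set_integrable_def by blast
  have C: "C \<ge> 0" using order_trans[OF norm_ge_zero b] .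
  have m\<phi>: "\<phi> \<in> borel_measurable lebesgue"
    by (rule borel_measurable_LIMSEQ_metric[OF m lim])
  have z: "\<phi> x = 0" if "x \<notin> K" for x
    using LIMSEQ_unique[OF lim[of x], of 0] K(3)[OF that] by simp
  have "(\<lambda>n. LINT x|lebesgue. (indicator K x *\<^sub>R u x) * \<phi>n n x) \<longlonglongrightarrow> (LINT x|lebesgue. (indicator K x *\<^sub>R u x) * \<phi> x)"
  proof (rule integral_dominated_convergence[where w = "\<lambda>x. norm (indicator K x *\<^sub>R u x) * C"])
    show "AE x in lebesgue. (\<lambda>n. (indicator K x *\<^sub>R u x) * \<phi>n n x) \<longlonglongrightarrow> (indicator K x *\<^sub>R u x) * \<phi> x"
      by (intro AE_I2 tendsto_intros lim)
    show "AE x in lebesgue. norm ((indicator K x *\<^sub>R u x) * \<phi>n n x) \<le> norm (indicator K x *\<^sub>R u x) * C" for n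
      unfolding norm_mult by (intro AE_I2 mult_left_mono b) auto
    show "integrable lebesgue (\<lambda>x. norm (indicator K x *\<^sub>R u x) * C)"
      by (intro integrable_mult_left integrable_norm i)
  qed (rule borel_measurable_times[OF borel_measurable_integrable[OF i]], rule m\<phi> m)+
  moreover have "(indicator K x *\<^sub>R u x) * \<phi>n n x = u x * \<phi>n n x" for n x using K(3) by (auto simp: indicator_def)
  moreover have "(indicator K x *\<^sub>R u x) * \<phi> x = u x * \<phi> x" for x using z by (auto simp: indicator_def)
  ultimately show ?thesis by simp
qed

text \<open>The approximants have a common compact support and common bounds, so both sides pass to
  the limit by dominated convergence.\<close>

lemma has_weak_gradient_Ckc:
  fixes u :: "real^'n \<Rightarrow> complex"
  assumes w: "has_weak_gradient D u G" and D: "open D" and \<phi>: "Ckc 1 D \<phi>"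
  shows "(LINT x|lebesgue. u x * grad \<phi> x $ i) = - (LINT x|lebesgue. G x $ i * \<phi> x)"
proof -
  obtain K C \<phi>n where K: "compact K" "K \<subseteq> D" "\<And>n x. x \<notin> K \<Longrightarrow> \<phi>n n x = 0" and K0: "\<And>x. x \<notin> K \<Longrightarrow> \<phi> x = 0"
    and tf: "\<And>n. test_function D (\<phi>n n)" and bd: "\<And>n x. norm (\<phi>n n x) \<le> C" "\<And>n x i. norm (grad (\<phi>n n) x $ i) \<le> C"
    and lim: "\<And>x. (\<lambda>n. \<phi>n n x) \<longlonglongrightarrow> \<phi> x" "\<And>x i. (\<lambda>n. grad (\<phi>n n) x $ i) \<longlonglongrightarrow> grad \<phi> x $ i"
    by (rule Ckc_1_approx[OF \<phi> D]) (rule that; assumption)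
  have L: "L1_loc D u" "L1_loc D (\<lambda>x. G x $ i)"
    using w L1_loc_component unfolding has_weak_gradient_def by blast+
  have z: "grad (\<phi>n n) x = 0" if "x \<notin> K" for n x
    using grad_zero_outside[of K "\<phi>n n" x] K(1,3) that by (simp add: compact_imp_closed)
  have l1: "(\<lambda>n. LINT x|lebesgue. u x * grad (\<phi>n n) x $ i) \<longlonglongrightarrow> (LINT x|lebesgue. u x * grad \<phi> x $ i)"
    using K bd lim tf z by (intro L1_loc_tendsto[OF L(1) K(1,2)] continuous_lebesgue_measurable test_function_continuous test_function_grad) auto
  have eq: "(LINT x|lebesgue. u x * grad (\<phi>n n) x $ i) = - (LINT x|lebesgue. G x $ i * \<phi>n n x)" for n
  proof -
    have "(LINT x|lebesgue_on D. u x * grad (\<phi>n n) x $ i) = - (LINT x|lebesgue_on D. G x $ i * \<phi>n n x)"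
      using w tf unfolding has_weak_gradient_def by blast
    moreover have "x \<notin> K" if "x \<notin> D" for x using that K(2) by auto
    ultimately show ?thesis using D K(3) z by (subst (asm) (1 2) LINT_lebesgue_on_eq) auto
  qed
  have l2: "(\<lambda>n. - (LINT x|lebesgue. G x $ i * \<phi>n n x)) \<longlonglongrightarrow> - (LINT x|lebesgue. G x $ i * \<phi> x)"
    using K bd lim tf by (intro tendsto_minus L1_loc_tendsto[OF L(2) K(1,2)] continuous_lebesgue_measurable test_function_continuous) auto
  show ?thesis using l1 l2 unfolding eq by (rule LIMSEQ_unique)
qed

lemma cdot_integrable:
  assumes "\<And>i. integrable M (\<lambda>x. v x $ i * w x $ i)" shows "integrable M (\<lambda>x. cdot (v x) (w x))"
  unfolding cdot_def using assms by auto

lemma integral_cdot: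
  assumes "\<And>i. integrable M (\<lambda>x. v x $ i * w x $ i)"
  shows "(LINT x|M. cdot (v x) (w x)) = (\<Sum>i\<in>UNIV. LINT x|M. v x $ i * w x $ i)"
  unfolding cdot_def using assms by (intro Bochner_Integration.integral_sum)

lemma weak_div_Ckc:
  fixes v :: "real^'n \<Rightarrow> complex^'n"
  assumes w: "weak_div D v h" and L: "L1_loc D v" "L1_loc D h" and D: "open D" and \<phi>: "Ckc 1 D \<phi>"
  shows "(LINT x|lebesgue. cdot (v x) (grad \<phi> x)) = - (LINT x|lebesgue. h x * \<phi> x)"
proof -
  obtain K C \<phi>n where K: "compact K" "K \<subseteq> D" "\<And>n x. x \<notin> K \<Longrightarrow> \<phi>n n x = 0" and K0: "\<And>x. x \<notin> K \<Longrightarrow> \<phi> x = 0"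
    and tf: "\<And>n. test_function D (\<phi>n n)" and bd: "\<And>n x. norm (\<phi>n n x) \<le> C" "\<And>n x i. norm (grad (\<phi>n n) x $ i) \<le> C"
    and lim: "\<And>x. (\<lambda>n. \<phi>n n x) \<longlonglongrightarrow> \<phi> x" "\<And>x i. (\<lambda>n. grad (\<phi>n n) x $ i) \<longlonglongrightarrow> grad \<phi> x $ i"
    by (rule Ckc_1_approx[OF \<phi> D]) (rule that; assumption)
  have z: "grad (\<phi>n n) x = 0" if "x \<notin> K" for n x
    using grad_zero_outside[of K "\<phi>n n" x] K(1,3) that by (simp add: compact_imp_closed)
  have i1: "integrable lebesgue (\<lambda>x. v x $ i * grad (\<phi>n n) x $ i)" for n i
    using z by (intro L1_loc_integrable_mult[OF L1_loc_component[OF L(1)] _ K(1,2)] test_function_continuous[OF test_function_grad[OF tf]]) auto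
  have c\<phi>: "continuous_on UNIV (\<lambda>x. grad \<phi> x $ i)" for i
    using \<phi> unfolding Ckc_def One_nat_def by simp
  have z\<phi>: "grad \<phi> x = 0" if "x \<notin> K" for x
    using grad_zero_outside[of K \<phi> x] K(1) K0 that by (simp add: compact_imp_closed)
  have i2: "integrable lebesgue (\<lambda>x. v x $ i * grad \<phi> x $ i)" for i
    using z\<phi> by (intro L1_loc_integrable_mult[OF L1_loc_component[OF L(1)] c\<phi> K(1,2)]) auto
  have "(\<lambda>n. \<Sum>i\<in>UNIV. LINT x|lebesgue. v x $ i * grad (\<phi>n n) x $ i) \<longlonglongrightarrow> (\<Sum>i\<in>UNIV. LINT x|lebesgue. v x $ i * grad \<phi> x $ i)"
    using K bd lim tf z by (intro tendsto_sum L1_loc_tendsto[OF L1_loc_component[OF L(1)] K(1,2)] continuous_lebesgue_measurable test_function_continuous test_function_grad) auto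
  then have l1: "(\<lambda>n. LINT x|lebesgue. cdot (v x) (grad (\<phi>n n) x)) \<longlonglongrightarrow> (LINT x|lebesgue. cdot (v x) (grad \<phi> x))"
    by (simp add: integral_cdot i1 i2)
  have eq: "(LINT x|lebesgue. cdot (v x) (grad (\<phi>n n) x)) = - (LINT x|lebesgue. h x * \<phi>n n x)" for n
  proof -
    have "(LINT x|lebesgue_on D. cdot (v x) (grad (\<phi>n n) x)) = - (LINT x|lebesgue_on D. h x * \<phi>n n x)"
      using w tf unfolding weak_div_def by blast
    moreover have "x \<notin> K" if "x \<notin> D" for x using that K(2) by auto
    ultimately show ?thesis using D K(3) z by (subst (asm) (1 2) LINT_lebesgue_on_eq) (auto simp: cdot_def)
  qed
  have l2: "(\<lambda>n. - (LINT x|lebesgue. h x * \<phi>n n x)) \<longlonglongrightarrow> - (LINT x|lebesgue. h x * \<phi> x)"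
    using K bd lim tf by (intro tendsto_minus L1_loc_tendsto[OF L(2) K(1,2)] continuous_lebesgue_measurable test_function_continuous) auto
  show ?thesis using l1 l2 unfolding eq by (rule LIMSEQ_unique)
qed

text \<open>The mollification of a locally integrable function only tests it against translates of the
  bump, so a distribution that vanishes has vanishing mollifications.\<close>

lemma AE_eq_0_if_weakly_0:
  fixes u :: "real^'n \<Rightarrow> complex"
  assumes u: "L1_loc D u" and D: "open D" and 0: "\<And>\<phi>. test_function D \<phi> \<Longrightarrow> (LINT x|lebesgue. u x * \<phi> x) = 0"
  shows "AE x\<in>D in lebesgue. u x = 0"
proof (rule AE_local)
  fix a assume "a \<in> D"
  then obtain r0 where "r0 > 0" "cball a r0 \<subseteq> D" using D open_contains_cball by blast
  then obtain r where r: "r > 0" "cball a (2 * r) \<subseteq> D"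
    by (intro that[of "r0 / 2"]) auto
  define U where "U x = indicator (cball a (2 * r)) x *\<^sub>R u x" for x
  have U: "integrable lebesgue U"
    using u[unfolded L1_loc_def, rule_format, of "cball a (2 * r)"] r(2) unfolding set_integrable_def U_def[abs_def] by simp
  define s where "s n = r / real (Suc n)" for n
  have s: "s n > 0" "s n \<le> r" for n using r(1) by (auto simp: s_def field_simps)
  have s0: "s \<longlonglongrightarrow> 0" unfolding s_def[abs_def] using LIMSEQ_Suc[OF lim_const_over_n[of r]] by simp
  have m0: "mol (s n) U x = 0" if "x \<in> ball a r" for n x
  proof -
    have "test_function D (\<lambda>y. eta_scaled (s n) ((-1) *\<^sub>R y + x))"
      unfolding test_function_iff
    proof (intro conjI allI exI[of _ "cball x (s n)"] impI)
      show "Ck j (\<lambda>y. eta_scaled (s n) ((-1) *\<^sub>R y + x))" for j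
        using test_function_eta_scaled[OF s(1) subset_UNIV, of n] unfolding test_function_iff by (intro Ck_affine) blast
      show "eta_scaled (s n) ((-1) *\<^sub>R y + x) = 0" if "y \<notin> cball x (s n)" for y
        using that eta_scaled_zero[OF s(1), of n "x - y"] by (simp add: dist_norm)
      show "cball x (s n) \<subseteq> D"
      proof (rule order_trans[OF _ r(2)], rule subsetI)
        fix y assume "y \<in> cball x (s n)"
        then show "y \<in> cball a (2 * r)" using that s(2)[of n] dist_triangle[of a y x] by simp
      qed
    qed simp
    from 0[OF this] have *: "(LINT y|lebesgue. u y * eta_scaled (s n) (x - y)) = 0" by simp
    have "U y * eta_scaled (s n) (x - y) = u y * eta_scaled (s n) (x - y)" for y
    proof (cases "y \<in> cball a (2 * r)")
      case False
      then have "norm (x - y) \<ge> s n" using that s(2)[of n] dist_triangle[of a y x] by (simp add: dist_norm)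
      then show ?thesis by (simp add: eta_scaled_zero[OF s(1)])
    qed (simp add: U_def)
    then show ?thesis unfolding mol_eq_conv[OF s(1)] conv_def by (simp only: *)
  qed
  have "(\<lambda>n. LINT x|lebesgue. norm (mol (s n) U ((\<lambda>_. 1) n *\<^sub>R x) - U x) ^ 1) \<longlonglongrightarrow> 0"
    using U s s0 by (intro mol_tendsto) auto
  then have lim: "(\<lambda>n. LINT x|lebesgue. norm (mol (s n) U x - U x)) \<longlonglongrightarrow> 0" by simp
  have iU: "integrable lebesgue (\<lambda>x. indicator (ball a r) x * norm (U x))"
    using integrable_mult_indicator[OF _ integrable_norm[OF U], of "ball a r"] by simp
  have "(LINT x|lebesgue. indicator (ball a r) x * norm (U x)) \<le> (LINT x|lebesgue. norm (mol (s n) U x - U x))" for n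
  proof (rule integral_mono[OF iU])
    have "test_function UNIV (mol (s n) U)"
    proof (rule test_function_mol[OF U s(1), of "cball a (3 * r)"])
      fix x z :: "real^'n" assume *: "x \<notin> cball a (3 * r)" "norm z \<le> 1"
      have "norm (s n *\<^sub>R z) \<le> r" using s[of n] mult_mono[of "s n" r "norm z" 1] * by simp
      then have "x - s n *\<^sub>R z \<notin> cball a (2 * r)"
        using * dist_triangle[of a x "x - s n *\<^sub>R z"] by (auto simp: dist_norm)
      then show "U (x - s n *\<^sub>R z) = 0" by (simp add: U_def)
    qed auto
    then have "integrable lebesgue (mol (s n) U)"
      by (metis compact_support_integrable test_functionE test_function_continuous)
    then show "integrable lebesgue (\<lambda>x. norm (mol (s n) U x - U x))" using U by simp
    show "indicator (ball a r) x * norm (U x) \<le> norm (mol (s n) U x - U x)" for x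
      using m0[of x n] by (auto simp: indicator_def)
  qed
  then have "(LINT x|lebesgue. indicator (ball a r) x * norm (U x)) \<le> 0"
    using lim by (intro LIMSEQ_le_const) auto
  moreover have "(LINT x|lebesgue. indicator (ball a r) x * norm (U x)) \<ge> 0" by simp
  ultimately have "AE x in lebesgue. indicator (ball a r) x * norm (U x) = 0"
    using integral_nonneg_eq_0_iff_AE[OF iU] by auto
  then have "AE x\<in>ball a r in lebesgue. u x = 0"
  proof eventually_elim
    case (elim x)
    have "x \<in> cball a (2 * r)" if "x \<in> ball a r" using that r(1) by auto
    with elim show ?case by (auto simp: U_def)
  qed
  then show "\<exists>V. open V \<and> a \<in> V \<and> (AE x\<in>V in lebesgue. u x = 0)"
    using r(1) by (intro exI[of _ "ball a r"]) auto
qed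

lemma weak_gradient_unique:
  fixes u :: "real^'n \<Rightarrow> complex"
  assumes G: "has_weak_gradient D u G" "has_weak_gradient D u G'" and D: "open D"
  shows "AE x\<in>D in lebesgue. G x = G' x"
proof -
  have L: "L1_loc D (\<lambda>x. G x $ i)" "L1_loc D (\<lambda>x. G' x $ i)" for i
    using G L1_loc_component unfolding has_weak_gradient_def by blast+
  have "AE x\<in>D in lebesgue. G x $ i - G' x $ i = 0" for i
  proof (rule AE_eq_0_if_weakly_0[OF _ D])
    show "L1_loc D (\<lambda>x. G x $ i - G' x $ i)"
      using L[of i] unfolding L1_loc_def by (intro allI impI set_integral_diff) blast+
    fix \<phi> assume \<phi>: "test_function D \<phi>"
    obtain K where K: "compact K" "K \<subseteq> D" "\<And>x. x \<notin> K \<Longrightarrow> \<phi> x = 0" using test_functionE[OF \<phi>] by metis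
    note c = test_function_continuous[OF \<phi>]
    have "integrable lebesgue (\<lambda>x. G x $ i * \<phi> x)" "integrable lebesgue (\<lambda>x. G' x $ i * \<phi> x)"
      using L1_loc_integrable_mult[OF L(1) c K, of i] L1_loc_integrable_mult[OF L(2) c K, of i] by blast+
    moreover have "(LINT x|lebesgue. G x $ i * \<phi> x) = (LINT x|lebesgue. G' x $ i * \<phi> x)"
      using has_weak_gradient_Ckc[OF G(1) D test_function_imp_Ckc[OF \<phi>], of i]
        has_weak_gradient_Ckc[OF G(2) D test_function_imp_Ckc[OF \<phi>], of i] by simp
    ultimately show "(LINT x|lebesgue. (G x $ i - G' x $ i) * \<phi> x) = 0"
      by (simp add: left_diff_distrib)
  qed
  then have "AE x in lebesgue. \<forall>i. x \<in> D \<longrightarrow> G x $ i - G' x $ i = 0"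
    by (subst AE_all_countable) auto
  then show ?thesis by eventually_elim (auto simp: vec_eq_iff)
qed

lemma wgrad_works: "has_weak_gradient D u G \<Longrightarrow> has_weak_gradient D u (wgrad D u)"
  unfolding wgrad_def by (rule someI[where P = "has_weak_gradient D u"])

lemma wgrad_eq:
  "has_weak_gradient D u G \<Longrightarrow> open D \<Longrightarrow> AE x\<in>D in lebesgue. wgrad D u x = G x"
  using weak_gradient_unique wgrad_works by blast

lemma L1_loc_cong_AE:
  fixes u :: "real^'n \<Rightarrow> 'b::euclidean_space"
  assumes "L1_loc D u" "AE x\<in>D in lebesgue. u x = u' x"
  shows "L1_loc D u'"
  unfolding L1_loc_def set_integrable_def
proof (intro allI impI)
  fix K assume K: "compact K \<and> K \<subseteq> D"
  then have i: "integrable lebesgue (\<lambda>x. indicator K x *\<^sub>R u x)"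
    using assms(1) unfolding L1_loc_def set_integrable_def by blast
  have ae: "AE x in lebesgue. indicator K x *\<^sub>R u x = indicator K x *\<^sub>R u' x"
    using assms(2) by eventually_elim (use K in \<open>auto simp: indicator_def\<close>)
  have m: "(\<lambda>x. indicator K x *\<^sub>R u' x) \<in> borel_measurable lebesgue"
    using borel_measurable_AE[OF borel_measurable_integrable[OF i] ae] .
  show "integrable lebesgue (\<lambda>x. indicator K x *\<^sub>R u' x)"
    using integrable_cong_AE[OF borel_measurable_integrable[OF i] m ae] i by simp
qed

text \<open>Lebesgue measure is complete, so the two functions are measurable together; if neither
  is, both integrals are 0 by convention.\<close>

lemma LINT_cong_AE:
  fixes f g :: "'a::euclidean_space \<Rightarrow> 'b::euclidean_space"
  assumes ae: "AE x in lebesgue. f x = g x"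
  shows "(LINT x|lebesgue. f x) = (LINT x|lebesgue. g x)"
proof (cases "f \<in> borel_measurable lebesgue")
  case True
  then show ?thesis using borel_measurable_AE[OF True ae] ae by (intro integral_cong_AE)
next
  case False
  moreover have "g \<notin> borel_measurable lebesgue"
  proof
    assume g: "g \<in> borel_measurable lebesgue"
    have "AE x in lebesgue. g x = f x" using ae by eventually_elim simp
    from borel_measurable_AE[OF g this] False show False by simp
  qed
  ultimately show ?thesis using borel_measurable_integrable by (metis not_integrable_integral_eq)
qed

lemma integrable_cong_AE_lebesgue:
  fixes f g :: "'a::euclidean_space \<Rightarrow> 'b::euclidean_space"
  assumes "integrable lebesgue f" and ae: "AE x in lebesgue. f x = g x"
  shows "integrable lebesgue g"
  using integrable_cong_AE[OF borel_measurable_integrable[OF assms(1)] borel_measurable_AE[OF borel_measurable_integrable[OF assms(1)] ae] ae] assms(1)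
  by simp

lemma has_weak_gradientI:
  fixes u :: "real^'n \<Rightarrow> complex"
  assumes "open D" "L1_loc D u" "L1_loc D G"
    "\<And>\<phi> i. test_function D \<phi> \<Longrightarrow> (LINT x|lebesgue. u x * grad \<phi> x $ i) = - (LINT x|lebesgue. G x $ i * \<phi> x)"
  shows "has_weak_gradient D u G"
  unfolding has_weak_gradient_def
proof (intro conjI allI impI assms(2,3))
  fix \<phi> i assume \<phi>: "test_function D \<phi>"
  obtain K where K: "compact K" "K \<subseteq> D" "\<And>x. x \<notin> K \<Longrightarrow> \<phi> x = 0" using test_functionE[OF \<phi>] by metis
  then have "\<phi> x = 0" "grad \<phi> x = 0" if "x \<notin> D" for x
    using grad_zero_outside[of K \<phi> x] that by (auto simp: compact_imp_closed)
  then show "(LINT x|lebesgue_on D. u x * grad \<phi> x $ i) = - (LINT x|lebesgue_on D. G x $ i * \<phi> x)"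
    using assms(1,4) \<phi> by (subst (1 2) LINT_lebesgue_on_eq) auto
qed

lemma has_weak_gradient_cong_AE:
  fixes u :: "real^'n \<Rightarrow> complex"
  assumes w: "has_weak_gradient D u G" and D: "open D"
    and u: "AE x\<in>D in lebesgue. u x = u' x" and G: "AE x\<in>D in lebesgue. G x = G' x"
  shows "has_weak_gradient D u' G'"
proof (rule has_weak_gradientI[OF D])
  show "L1_loc D u'" "L1_loc D G'"
    using w L1_loc_cong_AE[OF _ u] L1_loc_cong_AE[OF _ G] unfolding has_weak_gradient_def by blast+
  fix \<phi> i assume \<phi>: "test_function D \<phi>"
  obtain K where K: "compact K" "K \<subseteq> D" "\<And>x. x \<notin> K \<Longrightarrow> \<phi> x = 0" using test_functionE[OF \<phi>] by metis
  then have z: "\<phi> x = 0" "grad \<phi> x = 0" if "x \<notin> D" for x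
    using grad_zero_outside[of K \<phi> x] that by (auto simp: compact_imp_closed)
  have "(LINT x|lebesgue. u x * grad \<phi> x $ i) = (LINT x|lebesgue. u' x * grad \<phi> x $ i)"
    by (rule LINT_cong_AE) (use u in eventually_elim, use z in fastforce)
  moreover have "(LINT x|lebesgue. G x $ i * \<phi> x) = (LINT x|lebesgue. G' x $ i * \<phi> x)"
    by (rule LINT_cong_AE) (use G in eventually_elim, use z in fastforce)
  ultimately show "(LINT x|lebesgue. u' x * grad \<phi> x $ i) = - (LINT x|lebesgue. G' x $ i * \<phi> x)"
    using has_weak_gradient_Ckc[OF w D test_function_imp_Ckc[OF \<phi>], of i] by simp
qed

lemma has_weak_gradient_subset:
  fixes u :: "real^'n \<Rightarrow> complex"
  assumes w: "has_weak_gradient D u G" and D: "open D" "open E" "E \<subseteq> D"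
  shows "has_weak_gradient E u G"
proof (rule has_weak_gradientI[OF D(2)])
  show "L1_loc E u" "L1_loc E G"
    using w D(3) unfolding has_weak_gradient_def L1_loc_def by blast+
  fix \<phi> i assume "test_function E \<phi>"
  then have "test_function D \<phi>" using D(3) by (rule test_function_subset)
  then show "(LINT x|lebesgue. u x * grad \<phi> x $ i) = - (LINT x|lebesgue. G x $ i * \<phi> x)"
    using has_weak_gradient_Ckc[OF w D(1) test_function_imp_Ckc, of \<phi> i] by blast
qed

lemma L1_loc_lincomb:
  fixes u v :: "real^'n \<Rightarrow> complex"
  assumes "L1_loc D u" "L1_loc D v" shows "L1_loc D (\<lambda>x. a * u x + b * v x)"
proof -
  have "set_integrable lebesgue K (\<lambda>x. a * u x + b * v x)" if "set_integrable lebesgue K u" "set_integrable lebesgue K v" for K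
  proof -
    have "integrable lebesgue (\<lambda>x. a * (indicator K x *\<^sub>R u x) + b * (indicator K x *\<^sub>R v x))"
      using that unfolding set_integrable_def by (intro Bochner_Integration.integrable_add integrable_mult_right)
    then show ?thesis unfolding set_integrable_def by (simp add: scaleR_add_right)
  qed
  then show ?thesis using assms unfolding L1_loc_def by blast
qed

lemma has_weak_gradient_lincomb:
  fixes u v :: "real^'n \<Rightarrow> complex"
  assumes u: "has_weak_gradient D u G" and v: "has_weak_gradient D v H" and D: "open D"
  shows "has_weak_gradient D (\<lambda>x. a * u x + b * v x) (\<lambda>x. a *s G x + b *s H x)"
proof (rule has_weak_gradientI[OF D])
  note L = u[unfolded has_weak_gradient_def] v[unfolded has_weak_gradient_def]
  have Lu: "L1_loc D u" "L1_loc D v" "L1_loc D (\<lambda>x. G x $ i)" "L1_loc D (\<lambda>x. H x $ i)" for i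
    using L L1_loc_component by blast+
  show "L1_loc D (\<lambda>x. a * u x + b * v x)" using Lu by (intro L1_loc_lincomb)
  show "L1_loc D (\<lambda>x. a *s G x + b *s H x)"
    using L1_loc_lincomb[OF Lu(3,4)] by (intro L1_loc_componentwise) simp
  fix \<phi> i assume \<phi>: "test_function D \<phi>"
  obtain K where K: "compact K" "K \<subseteq> D" "\<And>x. x \<notin> K \<Longrightarrow> \<phi> x = 0" using test_functionE[OF \<phi>] by metis
  have z: "grad \<phi> x $ i = 0" if "x \<notin> K" for x
    using grad_zero_outside[of K \<phi> x] K that by (auto simp: compact_imp_closed)
  note c = test_function_continuous[OF \<phi>] and cg = test_function_continuous[OF test_function_grad[OF \<phi>]]
  have i: "integrable lebesgue (\<lambda>x. u x * grad \<phi> x $ i)" "integrable lebesgue (\<lambda>x. v x * grad \<phi> x $ i)"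
    "integrable lebesgue (\<lambda>x. G x $ i * \<phi> x)" "integrable lebesgue (\<lambda>x. H x $ i * \<phi> x)"
    using L1_loc_integrable_mult[OF Lu(1) cg K(1,2) z] L1_loc_integrable_mult[OF Lu(2) cg K(1,2) z]
      L1_loc_integrable_mult[OF Lu(3) c K] L1_loc_integrable_mult[OF Lu(4) c K] by blast+
  have "(LINT x|lebesgue. (a * u x + b * v x) * grad \<phi> x $ i) = (LINT x|lebesgue. a * (u x * grad \<phi> x $ i) + b * (v x * grad \<phi> x $ i))"
    by (simp add: algebra_simps)
  also have "\<dots> = a * (LINT x|lebesgue. u x * grad \<phi> x $ i) + b * (LINT x|lebesgue. v x * grad \<phi> x $ i)"
    using i by simp
  also have "\<dots> = - (a * (LINT x|lebesgue. G x $ i * \<phi> x) + b * (LINT x|lebesgue. H x $ i * \<phi> x))"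
    using has_weak_gradient_Ckc[OF u D test_function_imp_Ckc[OF \<phi>], of i] has_weak_gradient_Ckc[OF v D test_function_imp_Ckc[OF \<phi>], of i]
    by simp
  also have "\<dots> = - (LINT x|lebesgue. a * (G x $ i * \<phi> x) + b * (H x $ i * \<phi> x))"
    using i by simp
  also have "\<dots> = - (LINT x|lebesgue. (a *s G x + b *s H x) $ i * \<phi> x)"
    by (simp add: algebra_simps)
  finally show "(LINT x|lebesgue. (a * u x + b * v x) * grad \<phi> x $ i) = - (LINT x|lebesgue. (a *s G x + b *s H x) $ i * \<phi> x)" .
qed

section \<open>The Laplacian and weak harmonicity\<close>

definition lap :: "(real^'n \<Rightarrow> complex) \<Rightarrow> real^'n \<Rightarrow> complex" where
  "lap f x = (\<Sum>i\<in>UNIV. grad (\<lambda>y. grad f y $ i) x $ i)"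

text \<open>Both derivatives are placed on the test function, so that reflected functions, known
  only to be locally integrable, fall under it.\<close>

definition weakly_harmonic :: "(real^'n) set \<Rightarrow> (real^'n \<Rightarrow> complex) \<Rightarrow> bool" where
  "weakly_harmonic D V \<longleftrightarrow> L1_loc D V \<and> (\<forall>\<phi>. test_function D \<phi> \<longrightarrow> (LINT x|lebesgue. V x * lap \<phi> x) = 0)"

lemma test_function_lap: "test_function D \<phi> \<Longrightarrow> test_function D (lap \<phi>)"
proof -
  assume \<phi>: "test_function D \<phi>"
  obtain K where K: "compact K" "K \<subseteq> D" "\<And>x. x \<notin> K \<Longrightarrow> \<phi> x = 0" using test_functionE[OF \<phi>] by metis
  have g: "grad \<phi> x = 0" if "x \<notin> K" for x
    using grad_zero_outside[of K \<phi> x] K that by (simp add: compact_imp_closed)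
  have gg: "grad (\<lambda>y. grad \<phi> y $ i) x = 0" if "x \<notin> K" for x i
    by (rule grad_zero_outside[of K _ x]) (use g K that in \<open>auto simp: compact_imp_closed\<close>)
  have "Ck k (\<lambda>x. \<Sum>i\<in>UNIV. grad (\<lambda>y. grad \<phi> y $ i) x $ i)" for k
    by (intro Ck_sum) (use test_function_grad[OF test_function_grad[OF \<phi>]] in \<open>auto simp: test_function_def\<close>)
  then show ?thesis unfolding test_function_iff lap_def[abs_def]
    using K gg by (intro conjI allI exI[of _ K]) auto
qed

lemma grad_affine:
  fixes f :: "real^'n \<Rightarrow> complex"
  assumes "f differentiable (at (a *\<^sub>R x + b))"
  shows "grad (\<lambda>x. f (a *\<^sub>R x + b)) x = of_real a *s grad f (a *\<^sub>R x + b)"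
  by (rule grad_eqI[OF has_grad_affine[OF differentiable_imp_has_grad[OF assms]]])

lemma grad_cmult:
  fixes f :: "real^'n \<Rightarrow> complex"
  assumes "f differentiable (at x)"
  shows "grad (\<lambda>x. c * f x) x = c *s grad f x"
  using grad_eqI[OF has_grad_mult[OF has_grad_const differentiable_imp_has_grad[OF assms], of c]] by simp

lemma grad2_affine:
  fixes f :: "real^'n \<Rightarrow> complex"
  assumes "Ck 2 f"
  shows "grad (\<lambda>y. grad (\<lambda>x. f (a *\<^sub>R x + b)) y $ i) x $ j = of_real (a\<^sup>2) * (grad (\<lambda>y. grad f y $ i) (a *\<^sub>R x + b) $ j)"
proof -
  have C: "Ck (Suc (Suc 0)) f" using assms by (simp add: numeral_2_eq_2)
  then have d: "f differentiable (at x)" "(\<lambda>y. grad f y $ i) differentiable (at x)" for x i by auto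
  have d': "(\<lambda>y. grad f (a *\<^sub>R y + b) $ i) differentiable (at x)" for x
    using has_grad_imp_differentiable[OF has_grad_affine[OF differentiable_imp_has_grad[OF d(2)]], of a b i] .
  have "grad (\<lambda>y. grad (\<lambda>x. f (a *\<^sub>R x + b)) y $ i) x = grad (\<lambda>y. of_real a * (grad f (a *\<^sub>R y + b) $ i)) x"
    by (simp add: grad_affine[OF d(1)])
  also have "\<dots> = of_real a *s grad (\<lambda>y. grad f (a *\<^sub>R y + b) $ i) x"
    by (rule grad_cmult[OF d'])
  also have "\<dots> = of_real a *s (of_real a *s grad (\<lambda>y. grad f y $ i) (a *\<^sub>R x + b))"
    by (simp add: grad_affine[OF d(2)])
  finally show ?thesis by (simp add: power2_eq_square)
qed

lemma lap_affine:
  fixes f :: "real^'n \<Rightarrow> complex"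
  assumes "Ck 2 f"
  shows "lap (\<lambda>x. f (a *\<^sub>R x + b)) x = of_real (a\<^sup>2) * lap f (a *\<^sub>R x + b)"
  unfolding lap_def grad2_affine[OF assms] by (simp add: sum_distrib_left)

text \<open>The explicit Hessian serves twice: its trace identifies the scale derivative of the
  mollifier, and its symmetry in \<open>i\<close> and \<open>j\<close> is what makes second
  derivatives of mollifications commute.\<close>

lemma grad2_rbump:
  fixes x :: "real^'n"
  shows "grad (\<lambda>y. grad (\<lambda>x. of_real (rbump k x)) y $ i) x $ j =
    of_real (- 2 * ((if i = j then rbump (k + 2) x - real k * rbump (k + 1) x else 0) -
       2 * x $ i * x $ j * (rbump (k + 4) x - real (2 * k + 2) * rbump (k + 3) x + real (k * (k + 1)) * rbump (k + 2) x)))"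
proof -
  have "has_grad (\<lambda>y. (of_real (rbump (k + 2) y) - of_real (real k) * of_real (rbump (Suc k) y)) * (- 2 * of_real (y $ i)))
     ((of_real (rbump (k + 2) x) - of_real (real k) * of_real (rbump (Suc k) x)) *s ((-2) *s axis i 1 + of_real (x $ i) *s 0) + (- 2 * of_real (x $ i)) *s
       ((\<chi> i. of_real ((rbump (k + 2 + 2) x - real (k + 2) * rbump (Suc (k + 2)) x) * (- 2 * x $ i))) -
        (of_real (real k) *s (\<chi> i. of_real ((rbump (Suc k + 2) x - real (Suc k) * rbump (Suc (Suc k)) x) * (- 2 * x $ i))) + of_real (rbump (Suc k) x) *s 0))) x"
    by (intro has_grad_mult has_grad_diff has_grad_const has_grad_rbump has_grad_coord)
  then have "has_grad (\<lambda>y. grad (\<lambda>x. of_real (rbump k x)) y $ i)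
     ((of_real (rbump (k + 2) x) - of_real (real k) * of_real (rbump (Suc k) x)) *s ((-2) *s axis i 1 + of_real (x $ i) *s 0) + (- 2 * of_real (x $ i)) *s
       ((\<chi> i. of_real ((rbump (k + 2 + 2) x - real (k + 2) * rbump (Suc (k + 2)) x) * (- 2 * x $ i))) -
        (of_real (real k) *s (\<chi> i. of_real ((rbump (Suc k + 2) x - real (Suc k) * rbump (Suc (Suc k)) x) * (- 2 * x $ i))) + of_real (rbump (Suc k) x) *s 0))) x"
    by (simp add: grad_eqI[OF has_grad_rbump])
  from grad_eqI[OF this] show ?thesis
    by (simp only:) (cases "i = j"; simp add: axis_def eval_nat_numeral algebra_simps)
qed

lemma rbump_bounded: "\<exists>M. \<forall>x::real^'n. \<bar>rbump k x\<bar> \<le> M"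
  using continuous_compact_support_bounded[OF rbump_continuous compact_cball[of "0::real^'n" 1], of k] rbump_zero
  by (metis mem_cball_0 nle_le real_norm_def)

subsection \<open>Weyl's lemma in the plane\<close>

text \<open>This is d/dt of \<open>eta_scaled t z\<close> in the plane: the first term comes from
  the argument z/t, the second from the normalising factor 1/t^2.\<close>

definition eta_dot :: "real \<Rightarrow> real^2 \<Rightarrow> complex" where
  "eta_dot t z = of_real (((rbump 4 (z /\<^sub>R t) - 2 * rbump 3 (z /\<^sub>R t)) * (2 * (norm z)\<^sup>2 / t ^ 5) - 2 * rbump 2 (z /\<^sub>R t) / t ^ 3) / mass TYPE(2))"

lemma eta_scaled_has_derivative:
  fixes z :: "real^2"
  assumes "t > 0"
  shows "((\<lambda>t. eta_scaled t z) has_derivative (\<lambda>h. h *\<^sub>R eta_dot t z)) (at t)"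
proof -
  have q: "((\<lambda>t. 1 - (norm z)\<^sup>2 / t\<^sup>2) has_real_derivative 2 * (norm z)\<^sup>2 / t ^ 3) (at t)"
    using assms by (auto intro!: derivative_eq_intros simp: field_simps power2_eq_square eval_nat_numeral)
  have r: "rbump k (z /\<^sub>R t) = flat k (1 - (norm z)\<^sup>2 / t\<^sup>2)" for k t
    by (simp add: rbump_def power_divide divide_inverse power_mult_distrib power_inverse mult.commute)
  have "((\<lambda>t. flat 2 (1 - (norm z)\<^sup>2 / t\<^sup>2)) has_real_derivative
     (flat 4 (1 - (norm z)\<^sup>2 / t\<^sup>2) - 2 * flat 3 (1 - (norm z)\<^sup>2 / t\<^sup>2)) * (2 * (norm z)\<^sup>2 / t ^ 3)) (at t)"
    using DERIV_chain'[OF q flat_deriv[of 2]] by (simp add: eval_nat_numeral mult.commute)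
  then have "((\<lambda>t. flat 2 (1 - (norm z)\<^sup>2 / t\<^sup>2) / t ^ 2 / mass TYPE(2)) has_real_derivative
     ((flat 4 (1 - (norm z)\<^sup>2 / t\<^sup>2) - 2 * flat 3 (1 - (norm z)\<^sup>2 / t\<^sup>2)) * (2 * (norm z)\<^sup>2 / t ^ 5) - 2 * flat 2 (1 - (norm z)\<^sup>2 / t\<^sup>2) / t ^ 3) / mass TYPE(2)) (at t)"
    using assms mass_pos[where 'n=2]
    by (auto intro!: derivative_eq_intros simp: field_simps eval_nat_numeral)
  then have "((\<lambda>t. flat 2 (1 - (norm z)\<^sup>2 / t\<^sup>2) / t ^ 2 / mass TYPE(2)) has_derivative
     (\<lambda>h. h * (((flat 4 (1 - (norm z)\<^sup>2 / t\<^sup>2) - 2 * flat 3 (1 - (norm z)\<^sup>2 / t\<^sup>2)) * (2 * (norm z)\<^sup>2 / t ^ 5) - 2 * flat 2 (1 - (norm z)\<^sup>2 / t\<^sup>2) / t ^ 3) / mass TYPE(2)))) (at t)"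
    unfolding has_field_derivative_def by (rule has_derivative_eq_rhs) (rule ext, rule mult.commute)
  from bounded_linear.has_derivative[OF bounded_linear_of_real[where 'a = complex] this]
  show ?thesis
    unfolding eta_scaled_def eta_def r eta_dot_def
    by (simp add: scaleR_conv_of_real mult.commute)
qed

text \<open>For a scaled kernel, d/dt is -1/t times the divergence of z times the kernel. By the
  choice of \<open>eta\<close> this field is minus the gradient of \<open>rbump 0\<close> at z/t,
  divided by twice the mass; hence the constant 2 t times the mass.\<close>

lemma eta_dot_eq_lap:
  fixes x y :: "real^2"
  assumes "t > 0"
  shows "lap (\<lambda>y. of_real (rbump 0 ((1/t) *\<^sub>R y + (- (1/t)) *\<^sub>R x))) y = of_real (2 * t * mass TYPE(2)) * eta_dot t (x - y)"
proof -
  let ?w = "(1/t) *\<^sub>R y + (- (1/t)) *\<^sub>R x"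
  have sym: "rbump k ((x - y) /\<^sub>R t) = rbump k ?w" for k
  proof -
    have "(x - y) /\<^sub>R t = - ?w" by (simp add: algebra_simps divide_inverse)
    then have "norm ((x - y) /\<^sub>R t) = norm ?w" by (simp only: norm_minus_cancel)
    then show ?thesis by (simp only: rbump_def)
  qed
  have w: "(?w $ i) * (?w $ i) = ((x - y) $ i)\<^sup>2 / t\<^sup>2" for i
    using assms by (simp add: power2_eq_square field_simps)
  have "lap (\<lambda>y. of_real (rbump 0 ((1/t) *\<^sub>R y + (- (1/t)) *\<^sub>R x))) y = of_real ((1/t)\<^sup>2) * lap (\<lambda>y. of_real (rbump 0 y)) ?w"
    by (rule lap_affine[OF Ck_rbump])
  also have "lap (\<lambda>y. of_real (rbump 0 y)) ?w = of_real (- 4 * rbump 2 ?w + 4 * ((?w $ 1) * (?w $ 1) + (?w $ 2) * (?w $ 2)) * (rbump 4 ?w - 2 * rbump 3 ?w))"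
    unfolding lap_def grad2_rbump by (simp add: sum_2 algebra_simps) (simp add: numeral_2_eq_2)
  also have "(?w $ 1) * (?w $ 1) + (?w $ 2) * (?w $ 2) = (norm (x - y))\<^sup>2 / t\<^sup>2"
  proof -
    have "(norm (x - y))\<^sup>2 = ((x - y) $ 1)\<^sup>2 + ((x - y) $ 2)\<^sup>2"
      unfolding power2_norm_eq_inner inner_vec_def sum_2 by (simp add: power2_eq_square)
    then show ?thesis unfolding w by (simp only: add_divide_distrib)
  qed
  finally have "lap (\<lambda>y. of_real (rbump 0 ((1/t) *\<^sub>R y + (- (1/t)) *\<^sub>R x))) y =
    of_real ((1/t)\<^sup>2 * (- 4 * rbump 2 ?w + 4 * ((norm (x - y))\<^sup>2 / t\<^sup>2) * (rbump 4 ?w - 2 * rbump 3 ?w)))"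
    by (simp only: of_real_mult)
  moreover have "(1/t)\<^sup>2 * (- 4 * rbump 2 ?w + 4 * ((norm (x - y))\<^sup>2 / t\<^sup>2) * (rbump 4 ?w - 2 * rbump 3 ?w)) =
     2 * t * mass TYPE(2) * (((rbump 4 ?w - 2 * rbump 3 ?w) * (2 * (norm (x - y))\<^sup>2 / t ^ 5) - 2 * rbump 2 ?w / t ^ 3) / mass TYPE(2))"
  proof -
    have id: "(1/t)\<^sup>2 * (- 4 * a + 4 * (n / t\<^sup>2) * b) = 2 * t * m * ((b * (2 * n / t ^ 5) - 2 * a / t ^ 3) / m)" if "m > 0" for a b n m :: real
      using assms that by (simp add: field_simps eval_nat_numeral)
    show ?thesis by (rule id[OF mass_pos])
  qed
  ultimately show ?thesis unfolding eta_dot_def sym by (simp only: of_real_mult)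
qed

text \<open>This plays the part of the mean value property: the derivative in the radius is
  \<open>V\<close> tested against the Laplacian of a bump supported in \<open>cball x t\<close>, so
  it is 0.\<close>

lemma conv_eta_scaled_constant:
  fixes V :: "real^2 \<Rightarrow> complex"
  assumes V: "integrable lebesgue V" and harm: "\<And>\<phi>. test_function D \<phi> \<Longrightarrow> (LINT y|lebesgue. V y * lap \<phi> y) = 0"
    and r: "ball x r \<subseteq> D" and st: "0 < s" "s < r" "0 < t" "t < r"
  shows "conv V (eta_scaled s) x = conv V (eta_scaled t) x"
proof -
  have d: "((\<lambda>t. conv V (eta_scaled t) x) has_derivative (\<lambda>h. 0)) (at t)" if t: "0 < t" "t < r" for t
  proof -
    let ?\<phi> = "\<lambda>y. of_real (rbump 0 ((1/t) *\<^sub>R y + (- (1/t)) *\<^sub>R x)) :: complex"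
    have \<phi>: "test_function D ?\<phi>"
      unfolding test_function_iff
    proof (intro conjI allI exI[of _ "cball x t"] impI)
      show "Ck k ?\<phi>" for k by (rule Ck_affine[OF Ck_rbump])
      show "cball x t \<subseteq> D" using r t by auto
      show "?\<phi> y = 0" if "y \<notin> cball x t" for y
      proof -
        have "norm ((1/t) *\<^sub>R y + (- (1/t)) *\<^sub>R x) = norm (y - x) / t"
          using t by (simp add: scaleR_diff_right[symmetric] divide_inverse mult.commute)
        also have "\<dots> \<ge> 1" using that t by (simp add: dist_norm norm_minus_commute)
        finally show ?thesis by (simp add: rbump_zero)
      qed
    qed simp
    obtain M2 where M2: "\<And>x::real^2. \<bar>rbump 2 x\<bar> \<le> M2" using rbump_bounded by metis
    obtain M3 where M3: "\<And>x::real^2. \<bar>rbump 3 x\<bar> \<le> M3" using rbump_bounded by metis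
    obtain M4 where M4: "\<And>x::real^2. \<bar>rbump 4 x\<bar> \<le> M4" using rbump_bounded by metis
    \<comment> \<open>Radii within t/2 of t exceed t/2. The first term of \<open>eta_dot\<close>
      vanishes for |z| beyond the radius, so |z|^2 divided by the fifth power is at most the inverse
      third power there.\<close>
    define B where "B = ((M4 + 2 * M3) * 2 + 2 * M2) / (t / 2) ^ 3 / mass TYPE(2)"
    have bound: "norm (eta_dot \<tau> z) \<le> B" if "\<tau> \<in> ball t (t / 2)" for \<tau> z
    proof -
      have \<tau>: "\<tau> > t / 2" "\<tau> > 0" using that t by (auto simp: dist_real_def abs_if split: if_splits)
      have M0: "M2 \<ge> 0" "M3 \<ge> 0" "M4 \<ge> 0" using M2[of 0] M3[of 0] M4[of 0] by linarith+
      let ?a = "rbump 4 (z /\<^sub>R \<tau>) - 2 * rbump 3 (z /\<^sub>R \<tau>)"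
      have a1: "\<bar>?a * (2 * (norm z)\<^sup>2 / \<tau> ^ 5)\<bar> \<le> (M4 + 2 * M3) * (2 / \<tau> ^ 3)"
      proof (cases "norm z \<ge> \<tau>")
        case True
        then have "norm (z /\<^sub>R \<tau>) \<ge> 1" using \<tau> by (simp add: field_simps)
        then have "?a = 0" by (simp add: rbump_zero)
        then show ?thesis using M0 \<tau> by simp
      next
        case False
        then have "(norm z)\<^sup>2 \<le> \<tau>\<^sup>2" by (intro power_mono) auto
        then have "2 * (norm z)\<^sup>2 / \<tau> ^ 5 \<le> 2 * \<tau>\<^sup>2 / \<tau> ^ 5" using \<tau> by (intro divide_right_mono) auto
        also have "\<dots> = 2 / \<tau> ^ 3" using \<tau> by (simp add: field_simps eval_nat_numeral)
        finally have "2 * (norm z)\<^sup>2 / \<tau> ^ 5 \<le> 2 / \<tau> ^ 3" .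
        moreover have "\<bar>?a\<bar> \<le> M4 + 2 * M3" using M3[of "z /\<^sub>R \<tau>"] M4[of "z /\<^sub>R \<tau>"] by linarith
        ultimately show ?thesis using \<tau> unfolding abs_mult by (intro mult_mono) auto
      qed
      have a2: "\<bar>2 * rbump 2 (z /\<^sub>R \<tau>) / \<tau> ^ 3\<bar> \<le> 2 * M2 / \<tau> ^ 3"
        using M2[of "z /\<^sub>R \<tau>"] \<tau> by (simp add: abs_mult divide_right_mono)
      have "\<bar>?a * (2 * (norm z)\<^sup>2 / \<tau> ^ 5) - 2 * rbump 2 (z /\<^sub>R \<tau>) / \<tau> ^ 3\<bar> \<le> (M4 + 2 * M3) * (2 / \<tau> ^ 3) + 2 * M2 / \<tau> ^ 3"
        by (rule order_trans[OF abs_triangle_ineq4 add_mono[OF a1 a2]])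
      also have "\<dots> = ((M4 + 2 * M3) * 2 + 2 * M2) / \<tau> ^ 3" by (simp add: add_divide_distrib)
      also have "\<dots> \<le> ((M4 + 2 * M3) * 2 + 2 * M2) / (t / 2) ^ 3"
        using M0 \<tau> t by (intro divide_left_mono power_mono mult_pos_pos zero_less_power) auto
      finally have fin: "\<bar>?a * (2 * (norm z)\<^sup>2 / \<tau> ^ 5) - 2 * rbump 2 (z /\<^sub>R \<tau>) / \<tau> ^ 3\<bar> \<le> ((M4 + 2 * M3) * 2 + 2 * M2) / (t / 2) ^ 3" .
      show ?thesis unfolding eta_dot_def B_def norm_of_real abs_divide
        using divide_right_mono[OF fin less_imp_le[OF mass_pos[where 'n=2]]] mass_pos[where 'n=2] by (simp only: abs_of_pos)
    qed
    have e: "eta_dot t (x - y) = inverse (of_real (2 * t * mass TYPE(2))) * lap ?\<phi> y" for y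
      using eta_dot_eq_lap[OF t(1), of x y] t mass_pos[where 'n=2] by (simp add: field_simps)
    have int: "integrable lebesgue (\<lambda>y. V y * lap ?\<phi> y)"
    proof -
      obtain C where "\<And>y. norm (lap ?\<phi> y) \<le> C" using test_function_bounded[OF test_function_lap[OF \<phi>]] by metis
      then show ?thesis
        using test_function_continuous[OF test_function_lap[OF \<phi>]] V
        by (intro integrable_mult_bounded continuous_lebesgue_measurable)
    qed
    have "((\<lambda>t. conv V (eta_scaled t) x) has_derivative (\<lambda>h. LINT y|lebesgue. V y * (h *\<^sub>R eta_dot t (x - y)))) (at t)"
      unfolding conv_def
    proof (rule has_derivative_integral[where r = "t/2" and w = "\<lambda>y. norm (V y) * B" and k' = "\<lambda>t y h. V y * (h *\<^sub>R eta_dot t (x - y))"])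
      fix \<tau> assume \<tau>: "\<tau> \<in> ball t (t / 2)"
      then have \<tau>0: "\<tau> > 0" using t by (auto simp: dist_real_def abs_if split: if_splits)
      show "integrable lebesgue (\<lambda>y. V y * eta_scaled \<tau> (x - y))"
        by (rule conv_integrable[OF V test_function_eta_scaled[OF \<tau>0 subset_UNIV]])
      show "((\<lambda>t. V y * eta_scaled t (x - y)) has_derivative (\<lambda>h. V y * (h *\<^sub>R eta_dot \<tau> (x - y)))) (at \<tau>)" for y
        by (intro has_derivative_mult_right eta_scaled_has_derivative \<tau>0)
      show "norm (V y * (h *\<^sub>R eta_dot \<tau> (x - y))) \<le> norm (V y) * B * norm h" for y h
        using mult_left_mono[OF bound[OF \<tau>, of "x - y"], of "norm (V y) * \<bar>h\<bar>"]
        by (simp add: norm_mult algebra_simps)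
    next
      show "integrable lebesgue (\<lambda>y. V y * (h *\<^sub>R eta_dot t (x - y)))" for h
      proof -
        have "integrable lebesgue (\<lambda>y. (of_real h * inverse (of_real (2 * t * mass TYPE(2)))) * (V y * lap ?\<phi> y))"
          by (intro integrable_mult_right int)
        then show ?thesis by (simp add: e scaleR_conv_of_real mult.left_commute mult.assoc)
      qed
    qed (use t V in auto)
    moreover have "(LINT y|lebesgue. V y * (h *\<^sub>R eta_dot t (x - y))) = 0" for h
    proof -
      have "(LINT y|lebesgue. V y * (h *\<^sub>R eta_dot t (x - y))) = (LINT y|lebesgue. (of_real h * inverse (of_real (2 * t * mass TYPE(2)))) * (V y * lap ?\<phi> y))"
        by (simp add: e scaleR_conv_of_real mult.left_commute mult.assoc)
      also have "\<dots> = 0" using harm[OF \<phi>] by simp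
      finally show ?thesis .
    qed
    ultimately show ?thesis by (simp only:)
  qed
  have "\<exists>c. \<forall>t\<in>{0<..<r}. conv V (eta_scaled t) x = c"
  proof (rule has_derivative_zero_constant)
    fix t assume "t \<in> {0<..<r}"
    then show "((\<lambda>t. conv V (eta_scaled t) x) has_derivative (\<lambda>h. 0)) (at t within {0<..<r})"
      by (auto intro: has_derivative_at_withinI[OF d])
  qed simp
  then show ?thesis using st by auto
qed

text \<open>On the smaller ball the averages over all radii up to \<open>s\<close> coincide, while
  as the radius tends to 0 they converge to \<open>V\<close> in mean; so \<open>V\<close> equals any
  one of them.\<close>

lemma weyl:
  fixes V :: "real^2 \<Rightarrow> complex"
  assumes V: "integrable lebesgue V" "\<And>x. x \<notin> cball a R \<Longrightarrow> V x = 0"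
    and harm: "\<And>\<phi>. test_function (ball a R) \<phi> \<Longrightarrow> (LINT y|lebesgue. V y * lap \<phi> y) = 0"
    and s: "0 < s" "s < R"
  shows "AE x\<in>ball a (R - s) in lebesgue. V x = mol s V x"
proof -
  define sn where "sn n = s / real (Suc n)" for n
  have sn: "sn n > 0" "sn n \<le> s" for n using s by (auto simp: sn_def field_simps)
  have s0: "sn \<longlonglongrightarrow> 0" unfolding sn_def[abs_def] using LIMSEQ_Suc[OF lim_const_over_n[of s]] by simp
  have eq: "mol (sn n) V x = mol s V x" if "x \<in> ball a (R - s)" for x n
  proof -
    have "conv V (eta_scaled (sn n)) x = conv V (eta_scaled s) x"
    proof (rule conv_eta_scaled_constant[OF V(1) harm])
      show "ball x (R - dist a x) \<subseteq> ball a R"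
      proof
        fix y assume "y \<in> ball x (R - dist a x)"
        then show "y \<in> ball a R" using dist_triangle[of a y x] by simp
      qed
      show "s < R - dist a x" "sn n < R - dist a x" using that sn[of n] by auto
    qed (use sn s in auto)
    then show ?thesis by (simp add: mol_eq_conv sn s)
  qed
  have tf: "integrable lebesgue (mol t V)" if "t > 0" for t
  proof -
    have "test_function UNIV (mol t V)"
    proof (rule test_function_mol[OF V(1) that, of "cball a (R + t)"])
      fix x z :: "real^2" assume *: "x \<notin> cball a (R + t)" "norm z \<le> 1"
      have "norm (t *\<^sub>R z) \<le> t" using that mult_left_mono[of "norm z" 1 t] * by simp
      then have "x - t *\<^sub>R z \<notin> cball a R"
        using * dist_triangle[of a x "x - t *\<^sub>R z"] by (auto simp: dist_norm)
      then show "V (x - t *\<^sub>R z) = 0" by (rule V(2))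
    qed auto
    then show ?thesis
      by (metis compact_support_integrable test_functionE test_function_continuous)
  qed
  have "(\<lambda>n. LINT x|lebesgue. norm (mol (sn n) V ((\<lambda>_. 1) n *\<^sub>R x) - V x) ^ 1) \<longlonglongrightarrow> 0"
    using V sn s0 by (intro mol_tendsto) auto
  then have lim: "(\<lambda>n. LINT x|lebesgue. norm (mol (sn n) V x - V x)) \<longlonglongrightarrow> 0" by simp
  have i: "integrable lebesgue (\<lambda>x. indicator (ball a (R - s)) x * norm (mol s V x - V x))"
    using integrable_mult_indicator[OF _ integrable_norm[OF Bochner_Integration.integrable_diff[OF tf[OF s(1)] V(1)]], of "ball a (R - s)"] by simp
  have "(LINT x|lebesgue. indicator (ball a (R - s)) x * norm (mol s V x - V x)) \<le> (LINT x|lebesgue. norm (mol (sn n) V x - V x))" for n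
  proof (rule integral_mono[OF i])
    show "integrable lebesgue (\<lambda>x. norm (mol (sn n) V x - V x))" using V tf[OF sn(1)] by simp
    show "indicator (ball a (R - s)) x * norm (mol s V x - V x) \<le> norm (mol (sn n) V x - V x)" for x
      using eq[of x n] by (auto simp: indicator_def)
  qed
  then have "(LINT x|lebesgue. indicator (ball a (R - s)) x * norm (mol s V x - V x)) \<le> 0"
    using lim by (intro LIMSEQ_le_const) auto
  moreover have "(LINT x|lebesgue. indicator (ball a (R - s)) x * norm (mol s V x - V x)) \<ge> 0" by simp
  ultimately have "AE x in lebesgue. indicator (ball a (R - s)) x * norm (mol s V x - V x) = 0"
    using integral_nonneg_eq_0_iff_AE[OF i] by auto
  then show ?thesis by eventually_elim auto
qed

lemma grad2_eta_scaled_sym: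
  fixes x :: "real^'n"
  shows "grad (\<lambda>y. grad (eta_scaled s) y $ i) x $ j = grad (\<lambda>y. grad (eta_scaled s) y $ j) x $ i"
proof -
  let ?c = "of_real (1 / (mass TYPE('n) * s ^ CARD('n))) :: complex"
  let ?f = "\<lambda>x::real^'n. of_real (rbump 2 (inverse s *\<^sub>R x + 0)) :: complex"
  have e: "eta_scaled s = (\<lambda>x. ?c * ?f x)" by (simp add: eta_scaled_def[abs_def] eta_def)
  have C: "Ck (Suc (Suc 0)) ?f" by (rule Ck_affine[OF Ck_rbump])
  then have d: "?f differentiable (at x)" "(\<lambda>y. grad ?f y $ i) differentiable (at x)" for x i by auto
  have "grad (\<lambda>y. grad (eta_scaled s) y $ i) x $ j = ?c * (grad (\<lambda>y. grad ?f y $ i) x $ j)" for i j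
    unfolding e grad_cmult[OF d(1)] vector_smult_component grad_cmult[OF d(2)] ..
  moreover have "grad (\<lambda>y. grad ?f y $ i) x $ j = grad (\<lambda>y. grad ?f y $ j) x $ i"
    unfolding grad2_affine[OF Ck_rbump] grad2_rbump by (simp add: algebra_simps)
  ultimately show ?thesis by simp
qed

lemma grad_conv:
  fixes u k :: "real^'n \<Rightarrow> complex"
  assumes "integrable lebesgue u" "test_function D k"
  shows "(\<lambda>x. grad (conv u k) x $ i) = conv u (\<lambda>x. grad k x $ i)"
  using grad_eqI[OF has_grad_conv[OF assms]] by (intro ext) simp

text \<open>Cutting \<open>V\<close> off to \<open>cball a R\<close> makes the mollification a
  global test function that represents \<open>V\<close> on the smaller ball. Symmetry of its Hessian
  is recorded for the Cauchy-Riemann equations.\<close>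

lemma weyl_representative:
  fixes V :: "real^2 \<Rightarrow> complex"
  assumes V: "weakly_harmonic D V" and R: "cball a R \<subseteq> D" "0 < R'" "R' < R"
  obtains v where "v = mol (R - R') (\<lambda>x. indicator (cball a R) x *\<^sub>R V x)" "test_function UNIV v"
    "AE x in lebesgue. x \<in> ball a R' \<longrightarrow> V x = v x" "\<And>x. x \<in> ball a R' \<Longrightarrow> lap v x = 0"
    "\<And>x i j. grad (\<lambda>y. grad v y $ i) x $ j = grad (\<lambda>y. grad v y $ j) x $ i"
proof -
  define U where "U x = indicator (cball a R) x *\<^sub>R V x" for x
  define s where "s = R - R'"
  have s: "0 < s" "s < R" using R by (auto simp: s_def)
  have L: "L1_loc D V" and harm: "\<And>\<phi>. test_function D \<phi> \<Longrightarrow> (LINT x|lebesgue. V x * lap \<phi> x) = 0"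
    using V unfolding weakly_harmonic_def by blast+
  have U: "integrable lebesgue U"
    using L[unfolded L1_loc_def, rule_format, of "cball a R"] R(1) unfolding set_integrable_def U_def[abs_def] by simp
  have U0: "U x = 0" if "x \<notin> cball a R" for x using that by (simp add: U_def)
  have Uharm: "(LINT y|lebesgue. U y * lap \<phi> y) = 0" if \<phi>: "test_function (ball a R) \<phi>" for \<phi>
  proof -
    obtain K where K: "compact K" "K \<subseteq> ball a R" "\<And>x. x \<notin> K \<Longrightarrow> lap \<phi> x = 0"
      using test_functionE[OF test_function_lap[OF \<phi>]] by metis
    have eq: "U y * lap \<phi> y = V y * lap \<phi> y" for y
    proof (cases "y \<in> K")
      case True
      then have "y \<in> cball a R" using K(2) by auto
      then show ?thesis by (simp add: U_def)
    qed (simp add: K(3))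
    have "ball a R \<subseteq> D" using R(1) by auto
    with harm[OF test_function_subset[OF \<phi>]] show ?thesis unfolding eq by blast
  qed
  let ?k = "eta_scaled s :: real^2 \<Rightarrow> complex"
  have k: "test_function UNIV ?k" by (rule test_function_eta_scaled[OF s(1) subset_UNIV])
  have m: "mol s U = conv U ?k" using mol_eq_conv[OF s(1)] by auto
  have g2: "grad (\<lambda>y. grad (mol s U) y $ i) x $ j = conv U (\<lambda>x. grad (\<lambda>y. grad ?k y $ i) x $ j) x" for x i j
    unfolding m grad_conv[OF U k] using fun_cong[OF grad_conv[OF U test_function_grad[OF k]]] by simp
  show ?thesis
  proof (rule that[of "mol s U"])
    show "mol s U = mol (R - R') (\<lambda>x. indicator (cball a R) x *\<^sub>R V x)"
      by (simp add: s_def U_def[abs_def])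
    show "test_function UNIV (mol s U)"
    proof (rule test_function_mol[OF U s(1), of "cball a (R + s)"])
      fix x z :: "real^2" assume *: "x \<notin> cball a (R + s)" "norm z \<le> 1"
      have "norm (s *\<^sub>R z) \<le> s" using s mult_left_mono[of "norm z" 1 s] * by simp
      then have "x - s *\<^sub>R z \<notin> cball a R"
        using * dist_triangle[of a x "x - s *\<^sub>R z"] by (auto simp: dist_norm)
      then show "U (x - s *\<^sub>R z) = 0" by (rule U0)
    qed auto
    have "AE x\<in>ball a (R - s) in lebesgue. U x = mol s U x"
      by (rule weyl[OF U U0 Uharm s])
    then show "AE x in lebesgue. x \<in> ball a R' \<longrightarrow> V x = mol s U x"
    proof eventually_elim
      case (elim x)
      have "x \<in> cball a R" if "x \<in> ball a R'" using that R by auto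
      with elim show ?case by (auto simp: U_def s_def)
    qed
    show "grad (\<lambda>y. grad (mol s U) y $ i) x $ j = grad (\<lambda>y. grad (mol s U) y $ j) x $ i" for x i j
      unfolding g2 grad2_eta_scaled_sym[of s i _ j] ..
    fix x assume x: "x \<in> ball a R'"
    \<comment> \<open>The Laplacian of the average at \<open>x\<close> is \<open>U\<close> tested
      against the Laplacian of this translated kernel, whose support lies in \<open>ball a R\<close>
      because |x - a| < R' and s = R - R'.\<close>
    let ?\<phi> = "\<lambda>y. ?k ((-1) *\<^sub>R y + x)"
    have \<phi>: "test_function (ball a R) ?\<phi>"
      unfolding test_function_iff
    proof (intro conjI allI exI[of _ "cball x s"] impI)
      show "Ck j ?\<phi>" for j
        using k unfolding test_function_iff by (intro Ck_affine) blast
      show "?\<phi> y = 0" if "y \<notin> cball x s" for y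
        using that eta_scaled_zero[OF s(1), of "x - y"] by (simp add: dist_norm)
      show "cball x s \<subseteq> ball a R"
      proof
        fix y assume "y \<in> cball x s"
        then show "y \<in> ball a R" using x dist_triangle[of a y x] by (simp add: s_def)
      qed
    qed simp
    have k2: "Ck 2 ?k" using k unfolding test_function_def by blast
    have ii: "integrable lebesgue (\<lambda>y. U y * grad (\<lambda>y. grad ?k y $ i) (x - y) $ i)" for i
      by (rule conv_integrable[OF U test_function_grad[OF test_function_grad[OF k]]])
    have "lap (mol s U) x = (\<Sum>i\<in>UNIV. LINT y|lebesgue. U y * grad (\<lambda>y. grad ?k y $ i) (x - y) $ i)"
      unfolding lap_def g2 conv_def ..
    also have "\<dots> = (LINT y|lebesgue. U y * lap ?k (x - y))"
      unfolding lap_def sum_distrib_left by (rule Bochner_Integration.integral_sum[symmetric]) (rule ii)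
    also have "\<dots> = (LINT y|lebesgue. U y * lap ?\<phi> y)"
      unfolding lap_affine[OF k2] by simp
    also have "\<dots> = 0" by (rule Uharm[OF \<phi>])
    finally show "lap (mol s U) x = 0" .
  qed
qed

text \<open>\<open>V\<close> equals its averages over arbitrarily large radii. In such an average
  the values outside a fixed ball contribute at most \<open>e\<close>, and those inside carry the
  factor 1/s^2.\<close>

lemma liouville:
  fixes V :: "real^2 \<Rightarrow> complex"
  assumes V: "weakly_harmonic UNIV V" and V0: "tends_to_0_at_infinity V"
  shows "AE x in lebesgue. V x = 0"
proof -
  obtain M where M: "\<And>x::real^2. norm (eta x) \<le> M"
    using continuous_compact_support_bounded[OF eta_continuous compact_cball[of 0 1]] eta_zero
    by (metis mem_cball_0 nle_le)
  have M0: "M \<ge> 0" using M[of 0] by (meson norm_ge_zero order_trans)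
  have loc: "integrable lebesgue (\<lambda>x. indicator (cball 0 r) x *\<^sub>R V x)" for r
    using V[unfolded weakly_harmonic_def L1_loc_def, THEN conjunct1, rule_format, of "cball 0 r"] unfolding set_integrable_def by simp
  have small: "AE x in lebesgue. x \<in> ball 0 \<rho> \<longrightarrow> norm (V x) \<le> 2 * e" if pos: "\<rho> > 0" "e > 0" for \<rho> e :: real
  proof -
    obtain R0 where R0: "AE y in lebesgue. norm y > R0 \<longrightarrow> norm (V y) < e"
      using V0 \<open>e > 0\<close> unfolding tends_to_0_at_infinity_def by blast
    define I where "I = (LINT y|lebesgue. norm (indicator (cball 0 R0) y *\<^sub>R V y))"
    have I0: "I \<ge> 0" by (simp add: I_def)
    \<comment> \<open>With \<open>M\<close> bounding \<open>eta\<close> and \<open>I\<close> the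
      integral of |V| over the fixed ball, this choice gives M I / s^2 at most \<open>e\<close>, and
      s at least 1.\<close>
    define s where "s = 1 + M * I / e"
    have s1: "s \<ge> 1" using M0 I0 pos by (simp add: s_def)
    have "M * I = (s - 1) * e" using pos by (simp add: s_def)
    also have "\<dots> \<le> s\<^sup>2 * e"
    proof (rule mult_right_mono)
      have "s * 1 \<le> s * s" using s1 by (intro mult_left_mono) auto
      then show "s - 1 \<le> s\<^sup>2" unfolding power2_eq_square by linarith
    qed (use pos in simp)
    finally have sI: "M * I / s\<^sup>2 \<le> e" using s1 by (simp add: divide_le_eq mult.commute)
    define U where "U x = indicator (cball 0 (\<rho> + s)) x *\<^sub>R V x" for x
    obtain v where v: "v = mol s U" "AE x in lebesgue. x \<in> ball 0 \<rho> \<longrightarrow> V x = v x"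
      using weyl_representative[OF V subset_UNIV pos(1), of "\<rho> + s" 0] s1
      unfolding U_def[abs_def] by (auto simp: algebra_simps)
    have U: "integrable lebesgue U" unfolding U_def[abs_def] by (rule loc)
    have "norm (v x) \<le> 2 * e" for x
    proof -
      have n: "norm (eta_scaled s (x - y)) = eta ((1/s) *\<^sub>R x + (-(1/s)) *\<^sub>R y) / s\<^sup>2" for y
        using s1 by (simp add: eta_scaled_def eta_nonneg norm_divide norm_mult norm_inverse norm_power divide_inverse scaleR_diff_right)
      have i1: "integrable lebesgue (\<lambda>y. eta ((1/s) *\<^sub>R x + (-(1/s)) *\<^sub>R y))"
        using s1 by (subst integrable_lebesgue_affine) (auto simp: integrable_eta)
      have e1: "(LINT y|lebesgue. eta ((1/s) *\<^sub>R x + (-(1/s)) *\<^sub>R y)) = s\<^sup>2"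
        using s1 by (subst integral_lebesgue_affine) (auto simp: integral_eta power_one_over divide_inverse power_inverse)
      have i2: "integrable lebesgue (\<lambda>y. norm (indicator (cball 0 R0) y *\<^sub>R V y))"
        by (rule integrable_norm[OF loc])
      have "norm (v x) \<le> (LINT y|lebesgue. norm (U y * eta_scaled s (x - y)))"
        using s1 by (simp add: v(1) mol_eq_conv conv_def)
      also have "\<dots> \<le> (LINT y|lebesgue. norm (indicator (cball 0 R0) y *\<^sub>R V y) * (M / s\<^sup>2) + e / s\<^sup>2 * eta ((1/s) *\<^sub>R x + (-(1/s)) *\<^sub>R y))"
      proof (rule integral_mono_AE)
        show "integrable lebesgue (\<lambda>y. norm (U y * eta_scaled s (x - y)))"
          using conv_integrable[OF U test_function_eta_scaled[OF _ subset_UNIV], of s] s1 by (intro integrable_norm) auto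
        show "integrable lebesgue (\<lambda>y. norm (indicator (cball 0 R0) y *\<^sub>R V y) * (M / s\<^sup>2) + e / s\<^sup>2 * eta ((1/s) *\<^sub>R x + (-(1/s)) *\<^sub>R y))"
          by (intro Bochner_Integration.integrable_add integrable_mult_left integrable_mult_right i1 i2)
        show "AE y in lebesgue. norm (U y * eta_scaled s (x - y)) \<le> norm (indicator (cball 0 R0) y *\<^sub>R V y) * (M / s\<^sup>2) + e / s\<^sup>2 * eta ((1/s) *\<^sub>R x + (-(1/s)) *\<^sub>R y)"
          using R0
        proof eventually_elim
          case (elim y)
          let ?E = "eta ((1/s) *\<^sub>R x + (-(1/s)) *\<^sub>R y)"
          have E: "0 \<le> ?E" "?E \<le> M" using eta_nonneg M[of "(1/s) *\<^sub>R x + (-(1/s)) *\<^sub>R y"] by auto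
          have UV: "norm (U y) \<le> norm (V y)" by (simp add: U_def indicator_def)
          have n2: "norm (U y * eta_scaled s (x - y)) = norm (U y) * (?E / s\<^sup>2)" by (simp add: norm_mult n)
          show ?case
          proof (cases "norm y \<le> R0")
            case True
            have "norm (U y) * (?E / s\<^sup>2) \<le> norm (V y) * (M / s\<^sup>2)"
              using UV E by (intro mult_mono divide_right_mono) auto
            moreover have "0 \<le> e / s\<^sup>2 * ?E" using E pos by simp
            ultimately show ?thesis using True n2 by simp
          next
            case False
            then have "norm (U y) \<le> e" using UV elim by simp
            then have "norm (U y) * (?E / s\<^sup>2) \<le> e * (?E / s\<^sup>2)"
              using E by (intro mult_right_mono) auto
            moreover have "0 \<le> norm (indicator (cball 0 R0) y *\<^sub>R V y) * (M / s\<^sup>2)" using M0 by simp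
            ultimately show ?thesis using n2 by simp
          qed
        qed
      qed
      also have "\<dots> = I * (M / s\<^sup>2) + e / s\<^sup>2 * s\<^sup>2"
        unfolding I_def e1[symmetric]
        by (subst Bochner_Integration.integral_add[OF integrable_mult_left[OF i2] integrable_mult_right[OF i1]])
          (simp only: integral_mult_left_zero integral_mult_right_zero)
      also have "\<dots> \<le> 2 * e" using sI s1 by (simp add: mult.commute)
      finally show ?thesis .
    qed
    with v(2) show ?thesis by (auto elim!: eventually_mono)
  qed
  have "AE x in lebesgue. \<forall>m n. x \<in> ball 0 (real (Suc m)) \<longrightarrow> norm (V x) \<le> 2 * (1 / real (Suc n))"
    unfolding AE_all_countable by (intro allI small) auto
  then show ?thesis
  proof eventually_elim
    case (elim x)
    obtain m where "norm x < real m" using reals_Archimedean2 by blast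
    then have "x \<in> ball 0 (real (Suc m))" by simp
    then have *: "norm (V x) \<le> 2 * (1 / real (Suc n))" for n using elim by blast
    have "(\<lambda>n. 2 * (1 / real (Suc n))) \<longlonglongrightarrow> 2 * 0"
      by (intro tendsto_intros LIMSEQ_Suc[OF lim_1_over_n])
    then have "norm (V x) \<le> 2 * 0" by (rule LIMSEQ_le_const) (use * in blast)
    then show ?case by simp
  qed
qed

subsection \<open>Unique continuation for harmonic functions\<close>

definition plane :: "complex \<Rightarrow> real^2" where
  "plane z = vector [Re z, Im z]"

lemma plane_component [simp]: "plane z $ 1 = Re z" "plane z $ 2 = Im z"
  by (simp_all add: plane_def)

lemma norm_plane: "norm (plane z) = norm z"
  by (simp add: norm_vec_def L2_set_def sum_2 cmod_def)

lemma bounded_linear_plane: "bounded_linear plane"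
  unfolding linear_conv_bounded_linear[symmetric]
  by (intro linearI) (simp_all add: vec_eq_iff forall_2)

lemma plane_surj: "\<exists>z. plane z = x"
  by (rule exI[of _ "Complex (x $ 1) (x $ 2)"]) (simp add: vec_eq_iff forall_2)

text \<open>A gradient of the form (c, i c) says exactly that the real derivative is complex
  multiplication by c.\<close>

lemma Cauchy_Riemann_imp_holomorphic:
  fixes p :: "real^2 \<Rightarrow> complex"
  assumes a: "\<And>x. x \<in> D \<Longrightarrow> has_grad p (vector [c x, \<i> * c x]) x"
    and D: "open D"
  shows "(\<lambda>z. p (plane z)) holomorphic_on {z. plane z \<in> D}"
proof (rule holomorphic_onI)
  fix z assume "z \<in> {z. plane z \<in> D}"
  then have "(p has_derivative (\<lambda>h. \<Sum>i\<in>UNIV. (h $ i) *\<^sub>R (vector [c (plane z), \<i> * c (plane z)] $ i))) (at (plane z))"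
    using a[of "plane z"] unfolding has_grad_def by simp
  from has_derivative_compose[OF bounded_linear_imp_has_derivative[OF bounded_linear_plane] this]
  have "((\<lambda>z. p (plane z)) has_derivative (\<lambda>h. c (plane z) * h)) (at z)"
    by (rule has_derivative_eq_rhs)
      (auto simp: fun_eq_iff sum_2 scaleR_conv_of_real complex_eq_iff algebra_simps)
  then have "((\<lambda>z. p (plane z)) has_field_derivative c (plane z)) (at z)"
    by (simp add: has_field_derivative_def)
  then show "(\<lambda>z. p (plane z)) field_differentiable at z within {z. plane z \<in> D}"
    using field_differentiable_at_within field_differentiable_def by blast
qed

lemma Cauchy_Riemann_unique:
  fixes p :: "real^2 \<Rightarrow> complex"
  assumes a: "\<And>x. x \<in> ball 0 r \<Longrightarrow> has_grad p (vector [c x, \<i> * c x]) x"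
    and A: "open A" "A \<noteq> {}" "A \<subseteq> ball 0 r" "\<And>x. x \<in> A \<Longrightarrow> p x = 0" and x: "x \<in> ball 0 r"
  shows "p x = 0"
proof -
  have eq: "{z. plane z \<in> ball 0 r} = ball 0 r" by (auto simp: norm_plane)
  have hol: "(\<lambda>z. p (plane z)) holomorphic_on ball 0 r"
    using Cauchy_Riemann_imp_holomorphic[of "ball 0 r" p c] a eq by simp
  have cont: "continuous_on UNIV plane" by (rule linear_continuous_on[OF bounded_linear_plane])
  have op: "open (plane -` A)" using open_vimage[OF A(1) cont] .
  obtain y where "y \<in> A" using A(2) by blast
  with plane_surj[of y] have ne: "plane -` A \<noteq> {}" by auto
  have sub: "plane -` A \<subseteq> ball 0 r" using A(3) by (auto simp: norm_plane[symmetric])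
  obtain z where z: "plane z = x" using plane_surj by blast
  have "z \<in> ball 0 r" using x z by (auto simp: norm_plane[symmetric])
  from analytic_continuation_open[OF op open_ball ne connected_ball sub hol holomorphic_on_const[of 0] _ this]
  have "p (plane z) = 0" using A(4) by auto
  with z show ?thesis by simp
qed

text \<open>The function is complex-valued, so its gradient is not determined by one holomorphic
  combination. Both the combination with -i and the conjugate of the one with +i are holomorphic, by
  vanishing Laplacian and symmetric Hessian, and together they determine the gradient.\<close>

lemma harmonic_unique_continuation:
  fixes v :: "real^2 \<Rightarrow> complex"
  assumes v: "test_function UNIV v" and lap: "\<And>x. x \<in> ball 0 r \<Longrightarrow> lap v x = 0"
    and sym: "\<And>x i j. grad (\<lambda>y. grad v y $ i) x $ j = grad (\<lambda>y. grad v y $ j) x $ i"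
    and A: "open A" "A \<noteq> {}" "A \<subseteq> ball 0 r" "\<And>x. x \<in> A \<Longrightarrow> grad v x = 0" and x: "x \<in> ball 0 r"
  shows "grad v x = 0"
proof -
  let ?g = "\<lambda>i j x. grad (\<lambda>y. grad v y $ i) x $ j"
  have g: "has_grad (\<lambda>y. grad v y $ i) (grad (\<lambda>y. grad v y $ i) x) x" for i x
    by (rule test_function_has_grad[OF test_function_grad[OF v]])
  have l: "?g 2 2 x = - ?g 1 1 x" if "x \<in> ball 0 r" for x
    using lap[OF that] unfolding lap_def sum_2 by (simp add: add_eq_0_iff)
  have s: "?g 2 1 x = ?g 1 2 x" for x by (rule sym)
  have cr: "has_grad (\<lambda>y. grad v y $ 1 + (- \<i>) * (grad v y $ 2)) (vector [?g 1 1 x - \<i> * ?g 1 2 x, \<i> * (?g 1 1 x - \<i> * ?g 1 2 x)]) x"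
    if "x \<in> ball 0 r" for x
  proof -
    have "has_grad (\<lambda>y. grad v y $ 1 + (- \<i>) * (grad v y $ 2))
      (grad (\<lambda>y. grad v y $ 1) x + ((- \<i>) *s grad (\<lambda>y. grad v y $ 2) x + grad v x $ 2 *s 0)) x"
      by (intro has_grad_add has_grad_mult has_grad_const g)
    moreover have "grad (\<lambda>y. grad v y $ 1) x + ((- \<i>) *s grad (\<lambda>y. grad v y $ 2) x + grad v x $ 2 *s 0)
       = vector [?g 1 1 x - \<i> * ?g 1 2 x, \<i> * (?g 1 1 x - \<i> * ?g 1 2 x)]"
      using l[OF that] s[of x] by (simp add: vec_eq_iff forall_2 algebra_simps)
    ultimately show ?thesis by simp
  qed
  have p: "grad v y $ 1 + (- \<i>) * (grad v y $ 2) = 0" if "y \<in> ball 0 r" for y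
    by (rule Cauchy_Riemann_unique[OF cr A(1-3) _ that]) (use A(4) in auto)
  text \<open>The antiholomorphic combination is conjugated.\<close>
  have cr': "has_grad (\<lambda>y. cnj (grad v y $ 1 + \<i> * (grad v y $ 2))) (vector [cnj (?g 1 1 x + \<i> * ?g 1 2 x), \<i> * cnj (?g 1 1 x + \<i> * ?g 1 2 x)]) x"
    if "x \<in> ball 0 r" for x
  proof -
    have "has_grad (\<lambda>y. grad v y $ 1 + \<i> * (grad v y $ 2))
      (grad (\<lambda>y. grad v y $ 1) x + (\<i> *s grad (\<lambda>y. grad v y $ 2) x + grad v x $ 2 *s 0)) x"
      by (intro has_grad_add has_grad_mult has_grad_const g)
    then have "((\<lambda>y. cnj (grad v y $ 1 + \<i> * (grad v y $ 2))) has_derivative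
      (\<lambda>h. cnj (\<Sum>i\<in>UNIV. h $ i *\<^sub>R ((grad (\<lambda>y. grad v y $ 1) x + (\<i> *s grad (\<lambda>y. grad v y $ 2) x + grad v x $ 2 *s 0)) $ i)))) (at x)"
      unfolding has_grad_def by (rule bounded_linear.has_derivative[OF bounded_linear_cnj])
    then show ?thesis unfolding has_grad_def
      by (rule has_derivative_eq_rhs) (use l[OF that] s[of x] in \<open>simp add: fun_eq_iff sum_2 algebra_simps\<close>)
  qed
  have q: "cnj (grad v y $ 1 + \<i> * (grad v y $ 2)) = 0" if "y \<in> ball 0 r" for y
    by (rule Cauchy_Riemann_unique[OF cr' A(1-3) _ that]) (use A(4) in auto)
  have "grad v x $ 1 + (- \<i>) * (grad v x $ 2) = 0" "grad v x $ 1 + \<i> * (grad v x $ 2) = 0"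
    using p[OF x] q[OF x] by (simp_all only: complex_cnj_zero_iff)
  then show ?thesis by (simp add: vec_eq_iff forall_2 eq_neg_iff_add_eq_0 complex_eq_iff)
qed

lemma grad_zero_imp_constant:
  fixes v :: "real^'n \<Rightarrow> complex"
  assumes "\<And>x. x \<in> ball a r \<Longrightarrow> grad v x = 0" "\<And>x. v differentiable (at x)" "x \<in> ball a r"
  shows "v x = v a"
proof -
  have d: "(v has_derivative (\<lambda>h. 0)) (at x within ball a r)" if "x \<in> ball a r" for x
    using differentiable_imp_has_grad[OF assms(2), of x] assms(1)[OF that]
    unfolding has_grad_def by (auto intro: has_derivative_at_withinI)
  have "\<exists>c. \<forall>x\<in>ball a r. v x = c"
    by (rule has_derivative_zero_constant[OF convex_ball d])
  moreover have "a \<in> ball a r" using assms(3) by (auto intro: le_less_trans[OF zero_le_dist])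
  ultimately show ?thesis using assms(3) by auto
qed

lemma has_grad_transform_open:
  assumes "has_grad f d x" "open S" "x \<in> S" "\<And>y. y \<in> S \<Longrightarrow> f y = g y"
  shows "has_grad g d x"
  using assms has_derivative_transform_within_open[of f _ x UNIV S g] unfolding has_grad_def by blast

lemma has_grad_sum:
  assumes "finite I" "\<And>i. i \<in> I \<Longrightarrow> has_grad (f i) (d i) x"
  shows "has_grad (\<lambda>x. \<Sum>i\<in>I. f i x) (\<Sum>i\<in>I. d i) x"
  using assms by (induction I rule: finite_induct) (auto intro: has_grad_const has_grad_add)

subsection \<open>The Kelvin transform\<close>

lemma norm_kelvin: "norm (kelvin x) = 1 / norm x"
  by (cases "x = 0") (auto simp: kelvin_def power2_eq_square field_simps)

lemma kelvin_0 [simp]: "kelvin 0 = 0"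
  by (simp add: kelvin_def)

lemma kelvin_eq_0_iff [simp]: "kelvin x = 0 \<longleftrightarrow> x = 0"
  by (simp add: kelvin_def)

lemma kelvin_kelvin [simp]: "kelvin (kelvin x) = x"
proof (cases "x = 0")
  case False
  have "kelvin (kelvin x) = (x /\<^sub>R (norm x)\<^sup>2) /\<^sub>R (1 / norm x)\<^sup>2"
    by (simp add: kelvin_def[of "kelvin x"] norm_kelvin) (simp add: kelvin_def)
  then show ?thesis using False by (simp add: power_one_over)
qed simp

lemma inj_kelvin: "inj kelvin"
  by (rule injI) (metis kelvin_kelvin)

lemma kelvin_image: "kelvin ` (- {0}) = - {0}"
proof -
  have "x \<in> kelvin ` (- {0})" if "x \<noteq> 0" for x
    using that by (intro image_eqI[of _ _ "kelvin x"]) auto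
  then show ?thesis by auto
qed

text \<open>Entry (i, j) of the Jacobian matrix of \<open>kelvin\<close>: |x|^-2 times the
  reflection in the line orthogonal to x. Reciprocals appear as factors to suit the product
  rule.\<close>

definition kd :: "real^2 \<Rightarrow> 2 \<Rightarrow> 2 \<Rightarrow> real" where
  "kd x i j = (if i = j then 1 else 0) * (1 / (norm x)\<^sup>2) - 2 * x $ i * x $ j * (1 / ((norm x)\<^sup>2)\<^sup>2)"

lemma norm_sq_2: "(norm (x::real^2))\<^sup>2 = (x $ 1)\<^sup>2 + (x $ 2)\<^sup>2"
  unfolding power2_norm_eq_inner inner_vec_def sum_2 by (simp add: power2_eq_square)

lemma has_grad_inverse_norm:
  fixes x :: "real^'n"
  assumes "x \<noteq> 0"
  shows "has_grad (\<lambda>x. of_real (1 / (norm x)\<^sup>2)) (\<chi> l. of_real (- 2 * x $ l * (1 / ((norm x)\<^sup>2)\<^sup>2))) x"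
    and "has_grad (\<lambda>x. of_real (1 / ((norm x)\<^sup>2)\<^sup>2)) (\<chi> l. of_real (- 4 * x $ l * (1 / ((norm x)\<^sup>2) ^ 3))) x"
proof -
  have n: "(norm x)\<^sup>2 \<noteq> 0" using assms by simp
  have d1: "((\<lambda>t. 1 / t) has_real_derivative - (1 / t\<^sup>2)) (at t)" if "t \<noteq> 0" for t :: real
    using that by (auto intro!: derivative_eq_intros simp: power2_eq_square)
  have d2: "((\<lambda>t. 1 / t\<^sup>2) has_real_derivative - (2 / t ^ 3)) (at t)" if "t \<noteq> 0" for t :: real
    using that by (auto intro!: derivative_eq_intros simp: power2_eq_square eval_nat_numeral field_simps)
  have "of_real (- (1 / ((norm x)\<^sup>2)\<^sup>2)) *s (\<chi> i. of_real (2 * x $ i)) = (\<chi> l. complex_of_real (- 2 * x $ l * (1 / ((norm x)\<^sup>2)\<^sup>2)))"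
    by (simp add: vec_eq_iff)
  with has_grad_compose_real[OF has_grad_norm_sq d1[OF n]]
  show "has_grad (\<lambda>x. of_real (1 / (norm x)\<^sup>2)) (\<chi> l. of_real (- 2 * x $ l * (1 / ((norm x)\<^sup>2)\<^sup>2))) x"
    by simp
  have "of_real (- (2 / ((norm x)\<^sup>2) ^ 3)) *s (\<chi> i. of_real (2 * x $ i)) = (\<chi> l. complex_of_real (- 4 * x $ l * (1 / ((norm x)\<^sup>2) ^ 3)))"
    by (simp add: vec_eq_iff)
  with has_grad_compose_real[OF has_grad_norm_sq d2[OF n]]
  show "has_grad (\<lambda>x. of_real (1 / ((norm x)\<^sup>2)\<^sup>2)) (\<chi> l. of_real (- 4 * x $ l * (1 / ((norm x)\<^sup>2) ^ 3))) x"
    by simp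
qed

lemma has_grad_kelvin:
  assumes "x \<noteq> 0"
  shows "has_grad (\<lambda>x. of_real (kelvin x $ i)) (\<chi> j. of_real (kd x i j)) x"
proof -
  have "has_grad (\<lambda>x. of_real (x $ i) * of_real (1 / (norm x)\<^sup>2))
    (of_real (x $ i) *s (\<chi> l. of_real (- 2 * x $ l * (1 / ((norm x)\<^sup>2)\<^sup>2))) + of_real (1 / (norm x)\<^sup>2) *s axis i 1) x"
    by (intro has_grad_mult has_grad_coord has_grad_inverse_norm assms)
  moreover have "of_real (x $ i) *s (\<chi> l. of_real (- 2 * x $ l * (1 / ((norm x)\<^sup>2)\<^sup>2))) + of_real (1 / (norm x)\<^sup>2) *s axis i 1
     = (\<chi> j. complex_of_real (kd x i j))"
    by (simp add: vec_eq_iff kd_def axis_def)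
  moreover have "(\<lambda>x. of_real (x $ i) * of_real (1 / (norm x)\<^sup>2)) = (\<lambda>x. complex_of_real (kelvin x $ i))"
    by (simp add: kelvin_def divide_inverse fun_eq_iff)
  ultimately show ?thesis by simp
qed

lemma has_derivative_kelvin:
  assumes "x \<noteq> 0"
  shows "(kelvin has_derivative (\<lambda>h. \<chi> i. \<Sum>j\<in>UNIV. kd x i j * h $ j)) (at x)"
proof (subst has_derivative_componentwise_within, rule ballI)
  fix b :: "real^2" assume "b \<in> Basis"
  then obtain i where b: "b = axis i 1" unfolding Basis_vec_def by auto
  have "((\<lambda>x. Re (of_real (kelvin x $ i))) has_derivative (\<lambda>h. Re (\<Sum>j\<in>UNIV. (h $ j) *\<^sub>R ((\<chi> j. of_real (kd x i j)) $ j)))) (at x)"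
    using has_grad_kelvin[OF assms, of i] unfolding has_grad_def by (rule bounded_linear.has_derivative[OF bounded_linear_Re])
  then show "((\<lambda>x. kelvin x \<bullet> b) has_derivative (\<lambda>h. (\<chi> i. \<Sum>j\<in>UNIV. kd x i j * h $ j) \<bullet> b)) (at x)"
    unfolding b by (simp add: inner_axis mult.commute)
qed

text \<open>The matrix is a reflection scaled by |x|^-2 in dimension two; hence the sign and the
  fourth power.\<close>

lemma det_kelvin:
  assumes "x \<noteq> 0"
  shows "det (matrix (\<lambda>h. \<chi> i. \<Sum>j\<in>UNIV. kd x i j * h $ j)) = - (1 / norm x ^ 4)"
proof -
  let ?n = "(norm x)\<^sup>2"
  have n: "?n \<noteq> 0" using assms by simp
  have e: "(\<Sum>j\<in>UNIV. kd x i j * axis k 1 $ j) = kd x i k" for i k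
    by (simp add: axis_def if_distrib cong: if_cong)
  have "det (matrix (\<lambda>h. \<chi> i. \<Sum>j\<in>UNIV. kd x i j * h $ j)) = kd x 1 1 * kd x 2 2 - kd x 1 2 * kd x 2 1"
    unfolding det_2 matrix_def by (simp add: e)
  also have "\<dots> = 1 / ?n ^ 2 - 2 * ((x $ 1)\<^sup>2 + (x $ 2)\<^sup>2) / ?n ^ 3"
    using n unfolding kd_def by (simp add: field_simps eval_nat_numeral)
  also have "\<dots> = - (1 / ?n ^ 2)"
    unfolding norm_sq_2[symmetric] using n by (simp add: field_simps eval_nat_numeral)
  finally show ?thesis by (simp add: power_mult[symmetric])
qed

lemma jacobian_kelvin: "x \<noteq> 0 \<Longrightarrow> \<bar>det (jacobian kelvin (at x))\<bar> = 1 / norm x ^ 4"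
  unfolding jacobian_def frechet_derivative_at[OF has_derivative_kelvin, symmetric] det_kelvin by simp

text \<open>The change-of-variables theorem is stated for integrands with values in
  \<open>real^'n\<close>; complex values are carried there by \<open>plane\<close> and back by this
  inverse.\<close>

definition unplane :: "real^2 \<Rightarrow> complex" where
  "unplane x = Complex (x $ 1) (x $ 2)"

lemma unplane_plane [simp]: "unplane (plane z) = z"
  by (simp add: unplane_def)

lemma bounded_linear_unplane: "bounded_linear unplane"
  unfolding linear_conv_bounded_linear[symmetric]
  by (intro linearI) (simp_all add: unplane_def complex_eq_iff)

lemma integrable_plane_iff: "integrable M (\<lambda>x. plane (f x)) \<longleftrightarrow> integrable M f"
  using integrable_bounded_linear[OF bounded_linear_unplane, of M "\<lambda>x. plane (f x)"]
    integrable_bounded_linear[OF bounded_linear_plane, of M f] by auto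

lemma AE_lebesgue_neq: "AE x in lebesgue. x \<noteq> (c :: 'a::euclidean_space)"
  using AE_lborel_singleton[of c] by (rule AE_completion)

lemma absolutely_integrable_on_punctured:
  fixes h :: "real^2 \<Rightarrow> real^2"
  shows "h absolutely_integrable_on (- {0}) \<longleftrightarrow> integrable lebesgue h"
    and "h absolutely_integrable_on (- {0}) \<Longrightarrow> integral (- {0}) h = (LINT x|lebesgue. h x)"
proof -
  have ae: "AE x in lebesgue. indicator (- {0}) x *\<^sub>R h x = h x"
    using AE_lebesgue_neq[of 0] by eventually_elim auto
  then have ae': "AE x in lebesgue. h x = indicator (- {0}) x *\<^sub>R h x"
    by eventually_elim simp
  show "h absolutely_integrable_on (- {0}) \<longleftrightarrow> integrable lebesgue h"
    unfolding set_integrable_def using integrable_cong_AE_lebesgue[OF _ ae] integrable_cong_AE_lebesgue[OF _ ae'] by blast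
  show "integral (- {0}) h = (LINT x|lebesgue. h x)" if "h absolutely_integrable_on (- {0})"
    using set_lebesgue_integral_eq_integral(2)[OF that] LINT_cong_AE[OF ae]
    unfolding set_lebesgue_integral_def by simp
qed

text \<open>Change of variables for the involution \<open>kelvin\<close> on the punctured plane,
  where the weight is the absolute Jacobian determinant. The omitted origin is a null set.\<close>

lemma kelvin_substitution:
  fixes f :: "real^2 \<Rightarrow> complex"
  assumes "integrable lebesgue f"
  shows "integrable lebesgue (\<lambda>y. f (kelvin y) / of_real (norm y ^ 4))"
    and "(LINT y|lebesgue. f (kelvin y) / of_real (norm y ^ 4)) = (LINT x|lebesgue. f x)"
proof -
  let ?g' = "\<lambda>x h. \<chi> i. \<Sum>j\<in>UNIV. kd x i j * h $ j"
  let ?h = "\<lambda>x. \<bar>det (matrix (?g' x))\<bar> *\<^sub>R plane (f (kelvin x))"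
  have i: "(\<lambda>x. plane (f x)) absolutely_integrable_on (- {0})"
    unfolding absolutely_integrable_on_punctured integrable_plane_iff by (rule assms)
  have "?h absolutely_integrable_on (- {0}) \<and> integral (- {0}) ?h = integral (- {0}) (\<lambda>x. plane (f x))
    \<longleftrightarrow> (\<lambda>x. plane (f x)) absolutely_integrable_on (kelvin ` (- {0})) \<and> integral (kelvin ` (- {0})) (\<lambda>x. plane (f x)) = integral (- {0}) (\<lambda>x. plane (f x))"
    by (rule has_absolute_integral_change_of_variables)
      (auto intro!: has_derivative_at_withinI[OF has_derivative_kelvin] inj_on_subset[OF inj_kelvin])
  then have h: "?h absolutely_integrable_on (- {0})" "integral (- {0}) ?h = integral (- {0}) (\<lambda>x. plane (f x))"
    using i unfolding kelvin_image by auto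
  have ae: "AE y in lebesgue. ?h y = plane (f (kelvin y) / of_real (norm y ^ 4))"
    using AE_lebesgue_neq[of 0]
  proof eventually_elim
    case (elim y)
    have "plane (f (kelvin y) / of_real (norm y ^ 4)) = (1 / norm y ^ 4) *\<^sub>R plane (f (kelvin y))"
      using linear_scale[OF bounded_linear.linear[OF bounded_linear_plane], of "1 / norm y ^ 4" "f (kelvin y)"]
      by (simp add: scaleR_conv_of_real divide_inverse mult.commute)
    then show ?case using det_kelvin[OF elim] by simp
  qed
  have "integrable lebesgue (\<lambda>y. plane (f (kelvin y) / of_real (norm y ^ 4)))"
    using integrable_cong_AE_lebesgue[OF _ ae] h(1) unfolding absolutely_integrable_on_punctured by blast
  then show i2: "integrable lebesgue (\<lambda>y. f (kelvin y) / of_real (norm y ^ 4))"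
    unfolding integrable_plane_iff .
  have "plane (LINT y|lebesgue. f (kelvin y) / of_real (norm y ^ 4)) = (LINT y|lebesgue. plane (f (kelvin y) / of_real (norm y ^ 4)))"
    by (rule integral_bounded_linear[OF bounded_linear_plane i2, symmetric])
  also have "\<dots> = (LINT y|lebesgue. ?h y)" by (rule LINT_cong_AE[OF ae, symmetric])
  also have "\<dots> = (LINT x|lebesgue. plane (f x))"
    using absolutely_integrable_on_punctured(2)[OF h(1)] absolutely_integrable_on_punctured(2)[OF i] h(2) by simp
  also have "\<dots> = plane (LINT x|lebesgue. f x)"
    by (rule integral_bounded_linear[OF bounded_linear_plane assms])
  finally show "(LINT y|lebesgue. f (kelvin y) / of_real (norm y ^ 4)) = (LINT x|lebesgue. f x)"
    by (metis unplane_plane)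
qed

text \<open>As \<open>kelvin\<close> is its own inverse, preimages are images, and a map
  differentiable off the origin sends null sets to null sets.\<close>

lemma AE_kelvin:
  assumes "AE x in lebesgue. P x" shows "AE y in lebesgue. P (kelvin y)"
proof -
  obtain N where N: "N \<in> null_sets lebesgue" "{x. \<not> P x} \<subseteq> N"
    using assms by (auto simp: eventually_ae_filter)
  have "negligible (N - {0})"
    using N(1) by (rule negligible_subset[OF negligible_iff_null_sets[THEN iffD2]]) auto
  then have "negligible (kelvin ` (N - {0}))"
    by (rule negligible_differentiable_image_negligible[OF order_refl])
      (auto simp: differentiable_on_def differentiable_def intro!: exI has_derivative_at_withinI[OF has_derivative_kelvin])
  then have "negligible (insert 0 (kelvin ` (N - {0})))" by simp
  then have "insert 0 (kelvin ` (N - {0})) \<in> null_sets lebesgue" by (simp add: negligible_iff_null_sets)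
  moreover have "{y. \<not> P (kelvin y)} \<subseteq> insert 0 (kelvin ` (N - {0}))"
  proof
    fix y assume "y \<in> {y. \<not> P (kelvin y)}"
    then have "kelvin y \<in> N" using N(2) by auto
    then show "y \<in> insert 0 (kelvin ` (N - {0}))"
      by (cases "y = 0") (auto intro!: image_eqI[of _ _ "kelvin y"])
  qed
  ultimately show ?thesis by (auto simp: eventually_ae_filter)
qed

lemma kelvin_measurable [measurable]: "kelvin \<in> borel_measurable borel"
  unfolding kelvin_def[abs_def] by measurable

text \<open>Lebesgue measurability does not pass through composition in general; a Borel
  representative does, and \<open>AE_kelvin\<close> shows that the exceptional set stays
  null.\<close>

lemma borel_measurable_kelvin:
  fixes f :: "real^2 \<Rightarrow> complex"
  assumes "f \<in> borel_measurable lebesgue"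
  shows "(\<lambda>y. f (kelvin y)) \<in> borel_measurable lebesgue"
proof -
  obtain f' where [measurable]: "f' \<in> borel_measurable borel" and f': "AE x in lebesgue. f x = f' x"
    using borel_version[OF assms] by blast
  have "(\<lambda>y. f' (kelvin y)) \<in> borel_measurable lebesgue"
    by (rule measurable_completion) measurable
  moreover have "AE y in lebesgue. f' (kelvin y) = f (kelvin y)"
    using AE_kelvin[OF f'] by eventually_elim simp
  ultimately show ?thesis by (rule borel_measurable_AE)
qed

lemma has_grad_kd:
  assumes "x \<noteq> 0"
  shows "has_grad (\<lambda>x. of_real (kd x i j)) (\<chi> l. of_real ((if i = j then 1 else 0) * (- 2 * x $ l * (1 / ((norm x)\<^sup>2)\<^sup>2))
     - (2 * ((if l = i then x $ j else 0) + (if l = j then x $ i else 0)) * (1 / ((norm x)\<^sup>2)\<^sup>2) - 8 * x $ i * x $ j * x $ l * (1 / ((norm x)\<^sup>2) ^ 3)))) x"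
proof -
  have "has_grad (\<lambda>x. of_real (if i = j then 1 else 0) * of_real (1 / (norm x)\<^sup>2) - (2 * (of_real (x $ i) * of_real (x $ j))) * of_real (1 / ((norm x)\<^sup>2)\<^sup>2))
    ((of_real (if i = j then 1 else 0) *s (\<chi> l. of_real (- 2 * x $ l * (1 / ((norm x)\<^sup>2)\<^sup>2))) + of_real (1 / (norm x)\<^sup>2) *s 0) -
     ((2 * (of_real (x $ i) * of_real (x $ j))) *s (\<chi> l. of_real (- 4 * x $ l * (1 / ((norm x)\<^sup>2) ^ 3))) +
       of_real (1 / ((norm x)\<^sup>2)\<^sup>2) *s (2 *s (of_real (x $ i) *s axis j 1 + of_real (x $ j) *s axis i 1) + (of_real (x $ i) * of_real (x $ j)) *s 0))) x"
    by (intro has_grad_diff has_grad_mult has_grad_coord has_grad_inverse_norm has_grad_const assms)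
  moreover have "(of_real (if i = j then 1 else 0) *s (\<chi> l. of_real (- 2 * x $ l * (1 / ((norm x)\<^sup>2)\<^sup>2))) + of_real (1 / (norm x)\<^sup>2) *s 0) -
     ((2 * (of_real (x $ i) * of_real (x $ j))) *s (\<chi> l. of_real (- 4 * x $ l * (1 / ((norm x)\<^sup>2) ^ 3))) +
       of_real (1 / ((norm x)\<^sup>2)\<^sup>2) *s (2 *s (of_real (x $ i) *s axis j 1 + of_real (x $ j) *s axis i 1) + (of_real (x $ i) * of_real (x $ j)) *s 0))
    = (\<chi> l. complex_of_real ((if i = j then 1 else 0) * (- 2 * x $ l * (1 / ((norm x)\<^sup>2)\<^sup>2))
     - (2 * ((if l = i then x $ j else 0) + (if l = j then x $ i else 0)) * (1 / ((norm x)\<^sup>2)\<^sup>2) - 8 * x $ i * x $ j * x $ l * (1 / ((norm x)\<^sup>2) ^ 3))))"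
    by (simp add: vec_eq_iff axis_def algebra_simps)
  moreover have "(\<lambda>x. of_real (if i = j then 1 else 0) * of_real (1 / (norm x)\<^sup>2) - (2 * (of_real (x $ i) * of_real (x $ j))) * of_real (1 / ((norm x)\<^sup>2)\<^sup>2)) = (\<lambda>x. complex_of_real (kd x i j))"
    by (simp add: kd_def fun_eq_iff)
  ultimately show ?thesis by simp
qed

text \<open>The rows of the derivative of the Kelvin transform are divergence free, because its
  components are harmonic.\<close>

lemma div_kd: "x \<noteq> 0 \<Longrightarrow> (\<Sum>j\<in>UNIV. grad (\<lambda>x. of_real (kd x i j)) x $ j) = 0"
proof -
  assume x: "x \<noteq> 0"
  let ?n = "(norm x)\<^sup>2"
  have n: "?n \<noteq> 0" using x by simp
  have "(\<Sum>j\<in>UNIV. grad (\<lambda>x. of_real (kd x i j)) x $ j) = complex_of_real (\<Sum>j\<in>UNIV. (if i = j then 1 else 0) * (- 2 * x $ j * (1 / ?n\<^sup>2))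
     - (2 * ((if j = i then x $ j else 0) + (if j = j then x $ i else 0)) * (1 / ?n\<^sup>2) - 8 * x $ i * x $ j * x $ j * (1 / ?n ^ 3)))"
    unfolding grad_eqI[OF has_grad_kd[OF x]] by simp
  also have "(\<Sum>j\<in>UNIV. (if i = j then 1 else 0) * (- 2 * x $ j * (1 / ?n\<^sup>2))
     - (2 * ((if j = i then x $ j else 0) + (if j = j then x $ i else 0)) * (1 / ?n\<^sup>2) - 8 * x $ i * x $ j * x $ j * (1 / ?n ^ 3)))
     = - 8 * x $ i * (1 / ?n\<^sup>2) + 8 * x $ i * ((x $ 1)\<^sup>2 + (x $ 2)\<^sup>2) * (1 / ?n ^ 3)"
    using exhaust_2[of i] by (auto simp: sum_2 power2_eq_square algebra_simps)
  also have "\<dots> = 0" unfolding norm_sq_2[symmetric] using n by (simp add: field_simps eval_nat_numeral)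
  finally show ?thesis by simp
qed

text \<open>Conformality: the rows of the Jacobian are orthogonal and have equal length
  |x|^-2.\<close>

lemma kd_square:
  assumes "x \<noteq> 0"
  shows "(\<Sum>j\<in>UNIV. kd x i j * kd x k j) = (if i = k then 1 / norm x ^ 4 else 0)"
proof -
  let ?n = "(norm x)\<^sup>2"
  have n: "?n \<noteq> 0" using assms by simp
  have "(\<Sum>j\<in>UNIV. kd x i j * kd x k j) = (if i = k then 1 else 0) / ?n\<^sup>2 - 4 * x $ i * x $ k / ?n ^ 3 + 4 * x $ i * x $ k * ((x $ 1)\<^sup>2 + (x $ 2)\<^sup>2) / ?n ^ 4"
    using exhaust_2[of i] exhaust_2[of k] n unfolding kd_def sum_2
    by (auto simp: field_simps eval_nat_numeral)
  also have "\<dots> = (if i = k then 1 else 0) / ?n\<^sup>2"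
    unfolding norm_sq_2[symmetric] using n by (simp add: field_simps eval_nat_numeral)
  finally show ?thesis by (simp add: power_mult[symmetric])
qed

lemma has_grad_comp_kelvin:
  assumes "x \<noteq> 0" "has_grad \<phi> g (kelvin x)"
  shows "has_grad (\<lambda>x. \<phi> (kelvin x)) (\<chi> j. \<Sum>k\<in>UNIV. of_real (kd x k j) * g $ k) x"
proof -
  have "((\<lambda>x. \<phi> (kelvin x)) has_derivative (\<lambda>h. \<Sum>k\<in>UNIV. ((\<chi> i. \<Sum>j\<in>UNIV. kd x i j * h $ j) $ k) *\<^sub>R (g $ k))) (at x)"
    using has_derivative_compose[OF has_derivative_kelvin[OF assms(1)] assms(2)[unfolded has_grad_def]] by simp
  then show ?thesis unfolding has_grad_def
    by (rule has_derivative_eq_rhs) (simp add: fun_eq_iff sum_2 scaleR_conv_of_real algebra_simps)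
qed

text \<open>The second part is a Piola identity: in the divergence of row \<open>i\<close> times the
  pulled back function, the derivatives of the row cancel by \<open>div_kd\<close>, and
  \<open>kd_square\<close> reduces the rest to one partial derivative of the original
  function.\<close>

lemma kelvin_field:
  assumes x: "x \<noteq> 0" and g: "has_grad \<phi> g (kelvin x)"
  shows "has_grad (\<lambda>x. of_real (kd x i j) * \<phi> (kelvin x)) (grad (\<lambda>x. of_real (kd x i j) * \<phi> (kelvin x)) x) x"
    and "(\<Sum>j\<in>UNIV. grad (\<lambda>x. of_real (kd x i j) * \<phi> (kelvin x)) x $ j) = g $ i / of_real (norm x ^ 4)"
proof -
  let ?d = "\<lambda>j. grad (\<lambda>x. complex_of_real (kd x i j)) x"
  let ?e = "\<chi> j. \<Sum>k\<in>UNIV. of_real (kd x k j) * g $ k"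
  have kd: "has_grad (\<lambda>x. of_real (kd x i j)) (?d j) x" for j
    using has_grad_kd[OF x, of i j] grad_eqI by fastforce
  have h: "has_grad (\<lambda>x. of_real (kd x i j) * \<phi> (kelvin x)) (of_real (kd x i j) *s ?e + \<phi> (kelvin x) *s ?d j) x" for j
    by (intro has_grad_mult kd has_grad_comp_kelvin[OF x g])
  show "has_grad (\<lambda>x. of_real (kd x i j) * \<phi> (kelvin x)) (grad (\<lambda>x. of_real (kd x i j) * \<phi> (kelvin x)) x) x"
    unfolding grad_eqI[OF h] by (rule h)
  have "(\<Sum>j\<in>UNIV. grad (\<lambda>x. of_real (kd x i j) * \<phi> (kelvin x)) x $ j) =
     (\<Sum>j\<in>UNIV. of_real (kd x i j) * (\<Sum>k\<in>UNIV. of_real (kd x k j) * g $ k)) + \<phi> (kelvin x) * (\<Sum>j\<in>UNIV. ?d j $ j)"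
    unfolding grad_eqI[OF h] by (simp add: sum.distrib sum_distrib_left)
  also have "\<dots> = (\<Sum>j\<in>UNIV. of_real (kd x i j) * (\<Sum>k\<in>UNIV. of_real (kd x k j) * g $ k))"
    using div_kd[OF x, of i] by simp
  also have "\<dots> = (\<Sum>k\<in>UNIV. of_real (\<Sum>j\<in>UNIV. kd x i j * kd x k j) * g $ k)"
    by (simp add: sum_2 algebra_simps)
  also have "\<dots> = g $ i / of_real (norm x ^ 4)"
    unfolding kd_square[OF x] by (simp add: if_distrib if_distribR cong: if_cong)
  finally show "(\<Sum>j\<in>UNIV. grad (\<lambda>x. of_real (kd x i j) * \<phi> (kelvin x)) x $ j) = g $ i / of_real (norm x ^ 4)" .
qed

lemma grad_comp_kelvin:
  assumes "x \<noteq> 0" "test_function D \<phi>"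
  shows "grad (\<lambda>x. \<phi> (kelvin x)) x $ j = (\<Sum>k\<in>UNIV. of_real (kd x k j) * grad \<phi> (kelvin x) $ k)"
  using grad_eqI[OF has_grad_comp_kelvin[OF assms(1) test_function_has_grad[OF assms(2)]]] by simp

text \<open>The gradient of the composition is the sum over \<open>k\<close> of the fields of
  \<open>kelvin_field\<close>, so their divergences add up to the Laplacian: its conformal
  covariance in the plane.\<close>

lemma grad2_comp_kelvin:
  assumes x: "x \<noteq> 0" and \<phi>: "test_function D \<phi>"
  shows "has_grad (\<lambda>y. grad (\<lambda>x. \<phi> (kelvin x)) y $ j) (\<Sum>k\<in>UNIV. grad (\<lambda>y. of_real (kd y k j) * grad \<phi> (kelvin y) $ k) x) x"
    and "lap (\<lambda>x. \<phi> (kelvin x)) x = lap \<phi> (kelvin x) / of_real (norm x ^ 4)"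
proof -
  have g: "has_grad (\<lambda>y. grad \<phi> y $ k) (grad (\<lambda>y. grad \<phi> y $ k) z) z" for k z
    by (rule test_function_has_grad[OF test_function_grad[OF \<phi>]])
  show h: "has_grad (\<lambda>y. grad (\<lambda>x. \<phi> (kelvin x)) y $ j) (\<Sum>k\<in>UNIV. grad (\<lambda>y. of_real (kd y k j) * grad \<phi> (kelvin y) $ k) x) x" for j
  proof (rule has_grad_transform_open[of _ _ _ "- {0}"])
    show "has_grad (\<lambda>y. \<Sum>k\<in>UNIV. of_real (kd y k j) * grad \<phi> (kelvin y) $ k) (\<Sum>k\<in>UNIV. grad (\<lambda>y. of_real (kd y k j) * grad \<phi> (kelvin y) $ k) x) x"
      by (intro has_grad_sum finite kelvin_field(1)[OF x g])
  qed (use x grad_comp_kelvin[OF _ \<phi>] in auto)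
  have "lap (\<lambda>x. \<phi> (kelvin x)) x = (\<Sum>k\<in>UNIV. \<Sum>j\<in>UNIV. grad (\<lambda>y. of_real (kd y k j) * grad \<phi> (kelvin y) $ k) x $ j)"
    unfolding lap_def grad_eqI[OF h] by (simp add: sum_2 algebra_simps)
  also have "\<dots> = lap \<phi> (kelvin x) / of_real (norm x ^ 4)"
    unfolding kelvin_field(2)[OF x g] lap_def by (simp add: sum_divide_distrib)
  finally show "lap (\<lambda>x. \<phi> (kelvin x)) x = lap \<phi> (kelvin x) / of_real (norm x ^ 4)" .
qed

subsection \<open>Square integrable functions\<close>

lemma L2_iff:
  fixes u :: "real^'n \<Rightarrow> 'b::euclidean_space"
  assumes "D \<in> sets lebesgue"
  shows "L2 D u \<longleftrightarrow> (\<lambda>x. indicator D x *\<^sub>R u x) \<in> borel_measurable lebesgue \<and>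
     integrable lebesgue (\<lambda>x. indicator D x * (norm (u x))\<^sup>2)"
  unfolding L2_def using assms
  by (simp add: borel_measurable_restrict_space_iff integrable_restrict_space)

lemma L2_UNIV_iff:
  fixes u :: "real^'n \<Rightarrow> 'b::euclidean_space"
  shows "L2 UNIV u \<longleftrightarrow> u \<in> borel_measurable lebesgue \<and> integrable lebesgue (\<lambda>x. (norm (u x))\<^sup>2)"
  by (simp add: L2_iff)

lemma L2_imp_integrable:
  fixes u :: "real^'n \<Rightarrow> 'b::euclidean_space"
  assumes "L2 D u" "D \<in> lmeasurable"
  shows "integrable lebesgue (\<lambda>x. indicator D x *\<^sub>R u x)"
proof -
  have D: "D \<in> sets lebesgue" using assms(2) by (simp add: fmeasurableD)
  note u = assms(1)[unfolded L2_iff[OF D]]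
  have i: "integrable lebesgue (\<lambda>x. indicator D x + indicator D x * (norm (u x))\<^sup>2)"
    using u assms(2) by (intro Bochner_Integration.integrable_add) (auto simp: integrable_real_indicator fmeasurable_def)
  show ?thesis
  proof (rule Bochner_Integration.integrable_bound[OF i])
    show "(\<lambda>x. indicator D x *\<^sub>R u x) \<in> borel_measurable lebesgue" using u by blast
    have "norm (u x) \<le> 1 + (norm (u x))\<^sup>2" for x
      using zero_le_power2[of "norm (u x) - 1"] by (simp add: power2_diff)
        (smt (verit) zero_le_power2)
    then show "AE x in lebesgue. norm (indicator D x *\<^sub>R u x) \<le> norm (indicator D x + indicator D x * (norm (u x))\<^sup>2)"
      by (intro AE_I2) (auto simp: indicator_def)
  qed
qed

lemma L2_subset:
  fixes u :: "real^'n \<Rightarrow> 'b::euclidean_space"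
  assumes "L2 D u" "D \<in> sets lebesgue" "E \<in> sets lebesgue" "E \<subseteq> D"
  shows "L2 E u"
proof -
  note u = assms(1)[unfolded L2_iff[OF assms(2)]]
  have e: "indicator E x *\<^sub>R (indicator D x *\<^sub>R u x) = indicator E x *\<^sub>R u x" for x
    using assms(4) by (auto simp: indicator_def)
  have e2: "indicator E x *\<^sub>R (indicator D x * (norm (u x))\<^sup>2) = indicator E x * (norm (u x))\<^sup>2" for x
    using assms(4) by (auto simp: indicator_def)
  have "(\<lambda>x. indicator E x *\<^sub>R (indicator D x *\<^sub>R u x)) \<in> borel_measurable lebesgue"
    by (rule borel_measurable_scaleR[OF borel_measurable_indicator[OF assms(3)] conjunct1[OF u]])
  moreover have "integrable lebesgue (\<lambda>x. indicator E x *\<^sub>R (indicator D x * (norm (u x))\<^sup>2))"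
    using u assms(3) by (intro integrable_mult_indicator) auto
  ultimately show ?thesis unfolding L2_iff[OF assms(3)] e e2 by blast
qed

lemma L2_component:
  fixes G :: "real^'n \<Rightarrow> complex^'m"
  assumes "L2 D G" "D \<in> sets lebesgue" shows "L2 D (\<lambda>x. G x $ i)"
proof -
  note u = assms(1)[unfolded L2_iff[OF assms(2)]]
  have "(\<lambda>x. (indicator D x *\<^sub>R G x) $ i) \<in> borel_measurable lebesgue"
    by (rule borel_measurable_continuous_on[of "\<lambda>v. v $ i"]) (use u in \<open>auto intro!: continuous_intros\<close>)
  then have m: "(\<lambda>x. indicator D x *\<^sub>R G x $ i) \<in> borel_measurable lebesgue" by simp
  have "integrable lebesgue (\<lambda>x. indicator D x * (norm (G x $ i))\<^sup>2)"
  proof (rule Bochner_Integration.integrable_bound[OF conjunct2[OF u]])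
    have "(\<lambda>x. (norm (indicator D x *\<^sub>R G x $ i))\<^sup>2) \<in> borel_measurable lebesgue" using m by measurable
    moreover have "(norm (indicator D x *\<^sub>R G x $ i))\<^sup>2 = indicator D x * (norm (G x $ i))\<^sup>2" for x
      by (simp add: indicator_def)
    ultimately show "(\<lambda>x. indicator D x * (norm (G x $ i))\<^sup>2) \<in> borel_measurable lebesgue" by simp
    show "AE x in lebesgue. norm (indicator D x * (norm (G x $ i))\<^sup>2) \<le> norm (indicator D x * (norm (G x))\<^sup>2)"
      by (intro AE_I2) (auto simp: indicator_def intro!: power_mono Finite_Cartesian_Product.norm_nth_le)
  qed
  with m show ?thesis unfolding L2_iff[OF assms(2)] by blast
qed

lemma L2_loc_imp_L1_loc:
  fixes u :: "real^'n \<Rightarrow> 'b::euclidean_space"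
  assumes "\<And>K. compact K \<Longrightarrow> K \<subseteq> D \<Longrightarrow> L2 K u" shows "L1_loc D u"
  unfolding L1_loc_def set_integrable_def
  using assms L2_imp_integrable by (metis lmeasurable_compact)

lemma L2_imp_L1_loc:
  fixes u :: "real^'n \<Rightarrow> 'b::euclidean_space"
  assumes "L2 D u" "D \<in> sets lebesgue" shows "L1_loc D u"
  by (rule L2_loc_imp_L1_loc) (metis L2_subset assms compact_imp_closed lebesgue_closedin lmeasurable_compact fmeasurableD)

subsection \<open>Cutting off at the unit circle\<close>

text \<open>It vanishes for |x|^2 at least 1 - s and tends to 1 in the open disk as s tends to 0.
  With 1 - |x|^2 instead of the distance to the circle it is smooth at the origin too.\<close>

definition cutoff :: "real \<Rightarrow> real^2 \<Rightarrow> real" where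
  "cutoff s x = flat 0 ((1 - (norm x)\<^sup>2) / s - 1)"

text \<open>The radial factor of the gradient of \<open>cutoff\<close>, which is -2x times this. It
  can be of size 1/s.\<close>

definition cutoff_slope :: "real \<Rightarrow> real^2 \<Rightarrow> real" where
  "cutoff_slope s x = flat 2 ((1 - (norm x)\<^sup>2) / s - 1) / s"

lemma has_grad_cutoff:
  assumes "s \<noteq> 0"
  shows "has_grad (\<lambda>x. of_real (cutoff s x)) (\<chi> j. of_real (cutoff_slope s x * (- 2 * x $ j))) x"
proof -
  have d: "((\<lambda>t. flat 0 ((1 - t) / s - 1)) has_real_derivative - (flat 2 ((1 - (norm x)\<^sup>2) / s - 1) / s)) (at ((norm x)\<^sup>2))"
  proof -
    have "((\<lambda>t. (1 - t) / s - 1) has_real_derivative - (1 / s)) (at ((norm x)\<^sup>2))"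
      using assms by (auto intro!: derivative_eq_intros)
    from DERIV_chain'[OF this flat_deriv[of 0]] show ?thesis by (simp add: numeral_2_eq_2)
  qed
  have "of_real (- (flat 2 ((1 - (norm x)\<^sup>2) / s - 1) / s)) *s (\<chi> i. of_real (2 * x $ i)) = (\<chi> j. complex_of_real (cutoff_slope s x * (- 2 * x $ j)))"
    by (simp add: vec_eq_iff cutoff_slope_def)
  with has_grad_compose_real[OF has_grad_norm_sq d] show ?thesis unfolding cutoff_def by simp
qed

text \<open>With t = (1 - |x|^2)/s - 1 the product
  \<open>cutoff_slope s x * (1 - (norm x)\<^sup>2)\<close> is (1 + t) \<open>flat 2 t\<close>. So it
  is bounded uniformly in \<open>s\<close>, by exp y at least 1 + y + y^2/2 with y = 1/t, and small
  for large t.\<close>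

lemma flat_2_bound: "(1 + t) * flat 2 t \<le> 2" and flat_2_bound': "t > 0 \<Longrightarrow> (1 + t) * flat 2 t \<le> (1 + t) / t\<^sup>2"
proof -
  show "(1 + t) * flat 2 t \<le> (1 + t) / t\<^sup>2" if "t > 0" for t
    using that by (auto simp: flat_def intro!: divide_right_mono mult_left_le)
  show "(1 + t) * flat 2 t \<le> 2"
  proof (cases "t > 0")
    case True
    define y where "y = 1 / t"
    have y: "y > 0" "t = 1 / y" using True by (auto simp: y_def)
    have "(1 + t) * flat 2 t = (y + y\<^sup>2) * exp (- y)"
      using y(1) by (subst (1 2) y(2)) (simp add: flat_def field_simps power2_eq_square)
    also have "\<dots> \<le> (2 * exp y) * exp (- y)"
      using exp_lower_Taylor_quadratic[of y] y by (intro mult_right_mono) auto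
    also have "\<dots> = 2" by (simp add: exp_minus)
    finally show ?thesis .
  qed (simp add: flat_def)
qed

lemma cutoff_bounds:
  assumes "s > 0"
  shows "0 \<le> cutoff s x" "cutoff s x \<le> 1" "0 \<le> cutoff_slope s x"
    "norm x < 1 \<Longrightarrow> cutoff_slope s x * (1 - (norm x)\<^sup>2) \<le> 2"
    "(norm x)\<^sup>2 \<ge> 1 - s \<Longrightarrow> cutoff s x = 0" "(norm x)\<^sup>2 \<ge> 1 - s \<Longrightarrow> cutoff_slope s x = 0"
proof -
  show "0 \<le> cutoff s x" by (simp add: cutoff_def flat_nonneg)
  show "cutoff s x \<le> 1" by (simp add: cutoff_def flat_def)
  show "0 \<le> cutoff_slope s x" using assms by (simp add: cutoff_slope_def flat_nonneg)
  show "cutoff s x = 0" "cutoff_slope s x = 0" if "(norm x)\<^sup>2 \<ge> 1 - s"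
    using that assms by (auto simp: cutoff_def cutoff_slope_def flat_def field_simps)
  show "cutoff_slope s x * (1 - (norm x)\<^sup>2) \<le> 2"
    using flat_2_bound[of "(1 - (norm x)\<^sup>2) / s - 1"] assms by (simp add: cutoff_slope_def mult.commute)
qed

text \<open>At a fixed point of the disk the argument t of \<open>flat\<close> tends to infinity,
  where exp(-1/t) tends to 1 and (1 + t)/t^2 to 0.\<close>

lemma cutoff_tendsto:
  assumes "norm x < 1"
  shows "(\<lambda>n. cutoff (1 / real (Suc n)) x) \<longlonglongrightarrow> 1"
    and "(\<lambda>n. cutoff_slope (1 / real (Suc n)) x * (1 - (norm x)\<^sup>2)) \<longlonglongrightarrow> 0"
proof -
  define c where "c = 1 - (norm x)\<^sup>2"
  have c: "c > 0" using assms by (simp add: c_def power_less_one_iff abs_square_less_1)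
  define t where "t n = c * real (Suc n) - 1" for n
  have t: "filterlim t at_top sequentially"
    unfolding t_def using c by real_asymp
  have 1: "cutoff (1 / real (Suc n)) x = flat 0 (t n)" for n by (simp add: cutoff_def c_def t_def)
  have 2: "cutoff_slope (1 / real (Suc n)) x * (1 - (norm x)\<^sup>2) = (1 + t n) * flat 2 (t n)" for n
    by (simp add: cutoff_slope_def c_def t_def field_simps)
  have pos: "eventually (\<lambda>n. t n > 0) sequentially" using t by (simp add: filterlim_at_top_dense)
  have "((\<lambda>y::real. exp (- (1 / y))) \<longlongrightarrow> 1) at_top" by real_asymp
  from filterlim_compose[OF this t] have "(\<lambda>n. exp (- (1 / t n))) \<longlonglongrightarrow> 1" .
  then have "(\<lambda>n. flat 0 (t n)) \<longlonglongrightarrow> 1"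
    by (rule Lim_transform_eventually) (use pos in \<open>eventually_elim, simp add: flat_def\<close>)
  then show "(\<lambda>n. cutoff (1 / real (Suc n)) x) \<longlonglongrightarrow> 1" unfolding 1 .
  have "((\<lambda>y::real. (1 + y) / y\<^sup>2) \<longlongrightarrow> 0) at_top" by real_asymp
  from filterlim_compose[OF this t] have up: "(\<lambda>n. (1 + t n) / (t n)\<^sup>2) \<longlonglongrightarrow> 0" .
  have "(\<lambda>n. (1 + t n) * flat 2 (t n)) \<longlonglongrightarrow> 0"
  proof (rule tendsto_sandwich[OF _ _ tendsto_const up])
    show "eventually (\<lambda>n. 0 \<le> (1 + t n) * flat 2 (t n)) sequentially"
      using pos by eventually_elim (simp add: flat_nonneg)
    show "eventually (\<lambda>n. (1 + t n) * flat 2 (t n) \<le> (1 + t n) / (t n)\<^sup>2) sequentially"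
      using pos by eventually_elim (rule flat_2_bound')
  qed
  then show "(\<lambda>n. cutoff_slope (1 / real (Suc n)) x * (1 - (norm x)\<^sup>2)) \<longlonglongrightarrow> 0" unfolding 2 .
qed

lemma Ckc_cutoff_mult:
  assumes s: "0 < s" "s < 1" and \<Phi>: "Ck 1 \<Phi>"
  shows "Ckc 1 (ball 0 1) (\<lambda>x. of_real (cutoff s x) * \<Phi> x)"
    and "grad (\<lambda>x. of_real (cutoff s x) * \<Phi> x) x $ j = of_real (cutoff s x) * grad \<Phi> x $ j + of_real (cutoff_slope s x * (- 2 * x $ j)) * \<Phi> x"
proof -
  have C1: "Ck (Suc 0) \<Phi>" using \<Phi> by simp
  have g: "has_grad (\<lambda>x. of_real (cutoff s x) * \<Phi> x) (of_real (cutoff s x) *s grad \<Phi> x + \<Phi> x *s (\<chi> j. of_real (cutoff_slope s x * (- 2 * x $ j)))) x" for x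
    by (intro has_grad_mult has_grad_cutoff Ck_has_grad[OF C1]) (use s in simp)
  show "grad (\<lambda>x. of_real (cutoff s x) * \<Phi> x) x $ j = of_real (cutoff s x) * grad \<Phi> x $ j + of_real (cutoff_slope s x * (- 2 * x $ j)) * \<Phi> x"
    unfolding grad_eqI[OF g] by simp
  show "Ckc 1 (ball 0 1) (\<lambda>x. of_real (cutoff s x) * \<Phi> x)"
  proof (rule Ckc_1I[OF open_UNIV _ subset_UNIV _ _ g])
    show "compact (cball 0 (sqrt (1 - s)) :: (real^2) set)" by simp
    have "sqrt (1 - s) < 1" using s by (simp add: real_sqrt_lt_1_iff)
    then show "cball 0 (sqrt (1 - s)) \<subseteq> (ball 0 1 :: (real^2) set)"
      by (intro subsetI) (metis le_less_trans mem_ball_0 mem_cball_0)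
    show "of_real (cutoff s x) * \<Phi> x = 0" if "x \<notin> cball 0 (sqrt (1 - s))" for x
    proof -
      have "sqrt (1 - s) < norm x" using that by simp
      then have "(sqrt (1 - s))\<^sup>2 \<le> (norm x)\<^sup>2" using s by (intro power_mono) auto
      then have "(norm x)\<^sup>2 \<ge> 1 - s" using s by simp
      then show ?thesis using cutoff_bounds(5)[OF s(1)] by simp
    qed
    have c: "continuous_on UNIV (\<lambda>x. grad \<Phi> x $ i)" "continuous_on UNIV \<Phi>" for i
      using C1 Ck_SucD[OF C1] by auto
    have c': "continuous_on UNIV (cutoff s)" "continuous_on UNIV (cutoff_slope s)"
      unfolding cutoff_def[abs_def] cutoff_slope_def[abs_def] using s
      by (auto intro!: continuous_intros continuous_on_compose2[OF flat_continuous])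
    have "continuous_on UNIV (\<lambda>x. of_real (cutoff s x) * grad \<Phi> x $ i + \<Phi> x * of_real (cutoff_slope s x * (- 2 * x $ i)))" for i
      by (intro continuous_on_add continuous_on_mult continuous_on_of_real c c' continuous_on_const continuous_on_component continuous_on_id)
    then show "continuous_on UNIV (\<lambda>x. (of_real (cutoff s x) *s grad \<Phi> x + \<Phi> x *s (\<chi> j. of_real (cutoff_slope s x * (- 2 * x $ j)))) $ i)" for i
      by (simp only: vector_add_component vector_smult_component vec_lambda_beta)
  qed
qed

text \<open>The term with \<open>b\<close> carries the large slope. If \<open>b\<close> vanishes to
  first order at the circle, slope times \<open>b\<close> is dominated by 2m and tends to 0 at each
  point, so no boundary contribution survives.\<close>

lemma boundary_cutoff:
  fixes a b :: "real^2 \<Rightarrow> complex"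
  assumes a: "integrable lebesgue (\<lambda>x. indicator (ball 0 1) x *\<^sub>R a x)"
    and b: "(\<lambda>x. indicator (ball 0 1) x *\<^sub>R b x) \<in> borel_measurable lebesgue"
    and m: "integrable lebesgue (\<lambda>x. indicator (ball 0 1) x * m x)"
    and bm: "\<And>x. norm x < 1 \<Longrightarrow> norm (b x) \<le> (1 - (norm x)\<^sup>2) * m x"
    and eq: "\<And>s. 0 < s \<Longrightarrow> s < 1 \<Longrightarrow> (LINT x|lebesgue. of_real (cutoff s x) * a x + of_real (cutoff_slope s x) * b x) = 0"
  shows "(LINT x|lebesgue. indicator (ball 0 1) x *\<^sub>R a x) = 0"
proof -
  \<comment> \<open>The sequence starts at 1/2 because the hypothesis asks for s < 1.\<close>
  define sn where "sn n = 1 / real (Suc (Suc n))" for n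
  have sn: "0 < sn n" "sn n < 1" for n by (auto simp: sn_def)
  let ?a = "\<lambda>x. indicator (ball 0 1) x *\<^sub>R a x" and ?b = "\<lambda>x. indicator (ball 0 1) x *\<^sub>R b x"
  let ?p = "\<lambda>n x. of_real (cutoff (sn n) x) * ?a x + of_real (cutoff_slope (sn n) x) * ?b x"
  have out: "cutoff s x = 0" "cutoff_slope s x = 0" if "x \<notin> ball 0 1" "0 < s" for s x
  proof -
    have "(norm x)\<^sup>2 \<ge> 1" using that by (simp add: one_le_power)
    then show "cutoff s x = 0" "cutoff_slope s x = 0" using cutoff_bounds(5,6)[OF that(2), of x] that by auto
  qed
  have slope: "cutoff_slope s x * norm (b x) \<le> cutoff_slope s x * (1 - (norm x)\<^sup>2) * m x" if "norm x < 1" "0 < s" for s x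
    using mult_left_mono[OF bm[OF that(1)] cutoff_bounds(3)[OF that(2)]] by (simp add: mult.assoc)
  have m0: "m x \<ge> 0" if "norm x < 1" for x
  proof -
    have "1 - (norm x)\<^sup>2 > 0" using that by (simp add: power_less_one_iff abs_square_less_1)
    moreover have "0 \<le> (1 - (norm x)\<^sup>2) * m x" using bm[OF that] norm_ge_zero order_trans by blast
    ultimately show ?thesis by (simp add: zero_le_mult_iff)
  qed
  have cm: "cutoff s \<in> borel_measurable lebesgue" "cutoff_slope s \<in> borel_measurable lebesgue" if "s > 0" for s
    unfolding cutoff_def[abs_def] cutoff_slope_def[abs_def] using that
    by (auto intro!: continuous_lebesgue_measurable continuous_intros continuous_on_compose2[OF flat_continuous])
  have "(\<lambda>n. LINT x|lebesgue. ?p n x) \<longlonglongrightarrow> (LINT x|lebesgue. ?a x)"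
  proof (rule integral_dominated_convergence[where w = "\<lambda>x. norm (?a x) + 2 * (indicator (ball 0 1) x * m x)"])
    show "integrable lebesgue (\<lambda>x. norm (?a x) + 2 * (indicator (ball 0 1) x * m x))"
      by (intro Bochner_Integration.integrable_add integrable_norm a integrable_mult_right m)
    show "?a \<in> borel_measurable lebesgue" using a by (rule borel_measurable_integrable)
    then show "(\<lambda>x. ?p n x) \<in> borel_measurable lebesgue" for n
      using cm[OF sn(1)] b by (intro borel_measurable_add borel_measurable_times measurable_compose[OF _ borel_measurable_of_real]) auto
    show "AE x in lebesgue. norm (?p n x) \<le> norm (?a x) + 2 * (indicator (ball 0 1) x * m x)" for n
    proof (rule AE_I2)
      fix x :: "real^2"
      show "norm (?p n x) \<le> norm (?a x) + 2 * (indicator (ball 0 1) x * m x)"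
      proof (cases "norm x < 1")
        case True
        have "norm (of_real (cutoff (sn n) x) * a x) \<le> norm (a x)"
          using cutoff_bounds(1,2)[OF sn(1), of n x] by (simp add: norm_mult mult_left_le_one_le)
        moreover have "norm (of_real (cutoff_slope (sn n) x) * b x) \<le> 2 * m x"
        proof -
          have "norm (of_real (cutoff_slope (sn n) x) * b x) = cutoff_slope (sn n) x * norm (b x)"
            using cutoff_bounds(3)[OF sn(1), of n x] by (simp add: norm_mult)
          also have "\<dots> \<le> cutoff_slope (sn n) x * (1 - (norm x)\<^sup>2) * m x" by (rule slope[OF True sn(1)])
          also have "\<dots> \<le> 2 * m x" using cutoff_bounds(4)[OF sn(1) True] m0[OF True] by (intro mult_right_mono)
          finally show ?thesis .
        qed
        ultimately show ?thesis using True norm_triangle_ineq[of "of_real (cutoff (sn n) x) * a x" "of_real (cutoff_slope (sn n) x) * b x"] by simp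
      next
        case False
        then show ?thesis by simp
      qed
    qed
    show "AE x in lebesgue. (\<lambda>n. ?p n x) \<longlonglongrightarrow> ?a x"
    proof (rule AE_I2)
      fix x :: "real^2"
      show "(\<lambda>n. ?p n x) \<longlonglongrightarrow> ?a x"
      proof (cases "norm x < 1")
        case True
        have t: "(\<lambda>n. cutoff (sn n) x) \<longlonglongrightarrow> 1" "(\<lambda>n. cutoff_slope (sn n) x * (1 - (norm x)\<^sup>2)) \<longlonglongrightarrow> 0"
          unfolding sn_def using LIMSEQ_Suc[OF cutoff_tendsto(1)[OF True]] LIMSEQ_Suc[OF cutoff_tendsto(2)[OF True]] by simp_all
        have "(\<lambda>n. cutoff_slope (sn n) x * (1 - (norm x)\<^sup>2) * m x) \<longlonglongrightarrow> 0"
          using tendsto_mult_left_zero[OF t(2)] .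
        then have "(\<lambda>n. of_real (cutoff_slope (sn n) x) * b x) \<longlonglongrightarrow> 0"
          by (rule Lim_null_comparison[rotated])
            (use slope[OF True sn(1)] cutoff_bounds(3)[OF sn(1)] in \<open>simp add: norm_mult\<close>)
        then have "(\<lambda>n. of_real (cutoff (sn n) x) * a x + of_real (cutoff_slope (sn n) x) * b x) \<longlonglongrightarrow> of_real 1 * a x + 0"
          by (intro tendsto_intros t)
        then show ?thesis using True by simp
      qed simp
    qed
  qed
  moreover have "(LINT x|lebesgue. ?p n x) = 0" for n
  proof -
    have "?p n x = of_real (cutoff (sn n) x) * a x + of_real (cutoff_slope (sn n) x) * b x" for x
      using out[OF _ sn(1), of x n] by (auto simp: indicator_def)
    with eq[OF sn] show ?thesis by simp
  qed
  ultimately show ?thesis using LIMSEQ_unique[OF _ tendsto_const] by force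
qed

text \<open>A Lipschitz bound on the closed disk, applied between x and the nearest point x/|x| of
  the circle (any point of it when x = 0), and 1 - |x| is at most 1 - |x|^2.\<close>

lemma vanishing_on_circle_bound:
  fixes g :: "real^2 \<Rightarrow> complex"
  assumes g: "Ck 1 g" and 0: "\<And>x. norm x = 1 \<Longrightarrow> g x = 0"
  obtains C where "C \<ge> 0" "\<And>x. norm x < 1 \<Longrightarrow> norm (g x) \<le> C * (1 - (norm x)\<^sup>2)"
proof -
  have C1: "Ck (Suc 0) g" using g by simp
  have "\<exists>B. \<forall>x\<in>cball 0 1. norm (grad g x $ i) \<le> B" for i
  proof -
    have "continuous_on (cball 0 1) (\<lambda>x. grad g x $ i)" using C1 by (auto intro: continuous_on_subset)
    then have "bounded ((\<lambda>x. grad g x $ i) ` cball 0 1)" by (intro compact_imp_bounded compact_continuous_image) auto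
    then show ?thesis by (auto simp: bounded_iff)
  qed
  then obtain B where B: "\<And>i x. x \<in> cball 0 1 \<Longrightarrow> norm (grad g x $ i) \<le> B i" by metis
  define L where "L = B 1 + B 2"
  have B0: "B i \<ge> 0" for i using B[of 0 i] by (meson norm_ge_zero order_trans centre_in_cball zero_le_one)
  have L0: "L \<ge> 0" using B0 by (simp add: L_def)
  have lip: "norm (g x - g y) \<le> L * norm (x - y)" if "x \<in> cball 0 1" "y \<in> cball 0 1" for x y
  proof (rule differentiable_bound[OF convex_cball[of 0 1], where f' = "\<lambda>x h. \<Sum>i\<in>UNIV. (h $ i) *\<^sub>R (grad g x $ i)"])
    fix x :: "real^2" assume x: "x \<in> cball 0 1"
    show "(g has_derivative (\<lambda>h. \<Sum>i\<in>UNIV. (h $ i) *\<^sub>R (grad g x $ i))) (at x within cball 0 1)"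
      using Ck_has_grad[OF C1, of x] unfolding has_grad_def by (rule has_derivative_at_withinI)
    have "norm (\<Sum>i\<in>UNIV. (h $ i) *\<^sub>R (grad g x $ i)) \<le> L * norm h" for h
    proof -
      have "norm (\<Sum>i\<in>UNIV. (h $ i) *\<^sub>R (grad g x $ i)) \<le> (\<Sum>i\<in>UNIV. norm h * B i)"
        by (rule order_trans[OF norm_sum], rule sum_mono)
          (use B[OF x] in \<open>auto intro!: mult_mono component_le_norm_cart\<close>)
      also have "\<dots> = L * norm h" by (simp add: sum_2 L_def algebra_simps)
      finally show ?thesis .
    qed
    then show "onorm (\<lambda>h. \<Sum>i\<in>UNIV. (h $ i) *\<^sub>R (grad g x $ i)) \<le> L" by (rule onorm_le)
  qed (use that in auto)
  show ?thesis
  proof (rule that[OF L0])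
    fix x :: "real^2" assume x: "norm x < 1"
    obtain y where y: "norm y = 1" "norm (x - y) = 1 - norm x"
    proof (cases "x = 0")
      case True
      show ?thesis by (rule that[of "axis 1 1"]) (auto simp: True norm_axis_1)
    next
      case False
      have "x - x /\<^sub>R norm x = (1 - inverse (norm x)) *\<^sub>R x" by (simp add: algebra_simps)
      then have "norm (x - x /\<^sub>R norm x) = \<bar>1 - inverse (norm x)\<bar> * norm x" by simp
      also have "\<dots> = 1 - norm x" using False x by (simp add: abs_if field_simps)
      finally show ?thesis using False by (intro that[of "x /\<^sub>R norm x"]) auto
    qed
    have "norm (g x) \<le> L * (1 - norm x)" using lip[of x y] y x 0[OF y(1)] by simp
    also have "\<dots> \<le> L * (1 - (norm x)\<^sup>2)"
      using x L0 by (intro mult_left_mono) (auto simp: power2_eq_square mult_left_le)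
    finally show "norm (g x) \<le> L * (1 - (norm x)\<^sup>2)" .
  qed
qed

subsection \<open>Pulling back by the Kelvin transform\<close>

text \<open>The value at 0 has to be set: \<open>kelvin 0 = 0\<close>, while the continuous
  extension there is the value of the function at infinity, which is 0 for compact support.\<close>

definition kpull :: "(real^2 \<Rightarrow> complex) \<Rightarrow> real^2 \<Rightarrow> complex" where
  "kpull \<phi> x = (if x = 0 then 0 else \<phi> (kelvin x))"

lemma has_grad_grad: "has_grad f g x \<Longrightarrow> has_grad f (grad f x) x"
  by (simp add: grad_eqI)

lemma kpull_zero_near_0:
  assumes "test_function D \<phi>"
  obtains r where "r > 0" "\<And>x. norm x < r \<Longrightarrow> kpull \<phi> x = 0"
proof -
  obtain K where K: "compact K" "\<And>x. x \<notin> K \<Longrightarrow> \<phi> x = 0" using test_functionE[OF assms] by metis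
  obtain R where R: "R > 0" "\<And>x. x \<in> K \<Longrightarrow> norm x \<le> R"
    using compact_imp_bounded[OF K(1)] unfolding bounded_pos by metis
  show ?thesis
  proof (rule that[of "1 / R"])
    fix x :: "real^2" assume x: "norm x < 1 / R"
    show "kpull \<phi> x = 0"
    proof (cases "x = 0")
      case False
      then have "norm (kelvin x) > R" using x R(1) by (simp add: norm_kelvin field_simps)
      then have "kelvin x \<notin> K" using R(2) by fastforce
      then show ?thesis using K(2) by (simp add: kpull_def)
    qed (simp add: kpull_def)
  qed (use R in simp)
qed

lemma continuous_on_glue_0:
  fixes g :: "real^2 \<Rightarrow> complex"
  assumes "continuous_on (- {0}) g" "r > 0" "\<And>x. norm x < r \<Longrightarrow> g x = 0"
  shows "continuous_on UNIV g"
proof -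
  have "continuous_on (ball 0 r) g"
    by (rule continuous_on_eq[OF continuous_on_const[of _ 0]]) (use assms(3) in auto)
  then have "continuous_on (- {0} \<union> ball 0 r) g"
    using assms(1) by (intro continuous_on_open_Un) auto
  moreover have "- {0} \<union> ball 0 r = (UNIV :: (real^2) set)" using assms(2) by auto
  ultimately show ?thesis by simp
qed

lemma has_grad_zero_near_0:
  fixes g :: "real^2 \<Rightarrow> complex"
  assumes "\<And>x. norm x < r \<Longrightarrow> g x = 0" "norm x < r"
  shows "has_grad g 0 x"
  by (rule has_grad_transform_open[OF has_grad_const[of 0], of "ball 0 r"]) (use assms in auto)

lemma continuous_on_kelvin: "continuous_on (- {0}) kelvin"
  unfolding kelvin_def[abs_def] by (auto intro!: continuous_intros)

lemma continuous_on_kd: "continuous_on (- {0}) (\<lambda>x. kd x i j)"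
  unfolding kd_def[abs_def] by (auto intro!: continuous_intros)

lemma continuous_on_grad_kd: "continuous_on (- {0}) (\<lambda>x. grad (\<lambda>x. of_real (kd x i j)) x $ l)"
proof (rule continuous_on_eq)
  show "continuous_on (- {0}) (\<lambda>x. complex_of_real ((if i = j then 1 else 0) * (- 2 * x $ l * (1 / ((norm x)\<^sup>2)\<^sup>2))
     - (2 * ((if l = i then x $ j else 0) + (if l = j then x $ i else 0)) * (1 / ((norm x)\<^sup>2)\<^sup>2) - 8 * x $ i * x $ j * x $ l * (1 / ((norm x)\<^sup>2) ^ 3))))"
    by (cases "l = i"; cases "l = j") (auto intro!: continuous_intros)
qed (use grad_eqI[OF has_grad_kd] in auto)

lemma continuous_on_comp_kelvin:
  assumes "continuous_on UNIV \<psi>" shows "continuous_on (- {0}) (\<lambda>x. \<psi> (kelvin x))"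
  by (rule continuous_on_compose2[OF assms continuous_on_kelvin]) simp

lemma continuous_on_kelvin_field:
  fixes \<psi> :: "real^2 \<Rightarrow> complex"
  assumes \<psi>: "test_function D \<psi>"
  shows "continuous_on (- {0}) (\<lambda>x. grad (\<lambda>x. of_real (kd x i j) * \<psi> (kelvin x)) x $ l)"
proof (rule continuous_on_eq)
  let ?e = "\<lambda>x. of_real (kd x i j) * (\<Sum>k\<in>UNIV. of_real (kd x k l) * grad \<psi> (kelvin x) $ k) + \<psi> (kelvin x) * grad (\<lambda>x. of_real (kd x i j)) x $ l"
  show "continuous_on (- {0}) ?e"
    by (intro continuous_on_add continuous_on_mult continuous_on_sum continuous_on_of_real continuous_on_kd continuous_on_grad_kd
        continuous_on_comp_kelvin[OF test_function_continuous[OF \<psi>]] continuous_on_comp_kelvin[OF test_function_continuous[OF test_function_grad[OF \<psi>]]])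
  fix x :: "real^2" assume x: "x \<in> - {0}"
  have "has_grad (\<lambda>x. of_real (kd x i j)) (grad (\<lambda>x. of_real (kd x i j)) x) x"
    using has_grad_grad[OF has_grad_kd[of x i j]] x by simp
  then have "has_grad (\<lambda>x. of_real (kd x i j) * \<psi> (kelvin x))
    (of_real (kd x i j) *s (\<chi> j. \<Sum>k\<in>UNIV. of_real (kd x k j) * grad \<psi> (kelvin x) $ k) + \<psi> (kelvin x) *s grad (\<lambda>x. of_real (kd x i j)) x) x"
    using x by (intro has_grad_mult has_grad_comp_kelvin test_function_has_grad[OF \<psi>]) auto
  from grad_eqI[OF this]
  show "?e x = grad (\<lambda>x. of_real (kd x i j) * \<psi> (kelvin x)) x $ l" by simp
qed

lemma kpull_has_grad_nonzero:
  assumes "x \<noteq> 0" "test_function D \<phi>"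
  shows "has_grad (kpull \<phi>) (\<chi> j. \<Sum>k\<in>UNIV. of_real (kd x k j) * grad \<phi> (kelvin x) $ k) x"
  by (rule has_grad_transform_open[OF has_grad_comp_kelvin[OF assms(1) test_function_has_grad[OF assms(2)]], of "- {0}"])
    (use assms in \<open>auto simp: kpull_def\<close>)

lemma grad_kpull:
  assumes "x \<noteq> 0" "test_function D \<phi>"
  shows "grad (kpull \<phi>) x $ j = (\<Sum>k\<in>UNIV. of_real (kd x k j) * grad \<phi> (kelvin x) $ k)"
  using grad_eqI[OF kpull_has_grad_nonzero[OF assms]] by simp

lemma grad2_kpull_nonzero:
  assumes x: "x \<noteq> 0" and \<phi>: "test_function D \<phi>"
  shows "has_grad (\<lambda>y. grad (kpull \<phi>) y $ j) (\<Sum>k\<in>UNIV. grad (\<lambda>y. of_real (kd y k j) * grad \<phi> (kelvin y) $ k) x) x"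
  by (rule has_grad_transform_open[OF grad2_comp_kelvin(1)[OF x \<phi>], of "- {0}"])
    (use x in \<open>auto simp: grad_kpull[OF _ \<phi>] grad_comp_kelvin[OF _ \<phi>]\<close>)

lemma lap_kpull:
  assumes "x \<noteq> 0" "test_function D \<phi>"
  shows "lap (kpull \<phi>) x = lap \<phi> (kelvin x) / of_real (norm x ^ 4)"
  using grad2_comp_kelvin(2)[OF assms]
  unfolding lap_def grad_eqI[OF grad2_kpull_nonzero[OF assms]] grad_eqI[OF grad2_comp_kelvin(1)[OF assms]] .

text \<open>Near the origin the Kelvin transform leaves the support, so the function is 0 there and
  glues with the smooth composition. Its own support need not be compact; it is used on the disk,
  and two derivatives suffice there.\<close>

lemma Ck_2_kpull:
  assumes \<phi>: "test_function D \<phi>"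
  shows "Ck 2 (kpull \<phi>)"
proof -
  obtain r where r: "r > 0" "\<And>x. norm x < r \<Longrightarrow> kpull \<phi> x = 0" using kpull_zero_near_0[OF \<phi>] by metis
  have g0: "grad (kpull \<phi>) x = 0" if "norm x < r" for x
    by (rule grad_eqI[OF has_grad_zero_near_0[OF r(2) that]])
  have gg0: "grad (\<lambda>y. grad (kpull \<phi>) y $ j) x = 0" if "norm x < r" for x j
    by (rule grad_eqI[OF has_grad_zero_near_0[OF _ that]]) (simp add: g0)
  have h: "has_grad (kpull \<phi>) (grad (kpull \<phi>) x) x" for x
  proof (cases "x = 0")
    case True
    have "has_grad (kpull \<phi>) 0 x" by (rule has_grad_zero_near_0[OF r(2)]) (use True r in auto)
    then show ?thesis by (rule has_grad_grad)
  next
    case False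
    from kpull_has_grad_nonzero[OF this \<phi>] show ?thesis by (rule has_grad_grad)
  qed
  have h2: "has_grad (\<lambda>y. grad (kpull \<phi>) y $ j) (grad (\<lambda>y. grad (kpull \<phi>) y $ j) x) x" for x j
  proof (cases "x = 0")
    case True
    have "has_grad (\<lambda>y. grad (kpull \<phi>) y $ j) 0 x"
      by (rule has_grad_zero_near_0[where r = r]) (use True r g0 in auto)
    then show ?thesis by (rule has_grad_grad)
  next
    case False
    from grad2_kpull_nonzero[OF this \<phi>] show ?thesis by (rule has_grad_grad)
  qed
  have c: "continuous_on UNIV (\<lambda>x. grad (\<lambda>y. grad (kpull \<phi>) y $ j) x $ l)" for j l
  proof (rule continuous_on_glue_0[OF _ r(1)])
    show "continuous_on (- {0}) (\<lambda>x. grad (\<lambda>y. grad (kpull \<phi>) y $ j) x $ l)"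
    proof (rule continuous_on_eq)
      show "continuous_on (- {0}) (\<lambda>x. \<Sum>k\<in>UNIV. grad (\<lambda>y. of_real (kd y k j) * grad \<phi> (kelvin y) $ k) x $ l)"
        by (intro continuous_on_sum continuous_on_kelvin_field[OF test_function_grad[OF \<phi>]])
    qed (simp add: grad_eqI[OF grad2_kpull_nonzero[OF _ \<phi>]])
  qed (simp add: gg0)
  have "Ck (Suc 0) (\<lambda>x. grad (kpull \<phi>) x $ j)" for j
    by (rule Ck_SucI[OF h2]) (simp add: c)
  then have "Ck (Suc (Suc 0)) (kpull \<phi>)" by (rule Ck_SucI[OF h])
  then show ?thesis by (simp add: numeral_2_eq_2)
qed

lemma kelvin_unit: "norm x = 1 \<Longrightarrow> kelvin x = x"
  by (simp add: kelvin_def)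

text \<open>On the unit circle the Jacobian of \<open>kelvin\<close> is the reflection that reverses
  the radial direction. Hence the sum of a test function and its pull-back has zero radial
  derivative there.\<close>

lemma radial_kpull:
  assumes "norm x = 1" "test_function D \<phi>"
  shows "(\<Sum>j\<in>UNIV. of_real (x $ j) * grad (kpull \<phi>) x $ j) = - (\<Sum>j\<in>UNIV. of_real (x $ j) * grad \<phi> x $ j)"
proof -
  have x: "x \<noteq> 0" using assms(1) by auto
  have n: "(x $ 1)\<^sup>2 + (x $ 2)\<^sup>2 = 1" using norm_sq_2[of x] assms(1) by simp
  have kx: "(\<Sum>j\<in>UNIV. x $ j * kd x k j) = - (x $ k)" for k
  proof -
    have "(\<Sum>j\<in>UNIV. x $ j * kd x k j) = x $ k - 2 * x $ k * ((x $ 1)\<^sup>2 + (x $ 2)\<^sup>2)"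
      using exhaust_2[of k] assms(1) unfolding kd_def sum_2 by (auto simp: power2_eq_square algebra_simps)
    then show ?thesis unfolding n by simp
  qed
  have "(\<Sum>j\<in>UNIV. of_real (x $ j) * grad (kpull \<phi>) x $ j) = (\<Sum>k\<in>UNIV. of_real (\<Sum>j\<in>UNIV. x $ j * kd x k j) * grad \<phi> x $ k)"
    unfolding grad_kpull[OF x assms(2)] kelvin_unit[OF assms(1)] by (simp add: sum_2 algebra_simps)
  then show ?thesis unfolding kx by (simp add: sum_negf)
qed

section \<open>Green's formulas in the disk without traces\<close>

lemma ball_integrable_mult:
  fixes u h :: "real^'n \<Rightarrow> complex"
  assumes u: "integrable lebesgue (\<lambda>x. indicator (ball 0 r) x *\<^sub>R u x)" and h: "continuous_on UNIV h"
  shows "integrable lebesgue (\<lambda>x. indicator (ball 0 r) x *\<^sub>R (u x * h x))"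
proof -
  have "bounded (h ` cball 0 r)"
    using h by (intro compact_imp_bounded compact_continuous_image) (auto intro: continuous_on_subset)
  then obtain C where C: "C > 0" "\<And>x. x \<in> cball 0 r \<Longrightarrow> norm (h x) \<le> C" unfolding bounded_pos by blast
  have "integrable lebesgue (\<lambda>x. (indicator (ball 0 r) x *\<^sub>R u x) * (indicator (ball 0 r) x *\<^sub>R h x))"
  proof (rule integrable_mult_bounded[OF u])
    show "(\<lambda>x. indicator (ball 0 r) x *\<^sub>R h x) \<in> borel_measurable lebesgue"
      by (intro borel_measurable_scaleR borel_measurable_indicator continuous_lebesgue_measurable[OF h]) auto
    show "norm (indicator (ball 0 r) x *\<^sub>R h x) \<le> C" for x
      using C(2)[of x] C(1) by (auto simp: indicator_def)
  qed
  moreover have "(indicator (ball 0 r) x *\<^sub>R u x) * (indicator (ball 0 r) x *\<^sub>R h x) = indicator (ball 0 r) x *\<^sub>R (u x * h x)" for x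
    by (simp add: indicator_def)
  ultimately show ?thesis by (simp only:)
qed

lemma ball_integrable_cdot:
  fixes G H :: "real^'n \<Rightarrow> complex^'m"
  assumes "\<And>i. integrable lebesgue (\<lambda>x. indicator (ball 0 r) x *\<^sub>R G x $ i)" "\<And>i. continuous_on UNIV (\<lambda>x. H x $ i)"
  shows "integrable lebesgue (\<lambda>x. indicator (ball 0 r) x *\<^sub>R cdot (G x) (H x))"
  unfolding cdot_def scaleR_sum_right
  using ball_integrable_mult[OF assms(1) assms(2)] by (intro Bochner_Integration.integrable_sum) auto

text \<open>The weak gradient is tested with the cut-off partial derivatives of
  \<open>\<Phi>\<close>. The boundary term is \<open>u\<close> times the radial derivative of
  \<open>\<Phi>\<close>, which vanishes to first order at the circle, so it disappears whatever the
  boundary values of \<open>u\<close> are.\<close>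

lemma green_tangential:
  fixes u :: "real^2 \<Rightarrow> complex"
  assumes w: "has_weak_gradient (ball 0 1) u G"
    and u: "integrable lebesgue (\<lambda>x. indicator (ball 0 1) x *\<^sub>R u x)"
    and G: "\<And>i. integrable lebesgue (\<lambda>x. indicator (ball 0 1) x *\<^sub>R G x $ i)"
    and \<Phi>: "Ck 2 \<Phi>" and rad: "\<And>x. norm x = 1 \<Longrightarrow> (\<Sum>j\<in>UNIV. of_real (x $ j) * grad \<Phi> x $ j) = 0"
  shows "(LINT x|lebesgue. indicator (ball 0 1) x *\<^sub>R (u x * lap \<Phi> x + cdot (G x) (grad \<Phi> x))) = 0"
proof -
  have C2: "Ck (Suc (Suc 0)) \<Phi>" using \<Phi> by (simp add: numeral_2_eq_2)
  have C1: "Ck 1 (\<lambda>x. grad \<Phi> x $ j)" for j using C2 by simp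
  have cont: "continuous_on UNIV (\<lambda>x. grad \<Phi> x $ j)" for j using Ck_SucD[of 0] C1[of j] by (simp only: One_nat_def Ck.simps(1))
  have clap: "continuous_on UNIV (lap \<Phi>)"
    unfolding lap_def[abs_def] using C2 by (intro continuous_on_sum) simp
  define g where "g x = (\<Sum>j\<in>UNIV. of_real (x $ j) * grad \<Phi> x $ j)" for x
  have "Ck 1 g" unfolding g_def[abs_def] by (intro Ck_sum Ck_mult Ck_coord C1) simp
  then obtain C where C: "C \<ge> 0" "\<And>x. norm x < 1 \<Longrightarrow> norm (g x) \<le> C * (1 - (norm x)\<^sup>2)"
    using vanishing_on_circle_bound[of g] rad unfolding g_def by blast
  have cg: "continuous_on UNIV g" using Ck_SucD[of 0 g] \<open>Ck 1 g\<close> by simp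
  have L: "L1_loc (ball 0 1) u" "\<And>i. L1_loc (ball 0 1) (\<lambda>x. G x $ i)"
    using w L1_loc_component unfolding has_weak_gradient_def by blast+
  show ?thesis
  proof (rule boundary_cutoff[where b = "\<lambda>x. u x * (- 2 * g x)" and m = "\<lambda>x. 2 * C * norm (u x)"])
    show "integrable lebesgue (\<lambda>x. indicator (ball 0 1) x *\<^sub>R (u x * lap \<Phi> x + cdot (G x) (grad \<Phi> x)))"
      unfolding scaleR_add_right by (intro Bochner_Integration.integrable_add ball_integrable_mult[OF u clap] ball_integrable_cdot G cont)
    have "continuous_on UNIV (\<lambda>x. - 2 * g x)" using cg by (intro continuous_intros)
    from ball_integrable_mult[OF u this]
    show "(\<lambda>x. indicator (ball 0 1) x *\<^sub>R (u x * (- 2 * g x))) \<in> borel_measurable lebesgue" by (rule borel_measurable_integrable)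
    have "integrable lebesgue (\<lambda>x. 2 * C * norm (indicator (ball 0 1) x *\<^sub>R u x))" using integrable_norm[OF u] by (rule integrable_mult_right)
    then show "integrable lebesgue (\<lambda>x. indicator (ball 0 1) x * (2 * C * norm (u x)))" by (simp add: mult.left_commute)
    show "norm (u x * (- 2 * g x)) \<le> (1 - (norm x)\<^sup>2) * (2 * C * norm (u x))" if "norm x < 1" for x
      using mult_left_mono[OF C(2)[OF that], of "2 * norm (u x)"] by (simp add: norm_mult algebra_simps)
    fix s :: real assume s: "0 < s" "s < 1"
    let ?X = "\<lambda>j x. of_real (cutoff s x) * grad \<Phi> x $ j"
    have X: "Ckc 1 (ball 0 1) (?X j)" for j by (rule Ckc_cutoff_mult(1)[OF s C1])
    have int: "integrable lebesgue (\<lambda>x. u x * grad (?X j) x $ j)" "integrable lebesgue (\<lambda>x. G x $ j * ?X j x)" for j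
    proof -
      obtain K C where K: "compact K" "K \<subseteq> ball 0 1" "\<And>x. x \<notin> K \<Longrightarrow> ?X j x = 0" "\<And>x. x \<notin> K \<Longrightarrow> grad (?X j) x = 0"
        "C > 0" "\<And>x. norm (?X j x) \<le> C" "\<And>x i. norm (grad (?X j) x $ i) \<le> C"
        "continuous_on UNIV (?X j)" "\<And>i. continuous_on UNIV (\<lambda>x. grad (?X j) x $ i)" "\<And>x. has_grad (?X j) (grad (?X j) x) x"
        by (rule Ckc_1E[OF X[of j]]) (rule that; assumption)
      show "integrable lebesgue (\<lambda>x. u x * grad (?X j) x $ j)"
        by (rule L1_loc_integrable_mult[OF L(1) K(9,1,2)]) (simp add: K(4))
      show "integrable lebesgue (\<lambda>x. G x $ j * ?X j x)"
        by (rule L1_loc_integrable_mult[OF L(2) K(8,1,2)]) (rule K(3))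
    qed
    have "of_real (cutoff s x) * (u x * lap \<Phi> x + cdot (G x) (grad \<Phi> x)) + of_real (cutoff_slope s x) * (u x * (- 2 * g x))
      = (\<Sum>j\<in>UNIV. u x * grad (?X j) x $ j + G x $ j * ?X j x)" for x
      unfolding Ckc_cutoff_mult(2)[OF s C1] lap_def cdot_def g_def sum_2 by (simp add: algebra_simps)
    then have "(LINT x|lebesgue. of_real (cutoff s x) * (u x * lap \<Phi> x + cdot (G x) (grad \<Phi> x)) + of_real (cutoff_slope s x) * (u x * (- 2 * g x)))
      = (\<Sum>j\<in>UNIV. (LINT x|lebesgue. u x * grad (?X j) x $ j) + (LINT x|lebesgue. G x $ j * ?X j x))"
      using int by (simp add: Bochner_Integration.integral_sum)
    also have "\<dots> = 0"
      using has_weak_gradient_Ckc[OF w open_ball X] by simp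
    finally show "(LINT x|lebesgue. of_real (cutoff s x) * (u x * lap \<Phi> x + cdot (G x) (grad \<Phi> x)) + of_real (cutoff_slope s x) * (u x * (- 2 * g x))) = 0" .
  qed
qed

text \<open>The dual formula: here \<open>\<Phi>\<close> itself vanishes on the circle, so the
  boundary term of the divergence-free field disappears whatever its normal component is.\<close>

lemma green_vanishing:
  fixes G :: "real^2 \<Rightarrow> complex^2"
  assumes L: "L1_loc (ball 0 1) G"
    and G: "\<And>i. integrable lebesgue (\<lambda>x. indicator (ball 0 1) x *\<^sub>R G x $ i)"
    and div: "\<And>\<phi>. Ckc 1 (ball 0 1) \<phi> \<Longrightarrow> (LINT x|lebesgue. cdot (G x) (grad \<phi> x)) = 0"
    and \<Phi>: "Ck 1 \<Phi>" "\<And>x. norm x = 1 \<Longrightarrow> \<Phi> x = 0"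
  shows "(LINT x|lebesgue. indicator (ball 0 1) x *\<^sub>R cdot (G x) (grad \<Phi> x)) = 0"
proof -
  have C1: "Ck (Suc 0) \<Phi>" using \<Phi> by simp
  have cont: "continuous_on UNIV (\<lambda>x. grad \<Phi> x $ j)" "continuous_on UNIV \<Phi>" for j using C1 Ck_SucD[OF C1] by auto
  obtain C where C: "C \<ge> 0" "\<And>x. norm x < 1 \<Longrightarrow> norm (\<Phi> x) \<le> C * (1 - (norm x)\<^sup>2)"
    using vanishing_on_circle_bound[OF \<Phi>] by blast
  let ?m = "\<lambda>x. 2 * C * (norm (G x $ 1) + norm (G x $ 2))"
  show ?thesis
  proof (rule boundary_cutoff[where b = "\<lambda>x. cdot (G x) (\<chi> j. of_real (- 2 * x $ j) * \<Phi> x)" and m = ?m])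
    show "integrable lebesgue (\<lambda>x. indicator (ball 0 1) x *\<^sub>R cdot (G x) (grad \<Phi> x))"
      by (intro ball_integrable_cdot G cont)
    have "continuous_on UNIV (\<lambda>x. (\<chi> j. of_real (- 2 * x $ j) * \<Phi> x) $ i)" for i
      unfolding vec_lambda_beta by (intro continuous_on_mult continuous_on_of_real continuous_on_const continuous_on_component continuous_on_id cont)
    from borel_measurable_integrable[OF ball_integrable_cdot[OF G this]]
    show "(\<lambda>x. indicator (ball 0 1) x *\<^sub>R cdot (G x) (\<chi> j. of_real (- 2 * x $ j) * \<Phi> x)) \<in> borel_measurable lebesgue" .
    have "integrable lebesgue (\<lambda>x. 2 * C * (norm (indicator (ball 0 1) x *\<^sub>R G x $ 1) + norm (indicator (ball 0 1) x *\<^sub>R G x $ 2)))"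
      by (intro integrable_mult_right Bochner_Integration.integrable_add integrable_norm G)
    then show "integrable lebesgue (\<lambda>x. indicator (ball 0 1) x * ?m x)" by (simp add: algebra_simps)
    show "norm (cdot (G x) (\<chi> j. of_real (- 2 * x $ j) * \<Phi> x)) \<le> (1 - (norm x)\<^sup>2) * ?m x" if x: "norm x < 1" for x
    proof -
      have 1: "norm (G x $ j * (of_real (- 2 * x $ j) * \<Phi> x)) \<le> norm (G x $ j) * (2 * (C * (1 - (norm x)\<^sup>2)))" for j
      proof -
        have "\<bar>x $ j\<bar> \<le> 1" using component_le_norm_cart[of x j] x by simp
        then have "norm (of_real (- 2 * x $ j) * \<Phi> x) \<le> 2 * (C * (1 - (norm x)\<^sup>2))"
        proof -
          have "\<bar>x $ j\<bar> * norm (\<Phi> x) \<le> 1 * (C * (1 - (norm x)\<^sup>2))"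
            using \<open>\<bar>x $ j\<bar> \<le> 1\<close> C(2)[OF x] by (intro mult_mono) auto
          then show ?thesis by (simp add: norm_mult abs_mult)
        qed
        then show ?thesis unfolding norm_mult[of "G x $ j"] by (rule mult_left_mono) simp
      qed
      have "norm (cdot (G x) (\<chi> j. of_real (- 2 * x $ j) * \<Phi> x)) \<le> norm (G x $ 1 * (of_real (- 2 * x $ 1) * \<Phi> x)) + norm (G x $ 2 * (of_real (- 2 * x $ 2) * \<Phi> x))"
        unfolding cdot_def sum_2 vec_lambda_beta by (rule norm_triangle_ineq)
      also have "\<dots> \<le> norm (G x $ 1) * (2 * (C * (1 - (norm x)\<^sup>2))) + norm (G x $ 2) * (2 * (C * (1 - (norm x)\<^sup>2)))"
        by (intro add_mono 1)
      also have "\<dots> = (1 - (norm x)\<^sup>2) * ?m x" by (simp add: algebra_simps)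
      finally show ?thesis .
    qed
    fix s :: real assume s: "0 < s" "s < 1"
    have "of_real (cutoff s x) * cdot (G x) (grad \<Phi> x) + of_real (cutoff_slope s x) * cdot (G x) (\<chi> j. of_real (- 2 * x $ j) * \<Phi> x) =
       cdot (G x) (grad (\<lambda>x. of_real (cutoff s x) * \<Phi> x) x)" for x
      unfolding cdot_def Ckc_cutoff_mult(2)[OF s \<Phi>(1)] sum_2 by (simp add: algebra_simps)
    then show "(LINT x|lebesgue. of_real (cutoff s x) * cdot (G x) (grad \<Phi> x) + of_real (cutoff_slope s x) * cdot (G x) (\<chi> j. of_real (- 2 * x $ j) * \<Phi> x)) = 0"
      using div[OF Ckc_cutoff_mult(1)[OF s \<Phi>(1)]] by simp
  qed
qed

subsection \<open>Values and limits of representatives\<close>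

lemma weak_gradient_lap:
  fixes u :: "real^'n \<Rightarrow> complex"
  assumes w: "has_weak_gradient D u G" and D: "open D" and \<psi>: "test_function D \<psi>"
  shows "(LINT x|lebesgue. u x * lap \<psi> x) = - (LINT x|lebesgue. cdot (G x) (grad \<psi> x))"
proof -
  have L: "L1_loc D u" "\<And>i. L1_loc D (\<lambda>x. G x $ i)"
    using w L1_loc_component unfolding has_weak_gradient_def by blast+
  obtain K where K: "compact K" "K \<subseteq> D" "\<And>x. x \<notin> K \<Longrightarrow> \<psi> x = 0" using test_functionE[OF \<psi>] by metis
  have z: "grad \<psi> x = 0" if "x \<notin> K" for x
    using grad_zero_outside[of K \<psi> x] K that by (simp add: compact_imp_closed)
  have z2: "grad (\<lambda>y. grad \<psi> y $ i) x = 0" if "x \<notin> K" for x i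
    by (rule grad_zero_outside[of K _ x]) (use z K that in \<open>auto simp: compact_imp_closed\<close>)
  have i1: "integrable lebesgue (\<lambda>x. u x * grad (\<lambda>y. grad \<psi> y $ i) x $ i)" for i
    by (rule L1_loc_integrable_mult[OF L(1) test_function_continuous[OF test_function_grad[OF test_function_grad[OF \<psi>]]] K(1,2)]) (simp add: z2)
  have i2: "integrable lebesgue (\<lambda>x. G x $ i * grad \<psi> x $ i)" for i
    by (rule L1_loc_integrable_mult[OF L(2) test_function_continuous[OF test_function_grad[OF \<psi>]] K(1,2)]) (simp add: z)
  have "(LINT x|lebesgue. u x * lap \<psi> x) = (\<Sum>i\<in>UNIV. LINT x|lebesgue. u x * grad (\<lambda>y. grad \<psi> y $ i) x $ i)"
    unfolding lap_def sum_distrib_left by (rule Bochner_Integration.integral_sum) (rule i1)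
  also have "\<dots> = (\<Sum>i\<in>UNIV. - (LINT x|lebesgue. G x $ i * grad \<psi> x $ i))"
    using has_weak_gradient_Ckc[OF w D test_function_imp_Ckc[OF test_function_grad[OF \<psi>]]] by simp
  also have "\<dots> = - (LINT x|lebesgue. cdot (G x) (grad \<psi> x))"
    using integral_cdot[of lebesgue G "grad \<psi>"] i2 by (simp add: sum_negf)
  finally show ?thesis .
qed

lemma weakly_harmonicI:
  fixes u :: "real^'n \<Rightarrow> complex"
  assumes w: "has_weak_gradient D u G" and D: "open D"
    and div: "\<And>\<phi>. test_function D \<phi> \<Longrightarrow> (LINT x|lebesgue. cdot (G x) (grad \<phi> x)) = 0"
  shows "weakly_harmonic D u"
  using w weak_gradient_lap[OF w D] div unfolding weakly_harmonic_def has_weak_gradient_def by simp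

lemma weakly_harmonic_has_value:
  fixes V :: "real^2 \<Rightarrow> complex"
  assumes V: "weakly_harmonic D V" and D: "open D" "a \<in> D"
  shows "\<exists>c. has_value_at V a c"
proof -
  obtain R where R: "R > 0" "cball a R \<subseteq> D" using D open_contains_cball by blast
  obtain v where v: "test_function UNIV v" "AE x\<in>ball a (R / 2) in lebesgue. V x = v x"
    using weyl_representative[OF V R(2), of "R / 2"] R(1) by auto
  then show ?thesis unfolding has_value_at_def
    using R(1) test_function_continuous[OF v(1)] by (intro exI[of _ "v a"] exI[of _ "R / 2"] conjI exI[of _ v]) (auto intro: continuous_on_subset)
qed

lemma has_value_at_cong:
  assumes "has_value_at u a c" "r > 0" "AE x\<in>ball a r in lebesgue. u' x = p + q * u x"
  shows "has_value_at u' a (p + q * c)"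
proof -
  obtain s v where v: "s > 0" "continuous_on (ball a s) v" "AE x\<in>ball a s in lebesgue. u x = v x" "v a = c"
    using assms(1) unfolding has_value_at_def by blast
  have "AE x\<in>ball a (min r s) in lebesgue. u' x = p + q * v x"
    using assms(3) v(3) by eventually_elim auto
  moreover have "continuous_on (ball a (min r s)) (\<lambda>x. p + q * v x)"
    using v(2) by (intro continuous_intros) (auto elim: continuous_on_subset)
  ultimately show ?thesis unfolding has_value_at_def
    using assms(2) v by (intro exI[of _ "min r s"] conjI exI[of _ "\<lambda>x. p + q * v x"]) auto
qed

text \<open>Two continuous representatives agree on a relatively closed set of full measure near
  \<open>a\<close>, hence at \<open>a\<close>.\<close>

lemma has_value_at_unique:
  assumes "has_value_at u a c" "has_value_at u a d" shows "c = d"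
proof -
  obtain s v where v: "s > 0" "continuous_on (ball a s) v" "AE x\<in>ball a s in lebesgue. u x = v x" "v a = c"
    using assms(1) unfolding has_value_at_def by blast
  obtain r w where w: "r > 0" "continuous_on (ball a r) w" "AE x\<in>ball a r in lebesgue. u x = w x" "w a = d"
    using assms(2) unfolding has_value_at_def by blast
  define t where "t = min r s / 2"
  have t: "t > 0" "cball a t \<subseteq> ball a s" "cball a t \<subseteq> ball a r" using v(1) w(1) by (auto simp: t_def)
  have "continuous_on (cball a t) (\<lambda>x. norm (v x - w x))"
    using t by (intro continuous_intros) (auto intro: continuous_on_subset[OF v(2)] continuous_on_subset[OF w(2)])
  then have "closed (cball a t \<inter> (\<lambda>x. norm (v x - w x)) -` {0})"
    by (rule continuous_closed_preimage) auto
  moreover have "cball a t \<inter> (\<lambda>x. norm (v x - w x)) -` {0} = {x \<in> cball a t. norm (v x - w x) = 0}" by auto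
  ultimately have "closed {x \<in> cball a t. norm (v x - w x) = 0}" by (simp only:)
  \<comment> \<open>Adding the complement of the open ball gives a closed set containing almost
    every point of the space, as \<open>mem_closed_if_AE_lebesgue\<close> requires.\<close>
  then have cl: "closed ({x \<in> cball a t. norm (v x - w x) = 0} \<union> - ball a t)"
    by (intro closed_Un) (auto simp: closed_Compl)
  have "AE x in lebesgue. x \<in> {x \<in> cball a t. norm (v x - w x) = 0} \<union> - ball a t"
    using v(3) w(3)
  proof eventually_elim
    case (elim x)
    show ?case
    proof (cases "x \<in> ball a t")
      case True
      then have c: "x \<in> cball a t" by (rule subsetD[OF ball_subset_cball])
      then have "v x = w x" using elim t(2,3) by (metis subsetD)
      with c show ?thesis by simp
    qed simp
  qed
  from mem_closed_if_AE_lebesgue[OF cl this, of a] show ?thesis using t(1) v(4) w(4) by auto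
qed

lemma tends_to_0_combine:
  assumes "tends_to_0_at_infinity u" "tends_to_0_at_infinity h"
    "AE x in lebesgue. norm x > 1 \<longrightarrow> v x = u x + a * h x"
  shows "tends_to_0_at_infinity v"
  unfolding tends_to_0_at_infinity_def
proof (intro allI impI)
  fix e :: real assume e: "e > 0"
  obtain R1 where R1: "AE x in lebesgue. norm x > R1 \<longrightarrow> norm (u x) < e / 2"
    using assms(1) e unfolding tends_to_0_at_infinity_def by (meson half_gt_zero)
  have "e / (2 * (norm a + 1)) > 0" using e by (simp add: add_nonneg_pos)
  then obtain R2 where R2: "AE x in lebesgue. norm x > R2 \<longrightarrow> norm (h x) < e / (2 * (norm a + 1))"
    using assms(2) unfolding tends_to_0_at_infinity_def by meson
  have "AE x in lebesgue. norm x > max 1 (max R1 R2) \<longrightarrow> norm (v x) < e"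
    using R1 R2 assms(3)
  proof eventually_elim
    case (elim x)
    show ?case
    proof
      assume "max 1 (max R1 R2) < norm x"
      with elim have 1: "norm (u x) < e / 2" "norm (h x) < e / (2 * (norm a + 1))" and vx: "v x = u x + a * h x" by auto
      have "norm a * norm (h x) \<le> (norm a + 1) * (e / (2 * (norm a + 1)))"
        using 1(2) by (intro mult_mono) auto
      also have "\<dots> = e / 2"
      proof -
        have "t * (e / (2 * t)) = e / 2" if "t \<noteq> 0" for t :: real using that by simp
        moreover have "norm a + 1 \<noteq> 0" using norm_ge_zero[of a] by linarith
        ultimately show ?thesis by blast
      qed
      finally show "norm (v x) < e"
        using 1(1) norm_triangle_ineq[of "u x" "a * h x"] unfolding vx norm_mult by linarith
    qed
  qed
  then show "\<exists>R. AE x in lebesgue. norm x > R \<longrightarrow> norm (v x) < e" by blast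
qed

lemma tends_to_0_kelvin:
  assumes "has_value_at u 0 c"
  shows "tends_to_0_at_infinity (\<lambda>x. u (kelvin x) - c)"
  unfolding tends_to_0_at_infinity_def
proof (intro allI impI)
  fix e :: real assume e: "e > 0"
  obtain s v where v: "s > 0" "continuous_on (ball 0 s) v" "AE x\<in>ball 0 s in lebesgue. u x = v x" "v 0 = c"
    using assms(1) unfolding has_value_at_def by blast
  have "isCont v 0" using v(1,2) by (simp add: continuous_on_eq_continuous_at)
  then obtain d where d: "d > 0" "\<And>y. dist y 0 < d \<Longrightarrow> dist (v y) (v 0) < e"
    using e unfolding continuous_at_eps_delta by blast
  define R where "R = 1 / min s d"
  have R: "R > 0" using v(1) d(1) by (simp add: R_def)
  have "AE x in lebesgue. kelvin x \<in> ball 0 s \<longrightarrow> u (kelvin x) = v (kelvin x)"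
    by (rule AE_kelvin[OF v(3)])
  then have "AE x in lebesgue. norm x > R \<longrightarrow> norm (u (kelvin x) - c) < e"
  proof eventually_elim
    case (elim x)
    show ?case
    proof
      assume x: "norm x > R"
      then have "norm (kelvin x) < 1 / R" unfolding norm_kelvin using R by (intro divide_strict_left_mono mult_pos_pos) auto
      then have "norm (kelvin x) < s" "norm (kelvin x) < d" by (auto simp: R_def)
      then show "norm (u (kelvin x) - c) < e" using elim d(2)[of "kelvin x"] v(4) by (simp add: dist_norm)
    qed
  qed
  then show "\<exists>R. AE x in lebesgue. norm x > R \<longrightarrow> norm (u (kelvin x) - c) < e" by blast
qed

subsection \<open>Reflection in the unit circle\<close>

definition reflect_out :: "(real^2 \<Rightarrow> complex) \<Rightarrow> real^2 \<Rightarrow> complex" where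
  "reflect_out u x = (if norm x > 1 then u (kelvin x) else 0)"

lemma norm_kelvin_less_1: "norm (kelvin x) < 1 \<longleftrightarrow> x = 0 \<or> norm x > 1"
  by (cases "x = 0") (auto simp: norm_kelvin divide_less_eq)

lemma AE_norm_neq_1: "AE x in lebesgue. norm (x :: real^2) \<noteq> 1"
proof -
  have "negligible (sphere (0 :: real^2) 1)" by (rule negligible_sphere)
  then have "sphere (0 :: real^2) 1 \<in> null_sets lebesgue" by (simp add: negligible_iff_null_sets)
  then show ?thesis by (rule AE_I') auto
qed

text \<open>If \<open>kelvin y\<close> lies in a compact set of radius R, then |y| is at least 1/R,
  so the Jacobian weight is at most R^4 on the relevant part of the disk.\<close>

lemma L1_loc_reflect_out:
  assumes u: "integrable lebesgue (\<lambda>x. indicator (ball 0 1) x *\<^sub>R u x)"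
  shows "L1_loc UNIV (reflect_out u)"
  unfolding L1_loc_def set_integrable_def
proof (intro allI impI)
  fix K :: "(real^2) set" assume K: "compact K \<and> K \<subseteq> UNIV"
  obtain R where R: "R > 0" "\<And>x. x \<in> K \<Longrightarrow> norm x \<le> R"
    using compact_imp_bounded[of K] K unfolding bounded_pos by metis
  let ?h = "\<lambda>y. indicator K (kelvin y) *\<^sub>R (1 / of_real (norm y ^ 4)) :: complex"
  have [measurable]: "K \<in> sets borel" using K by (simp add: compact_imp_closed borel_closed)
  have "integrable lebesgue (\<lambda>y. (indicator (ball 0 1) y *\<^sub>R u y) * ?h y)"
  proof (rule integrable_mult_bounded[OF u])
    show "?h \<in> borel_measurable lebesgue" by (rule measurable_completion) measurable
    show "norm (?h y) \<le> R ^ 4" for y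
    proof (cases "kelvin y \<in> K \<and> y \<noteq> 0")
      case True
      then have "1 / norm y \<le> R" using R(2)[of "kelvin y"] by (simp add: norm_kelvin)
      then have "(1 / norm y) ^ 4 \<le> R ^ 4" by (intro power_mono) auto
      then show ?thesis using True by (simp add: norm_divide norm_power power_one_over)
    qed (use R in auto)
  qed
  from kelvin_substitution(1)[OF this]
  have "integrable lebesgue (\<lambda>x. (indicator (ball 0 1) (kelvin x) *\<^sub>R u (kelvin x)) * ?h (kelvin x) / of_real (norm x ^ 4))" .
  moreover have "(indicator (ball 0 1) (kelvin x) *\<^sub>R u (kelvin x)) * ?h (kelvin x) / of_real (norm x ^ 4) = indicator K x *\<^sub>R reflect_out u x" for x
  proof (cases "x = 0")
    case False
    then have "norm (kelvin x) ^ 4 * norm x ^ 4 = 1" by (simp add: norm_kelvin power_mult_distrib[symmetric])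
    then have e: "1 / complex_of_real (norm (kelvin x) ^ 4) / of_real (norm x ^ 4) = 1"
      by (simp add: of_real_mult[symmetric] del: of_real_mult of_real_power)
    show ?thesis
    proof (cases "norm x > 1 \<and> x \<in> K")
      case True
      then have "norm (kelvin x) < 1" by (simp add: norm_kelvin_less_1)
      then show ?thesis using True e by (simp add: reflect_out_def)
    next
      case F: False
      then show ?thesis using False by (auto simp: reflect_out_def indicator_def norm_kelvin_less_1)
    qed
  qed (simp add: reflect_out_def)
  ultimately show "integrable lebesgue (\<lambda>x. indicator K x *\<^sub>R reflect_out u x)" by (simp only:)
qed

text \<open>The factor |x|^-4 in the Laplacian of the pull-back is the Jacobian of the substitution,
  so the pairing moves from the exterior to the disk without a weight.\<close>

lemma reflect_out_lap:
  assumes u: "integrable lebesgue (\<lambda>x. indicator (ball 0 1) x *\<^sub>R u x)" and \<phi>: "test_function D \<phi>"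
  shows "integrable lebesgue (\<lambda>x. reflect_out u x * lap \<phi> x)"
    and "(LINT x|lebesgue. reflect_out u x * lap \<phi> x) = (LINT x|lebesgue. indicator (ball 0 1) x *\<^sub>R (u x * lap (kpull \<phi>) x))"
proof -
  let ?f = "\<lambda>x. indicator (ball 0 1) x *\<^sub>R (u x * lap (kpull \<phi>) x)"
  have C2: "Ck (Suc (Suc 0)) (kpull \<phi>)" using Ck_2_kpull[OF \<phi>] by (simp add: numeral_2_eq_2)
  have clap: "continuous_on UNIV (lap (kpull \<phi>))"
    unfolding lap_def[abs_def] using C2 by (intro continuous_on_sum) simp
  have f: "integrable lebesgue ?f" by (rule ball_integrable_mult[OF u clap])
  have e: "?f (kelvin x) / of_real (norm x ^ 4) = reflect_out u x * lap \<phi> x" for x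
  proof (cases "norm x > 1")
    case True
    then have x: "x \<noteq> 0" "kelvin x \<noteq> 0" by auto
    have "norm (kelvin x) ^ 4 * norm x ^ 4 = 1" using x(1) by (simp add: norm_kelvin power_mult_distrib[symmetric])
    then have n: "complex_of_real (norm (kelvin x) ^ 4) * of_real (norm x ^ 4) = 1"
      by (simp only: of_real_mult[symmetric] of_real_1)
    have "norm (kelvin x) < 1" using True by (simp add: norm_kelvin_less_1)
    then show ?thesis using True n unfolding reflect_out_def lap_kpull[OF x(2) \<phi>] by (simp add: divide_divide_eq_left del: of_real_power)
  next
    case False
    then show ?thesis by (cases "x = 0") (auto simp: reflect_out_def indicator_def norm_kelvin_less_1)
  qed
  show "integrable lebesgue (\<lambda>x. reflect_out u x * lap \<phi> x)"
    "(LINT x|lebesgue. reflect_out u x * lap \<phi> x) = (LINT x|lebesgue. ?f x)"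
    using kelvin_substitution[OF f] unfolding e by blast+
qed

definition reflect :: "(real^2 \<Rightarrow> complex) \<Rightarrow> real^2 \<Rightarrow> complex" where
  "reflect u x = indicator (ball 0 1) x *\<^sub>R u x + reflect_out u x"

text \<open>The relation u = V + (1 - kappa)(reflection of u - c) solved for V. For kappa = i delta
  / 2, which makes the coefficient in the disk -1 + 2 kappa, the flux of V is continuous across the
  circle. In the disk V is an affine function of u.\<close>

definition newton :: "complex \<Rightarrow> complex \<Rightarrow> (real^2 \<Rightarrow> complex) \<Rightarrow> real^2 \<Rightarrow> complex" where
  "newton \<kappa> c u x = (1 - \<kappa>) * c + (u x - (1 - \<kappa>) * reflect u x)"

lemma test_function_integrable:
  fixes \<psi> :: "real^'n \<Rightarrow> complex"
  shows "test_function D \<psi> \<Longrightarrow> integrable lebesgue \<psi>"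
  by (metis compact_support_integrable test_functionE test_function_continuous)

lemma test_function_lap_integral_0:
  fixes \<phi> :: "real^'n \<Rightarrow> complex"
  assumes \<phi>: "test_function UNIV \<phi>"
  shows "(LINT x|lebesgue. lap \<phi> x) = 0"
proof -
  have "(LINT x|lebesgue. lap \<phi> x) = (\<Sum>i\<in>UNIV. LINT x|lebesgue. grad (\<lambda>y. grad \<phi> y $ i) x $ i)"
    unfolding lap_def by (rule Bochner_Integration.integral_sum) (rule test_function_integrable[OF test_function_grad[OF test_function_grad[OF \<phi>]]])
  also have "\<dots> = 0" using integral_grad_eq_0[OF test_function_imp_Ckc[OF test_function_grad[OF \<phi>]]] by simp
  finally show ?thesis .
qed

lemma L1_loc_add_const:
  fixes u :: "real^'n \<Rightarrow> complex"
  assumes "L1_loc D u" shows "L1_loc D (\<lambda>x. c + u x)"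
proof -
  have "set_integrable lebesgue K (\<lambda>x. c + u x)" if "set_integrable lebesgue K u" "compact K" for K
  proof -
    have "integrable lebesgue (\<lambda>x. indicator K x *\<^sub>R c)"
      using lmeasurable_compact[OF that(2)] by (intro integrable_scaleR_left) (auto simp: integrable_real_indicator fmeasurable_def)
    from Bochner_Integration.integrable_add[OF this that(1)[unfolded set_integrable_def]]
    show ?thesis unfolding set_integrable_def by (simp add: scaleR_add_right)
  qed
  then show ?thesis using assms unfolding L1_loc_def by blast
qed

lemma L1_loc_ball_indicator:
  fixes u :: "real^'n \<Rightarrow> complex"
  assumes "integrable lebesgue (\<lambda>x. indicator (ball 0 1) x *\<^sub>R u x)"
  shows "L1_loc UNIV (\<lambda>x. indicator (ball 0 1) x *\<^sub>R u x)"
  unfolding L1_loc_def set_integrable_def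
proof (intro allI impI)
  fix K :: "(real^'n) set" assume "compact K \<and> K \<subseteq> UNIV"
  then show "integrable lebesgue (\<lambda>x. indicator K x *\<^sub>R (indicator (ball 0 1) x *\<^sub>R u x))"
    by (intro integrable_mult_indicator assms) (auto simp: compact_imp_closed)
qed

lemma L1_loc_newton:
  assumes "L1_loc UNIV u" and u: "integrable lebesgue (\<lambda>x. indicator (ball 0 1) x *\<^sub>R u x)"
  shows "L1_loc UNIV (newton \<kappa> c u)"
proof -
  have "L1_loc UNIV (\<lambda>x. 1 * (indicator (ball 0 1) x *\<^sub>R u x) + 1 * reflect_out u x)"
    by (rule L1_loc_lincomb[OF L1_loc_ball_indicator[OF u] L1_loc_reflect_out[OF u]])
  then have "L1_loc UNIV (reflect u)" unfolding reflect_def[abs_def] by simp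
  from L1_loc_add_const[OF L1_loc_lincomb[OF assms(1) this, of 1 "- (1 - \<kappa>)"], of "(1 - \<kappa>) * c"]
  show ?thesis unfolding newton_def[abs_def] by (simp add: algebra_simps)
qed

text \<open>Inside the disk the coefficient is a constant with real part -1, so it can be divided
  out, and the source vanishes there.\<close>

lemma transmission_div_free:
  assumes eq: "\<And>\<phi>. Ckc 1 UNIV \<phi> \<Longrightarrow> (LINT x|lebesgue. eps \<delta> x * cdot (G x) (grad \<phi> x)) = - (LINT x|lebesgue. f x * \<phi> x)"
    and f: "AE x in lebesgue. norm x < 1 \<longrightarrow> f x = 0" and \<psi>: "Ckc 1 (ball 0 1) \<psi>"
  shows "(LINT x|lebesgue. cdot (G x) (grad \<psi> x)) = 0"
proof -
  have e0: "-1 + \<i> * of_real \<delta> \<noteq> 0" by (simp add: complex_eq_iff)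
  obtain K where K: "compact K" "K \<subseteq> ball 0 1" "\<And>x. x \<notin> K \<Longrightarrow> \<psi> x = 0"
    using \<psi> unfolding Ckc_def by blast
  have z: "grad \<psi> x = 0" if "x \<notin> ball 0 1" for x
  proof -
    have "x \<notin> K" using K(2) that by blast
    then show ?thesis using grad_zero_outside[of K \<psi> x] K by (simp add: compact_imp_closed)
  qed
  have e: "eps \<delta> x * cdot (G x) (grad \<psi> x) = (-1 + \<i> * of_real \<delta>) * cdot (G x) (grad \<psi> x)" for x
    using z[of x] by (auto simp: eps_def cdot_def)
  have "(-1 + \<i> * of_real \<delta>) * (LINT x|lebesgue. cdot (G x) (grad \<psi> x)) = (LINT x|lebesgue. eps \<delta> x * cdot (G x) (grad \<psi> x))"
    unfolding e by (rule integral_mult_right_zero[symmetric])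
  also have "\<dots> = - (LINT x|lebesgue. f x * \<psi> x)" by (rule eq[OF Ckc_subset[OF \<psi>]]) simp
  also have "(LINT x|lebesgue. f x * \<psi> x) = (LINT x|lebesgue. (0::complex) * indicator UNIV (x::real^2))"
    by (rule LINT_cong_AE) (use f in eventually_elim, use K in fastforce)
  finally show ?thesis using e0 by simp
qed

text \<open>The exterior reflection is moved into the disk as a pairing with the pulled back test
  function. The even and odd Green formulas then express both disk integrals through the gradient,
  and the factor 1 - 2(1 - kappa) that appears there is the coefficient -1 + i delta.\<close>

lemma newton_distribution:
  assumes w: "has_weak_gradient UNIV u G"
    and G: "\<And>i. integrable lebesgue (\<lambda>x. indicator (ball 0 1) x *\<^sub>R G x $ i)"
    and u: "integrable lebesgue (\<lambda>x. indicator (ball 0 1) x *\<^sub>R u x)"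
    and eq: "\<And>\<phi>. Ckc 1 UNIV \<phi> \<Longrightarrow> (LINT x|lebesgue. eps \<delta> x * cdot (G x) (grad \<phi> x)) = - (LINT x|lebesgue. f x * \<phi> x)"
    and f: "AE x in lebesgue. norm x < 1 \<longrightarrow> f x = 0"
    and \<delta>: "\<delta> > 0" and \<kappa>: "\<kappa> = \<i> * of_real \<delta> / 2" and \<phi>: "test_function UNIV \<phi>"
  shows "(LINT x|lebesgue. newton \<kappa> c u x * lap \<phi> x) = (LINT x|lebesgue. f x * \<phi> x)"
proof -
  have L: "L1_loc UNIV u" "\<And>i. L1_loc UNIV (\<lambda>x. G x $ i)" "L1_loc UNIV G"
    using w L1_loc_component unfolding has_weak_gradient_def by blast+
  have wB: "has_weak_gradient (ball 0 1) u G"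
    by (rule has_weak_gradient_subset[OF w]) auto
  have LB: "L1_loc (ball 0 1) G" using wB unfolding has_weak_gradient_def by blast
  note div = transmission_div_free[OF eq f]
  let ?\<psi> = "kpull \<phi>"
  have C2\<phi>: "Ck 2 \<phi>" using \<phi> unfolding test_function_def by blast
  have C2: "Ck 2 (\<lambda>x. \<phi> x + ?\<psi> x)" by (intro Ck_add C2\<phi> Ck_2_kpull[OF \<phi>])
  have C1k: "Ck 1 ?\<psi>" "Ck 1 \<phi>" using Ck_SucD[of 1] Ck_2_kpull[OF \<phi>] C2\<phi> by (auto simp: numeral_2_eq_2)
  have C1: "Ck 1 (\<lambda>x. \<phi> x + (-1) * ?\<psi> x)" by (intro Ck_add Ck_mult Ck_const C1k)
  have hg: "has_grad \<phi> (grad \<phi> x) x" "has_grad ?\<psi> (grad ?\<psi> x) x" for x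
    using C1k Ck_has_grad unfolding One_nat_def by blast+
  have g_add: "grad (\<lambda>x. \<phi> x + ?\<psi> x) x = grad \<phi> x + grad ?\<psi> x" for x
    by (rule grad_eqI[OF has_grad_add[OF hg]])
  have g_diff: "grad (\<lambda>x. \<phi> x + (-1) * ?\<psi> x) x = grad \<phi> x - grad ?\<psi> x" for x
  proof -
    have "has_grad (\<lambda>x. \<phi> x + (-1) * ?\<psi> x) (grad \<phi> x + ((-1) *s grad ?\<psi> x + ?\<psi> x *s 0)) x"
      by (intro has_grad_add has_grad_mult has_grad_const hg)
    from grad_eqI[OF this] show ?thesis by (simp add: vec_eq_iff)
  qed
  have lap_add: "lap (\<lambda>x. \<phi> x + ?\<psi> x) x = lap \<phi> x + lap ?\<psi> x" for x
  proof -
    have h2: "has_grad (\<lambda>y. grad \<phi> y $ i) (grad (\<lambda>y. grad \<phi> y $ i) x) x" "has_grad (\<lambda>y. grad ?\<psi> y $ i) (grad (\<lambda>y. grad ?\<psi> y $ i) x) x" for i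
      using C2\<phi> Ck_2_kpull[OF \<phi>] Ck_has_grad[of 0] by (simp_all add: numeral_2_eq_2 differentiable_imp_has_grad)
    show ?thesis unfolding lap_def g_add vector_add_component grad_eqI[OF has_grad_add[OF h2]] by (simp add: sum.distrib)
  qed
  have cont: "continuous_on UNIV (\<lambda>x. grad \<phi> x $ i)" "continuous_on UNIV (\<lambda>x. grad ?\<psi> x $ i)" for i
    using C1k by (simp_all add: One_nat_def)
  have clap: "continuous_on UNIV (lap \<phi>)" "continuous_on UNIV (lap ?\<psi>)"
    using C2\<phi> Ck_2_kpull[OF \<phi>] unfolding lap_def[abs_def] by (auto simp: numeral_2_eq_2 intro!: continuous_on_sum)
  have iG: "integrable lebesgue (\<lambda>x. indicator (ball 0 1) x *\<^sub>R cdot (G x) (grad \<phi> x))"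
    "integrable lebesgue (\<lambda>x. indicator (ball 0 1) x *\<^sub>R cdot (G x) (grad ?\<psi> x))"
    by (intro ball_integrable_cdot G cont)+
  have iu: "integrable lebesgue (\<lambda>x. indicator (ball 0 1) x *\<^sub>R (u x * lap \<phi> x))"
    "integrable lebesgue (\<lambda>x. indicator (ball 0 1) x *\<^sub>R (u x * lap ?\<psi> x))"
    by (intro ball_integrable_mult[OF u] clap)+
  let ?I = "\<lambda>h. LINT x|lebesgue. indicator (ball 0 1) x *\<^sub>R h x"
  have rad: "(\<Sum>j\<in>UNIV. of_real (x $ j) * grad (\<lambda>x. \<phi> x + ?\<psi> x) x $ j) = 0" if "norm x = 1" for x
    using radial_kpull[OF that \<phi>] unfolding g_add by (simp add: distrib_left sum.distrib)
  \<comment> \<open>The even combination has zero radial derivative on the circle.\<close>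
  have T: "?I (\<lambda>x. u x * lap \<phi> x) + ?I (\<lambda>x. u x * lap ?\<psi> x) + ?I (\<lambda>x. cdot (G x) (grad \<phi> x)) + ?I (\<lambda>x. cdot (G x) (grad ?\<psi> x)) = 0"
  proof -
    have "u x * lap (\<lambda>x. \<phi> x + ?\<psi> x) x + cdot (G x) (grad (\<lambda>x. \<phi> x + ?\<psi> x) x)
      = u x * lap \<phi> x + u x * lap ?\<psi> x + cdot (G x) (grad \<phi> x) + cdot (G x) (grad ?\<psi> x)" for x
      unfolding lap_add g_add cdot_def by (simp add: algebra_simps sum.distrib)
    with green_tangential[OF wB u G C2 rad] iG iu show ?thesis by (simp add: scaleR_add_right)
  qed
  \<comment> \<open>The odd combination vanishes on the circle, which \<open>kelvin\<close> fixes
    pointwise.\<close>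
  have N: "?I (\<lambda>x. cdot (G x) (grad \<phi> x)) - ?I (\<lambda>x. cdot (G x) (grad ?\<psi> x)) = 0"
  proof -
    have v: "\<phi> x + (-1) * ?\<psi> x = 0" if "norm x = 1" for x
    proof -
      have "x \<noteq> 0" using that by auto
      then show ?thesis using kelvin_unit[OF that] by (simp add: kpull_def)
    qed
    have "cdot (G x) (grad (\<lambda>x. \<phi> x + (-1) * ?\<psi> x) x) = cdot (G x) (grad \<phi> x) - cdot (G x) (grad ?\<psi> x)" for x
      unfolding g_diff cdot_def by (simp add: algebra_simps sum_subtractf)
    with green_vanishing[OF LB G div C1 v] iG show ?thesis by (simp add: scaleR_diff_right)
  qed
  obtain K where K: "compact K" "\<And>x. x \<notin> K \<Longrightarrow> \<phi> x = 0" using test_functionE[OF \<phi>] by metis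
  have z: "grad \<phi> x = 0" if "x \<notin> K" for x
    using grad_zero_outside[of K \<phi> x] K that by (simp add: compact_imp_closed)
  have ic: "integrable lebesgue (\<lambda>x. cdot (G x) (grad \<phi> x))"
    by (intro cdot_integrable L1_loc_integrable_mult[OF L(2) cont(1) K(1) subset_UNIV]) (simp add: z)
  have il: "integrable lebesgue (\<lambda>x. u x * lap \<phi> x)"
  proof -
    obtain K' where K': "compact K'" "\<And>x. x \<notin> K' \<Longrightarrow> lap \<phi> x = 0" using test_functionE[OF test_function_lap[OF \<phi>]] by metis
    show ?thesis by (rule L1_loc_integrable_mult[OF L(1) clap(1) K'(1) subset_UNIV K'(2)])
  qed
  have lapu: "(LINT x|lebesgue. u x * lap \<phi> x) = - (LINT x|lebesgue. cdot (G x) (grad \<phi> x))"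
    by (rule weak_gradient_lap[OF w open_UNIV \<phi>])
  have "newton \<kappa> c u x * lap \<phi> x = (1 - \<kappa>) * c * lap \<phi> x + (u x * lap \<phi> x - (1 - \<kappa>) * (indicator (ball 0 1) x *\<^sub>R (u x * lap \<phi> x) + reflect_out u x * lap \<phi> x))" for x
    unfolding newton_def reflect_def by (simp add: algebra_simps)
  then have "(LINT x|lebesgue. newton \<kappa> c u x * lap \<phi> x) = (1 - \<kappa>) * c * (LINT x|lebesgue. lap \<phi> x) +
     ((LINT x|lebesgue. u x * lap \<phi> x) - (1 - \<kappa>) * (?I (\<lambda>x. u x * lap \<phi> x) + (LINT x|lebesgue. reflect_out u x * lap \<phi> x)))"
    using test_function_integrable[OF test_function_lap[OF \<phi>]] il iu(1) reflect_out_lap(1)[OF u \<phi>] by simp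
  also have "\<dots> = - (LINT x|lebesgue. cdot (G x) (grad \<phi> x)) - (1 - \<kappa>) * (?I (\<lambda>x. u x * lap \<phi> x) + ?I (\<lambda>x. u x * lap ?\<psi> x))"
    unfolding test_function_lap_integral_0[OF \<phi>] lapu reflect_out_lap(2)[OF u \<phi>] by simp
  also have "?I (\<lambda>x. u x * lap \<phi> x) + ?I (\<lambda>x. u x * lap ?\<psi> x) = - 2 * ?I (\<lambda>x. cdot (G x) (grad \<phi> x))"
  proof -
    have "a + b = - 2 * c" if "a + b + c + d = 0" "c - d = 0" for a b c d :: complex
      using that by (simp add: eq_neg_iff_add_eq_0 algebra_simps)
    from this[OF T N] show ?thesis .
  qed
  also have "- (LINT x|lebesgue. cdot (G x) (grad \<phi> x)) - (1 - \<kappa>) * (- 2 * ?I (\<lambda>x. cdot (G x) (grad \<phi> x)))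
    = - (LINT x|lebesgue. cdot (G x) (grad \<phi> x) - 2 * (1 - \<kappa>) * (indicator (ball 0 1) x *\<^sub>R cdot (G x) (grad \<phi> x)))"
    unfolding Bochner_Integration.integral_diff[OF ic integrable_mult_right[OF iG(1)]] integral_mult_right_zero
    by (simp add: algebra_simps)
  also have "\<dots> = - (LINT x|lebesgue. eps \<delta> x * cdot (G x) (grad \<phi> x))"
  proof -
    have "cdot (G x) (grad \<phi> x) - 2 * (1 - \<kappa>) * (indicator (ball 0 1) x *\<^sub>R cdot (G x) (grad \<phi> x)) = eps \<delta> x * cdot (G x) (grad \<phi> x)" for x
      unfolding \<kappa> eps_def by (simp add: indicator_def algebra_simps)
    then show ?thesis by simp
  qed
  also have "\<dots> = (LINT x|lebesgue. f x * \<phi> x)" using eq[OF test_function_imp_Ckc[OF \<phi>]] by simp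
  finally show ?thesis .
qed

lemma distribution_unique:
  fixes V W :: "real^2 \<Rightarrow> complex"
  assumes "L1_loc UNIV V" "L1_loc UNIV W" "tends_to_0_at_infinity V" "tends_to_0_at_infinity W"
    and "\<And>\<phi>. test_function UNIV \<phi> \<Longrightarrow> (LINT x|lebesgue. V x * lap \<phi> x) = (LINT x|lebesgue. W x * lap \<phi> x)"
  shows "AE x in lebesgue. V x = W x"
proof -
  have "AE x in lebesgue. 1 * V x + (-1) * W x = 0"
  proof (rule liouville)
    show "tends_to_0_at_infinity (\<lambda>x. 1 * V x + (-1) * W x)"
      by (rule tends_to_0_combine[OF assms(3,4), of _ "-1"]) simp
    show "weakly_harmonic UNIV (\<lambda>x. 1 * V x + (-1) * W x)"
      unfolding weakly_harmonic_def
    proof (intro conjI allI impI L1_loc_lincomb assms(1,2))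
      fix \<phi> :: "real^2 \<Rightarrow> complex" assume \<phi>: "test_function UNIV \<phi>"
      obtain K where K: "compact K" "\<And>x. x \<notin> K \<Longrightarrow> lap \<phi> x = 0" using test_functionE[OF test_function_lap[OF \<phi>]] by metis
      have "integrable lebesgue (\<lambda>x. V x * lap \<phi> x)" "integrable lebesgue (\<lambda>x. W x * lap \<phi> x)"
        using L1_loc_integrable_mult[OF assms(1) test_function_continuous[OF test_function_lap[OF \<phi>]] K(1) subset_UNIV K(2)]
          L1_loc_integrable_mult[OF assms(2) test_function_continuous[OF test_function_lap[OF \<phi>]] K(1) subset_UNIV K(2)] by blast+
      then show "(LINT x|lebesgue. (1 * V x + (-1) * W x) * lap \<phi> x) = 0"
        using assms(5)[OF \<phi>] by (simp add: left_diff_distrib)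
    qed
  qed
  then show ?thesis by eventually_elim simp
qed

lemma AE_outside_ess_supp:
  fixes f :: "real^'n \<Rightarrow> complex"
  shows "AE x in lebesgue. x \<notin> ess_supp f \<longrightarrow> f x = 0"
proof -
  have "AE x in lebesgue. x \<in> - ess_supp f \<longrightarrow> f x = 0"
    by (rule AE_local) (auto simp: ess_supp_def)
  then show ?thesis by simp
qed

lemma borel_measurable_eps: "eps \<delta> \<in> borel_measurable lebesgue"
proof -
  have "(\<lambda>x. if norm x < 1 then -1 + \<i> * of_real \<delta> else 1) \<in> borel_measurable (borel :: (real^2) measure)" by measurable
  then show ?thesis unfolding eps_def[abs_def] by (simp add: measurable_completion)
qed

lemma L1_loc_mult_bounded:
  fixes u h :: "real^'n \<Rightarrow> complex"
  assumes "L1_loc D u" "h \<in> borel_measurable lebesgue" "\<And>x. norm (h x) \<le> C"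
  shows "L1_loc D (\<lambda>x. u x * h x)"
  unfolding L1_loc_def set_integrable_def
proof (intro allI impI)
  fix K assume K: "compact K \<and> K \<subseteq> D"
  then have "integrable lebesgue (\<lambda>x. indicator K x *\<^sub>R u x)"
    using assms(1) unfolding L1_loc_def set_integrable_def by blast
  from integrable_mult_bounded[OF this assms(2,3)]
  show "integrable lebesgue (\<lambda>x. indicator K x *\<^sub>R (u x * h x))" by simp
qed

lemma solution_facts:
  assumes sol: "is_solution \<delta> f u" and f: "L1_loc UNIV f" and \<delta>: "0 < \<delta>" "\<delta> < 1"
  shows "has_weak_gradient UNIV u (wgrad UNIV u)" "L2 UNIV (wgrad UNIV u)" "L1_loc UNIV u" "tends_to_0_at_infinity u"
    "\<And>K. compact K \<Longrightarrow> L2 K u"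
    "Ckc 1 UNIV \<phi> \<Longrightarrow> (LINT x|lebesgue. eps \<delta> x * cdot (wgrad UNIV u x) (grad \<phi> x)) = - (LINT x|lebesgue. f x * \<phi> x)"
proof -
  let ?G = "wgrad UNIV u"
  have W: "W1 u" "tends_to_0_at_infinity u" "weak_div UNIV (\<lambda>x. eps \<delta> x *s ?G x) f"
    using sol unfolding is_solution_def by blast+
  show "tends_to_0_at_infinity u" by (rule W(2))
  show G: "has_weak_gradient UNIV u ?G" using W(1) wgrad_works unfolding W1_def weakly_differentiable_def by blast
  show "L2 UNIV ?G" using W(1) unfolding W1_def by blast
  show "L2 K u" if "compact K" for K using W(1) that unfolding W1_def L2_loc_def by blast
  show "L1_loc UNIV u" using G unfolding has_weak_gradient_def by blast
  have LG: "L1_loc UNIV (\<lambda>x. ?G x $ i)" for i using G L1_loc_component unfolding has_weak_gradient_def by blast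
  have b: "norm (eps \<delta> x) \<le> 2" for x
    using \<delta> norm_triangle_ineq[of "-1" "\<i> * of_real \<delta>"] by (auto simp: eps_def norm_mult)
  have "L1_loc UNIV (\<lambda>x. ?G x $ i * eps \<delta> x)" for i by (rule L1_loc_mult_bounded[OF LG borel_measurable_eps b])
  then have L: "L1_loc UNIV (\<lambda>x. eps \<delta> x *s ?G x)" by (intro L1_loc_componentwise) (simp add: mult.commute)
  have c: "cdot (eps \<delta> x *s ?G x) (grad \<phi> x) = eps \<delta> x * cdot (?G x) (grad \<phi> x)" for x \<phi>
    by (simp add: cdot_def sum_distrib_left mult.assoc)
  show "(LINT x|lebesgue. eps \<delta> x * cdot (?G x) (grad \<phi> x)) = - (LINT x|lebesgue. f x * \<phi> x)" if "Ckc 1 UNIV \<phi>"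
    using weak_div_Ckc[OF W(3) L f open_UNIV that] unfolding c .
qed

lemma L2_ball_integrable:
  fixes u :: "real^'n \<Rightarrow> 'b::euclidean_space"
  assumes "L2 (ball 0 1) u" shows "integrable lebesgue (\<lambda>x. indicator (ball 0 1) x *\<^sub>R u x)"
  using assms by (rule L2_imp_integrable) (rule lmeasurable_ball)

lemma newton_in_ball: "norm x < 1 \<Longrightarrow> newton \<kappa> c u x = (1 - \<kappa>) * c + \<kappa> * u x"
  by (simp add: newton_def reflect_def reflect_out_def algebra_simps)

lemma reflect_simps:
  "norm x < 1 \<Longrightarrow> reflect u x = u x" "norm x > 1 \<Longrightarrow> reflect u x = u (kelvin x)"
  by (simp_all add: reflect_def reflect_out_def)

text \<open>The solution is harmonic in the disk, so it has a value \<open>c\<close> at 0, and (1 -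
  kappa) c + kappa c = c is the value of \<open>newton\<close> there. With this constant the
  reflected part tends to 0 at infinity, because continuity at 0 becomes decay under
  \<open>kelvin\<close>.\<close>

lemma solution_newton:
  assumes sol: "is_solution \<delta> f u" and f: "L1_loc UNIV f" "AE x in lebesgue. norm x < 1 \<longrightarrow> f x = 0"
    and \<delta>: "0 < \<delta>" "\<delta> < 1" and \<kappa>: "\<kappa> = \<i> * of_real \<delta> / 2"
  obtains c where "L1_loc UNIV (newton \<kappa> c u)" "tends_to_0_at_infinity (newton \<kappa> c u)" "has_value_at (newton \<kappa> c u) 0 c"
    "\<And>\<phi>. test_function UNIV \<phi> \<Longrightarrow> (LINT x|lebesgue. newton \<kappa> c u x * lap \<phi> x) = (LINT x|lebesgue. f x * \<phi> x)"
proof -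
  note S = solution_facts[OF sol f(1) \<delta>]
  have G: "integrable lebesgue (\<lambda>x. indicator (ball 0 1) x *\<^sub>R wgrad UNIV u x $ i)" for i
    using L2_ball_integrable[OF L2_subset[OF L2_component[OF S(2)]], of i] by simp
  have u: "integrable lebesgue (\<lambda>x. indicator (ball 0 1) x *\<^sub>R u x)"
    by (rule L2_ball_integrable[OF L2_subset[OF S(5)[of "cball 0 1"]]]) auto
  have "weakly_harmonic (ball 0 1) u"
    by (rule weakly_harmonicI[OF has_weak_gradient_subset[OF S(1)] open_ball transmission_div_free[OF S(6) f(2)]])
      (auto intro: test_function_imp_Ckc)
  then obtain c where c: "has_value_at u 0 c" using weakly_harmonic_has_value[of "ball 0 1" u 0] by auto
  show ?thesis
  proof (rule that[of c])
    show "L1_loc UNIV (newton \<kappa> c u)" by (rule L1_loc_newton[OF S(3) u])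
    show "tends_to_0_at_infinity (newton \<kappa> c u)"
      by (rule tends_to_0_combine[OF S(4) tends_to_0_kelvin[OF c], of _ "- (1 - \<kappa>)"])
        (auto simp: newton_def reflect_simps algebra_simps)
    show "has_value_at (newton \<kappa> c u) 0 c"
      using has_value_at_cong[OF c, of 1 "newton \<kappa> c u" "(1 - \<kappa>) * c" \<kappa>] by (simp add: newton_in_ball algebra_simps)
    show "(LINT x|lebesgue. newton \<kappa> c u x * lap \<phi> x) = (LINT x|lebesgue. f x * \<phi> x)" if "test_function UNIV \<phi>" for \<phi>
      by (rule newton_distribution[OF S(1) G u S(6) f(2) \<delta>(1) \<kappa> that])
  qed
qed

lemma AE_reflect_cong:
  assumes "AE x in lebesgue. u x = v x" shows "AE x in lebesgue. reflect u x = reflect v x"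
  using assms AE_kelvin[OF assms] by eventually_elim (auto simp: reflect_def reflect_out_def)

text \<open>The function built from delta = 1/2 has the same Laplacian and decay as the one built
  from any other delta, so Liouville's theorem identifies them. As V - c equals kappa (u - c) in the
  disk, the relation can be solved for u.\<close>

lemma solutions_representation:
  assumes f: "L1_loc UNIV f" "AE x in lebesgue. norm x < 1 \<longrightarrow> f x = 0"
    and sol: "\<And>\<delta>. 0 < \<delta> \<Longrightarrow> \<delta> < 1 \<Longrightarrow> is_solution \<delta> f (u \<delta>)"
  obtains V c where "L1_loc UNIV V" "tends_to_0_at_infinity V" "has_value_at V 0 c"
    "\<And>\<phi>. test_function UNIV \<phi> \<Longrightarrow> (LINT x|lebesgue. V x * lap \<phi> x) = (LINT x|lebesgue. f x * \<phi> x)"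
    "\<And>\<delta>. 0 < \<delta> \<Longrightarrow> \<delta> < 1 \<Longrightarrow> AE x in lebesgue. u \<delta> x = V x + (2 / (\<i> * of_real \<delta>) - 1) * (reflect V x - c)"
proof -
  have "is_solution (1/2) f (u (1/2))" by (rule sol) auto
  then obtain c where V: "L1_loc UNIV (newton (\<i> * of_real (1/2) / 2) c (u (1/2)))"
    "tends_to_0_at_infinity (newton (\<i> * of_real (1/2) / 2) c (u (1/2)))" "has_value_at (newton (\<i> * of_real (1/2) / 2) c (u (1/2))) 0 c"
    "\<And>\<phi>. test_function UNIV \<phi> \<Longrightarrow> (LINT x|lebesgue. newton (\<i> * of_real (1/2) / 2) c (u (1/2)) x * lap \<phi> x) = (LINT x|lebesgue. f x * \<phi> x)"
    by (rule solution_newton[OF _ f _ _ refl]) auto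
  define V where "V = newton (\<i> * of_real (1/2) / 2) c (u (1/2))"
  note V = V[folded V_def]
  show ?thesis
  proof (rule that[OF V(1-3)])
    show "(LINT x|lebesgue. V x * lap \<phi> x) = (LINT x|lebesgue. f x * \<phi> x)" if "test_function UNIV \<phi>" for \<phi>
      by (rule V(4)[OF that])
    fix \<delta> :: real assume \<delta>: "0 < \<delta>" "\<delta> < 1"
    define \<kappa> where "\<kappa> = \<i> * complex_of_real \<delta> / 2"
    have \<kappa>0: "\<kappa> \<noteq> 0" using \<delta> by (simp add: \<kappa>_def)
    obtain d where W: "L1_loc UNIV (newton \<kappa> d (u \<delta>))" "tends_to_0_at_infinity (newton \<kappa> d (u \<delta>))" "has_value_at (newton \<kappa> d (u \<delta>)) 0 d"
      "\<And>\<phi>. test_function UNIV \<phi> \<Longrightarrow> (LINT x|lebesgue. newton \<kappa> d (u \<delta>) x * lap \<phi> x) = (LINT x|lebesgue. f x * \<phi> x)"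
      using solution_newton[OF sol[OF \<delta>] f \<delta> \<kappa>_def] by blast
    have eq: "AE x in lebesgue. V x = newton \<kappa> d (u \<delta>) x"
      by (rule distribution_unique[OF V(1) W(1) V(2) W(2)]) (simp add: V(4) W(4))
    \<comment> \<open>Both constants are values at 0 of functions that agree almost everywhere,
      hence they coincide.\<close>
    have "has_value_at V 0 (0 + 1 * d)"
      by (rule has_value_at_cong[OF W(3), of 1]) (use eq in \<open>auto elim: eventually_mono\<close>)
    then have d: "d = c" using has_value_at_unique[OF V(3)] by simp
    have r: "AE x in lebesgue. reflect V x = reflect (newton \<kappa> d (u \<delta>)) x" by (rule AE_reflect_cong[OF eq])
    show "AE x in lebesgue. u \<delta> x = V x + (2 / (\<i> * of_real \<delta>) - 1) * (reflect V x - c)"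
      using eq r AE_norm_neq_1
    proof eventually_elim
      case (elim x)
      have rn: "reflect (newton \<kappa> d (u \<delta>)) x = (1 - \<kappa>) * d + \<kappa> * reflect (u \<delta>) x"
      proof (cases "norm x < 1")
        case True
        then show ?thesis by (simp add: reflect_simps newton_in_ball)
      next
        case False
        with elim(3) have x: "norm x > 1" by simp
        then have "norm (kelvin x) < 1" by (simp add: norm_kelvin_less_1)
        with x show ?thesis by (simp add: reflect_simps newton_in_ball)
      qed
      have k: "2 / (\<i> * of_real \<delta>) = 1 / \<kappa>" by (simp add: \<kappa>_def)
      have "(1 / k - 1) * (k * r - k * c) = (1 - k) * (r - c)" if "k \<noteq> 0" for k r c :: complex
      proof -
        have "(1 / k - 1) * (k * r - k * c) = (1 / k * k - k) * (r - c)" by algebra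
        then show ?thesis using that by simp
      qed
      from this[OF \<kappa>0, of "reflect (u \<delta>) x" c]
      have A: "(1 / \<kappa> - 1) * (reflect V x - c) = (1 - \<kappa>) * (reflect (u \<delta>) x - c)"
        using elim(2) rn unfolding d by (simp add: right_diff_distrib left_diff_distrib)
      show ?case unfolding k A elim(1) d newton_def by (simp add: algebra_simps)
    qed
  qed
qed

subsection \<open>The compatible case\<close>

lemma kelvin_push_eq:
  "kelvin_push f y = (if y \<noteq> 0 \<and> norm y \<le> 1 then f (kelvin y) / of_real (norm y ^ 4) else 0)"
proof (cases "y \<noteq> 0 \<and> norm y \<le> 1")
  case True
  then have k: "kelvin y \<in> - ball 0 1" by (simp add: norm_kelvin)
  then have "y \<in> kelvin ` (- ball 0 1)" by (intro image_eqI[of _ _ "kelvin y"]) simp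
  moreover have "inv_into (- ball 0 1) kelvin y = kelvin y"
    using inv_into_f_f[OF inj_on_subset[OF inj_kelvin subset_UNIV] k] by simp
  moreover have "\<bar>det (jacobian kelvin (at (kelvin y)))\<bar> = norm y ^ 4"
    using True by (simp add: jacobian_kelvin norm_kelvin power_one_over)
  ultimately show ?thesis using True unfolding kelvin_push_def push_fun_def by (simp add: Let_def)
next
  case False
  have "y \<notin> kelvin ` (- ball 0 1)"
  proof
    assume "y \<in> kelvin ` (- ball 0 1)"
    then obtain x where x: "norm x \<ge> 1" "y = kelvin x" by (auto simp: not_less)
    then have "y \<noteq> 0" by auto
    moreover have "norm y \<le> 1" unfolding x(2) norm_kelvin using x(1) by (simp add: divide_le_eq)
    ultimately show False using False by simp
  qed
  then show ?thesis using False unfolding kelvin_push_def push_fun_def by auto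
qed

text \<open>The weight in the push-forward is the Jacobian of the substitution; as \<open>f\<close>
  vanishes in the disk, the region |y| > 1 contributes nothing.\<close>

lemma kelvin_push_integral:
  assumes f: "L1_loc UNIV f" "AE x in lebesgue. norm x < 1 \<longrightarrow> f x = 0" and \<phi>: "test_function D \<phi>"
  shows "integrable lebesgue (\<lambda>y. indicator (ball 0 1) y *\<^sub>R (kelvin_push f y * kpull \<phi> y))"
    and "(LINT y|lebesgue. indicator (ball 0 1) y *\<^sub>R (kelvin_push f y * kpull \<phi> y)) = (LINT x|lebesgue. f x * \<phi> x)"
proof -
  obtain K where K: "compact K" "\<And>x. x \<notin> K \<Longrightarrow> \<phi> x = 0" using test_functionE[OF \<phi>] by metis
  have i: "integrable lebesgue (\<lambda>x. f x * \<phi> x)"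
    by (rule L1_loc_integrable_mult[OF f(1) test_function_continuous[OF \<phi>] K(1) subset_UNIV K(2)])
  have ae: "AE y in lebesgue. f (kelvin y) * \<phi> (kelvin y) / of_real (norm y ^ 4) = indicator (ball 0 1) y *\<^sub>R (kelvin_push f y * kpull \<phi> y)"
    using AE_kelvin[OF f(2)] AE_lebesgue_neq[of 0] AE_norm_neq_1
  proof eventually_elim
    case (elim y)
    show ?case
    proof (cases "norm y < 1")
      case True
      then show ?thesis using elim by (simp add: kelvin_push_eq kpull_def)
    next
      case False
      with elim have "norm (kelvin y) < 1" by (simp add: norm_kelvin_less_1)
      then show ?thesis using elim False by simp
    qed
  qed
  show "integrable lebesgue (\<lambda>y. indicator (ball 0 1) y *\<^sub>R (kelvin_push f y * kpull \<phi> y))"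
    by (rule integrable_cong_AE_lebesgue[OF kelvin_substitution(1)[OF i] ae])
  show "(LINT y|lebesgue. indicator (ball 0 1) y *\<^sub>R (kelvin_push f y * kpull \<phi> y)) = (LINT x|lebesgue. f x * \<phi> x)"
    using LINT_cong_AE[OF ae] kelvin_substitution(2)[OF i] by simp
qed

lemma weak_div_test:
  fixes v :: "real^'n \<Rightarrow> complex^'n"
  assumes "weak_div D v h" "open D" "test_function D \<phi>"
  shows "(LINT x|lebesgue. cdot (v x) (grad \<phi> x)) = - (LINT x|lebesgue. h x * \<phi> x)"
proof -
  obtain K where K: "compact K" "K \<subseteq> D" "\<And>x. x \<notin> K \<Longrightarrow> \<phi> x = 0" using test_functionE[OF assms(3)] by metis
  have z: "\<phi> x = 0" "grad \<phi> x = 0" if "x \<notin> D" for x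
    using grad_zero_outside[of K \<phi> x] K that by (auto simp: compact_imp_closed)
  have "(LINT x|lebesgue_on D. cdot (v x) (grad \<phi> x)) = - (LINT x|lebesgue_on D. h x * \<phi> x)"
    using assms unfolding weak_div_def by blast
  then show ?thesis using assms(2) z by (subst (asm) (1 2) LINT_lebesgue_on_eq) (auto simp: cdot_def)
qed

lemma norm_add_power2_le:
  fixes x y :: "'a::real_normed_vector"
  shows "(norm (x + y))\<^sup>2 \<le> 2 * (norm x)\<^sup>2 + 2 * (norm y)\<^sup>2"
proof -
  have "(norm (x + y))\<^sup>2 \<le> (norm x + norm y)\<^sup>2" by (intro power_mono norm_triangle_ineq) simp
  then show ?thesis using zero_le_power2[of "norm x - norm y"] unfolding power2_sum power2_diff by simp
qed

lemma L2_mult_integrable: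
  fixes a b :: "'a \<Rightarrow> complex"
  assumes "a \<in> borel_measurable M" "integrable M (\<lambda>x. (norm (a x))\<^sup>2)" "b \<in> borel_measurable M" "integrable M (\<lambda>x. (norm (b x))\<^sup>2)"
  shows "integrable M (\<lambda>x. a x * b x)"
proof (rule Bochner_Integration.integrable_bound)
  show "integrable M (\<lambda>x. (norm (a x))\<^sup>2 + (norm (b x))\<^sup>2)" using assms by auto
  show "(\<lambda>x. a x * b x) \<in> borel_measurable M" using assms by auto
  have "s * t \<le> s\<^sup>2 + t\<^sup>2" for s t :: real
    using zero_le_power2[of "s - t"] zero_le_power2[of s] zero_le_power2[of t] unfolding power2_diff by linarith
  then show "AE x in M. norm (a x * b x) \<le> norm ((norm (a x))\<^sup>2 + (norm (b x))\<^sup>2)" by (simp add: norm_mult)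
qed

lemma norm_vec_power2: "(norm (v :: complex^'m))\<^sup>2 = (\<Sum>i\<in>UNIV. (norm (v $ i))\<^sup>2)"
  by (simp add: norm_vec_def L2_set_def sum_nonneg)

text \<open>Young's inequality with a free parameter replaces the Cauchy-Schwarz inequality.\<close>

lemma L2_product_tendsto_0_bounded:
  fixes g k :: "nat \<Rightarrow> 'a \<Rightarrow> complex"
  assumes g: "\<And>n. g n \<in> borel_measurable M" "\<And>n. integrable M (\<lambda>x. (norm (g n x))\<^sup>2)" "(\<lambda>n. LINT x|M. (norm (g n x))\<^sup>2) \<longlonglongrightarrow> 0"
    and k: "\<And>n. k n \<in> borel_measurable M" "\<And>n. integrable M (\<lambda>x. (norm (k n x))\<^sup>2)" "\<And>n. (LINT x|M. (norm (k n x))\<^sup>2) \<le> C"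
  shows "\<And>n. integrable M (\<lambda>x. g n x * k n x)" "(\<lambda>n. LINT x|M. g n x * k n x) \<longlonglongrightarrow> 0"
proof -
  have young: "norm (a * b) \<le> t * (norm b)\<^sup>2 + (norm a)\<^sup>2 / t" if "t > 0" for a b :: complex and t :: real
  proof -
    have "0 \<le> (norm a / sqrt t - sqrt t * norm b)\<^sup>2" by simp
    also have "\<dots> = (norm a)\<^sup>2 / t + t * (norm b)\<^sup>2 - 2 * (norm a * norm b)"
      using that by (simp add: power2_diff power_divide power_mult_distrib)
    finally have "2 * (norm a * norm b) \<le> t * (norm b)\<^sup>2 + (norm a)\<^sup>2 / t" by linarith
    moreover have "0 \<le> norm a * norm b" by simp
    ultimately show ?thesis unfolding norm_mult by linarith
  qed
  show i: "integrable M (\<lambda>x. g n x * k n x)" for n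
  proof (rule Bochner_Integration.integrable_bound)
    show "integrable M (\<lambda>x. 1 * (norm (k n x))\<^sup>2 + (norm (g n x))\<^sup>2 / 1)" using g k by simp
    show "AE x in M. norm (g n x * k n x) \<le> norm (1 * (norm (k n x))\<^sup>2 + (norm (g n x))\<^sup>2 / 1)"
      using young[of 1] by (intro AE_I2) (auto intro: order_trans[OF _ abs_ge_self])
  qed (use g k in measurable)
  have le: "norm (LINT x|M. g n x * k n x) \<le> t * C + (LINT x|M. (norm (g n x))\<^sup>2) / t" if "t > 0" for t n
  proof -
    have "norm (LINT x|M. g n x * k n x) \<le> (LINT x|M. norm (g n x * k n x))" by (rule integral_norm_bound)
    also have "\<dots> \<le> (LINT x|M. t * (norm (k n x))\<^sup>2 + (norm (g n x))\<^sup>2 / t)"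
      using g k i young[OF that] by (intro integral_mono) auto
    also have "\<dots> = t * (LINT x|M. (norm (k n x))\<^sup>2) + (LINT x|M. (norm (g n x))\<^sup>2) / t" using g k by simp
    also have "\<dots> \<le> t * C + (LINT x|M. (norm (g n x))\<^sup>2) / t" using k(3)[of n] that by simp
    finally show ?thesis .
  qed
  show "(\<lambda>n. LINT x|M. g n x * k n x) \<longlonglongrightarrow> 0"
  proof (rule LIMSEQ_I)
    fix e :: real assume e: "e > 0"
    have K0: "C \<ge> 0" using k(3)[of 0] by (rule order_trans[rotated]) simp
    define t where "t = e / (2 * (C + 1))"
    have t: "t > 0" unfolding t_def using e K0 by (intro divide_pos_pos mult_pos_pos) linarith+
    have tK: "t * C \<le> e / 2"
    proof -
      have "t * C \<le> t * (C + 1)" using t by (intro mult_left_mono) auto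
      also have "\<dots> = e / 2"
      proof -
        have "(e / (2 * T)) * T = e / 2" if "T \<noteq> 0" for T :: real using that by simp
        moreover have "C + 1 \<noteq> 0" using K0 by linarith
        ultimately show ?thesis unfolding t_def by blast
      qed
      finally show ?thesis .
    qed
    have "(\<lambda>n. (LINT x|M. (norm (g n x))\<^sup>2) / t) \<longlonglongrightarrow> 0 / t" using g(3) t by (intro tendsto_intros) auto
    then have "eventually (\<lambda>n. (LINT x|M. (norm (g n x))\<^sup>2) / t < e / 2) sequentially"
      using e by (intro order_tendstoD(2)) auto
    then have "eventually (\<lambda>n. norm ((LINT x|M. g n x * k n x) - 0) < e) sequentially"
    proof eventually_elim
      case (elim n)
      then show ?case unfolding diff_0_right using le[OF t, of n] tK by linarith
    qed
    then show "\<exists>no. \<forall>n\<ge>no. norm ((LINT x|M. g n x * k n x) - 0) < e" by (simp add: eventually_sequentially)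
  qed
qed

lemma L2_product_tendsto_0:
  fixes g :: "nat \<Rightarrow> 'a \<Rightarrow> complex"
  assumes g: "\<And>n. g n \<in> borel_measurable M" "\<And>n. integrable M (\<lambda>x. (norm (g n x))\<^sup>2)" "(\<lambda>n. LINT x|M. (norm (g n x))\<^sup>2) \<longlonglongrightarrow> 0"
    and k: "k \<in> borel_measurable M" "integrable M (\<lambda>x. (norm (k x))\<^sup>2)"
  shows "\<And>n. integrable M (\<lambda>x. g n x * k x)" "(\<lambda>n. LINT x|M. g n x * k x) \<longlonglongrightarrow> 0"
  using L2_product_tendsto_0_bounded[of g M "\<lambda>_. k", OF g k order_refl] by blast+

lemma L2_cong_AE:
  fixes u v :: "real^'n \<Rightarrow> 'b::euclidean_space"
  assumes "L2 D u" "D \<in> sets lebesgue" "AE x\<in>D in lebesgue. u x = v x"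
  shows "L2 D v"
proof -
  note u = assms(1)[unfolded L2_iff[OF assms(2)]]
  have 1: "AE x in lebesgue. indicator D x *\<^sub>R u x = indicator D x *\<^sub>R v x"
    using assms(3) by eventually_elim (auto simp: indicator_def)
  have 2: "AE x in lebesgue. indicator D x * (norm (u x))\<^sup>2 = indicator D x * (norm (v x))\<^sup>2"
    using assms(3) by eventually_elim (auto simp: indicator_def)
  show ?thesis unfolding L2_iff[OF assms(2)]
    using borel_measurable_AE[OF _ 1] integrable_cong_AE_lebesgue[OF _ 2] u by blast
qed

lemma L2_componentwise:
  fixes G :: "real^'n \<Rightarrow> complex^'m"
  assumes "\<And>i. L2 D (\<lambda>x. G x $ i)" "D \<in> sets lebesgue" shows "L2 D G"
proof -
  note u = assms(1)[unfolded L2_iff[OF assms(2)]]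
  have "(\<lambda>x. \<Sum>i\<in>UNIV. axis i (indicator D x *\<^sub>R (G x $ i)) :: complex^'m) \<in> borel_measurable lebesgue"
  proof (rule borel_measurable_sum)
    fix i
    have "linear (\<lambda>c::complex. axis i c :: complex^'m)"
      by (intro linearI) (auto simp: vec_eq_iff axis_def)
    then have "continuous_on UNIV (\<lambda>c::complex. axis i c :: complex^'m)"
      by (simp add: linear_continuous_on linear_conv_bounded_linear)
    from borel_measurable_continuous_on[OF this]
    show "(\<lambda>x. axis i (indicator D x *\<^sub>R (G x $ i)) :: complex^'m) \<in> borel_measurable lebesgue" using u by blast
  qed
  moreover have "(\<Sum>i\<in>UNIV. axis i (indicator D x *\<^sub>R (G x $ i))) = indicator D x *\<^sub>R G x" for x
    by (auto simp: vec_eq_iff axis_def)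
  moreover have "integrable lebesgue (\<lambda>x. \<Sum>i\<in>UNIV. indicator D x * (norm (G x $ i))\<^sup>2)"
    using u by (intro Bochner_Integration.integrable_sum) blast
  moreover have "(\<Sum>i\<in>UNIV. indicator D x * (norm (G x $ i))\<^sup>2) = indicator D x * (norm (G x))\<^sup>2" for x
    by (simp add: norm_vec_power2 sum_distrib_left)
  ultimately show ?thesis unfolding L2_iff[OF assms(2)] by simp
qed

lemma L2_ball_continuous:
  fixes h :: "real^'n \<Rightarrow> complex"
  assumes "continuous_on UNIV h" shows "L2 (ball 0 1) h"
proof -
  have i: "integrable lebesgue (\<lambda>x. indicator (ball 0 1) x *\<^sub>R (1::complex))"
    using lmeasurable_ball[of 0 1] by (intro integrable_scaleR_left) (auto simp: integrable_real_indicator fmeasurable_def)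
  have "continuous_on UNIV (\<lambda>x. of_real ((norm (h x))\<^sup>2) :: complex)" using assms by (intro continuous_intros)
  from integrable_norm[OF ball_integrable_mult[OF i this]]
  have "integrable lebesgue (\<lambda>x. indicator (ball 0 1) x * (norm (h x))\<^sup>2)"
    by (rule integrable_cong_AE_lebesgue) (auto simp: indicator_def norm_power)
  moreover have "(\<lambda>x. indicator (ball 0 1) x *\<^sub>R h x) \<in> borel_measurable lebesgue"
    by (intro borel_measurable_scaleR borel_measurable_indicator continuous_lebesgue_measurable assms) auto
  ultimately show ?thesis by (simp add: L2_iff)
qed

lemma H1_C1:
  fixes \<psi> :: "real^'n \<Rightarrow> complex"
  assumes "Ck 1 \<psi>"
  shows "H1 (ball 0 1) \<psi>" "AE x\<in>ball 0 1 in lebesgue. wgrad (ball 0 1) \<psi> x = grad \<psi> x"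
    "has_weak_gradient (ball 0 1) \<psi> (grad \<psi>)"
proof -
  have C1: "Ck (Suc 0) \<psi>" using assms by simp
  have c: "continuous_on UNIV \<psi>" "\<And>i. continuous_on UNIV (\<lambda>x. grad \<psi> x $ i)" using C1 Ck_SucD[OF C1] by auto
  show w: "has_weak_gradient (ball 0 1) \<psi> (grad \<psi>)"
    by (rule has_weak_gradient_C1[OF open_ball Ck_has_grad[OF C1]]) (rule continuous_on_subset[OF c(2) subset_UNIV])
  show ae: "AE x\<in>ball 0 1 in lebesgue. wgrad (ball 0 1) \<psi> x = grad \<psi> x" by (rule wgrad_eq[OF w open_ball])
  have "L2 (ball 0 1) (grad \<psi>)" by (rule L2_componentwise[OF L2_ball_continuous[OF c(2)]]) simp
  then have "L2 (ball 0 1) (wgrad (ball 0 1) \<psi>)"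
    by (rule L2_cong_AE) (use ae in \<open>auto elim: eventually_mono\<close>)
  then show "H1 (ball 0 1) \<psi>" unfolding H1_def weakly_differentiable_def using w L2_ball_continuous[OF c(1)] by blast
qed

lemma L2_restrict:
  fixes u :: "real^'n \<Rightarrow> complex"
  assumes "L2 D u" shows "u \<in> borel_measurable (lebesgue_on D)" "integrable (lebesgue_on D) (\<lambda>x. (norm (u x))\<^sup>2)"
  using assms unfolding L2_def by auto

lemma L2_diff:
  fixes u v :: "real^'n \<Rightarrow> complex"
  assumes "L2 D u" "L2 D v" shows "L2 D (\<lambda>x. u x - v x)"
  unfolding L2_def
proof
  show m: "(\<lambda>x. u x - v x) \<in> borel_measurable (lebesgue_on D)" using assms unfolding L2_def by auto
  show "integrable (lebesgue_on D) (\<lambda>x. (norm (u x - v x))\<^sup>2)"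
  proof (rule Bochner_Integration.integrable_bound)
    show "integrable (lebesgue_on D) (\<lambda>x. 2 * (norm (u x))\<^sup>2 + 2 * (norm (v x))\<^sup>2)" using assms unfolding L2_def by auto
    show "AE x in lebesgue_on D. norm ((norm (u x - v x))\<^sup>2) \<le> norm (2 * (norm (u x))\<^sup>2 + 2 * (norm (v x))\<^sup>2)"
      using norm_add_power2_le[of "u _" "- v _"] by simp
  qed (use m in measurable)
qed

lemma component_L2_tendsto:
  fixes H :: "nat \<Rightarrow> real^'n \<Rightarrow> complex^'m"
  assumes "\<And>n. L2 D (H n)" "D \<in> sets lebesgue" "(\<lambda>n. LINT x|lebesgue_on D. (norm (H n x))\<^sup>2) \<longlonglongrightarrow> 0"
  shows "(\<lambda>n. LINT x|lebesgue_on D. (norm (H n x $ i))\<^sup>2) \<longlonglongrightarrow> 0"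
proof (rule tendsto_sandwich[OF _ _ tendsto_const assms(3)])
  show "eventually (\<lambda>n. (LINT x|lebesgue_on D. (norm (H n x $ i))\<^sup>2) \<le> (LINT x|lebesgue_on D. (norm (H n x))\<^sup>2)) sequentially"
  proof (intro always_eventually allI integral_mono)
    show "integrable (lebesgue_on D) (\<lambda>x. (norm (H n x $ i))\<^sup>2)" for n using L2_restrict(2)[OF L2_component[OF assms(1,2)]] .
    show "integrable (lebesgue_on D) (\<lambda>x. (norm (H n x))\<^sup>2)" for n using assms(1) unfolding L2_def by blast
  qed (auto intro!: power_mono Finite_Cartesian_Product.norm_nth_le)
qed simp

lemma test_function_L2_ball:
  fixes \<phi> :: "real^'n \<Rightarrow> complex"
  assumes "test_function D \<phi>"
  shows "L2 (ball 0 1) \<phi>" "L2 (ball 0 1) (\<lambda>x. grad \<phi> x $ i)"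
  using L2_ball_continuous test_function_continuous assms test_function_grad by blast+

text \<open>For compactly supported approximants there is no boundary term, although
  \<open>\<psi>\<close> is not zero on the circle. Convergence of values and gradients in square
  mean passes the identity on to \<open>w\<close>.\<close>

lemma H1_0_green:
  fixes w :: "real^2 \<Rightarrow> complex"
  assumes w: "H1_0 (ball 0 1) w" and \<psi>: "Ck 2 \<psi>"
  shows "(LINT x|lebesgue_on (ball 0 1). w x * lap \<psi> x) = - (LINT x|lebesgue_on (ball 0 1). cdot (wgrad (ball 0 1) w x) (grad \<psi> x))"
proof -
  let ?M = "lebesgue_on (ball 0 (1::real)) :: (real^2) measure" and ?G = "wgrad (ball 0 1) w"
  have C2: "Ck (Suc (Suc 0)) \<psi>" using \<psi> by (simp add: numeral_2_eq_2)
  have C1: "Ck 1 (\<lambda>x. grad \<psi> x $ i)" for i using C2 by simp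
  have c: "continuous_on UNIV (\<lambda>x. grad \<psi> x $ i)" for i using C1[of i] Ck_SucD[of 0] unfolding One_nat_def by simp
  have clap: "continuous_on UNIV (lap \<psi>)" using C2 unfolding lap_def[abs_def] by (auto intro!: continuous_on_sum)
  obtain \<phi> where \<phi>: "\<And>n. test_function (ball 0 1) (\<phi> n)"
    and lim: "(\<lambda>n. LINT x|?M. (norm (\<phi> n x - w x))\<^sup>2) \<longlonglongrightarrow> 0" "(\<lambda>n. LINT x|?M. (norm (grad (\<phi> n) x - ?G x))\<^sup>2) \<longlonglongrightarrow> 0"
    using w unfolding H1_0_def by blast
  have L2w: "L2 (ball 0 1) w" "L2 (ball 0 1) ?G" using w unfolding H1_0_def H1_def by blast+
  have L2G: "L2 (ball 0 1) (\<lambda>x. ?G x $ i)" for i by (rule L2_component[OF L2w(2)]) simp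
  have d1: "L2 (ball 0 1) (\<lambda>x. \<phi> n x - w x)" for n by (rule L2_diff[OF test_function_L2_ball(1)[OF \<phi>] L2w(1)])
  have d2i: "L2 (ball 0 1) (\<lambda>x. grad (\<phi> n) x $ i - ?G x $ i)" for n i by (rule L2_diff[OF test_function_L2_ball(2)[OF \<phi>] L2G])
  have d2: "L2 (ball 0 1) (\<lambda>x. grad (\<phi> n) x - ?G x)" for n
    by (rule L2_componentwise) (use d2i in auto)
  have lim2: "(\<lambda>n. LINT x|?M. (norm (grad (\<phi> n) x $ i - ?G x $ i))\<^sup>2) \<longlonglongrightarrow> 0" for i
    using component_L2_tendsto[OF d2 _ lim(2), of i] by simp
  have Lp: "L2 (ball 0 1) (\<lambda>x. grad \<psi> x $ i)" "L2 (ball 0 1) (lap \<psi>)" for i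
    by (rule L2_ball_continuous, rule c clap)+
  note P1 = L2_product_tendsto_0[OF L2_restrict(1)[OF d1] L2_restrict(2)[OF d1] lim(1) L2_restrict[OF Lp(2)]]
  note P2 = L2_product_tendsto_0[OF L2_restrict(1)[OF d2i] L2_restrict(2)[OF d2i] lim2 L2_restrict[OF Lp(1)]]
  have prod: "integrable ?M (\<lambda>x. a x * b x)" if "L2 (ball 0 1) a" "L2 (ball 0 1) b" for a b :: "real^2 \<Rightarrow> complex"
    using that unfolding L2_def by (intro L2_mult_integrable) auto
  have iw: "integrable ?M (\<lambda>x. w x * lap \<psi> x)" "integrable ?M (\<lambda>x. \<phi> n x * lap \<psi> x)"
    "integrable ?M (\<lambda>x. ?G x $ i * grad \<psi> x $ i)" "integrable ?M (\<lambda>x. grad (\<phi> n) x $ i * grad \<psi> x $ i)" for n i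
    by (intro prod L2w Lp L2G test_function_L2_ball[OF \<phi>])+
  have A: "(\<lambda>n. LINT x|?M. \<phi> n x * lap \<psi> x) \<longlonglongrightarrow> (LINT x|?M. w x * lap \<psi> x)"
  proof (rule LIM_zero_cancel)
    have "(\<lambda>n. LINT x|?M. (\<phi> n x - w x) * lap \<psi> x) \<longlonglongrightarrow> 0" by (rule P1(2))
    then show "(\<lambda>n. (LINT x|?M. \<phi> n x * lap \<psi> x) - (LINT x|?M. w x * lap \<psi> x)) \<longlonglongrightarrow> 0"
      unfolding left_diff_distrib Bochner_Integration.integral_diff[OF iw(2) iw(1)] .
  qed
  have Bi: "(\<lambda>n. LINT x|?M. grad (\<phi> n) x $ i * grad \<psi> x $ i) \<longlonglongrightarrow> (LINT x|?M. ?G x $ i * grad \<psi> x $ i)" for i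
  proof (rule LIM_zero_cancel)
    have "(\<lambda>n. LINT x|?M. (grad (\<phi> n) x $ i - ?G x $ i) * grad \<psi> x $ i) \<longlonglongrightarrow> 0" by (rule P2(2))
    then show "(\<lambda>n. (LINT x|?M. grad (\<phi> n) x $ i * grad \<psi> x $ i) - (LINT x|?M. ?G x $ i * grad \<psi> x $ i)) \<longlonglongrightarrow> 0"
      unfolding left_diff_distrib Bochner_Integration.integral_diff[OF iw(4) iw(3)] .
  qed
  have e: "(LINT x|?M. \<phi> n x * lap \<psi> x) = - (\<Sum>i\<in>UNIV. LINT x|?M. grad (\<phi> n) x $ i * grad \<psi> x $ i)" for n
  proof -
    have "(LINT x|?M. grad \<psi> x $ i * grad (\<phi> n) x $ i) = - (LINT x|?M. grad (\<lambda>y. grad \<psi> y $ i) x $ i * \<phi> n x)" for i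
      using H1_C1(3)[OF C1] \<phi> unfolding has_weak_gradient_def by blast
    then have "(\<Sum>i\<in>UNIV. LINT x|?M. grad (\<phi> n) x $ i * grad \<psi> x $ i) = (\<Sum>i\<in>UNIV. - (LINT x|?M. \<phi> n x * grad (\<lambda>y. grad \<psi> y $ i) x $ i))"
      by (simp add: mult.commute)
    also have "\<dots> = - (LINT x|?M. \<phi> n x * lap \<psi> x)"
    proof -
      have "L2 (ball 0 1) (\<lambda>x. grad (\<lambda>y. grad \<psi> y $ i) x $ i)" for i
        using C2 by (intro L2_ball_continuous) simp
      then have "integrable ?M (\<lambda>x. \<phi> n x * grad (\<lambda>y. grad \<psi> y $ i) x $ i)" for i
        by (intro prod test_function_L2_ball[OF \<phi>])
      then show ?thesis unfolding lap_def sum_distrib_left by (subst Bochner_Integration.integral_sum) (auto simp: sum_negf)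
    qed
    finally show ?thesis by simp
  qed
  have "(\<lambda>n. - (\<Sum>i\<in>UNIV. LINT x|?M. grad (\<phi> n) x $ i * grad \<psi> x $ i)) \<longlonglongrightarrow> - (\<Sum>i\<in>UNIV. LINT x|?M. ?G x $ i * grad \<psi> x $ i)"
    by (intro tendsto_intros Bi)
  with A have "(LINT x|?M. w x * lap \<psi> x) = - (\<Sum>i\<in>UNIV. LINT x|?M. ?G x $ i * grad \<psi> x $ i)"
    unfolding e by (rule LIMSEQ_unique)
  then show ?thesis using integral_cdot[of ?M ?G "grad \<psi>"] iw(3) by simp
qed

lemma LINT_ball:
  fixes h :: "real^'n \<Rightarrow> complex"
  shows "(LINT x|lebesgue_on (ball 0 1). h x) = (LINT x|lebesgue. indicator (ball 0 1) x *\<^sub>R h x)"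
  by (subst integral_restrict_space) auto

text \<open>As \<open>f\<close> vanishes far out, its push-forward vanishes near 0, so
  \<open>w\<close> is harmonic there and Weyl's lemma gives a continuous representative.\<close>

lemma cauchy_solution_value:
  assumes w: "cauchy_solution f w" and R: "AE x in lebesgue. norm x > R \<longrightarrow> f x = 0"
  shows "\<exists>c. has_value_at w 0 c"
proof -
  let ?G = "wgrad (ball 0 1) w"
  \<comment> \<open>Points with norm below this radius are sent beyond norm \<open>R\<close>; the
    absolute value and the 1 keep the denominator positive for any real \<open>R\<close>.\<close>
  define r where "r = 1 / (\<bar>R\<bar> + 1)"
  have r: "r > 0" "r \<le> 1" by (auto simp: r_def)
  have sub: "ball 0 r \<subseteq> (ball 0 1 :: (real^2) set)" using r by auto
  have "has_weak_gradient (ball 0 1) w ?G"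
    using w wgrad_works unfolding cauchy_solution_def H1_def weakly_differentiable_def by blast
  then have wg: "has_weak_gradient (ball 0 r) w ?G" by (rule has_weak_gradient_subset[OF _ open_ball open_ball sub])
  have "weakly_harmonic (ball 0 r) w"
  proof (rule weakly_harmonicI[OF wg open_ball])
    fix \<phi> :: "real^2 \<Rightarrow> complex" assume \<phi>: "test_function (ball 0 r) \<phi>"
    obtain K where K: "compact K" "K \<subseteq> ball 0 r" "\<And>x. x \<notin> K \<Longrightarrow> \<phi> x = 0" using test_functionE[OF \<phi>] by metis
    have "(LINT x|lebesgue. cdot (?G x) (grad \<phi> x)) = - (LINT x|lebesgue. kelvin_push f x * \<phi> x)"
      using w weak_div_test[OF _ open_ball test_function_subset[OF \<phi> sub]] unfolding cauchy_solution_def by blast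
    also have "(LINT x|lebesgue. kelvin_push f x * \<phi> x) = (LINT x|lebesgue. (0::complex) * indicator UNIV (x::real^2))"
    proof (rule LINT_cong_AE)
      show "AE x in lebesgue. kelvin_push f x * \<phi> x = 0 * indicator UNIV x"
        using AE_kelvin[OF R]
      proof eventually_elim
        case (elim x)
        show ?case
        proof (cases "x \<in> K \<and> x \<noteq> 0")
          case True
          then have "norm x < r" "x \<noteq> 0" using K(2) by auto
          then have "norm x * (\<bar>R\<bar> + 1) < 1" unfolding r_def by (simp add: pos_less_divide_eq)
          moreover have "R * norm x \<le> norm x * (\<bar>R\<bar> + 1)"
            unfolding mult.commute[of "norm x"] by (rule mult_right_mono) auto
          ultimately have "R * norm x < 1" by linarith
          then have "norm (kelvin x) > R" unfolding norm_kelvin using \<open>x \<noteq> 0\<close> by (simp add: pos_less_divide_eq)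
          then show ?thesis using elim by (simp add: kelvin_push_eq)
        qed (use K(3) in \<open>auto simp: kelvin_push_eq\<close>)
      qed
    qed
    finally show "(LINT x|lebesgue. cdot (?G x) (grad \<phi> x)) = 0" by simp
  qed
  then show ?thesis by (rule weakly_harmonic_has_value) (use r in auto)
qed

text \<open>Both Cauchy data enter: the zero normal trace is tested with the pull-back of the test
  function, and the zero Dirichlet data turn the gradient pairing into one with the Laplacian. Hence
  the exterior reflection extended by 0 has Laplacian \<open>f\<close> across the circle. The
  constant drops out since the Laplacian of a test function has integral 0.\<close>

lemma cauchy_solution_distribution:
  assumes w: "cauchy_solution f w" and f: "L1_loc UNIV f" "AE x in lebesgue. norm x < 1 \<longrightarrow> f x = 0"
    and \<phi>: "test_function UNIV \<phi>"
  shows "(LINT x|lebesgue. (- c + reflect_out w x) * lap \<phi> x) = (LINT x|lebesgue. f x * \<phi> x)"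
proof -
  let ?G = "wgrad (ball 0 1) w" and ?\<psi> = "kpull \<phi>"
  have H: "H1_0 (ball 0 1) w" "normal_trace_0 (ball 0 1) ?G (kelvin_push f)" "L2 (ball 0 1) w" "L2 (ball 0 1) ?G"
    using w unfolding cauchy_solution_def H1_def by blast+
  have iw: "integrable lebesgue (\<lambda>x. indicator (ball 0 1) x *\<^sub>R w x)" by (rule L2_ball_integrable[OF H(3)])
  have iG: "integrable lebesgue (\<lambda>x. indicator (ball 0 1) x *\<^sub>R ?G x $ i)" for i
    using L2_ball_integrable[OF L2_component[OF H(4)], of i] by simp
  have C2: "Ck 2 ?\<psi>" by (rule Ck_2_kpull[OF \<phi>])
  have "Ck (Suc 1) ?\<psi>" using C2 by (simp only: Suc_1)
  then have C1: "Ck 1 ?\<psi>" by (rule Ck_SucD)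
  have c: "continuous_on UNIV (\<lambda>x. grad ?\<psi> x $ i)" for i using C1 by simp
  note h1 = H1_C1[OF C1]
  have ae: "AE x in lebesgue. indicator (ball 0 1) x *\<^sub>R (cdot (?G x) (wgrad (ball 0 1) ?\<psi> x) + kelvin_push f x * ?\<psi> x)
     = indicator (ball 0 1) x *\<^sub>R cdot (?G x) (grad ?\<psi> x) + indicator (ball 0 1) x *\<^sub>R (kelvin_push f x * ?\<psi> x)"
    using h1(2) by eventually_elim (auto simp: indicator_def)
  note K = kelvin_push_integral[OF f \<phi>]
  have "0 = (LINT x|lebesgue_on (ball 0 1). cdot (?G x) (wgrad (ball 0 1) ?\<psi> x) + kelvin_push f x * ?\<psi> x)"
    using H(2) h1(1) unfolding normal_trace_0_def by simp
  also have "\<dots> = (LINT x|lebesgue. indicator (ball 0 1) x *\<^sub>R cdot (?G x) (grad ?\<psi> x) + indicator (ball 0 1) x *\<^sub>R (kelvin_push f x * ?\<psi> x))"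
    unfolding LINT_ball by (rule LINT_cong_AE[OF ae])
  also have "\<dots> = (LINT x|lebesgue. indicator (ball 0 1) x *\<^sub>R cdot (?G x) (grad ?\<psi> x)) + (LINT x|lebesgue. f x * \<phi> x)"
    unfolding Bochner_Integration.integral_add[OF ball_integrable_cdot[OF iG c] K(1)] K(2) ..
  also have "(LINT x|lebesgue. indicator (ball 0 1) x *\<^sub>R cdot (?G x) (grad ?\<psi> x)) = - (LINT x|lebesgue. indicator (ball 0 1) x *\<^sub>R (w x * lap ?\<psi> x))"
    using H1_0_green[OF H(1) C2] unfolding LINT_ball by simp
  also have "(LINT x|lebesgue. indicator (ball 0 1) x *\<^sub>R (w x * lap ?\<psi> x)) = (LINT x|lebesgue. reflect_out w x * lap \<phi> x)"
    by (rule reflect_out_lap(2)[OF iw \<phi>, symmetric])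
  finally have "(LINT x|lebesgue. reflect_out w x * lap \<phi> x) = (LINT x|lebesgue. f x * \<phi> x)" by simp
  moreover have "(LINT x|lebesgue. (- c + reflect_out w x) * lap \<phi> x) = - c * (LINT x|lebesgue. lap \<phi> x) + (LINT x|lebesgue. reflect_out w x * lap \<phi> x)"
    using test_function_integrable[OF test_function_lap[OF \<phi>]] reflect_out_lap(1)[OF iw \<phi>] unfolding distrib_right by simp
  ultimately show ?thesis using test_function_lap_integral_0[OF \<phi>] by simp
qed

lemma compatible_case:
  assumes f: "L1_loc UNIV f" "AE x in lebesgue. norm x < 1 \<longrightarrow> f x = 0" "AE x in lebesgue. norm x > R \<longrightarrow> f x = 0"
    and sol: "\<And>\<delta>. 0 < \<delta> \<Longrightarrow> \<delta> < 1 \<Longrightarrow> is_solution \<delta> f (u \<delta>)" and w: "cauchy_solution f w"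
  shows "\<exists>w0. has_value_at w 0 w0 \<and> (\<forall>\<delta>. 0 < \<delta> \<and> \<delta> < 1 \<longrightarrow>
    (AE x in lebesgue. u \<delta> x = (if x \<in> ball 0 1 then - w0 else w (kelvin x) - w0)))"
proof -
  obtain w0 where w0: "has_value_at w 0 w0" using cauchy_solution_value[OF w f(3)] by blast
  obtain V c where V: "L1_loc UNIV V" "tends_to_0_at_infinity V" "has_value_at V 0 c"
    "\<And>\<phi>. test_function UNIV \<phi> \<Longrightarrow> (LINT x|lebesgue. V x * lap \<phi> x) = (LINT x|lebesgue. f x * \<phi> x)"
    "\<And>\<delta>. 0 < \<delta> \<Longrightarrow> \<delta> < 1 \<Longrightarrow> AE x in lebesgue. u \<delta> x = V x + (2 / (\<i> * of_real \<delta>) - 1) * (reflect V x - c)"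
    using solutions_representation[OF f(1,2) sol] by blast
  let ?U = "\<lambda>x. - w0 + reflect_out w x"
  have iw: "integrable lebesgue (\<lambda>x. indicator (ball 0 1) x *\<^sub>R w x)"
    using w L2_ball_integrable unfolding cauchy_solution_def H1_def by blast
  have zero: "tends_to_0_at_infinity (\<lambda>x. 0)" unfolding tends_to_0_at_infinity_def by auto
  have U: "tends_to_0_at_infinity ?U"
    by (rule tends_to_0_combine[OF zero tends_to_0_kelvin[OF w0], of _ 1]) (auto simp: reflect_out_def)
  have VU: "AE x in lebesgue. V x = ?U x"
    by (rule distribution_unique[OF V(1) L1_loc_add_const[OF L1_loc_reflect_out[OF iw]] V(2) U])
      (simp only: V(4) cauchy_solution_distribution[OF w f(1,2)])
  have "has_value_at V 0 (- w0)"
    unfolding has_value_at_def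
  proof (intro exI[of _ 1] conjI exI[of _ "\<lambda>x. - w0"])
    show "AE x\<in>ball 0 1 in lebesgue. V x = - w0"
      using VU by eventually_elim (auto simp: reflect_out_def)
  qed auto
  \<comment> \<open>\<open>V\<close> is the constant -w0 in the disk, so its reflection equals
    \<open>c\<close> and the factor that is singular in delta multiplies 0.\<close>
  then have c: "c = - w0" using has_value_at_unique[OF V(3)] by simp
  have "AE x in lebesgue. u \<delta> x = (if x \<in> ball 0 1 then - w0 else w (kelvin x) - w0)" if \<delta>: "0 < \<delta>" "\<delta> < 1" for \<delta>
    using V(5)[OF \<delta>] VU AE_reflect_cong[OF VU] AE_norm_neq_1
  proof eventually_elim
    case (elim x)
    have "reflect ?U x = - w0"
    proof (cases "norm x < 1")
      case True
      then show ?thesis by (simp add: reflect_simps reflect_out_def)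
    next
      case False
      then have x: "norm x > 1" using elim(4) by simp
      then have "norm (kelvin x) < 1" by (simp add: norm_kelvin_less_1)
      with x show ?thesis by (simp add: reflect_simps reflect_out_def)
    qed
    then have "u \<delta> x = ?U x" using elim(1-3) c by simp
    then show ?case using elim(4) by (auto simp: reflect_out_def)
  qed
  with w0 show ?thesis by blast
qed

section \<open>Extending weak equations across the origin\<close>

text \<open>The indicator of the disk of radius 2 mollified at scale 1/2: averages only see points
  within 1/2, so nothing changes up to radius 1 and all vanishes beyond 5/2.\<close>

lemma smooth_cutoff:
  obtains \<zeta> :: "real^'n \<Rightarrow> complex" where "test_function UNIV \<zeta>" "\<And>x. norm x \<le> 1 \<Longrightarrow> \<zeta> x = 1" "\<And>x. norm x > 5/2 \<Longrightarrow> \<zeta> x = 0"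
proof -
  define g :: "real^'n \<Rightarrow> complex" where "g x = indicator (cball 0 2) x *\<^sub>R 1" for x
  have g: "integrable lebesgue g" unfolding g_def
    using lmeasurable_cball[of 0 2] by (intro integrable_scaleR_left) (auto simp: integrable_real_indicator fmeasurable_def)
  have n: "norm (x - (1/2) *\<^sub>R z) \<le> norm x + 1/2" "norm x - 1/2 \<le> norm (x - (1/2) *\<^sub>R z)" if "norm z \<le> 1" for x z :: "real^'n"
    using norm_triangle_ineq4[of x "(1/2) *\<^sub>R z"] norm_triangle_ineq2[of x "(1/2) *\<^sub>R z"] that by auto
  show ?thesis
  proof (rule that[of "mol (1/2) g"])
    show "test_function UNIV (mol (1/2) g)"
    proof (rule test_function_mol[OF g])
      show "g (x - (1/2) *\<^sub>R z) = 0" if "x \<notin> cball 0 (5/2)" "norm z \<le> 1" for x z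
      proof -
        have "norm (x - (1/2) *\<^sub>R z) > 2" using n(2)[OF that(2), of x] that(1) by simp
        then show ?thesis by (simp add: g_def)
      qed
    qed auto
    show "mol (1/2) g x = 1" if "norm x \<le> 1" for x
    proof -
      have "norm (g (x - (1/2) *\<^sub>R z) - 1) \<le> 0" if "norm z \<le> 1" for z
      proof -
        have "norm (x - (1/2) *\<^sub>R z) \<le> 2" using n(1)[OF that, of x] \<open>norm x \<le> 1\<close> by simp
        then show ?thesis by (simp add: g_def)
      qed
      then have "norm (mol (1/2) g x - 1) \<le> 0" by (intro norm_mol_le[OF g]) auto
      then show ?thesis by simp
    qed
    show "mol (1/2) g x = 0" if "norm x > 5/2" for x
    proof -
      have "norm (g (x - (1/2) *\<^sub>R z) - 0) \<le> 0" if "norm z \<le> 1" for z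
      proof -
        have "norm (x - (1/2) *\<^sub>R z) > 2" using n(2)[OF that, of x] \<open>norm x > 5/2\<close> by simp
        then show ?thesis by (simp add: g_def)
      qed
      then have "norm (mol (1/2) g x - 0) \<le> 0" by (intro norm_mol_le[OF g]) auto
      then show ?thesis by simp
    qed
  qed
qed

lemma tendsto_LINT_mult:
  fixes q :: "'a \<Rightarrow> complex" and h :: "nat \<Rightarrow> 'a \<Rightarrow> complex"
  assumes q: "integrable M q" and h: "\<And>n. h n \<in> borel_measurable M" "\<And>n x. norm (h n x) \<le> C" and l: "AE x in M. (\<lambda>n. h n x) \<longlonglongrightarrow> 1"
  shows "(\<lambda>n. LINT x|M. q x * h n x) \<longlonglongrightarrow> (LINT x|M. q x)"
proof (rule integral_dominated_convergence[where w = "\<lambda>x. C * norm (q x)"])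
  show "AE x in M. (\<lambda>n. q x * h n x) \<longlonglongrightarrow> q x"
    using l by eventually_elim (auto intro: tendsto_eq_intros)
  show "AE x in M. norm (q x * h n x) \<le> C * norm (q x)" for n
    unfolding norm_mult mult.commute[of C] by (intro AE_I2 mult_left_mono h(2)) simp
qed (use q h in auto)

text \<open>In the plane the gradients of the rescaled cutoffs are bounded in \<open>L\<^sup>2\<close>, while the square
  integrals of \<open>a\<close> over the shrinking supports tend to zero.\<close>

lemma weak_div_across_origin:
  fixes a :: "real^2 \<Rightarrow> complex^2" and b :: "real^2 \<Rightarrow> complex"
  assumes a: "L2 UNIV a" and b: "L1_loc UNIV b"
    and eq: "\<And>\<phi> s. test_function UNIV \<phi> \<Longrightarrow> s > 0 \<Longrightarrow> (\<And>x. norm x < s \<Longrightarrow> \<phi> x = 0) \<Longrightarrow>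
      (LINT x|lebesgue. cdot (a x) (grad \<phi> x)) = - (LINT x|lebesgue. b x * \<phi> x)"
    and \<phi>: "test_function UNIV \<phi>"
  shows "(LINT x|lebesgue. cdot (a x) (grad \<phi> x)) = - (LINT x|lebesgue. b x * \<phi> x)"
proof -
  obtain \<zeta> :: "real^2 \<Rightarrow> complex" where \<zeta>: "test_function UNIV \<zeta>" "\<And>x. norm x \<le> 1 \<Longrightarrow> \<zeta> x = 1" "\<And>x. norm x > 5/2 \<Longrightarrow> \<zeta> x = 0"
    by (rule smooth_cutoff) (rule that; assumption)
  obtain K where K: "compact K" "\<And>x. x \<notin> K \<Longrightarrow> \<phi> x = 0" "\<And>k. Ck k \<phi>" using test_functionE[OF \<phi>] by metis
  obtain C1 where C1: "C1 > 0" "\<And>x. norm (\<zeta> x) \<le> C1" using test_function_bounded[OF \<zeta>(1)] by metis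
  obtain C2 where C2: "C2 > 0" "\<And>x. norm (\<phi> x) \<le> C2" using test_function_bounded[OF \<phi>] by metis
  have cg: "continuous_on UNIV (\<lambda>x. grad \<zeta> x $ i)" for i by (rule test_function_continuous[OF test_function_grad[OF \<zeta>(1)]])
  have cf: "continuous_on UNIV \<phi>" "continuous_on UNIV \<zeta>" using test_function_continuous \<phi> \<zeta>(1) by blast+
  have g\<zeta>: "grad \<zeta> x = 0" if "norm x > 5/2" for x
    by (rule grad_zero_outside[of "cball 0 (5/2)"]) (use \<zeta>(3) that in auto)
  define t where "t n = real (Suc n)" for n
  have t: "t n > 0" "t n \<noteq> 0" for n by (auto simp: t_def)
  have lim3: "(\<lambda>n. 3 / t n) \<longlonglongrightarrow> 0" unfolding t_def by (rule LIMSEQ_Suc[OF lim_const_over_n])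
  have far: "eventually (\<lambda>n. norm (t n *\<^sub>R x) > 5/2) sequentially" if "x \<noteq> 0" for x :: "real^2"
  proof -
    have "eventually (\<lambda>n. 3 / t n < norm x) sequentially" using order_tendstoD(2)[OF lim3, of "norm x"] that by simp
    then show ?thesis
    proof (rule eventually_mono)
      fix n assume "3 / t n < norm x"
      then have "3 < norm x * t n" using t by (simp add: pos_divide_less_eq)
      then show "norm (t n *\<^sub>R x) > 5/2" using t(1)[of n] by (simp add: mult.commute)
    qed
  qed
  define \<psi> where "\<psi> n x = \<phi> x * (1 + (-1) * \<zeta> (t n *\<^sub>R x + 0))" for n x
  have T: "test_function UNIV (\<psi> n)" for n
    unfolding test_function_iff
  proof (intro conjI allI exI[of _ K] impI)
    show "Ck k (\<psi> n)" for k
      unfolding \<psi>_def[abs_def] by (intro Ck_mult Ck_add Ck_const Ck_affine K(3)) (use \<zeta>(1) in \<open>simp add: test_function_def\<close>)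
  qed (use K in \<open>auto simp: \<psi>_def\<close>)
  have G: "grad (\<psi> n) x = (1 - \<zeta> (t n *\<^sub>R x)) *s grad \<phi> x - (of_real (t n) * \<phi> x) *s grad \<zeta> (t n *\<^sub>R x)" for n x
  proof -
    have "has_grad \<zeta> (grad \<zeta> (t n *\<^sub>R x + 0)) (t n *\<^sub>R x + 0)" by (rule test_function_has_grad[OF \<zeta>(1)])
    note h = has_grad_mult[OF test_function_has_grad[OF \<phi>] has_grad_add[OF has_grad_const has_grad_mult[OF has_grad_const has_grad_affine[OF this]]]]
    show ?thesis unfolding \<psi>_def[abs_def] grad_eqI[OF h] by (simp add: vec_eq_iff algebra_simps)
  qed
  define h where "h n x = 1 - \<zeta> (t n *\<^sub>R x)" for n x
  have h: "h n \<in> borel_measurable lebesgue" "norm (h n x) \<le> 1 + C1" for n x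
  proof -
    show "h n \<in> borel_measurable lebesgue" unfolding h_def[abs_def]
      by (intro continuous_lebesgue_measurable continuous_on_diff continuous_on_const continuous_on_compose2[OF cf(2)]) (auto intro: continuous_intros)
    show "norm (h n x) \<le> 1 + C1" unfolding h_def using norm_triangle_ineq4[of 1 "\<zeta> (t n *\<^sub>R x)"] C1(2)[of "t n *\<^sub>R x"] by simp
  qed
  have hl: "AE x in lebesgue. (\<lambda>n. h n x) \<longlonglongrightarrow> 1"
    using AE_lebesgue_neq[of 0]
  proof eventually_elim
    case (elim x)
    then have "eventually (\<lambda>n. h n x = 1) sequentially" using far[OF elim] by (auto simp: h_def \<zeta>(3) elim: eventually_mono)
    then show ?case by (rule tendsto_eventually)
  qed
  have La: "L1_loc UNIV (\<lambda>x. a x $ i)" for i by (rule L1_loc_component[OF L2_imp_L1_loc[OF a]]) simp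
  have ai: "(\<lambda>x. a x $ i) \<in> borel_measurable lebesgue" "integrable lebesgue (\<lambda>x. (norm (a x $ i))\<^sup>2)" for i
    using L2_component[OF a, of i] unfolding L2_UNIV_iff by auto
  \<comment> \<open>The product of \<open>a\<close> with the gradient of the rescaled cutoff is
    split into a factor restricted to the shrinking disk and a factor bounded in L2. The radius 3/t
    exceeds 5/(2t), beyond which that gradient vanishes.\<close>
  define g where "g i n x = indicator (ball 0 (3 / t n)) x *\<^sub>R (a x $ i)" for i n x
  define k where "k i n x = \<phi> x * (of_real (t n) * grad \<zeta> (t n *\<^sub>R x) $ i)" for i n x
  have gm: "g i n \<in> borel_measurable lebesgue" for i n
    unfolding g_def[abs_def] by (intro borel_measurable_scaleR borel_measurable_indicator ai) auto
  have gb: "(norm (g i n x))\<^sup>2 \<le> (norm (a x $ i))\<^sup>2" for i n x by (auto simp: g_def indicator_def)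
  have gi: "integrable lebesgue (\<lambda>x. (norm (g i n x))\<^sup>2)" for i n
    by (rule Bochner_Integration.integrable_bound[OF ai(2)[of i]]) (use gm gb in auto)
  have gl: "(\<lambda>n. LINT x|lebesgue. (norm (g i n x))\<^sup>2) \<longlonglongrightarrow> 0" for i
  proof -
    have "(\<lambda>n. LINT x|lebesgue. (norm (g i n x))\<^sup>2) \<longlonglongrightarrow> (LINT x|lebesgue. (0::real) * indicator UNIV (x::real^2))"
    proof (rule integral_dominated_convergence[where w = "\<lambda>x. (norm (a x $ i))\<^sup>2"])
      show "AE x in lebesgue. (\<lambda>n. (norm (g i n x))\<^sup>2) \<longlonglongrightarrow> 0 * indicator UNIV x"
        using AE_lebesgue_neq[of 0]
      proof eventually_elim
        case (elim x)
        then have "eventually (\<lambda>n. 3 / t n < norm x) sequentially" using order_tendstoD(2)[OF lim3, of "norm x"] by simp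
        then have "eventually (\<lambda>n. (norm (g i n x))\<^sup>2 = 0 * indicator UNIV x) sequentially" by eventually_elim (auto simp: g_def)
        then show ?case by (rule tendsto_eventually)
      qed
    qed (use ai gm gb in auto)
    then show ?thesis by simp
  qed
  have ct: "continuous_on UNIV (\<lambda>x. grad \<zeta> (t n *\<^sub>R x) $ i)" for i n
    by (rule continuous_on_compose2[OF cg[of i]]) (auto intro: continuous_intros)
  have kc: "continuous_on UNIV (k i n)" for i n
    unfolding k_def[abs_def] by (intro continuous_on_mult cf ct continuous_on_const)
  have km: "k i n \<in> borel_measurable lebesgue" for i n by (rule continuous_lebesgue_measurable[OF kc])
  have ki: "integrable lebesgue (\<lambda>x. (norm (k i n x))\<^sup>2)" for i n
    by (rule compact_support_integrable[OF continuous_on_power[OF continuous_on_norm[OF kc]] K(1)]) (simp add: k_def K(2))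
  have kb: "(LINT x|lebesgue. (norm (k i n x))\<^sup>2) \<le> C2\<^sup>2 * (\<Sum>i\<in>UNIV. LINT x|lebesgue. (norm (grad \<zeta> x $ i))\<^sup>2)" for i n
  proof -
    let ?q = "\<lambda>x. (norm (grad \<zeta> x $ i))\<^sup>2"
    have q: "integrable lebesgue ?q"
      by (rule compact_support_integrable[OF continuous_on_power[OF continuous_on_norm[OF cg]] compact_cball[of 0 "5/2"]])
        (simp add: g\<zeta>)
    have "(LINT x|lebesgue. (norm (k i n x))\<^sup>2) \<le> (LINT x|lebesgue. (C2 * t n)\<^sup>2 * ?q (0 + t n *\<^sub>R x))"
    proof (rule integral_mono[OF ki])
      show "integrable lebesgue (\<lambda>x. (C2 * t n)\<^sup>2 * ?q (0 + t n *\<^sub>R x))"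
        by (rule integrable_mult_right[OF integrable_lebesgue_affine_imp[OF t(2) q]])
      show "(norm (k i n x))\<^sup>2 \<le> (C2 * t n)\<^sup>2 * ?q (0 + t n *\<^sub>R x)" for x
      proof -
        have "norm (k i n x) \<le> (C2 * t n) * norm (grad \<zeta> (0 + t n *\<^sub>R x) $ i)"
          unfolding k_def norm_mult mult.assoc add_0_left using C2(1) C2(2)[of x] t(1)[of n] by (intro mult_mono) auto
        then show ?thesis unfolding power_mult_distrib[symmetric] by (intro power_mono) auto
      qed
    qed
    also have "\<dots> = (C2 * t n)\<^sup>2 * ((LINT x|lebesgue. ?q x) /\<^sub>R \<bar>t n\<bar> ^ DIM(real^2))"
      unfolding integral_mult_right_zero integral_lebesgue_affine[OF t(2), of ?q 0] ..
    also have "\<dots> = C2\<^sup>2 * (LINT x|lebesgue. ?q x)" using t(1)[of n] by (simp add: power_mult_distrib)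
    also have "\<dots> \<le> C2\<^sup>2 * (\<Sum>i\<in>UNIV. LINT x|lebesgue. (norm (grad \<zeta> x $ i))\<^sup>2)"
      by (intro mult_left_mono member_le_sum) auto
    finally show ?thesis .
  qed
  note P = L2_product_tendsto_0_bounded[of "g i" lebesgue "k i" for i, OF gm gi gl km ki kb]
  obtain C3 where "\<And>x i. norm (grad \<phi> x $ i) \<le> C3" using test_function_grad_bounded[OF \<phi>] by metis
  have qi: "integrable lebesgue (\<lambda>x. a x $ i * grad \<phi> x $ i)" for i
    by (rule L1_loc_integrable_mult[OF La test_function_continuous[OF test_function_grad[OF \<phi>]] K(1) subset_UNIV])
      (use grad_zero_outside[OF compact_imp_closed[OF K(1)] K(2)] in auto)
  have q: "integrable lebesgue (\<lambda>x. cdot (a x) (grad \<phi> x))" by (rule cdot_integrable[OF qi])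
  have qb: "integrable lebesgue (\<lambda>x. b x * \<phi> x)"
    by (rule L1_loc_integrable_mult[OF b cf(1) K(1) subset_UNIV K(2)])
  have iq: "integrable lebesgue (\<lambda>x. cdot (a x) (grad \<phi> x) * h n x)" for n
    by (rule integrable_mult_bounded[OF q h])
  have pt: "cdot (a x) (grad (\<psi> n) x) = cdot (a x) (grad \<phi> x) * h n x - (\<Sum>i\<in>UNIV. g i n x * k i n x)" for n x
  proof -
    have z: "a x $ i * k i n x = g i n x * k i n x" for i
    proof (cases "norm x < 3 / t n")
      case True
      then show ?thesis by (simp add: g_def)
    next
      case False
      then have "3 \<le> norm x * t n" using t(1)[of n] by (simp add: pos_divide_le_eq not_less)
      then have "norm (t n *\<^sub>R x) > 5/2" using t(1)[of n] by (simp add: mult.commute)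
      then show ?thesis by (simp add: k_def g\<zeta>)
    qed
    show ?thesis unfolding G z[symmetric] unfolding cdot_def h_def k_def
      by (simp add: sum_2 algebra_simps)
  qed
  have L: "(LINT x|lebesgue. cdot (a x) (grad (\<psi> n) x)) = (LINT x|lebesgue. cdot (a x) (grad \<phi> x) * h n x) - (\<Sum>i\<in>UNIV. LINT x|lebesgue. g i n x * k i n x)" for n
    unfolding pt using iq[of n] P(1) by (subst Bochner_Integration.integral_diff) (auto simp: Bochner_Integration.integral_sum)
  have E: "(LINT x|lebesgue. cdot (a x) (grad (\<psi> n) x)) = - (LINT x|lebesgue. b x * \<phi> x * h n x)" for n
  proof -
    have "\<psi> n x = 0" if "norm x < 1 / t n" for x
    proof -
      have "norm x * t n < 1" using that t(1)[of n] by (simp add: pos_less_divide_eq)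
      then have "norm (t n *\<^sub>R x) \<le> 1" using t(1)[of n] by (simp add: mult.commute)
      then show ?thesis by (simp add: \<psi>_def \<zeta>(2))
    qed
    then have "(LINT x|lebesgue. cdot (a x) (grad (\<psi> n) x)) = - (LINT x|lebesgue. b x * \<psi> n x)"
      using t(1)[of n] by (intro eq[OF T, of "1 / t n"]) auto
    then show ?thesis by (simp add: \<psi>_def h_def mult.assoc)
  qed
  have "(\<lambda>n. (LINT x|lebesgue. cdot (a x) (grad \<phi> x) * h n x) - (\<Sum>i\<in>UNIV. LINT x|lebesgue. g i n x * k i n x))
      \<longlonglongrightarrow> (LINT x|lebesgue. cdot (a x) (grad \<phi> x)) - (\<Sum>i\<in>(UNIV::2 set). 0)"
    by (intro tendsto_diff tendsto_sum P(2) tendsto_LINT_mult[OF q h hl])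
  moreover have "(\<lambda>n. - (LINT x|lebesgue. b x * \<phi> x * h n x)) \<longlonglongrightarrow> - (LINT x|lebesgue. b x * \<phi> x)"
    by (intro tendsto_minus tendsto_LINT_mult[OF qb h hl])
  ultimately show ?thesis unfolding L[symmetric] E by (simp add: LIMSEQ_unique)
qed

subsection \<open>Transport of weak gradients by the Kelvin transform\<close>

text \<open>The chain rule for the gradient of a composition with \<open>kelvin\<close>; the
  Jacobian matrix is symmetric, so rows and columns may be exchanged.\<close>

definition kpush :: "(real^2 \<Rightarrow> complex^2) \<Rightarrow> real^2 \<Rightarrow> complex^2" where
  "kpush G y = (\<chi> i. \<Sum>j\<in>UNIV. of_real (kd y i j) * G (kelvin y) $ j)"

text \<open>The Jacobian at the image point is the inverse matrix, since \<open>kelvin\<close> is an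
  involution. By \<open>kd_square\<close> and symmetry the inverse is |x|^4 times the matrix
  itself.\<close>

lemma kd_kelvin: "x \<noteq> 0 \<Longrightarrow> kd (kelvin x) i j = norm x ^ 4 * kd x i j"
proof -
  assume x: "x \<noteq> 0"
  then have n: "norm x \<noteq> 0" by simp
  have "kelvin x $ i = x $ i / (norm x)\<^sup>2" for i by (simp add: kelvin_def divide_inverse mult.commute)
  moreover have "d * (1 / (1 / n)\<^sup>2) - 2 * (p / n\<^sup>2) * (q / n\<^sup>2) * (1 / ((1 / n)\<^sup>2)\<^sup>2)
      = n ^ 4 * (d * (1 / n\<^sup>2) - 2 * p * q * (1 / (n\<^sup>2)\<^sup>2))" if "n \<noteq> 0" for n d p q :: real
    using that by (simp add: field_simps eval_nat_numeral)
  ultimately show ?thesis unfolding kd_def norm_kelvin using n by simp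
qed

lemma integrable_kelvin_real:
  fixes h :: "real^2 \<Rightarrow> real"
  assumes "integrable lebesgue h" shows "integrable lebesgue (\<lambda>y. h (kelvin y) / norm y ^ 4)"
  using integrable_Re[OF kelvin_substitution(1)[OF integrable_of_real[OF assms]]] by (simp flip: of_real_divide of_real_power)

text \<open>Conformal invariance of the Dirichlet integral up to a constant: each squared entry of
  the Jacobian matrix is at most |y|^-4, the weight of the substitution.\<close>

lemma L2_kpush:
  assumes G: "L2 UNIV G" shows "L2 UNIV (kpush G)"
proof (rule L2_componentwise)
  fix i
  have Gj: "(\<lambda>x. G x $ j) \<in> borel_measurable lebesgue" "integrable lebesgue (\<lambda>x. (norm (G x $ j))\<^sup>2)" for j
    using L2_component[OF G, of j] unfolding L2_UNIV_iff by auto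
  have kdm: "(\<lambda>x. complex_of_real (kd x i j)) \<in> borel_measurable lebesgue" for i j
  proof -
    have [measurable]: "(\<lambda>x::real^2. x $ i) \<in> borel_measurable borel" for i
      by (intro borel_measurable_continuous_onI continuous_intros)
    have "(\<lambda>x. complex_of_real (kd x i j)) \<in> borel_measurable borel" unfolding kd_def[abs_def] by measurable
    then show ?thesis by (simp add: measurable_completion)
  qed
  have m: "(\<lambda>y. kpush G y $ i) \<in> borel_measurable lebesgue" unfolding kpush_def vec_lambda_beta
    by (intro borel_measurable_sum borel_measurable_times kdm borel_measurable_kelvin[OF Gj(1)])
  have kdb: "(kd y i j)\<^sup>2 \<le> 1 / norm y ^ 4" if "y \<noteq> 0" for y j
  proof -
    have "(kd y i j)\<^sup>2 \<le> (\<Sum>j\<in>UNIV. kd y i j * kd y i j)" unfolding power2_eq_square by (rule member_le_sum) auto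
    then show ?thesis using kd_square[OF that, of i i] by simp
  qed
  have int: "integrable lebesgue (\<lambda>y. 2 * (\<Sum>j\<in>UNIV. (norm (G (kelvin y) $ j))\<^sup>2 / norm y ^ 4))"
    by (intro integrable_mult_right Bochner_Integration.integrable_sum integrable_kelvin_real[OF Gj(2)])
  have "integrable lebesgue (\<lambda>y. (norm (kpush G y $ i))\<^sup>2)"
  proof (rule Bochner_Integration.integrable_bound[OF int])
    show "AE y in lebesgue. norm ((norm (kpush G y $ i))\<^sup>2) \<le> norm (2 * (\<Sum>j\<in>UNIV. (norm (G (kelvin y) $ j))\<^sup>2 / norm y ^ 4))"
      using AE_lebesgue_neq[of 0]
    proof eventually_elim
      case (elim y)
      have "(norm (kpush G y $ i))\<^sup>2 \<le> 2 * (\<Sum>j\<in>UNIV. (norm (of_real (kd y i j) * G (kelvin y) $ j))\<^sup>2)"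
        unfolding kpush_def vec_lambda_beta sum_2 distrib_left by (rule norm_add_power2_le)
      also have "\<dots> \<le> 2 * (\<Sum>j\<in>UNIV. (norm (G (kelvin y) $ j))\<^sup>2 / norm y ^ 4)"
      proof (intro mult_left_mono sum_mono)
        fix j
        show "(norm (of_real (kd y i j) * G (kelvin y) $ j))\<^sup>2 \<le> (norm (G (kelvin y) $ j))\<^sup>2 / norm y ^ 4"
          using mult_right_mono[OF kdb[OF elim, of j], of "(norm (G (kelvin y) $ j))\<^sup>2"] by (simp add: norm_mult power_mult_distrib)
      qed simp
      finally show ?case by simp
    qed
  qed (use m in measurable)
  with m show "L2 UNIV (\<lambda>y. kpush G y $ i)" unfolding L2_UNIV_iff by blast
qed simp

text \<open>The weak gradient of \<open>V\<close> is tested with the fields of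
  \<open>kelvin_field\<close>, whose divergence is the pulled back partial derivative with the
  Jacobian weight; the substitution then brings everything to the other side.\<close>

lemma kelvin_weak_gradient:
  assumes V: "has_weak_gradient UNIV V G" and \<phi>: "test_function UNIV \<phi>" "s > 0" "\<And>x. norm x < s \<Longrightarrow> \<phi> x = 0"
  shows "(LINT y|lebesgue. V (kelvin y) * grad \<phi> y $ i) = - (LINT y|lebesgue. kpush G y $ i * \<phi> y)"
proof -
  define X where "X j x = of_real (kd x i j) * \<phi> (kelvin x)" for j x
  obtain K where K: "compact K" "\<And>x. x \<notin> K \<Longrightarrow> \<phi> x = 0" using test_functionE[OF \<phi>(1)] by metis
  obtain M where M: "M > 0" "\<And>x. x \<in> K \<Longrightarrow> norm x \<le> M" using compact_imp_bounded[OF K(1)] unfolding bounded_pos by blast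
  \<comment> \<open>An annulus: \<open>\<phi>\<close> vanishes near 0, which bounds the support of
    the fields, and its compact support keeps them away from 0.\<close>
  define L :: "(real^2) set" where "L = cball 0 (1/s) - ball 0 (1/M)"
  have L: "compact L" "L \<subseteq> - {0}" unfolding L_def using M(1) by (auto intro: compact_diff)
  have XL: "X j x = 0" if "x \<notin> L" for j x
  proof (cases "x = 0")
    case False
    show ?thesis
    proof (cases "norm x < 1 / M")
      case True
      then have "norm (kelvin x) > M" unfolding norm_kelvin using False M(1) by (simp add: field_simps)
      then show ?thesis unfolding X_def using K(2) M(2)[of "kelvin x"] by fastforce
    next
      case F: False
      then have "norm x > 1 / s" using that unfolding L_def by auto
      then have "norm (kelvin x) < s" unfolding norm_kelvin using False \<phi>(2) by (simp add: field_simps)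
      then show ?thesis unfolding X_def using \<phi>(3) by simp
    qed
  qed (simp add: X_def kd_def)
  have hg: "has_grad (X j) (grad (X j) x) x" "(\<Sum>j\<in>UNIV. grad (X j) x $ j) = grad \<phi> (kelvin x) $ i / of_real (norm x ^ 4)" if "x \<noteq> 0" for j x
    using kelvin_field[OF that test_function_has_grad[OF \<phi>(1)], of i] unfolding X_def[abs_def] by auto
  have C: "Ckc 1 UNIV (X j)" for j
  proof (rule Ckc_1I[OF _ L(1,2) subset_UNIV XL])
    show "has_grad (X j) (grad (X j) x) x" if "x \<in> - {0}" for x using hg(1) that by simp
    show "continuous_on (- {0}) (\<lambda>x. grad (X j) x $ l)" for l
      unfolding X_def[abs_def] by (rule continuous_on_kelvin_field[OF \<phi>(1)])
  qed auto
  have LV: "L1_loc UNIV V" "L1_loc UNIV (\<lambda>x. G x $ j)" for j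
    using V L1_loc_component unfolding has_weak_gradient_def by blast+
  have i1: "integrable lebesgue (\<lambda>x. V x * grad (X j) x $ j)" for j
    by (rule Ckc_1E[OF C[of j]]) (rule L1_loc_integrable_mult[OF LV(1)], auto)
  have i2: "integrable lebesgue (\<lambda>x. G x $ j * X j x)" for j
    by (rule Ckc_1E[OF C[of j]]) (rule L1_loc_integrable_mult[OF LV(2)], auto)
  let ?p = "\<lambda>x. V x * (grad \<phi> (kelvin x) $ i / of_real (norm x ^ 4))" and ?q = "\<lambda>x. \<Sum>j\<in>UNIV. G x $ j * X j x"
  have ae: "AE x in lebesgue. (\<Sum>j\<in>UNIV. V x * grad (X j) x $ j) = ?p x"
    using AE_lebesgue_neq[of 0] by eventually_elim (simp add: hg(2) flip: sum_distrib_left)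
  have ip: "integrable lebesgue ?p" by (rule integrable_cong_AE_lebesgue[OF _ ae]) (use i1 in auto)
  have iq: "integrable lebesgue ?q" using i2 by auto
  have "(LINT x|lebesgue. ?p x) = (\<Sum>j\<in>UNIV. LINT x|lebesgue. V x * grad (X j) x $ j)"
    unfolding LINT_cong_AE[OF ae, symmetric] using i1 by (intro Bochner_Integration.integral_sum)
  also have "\<dots> = (\<Sum>j\<in>UNIV. - (LINT x|lebesgue. G x $ j * X j x))"
    by (intro sum.cong refl has_weak_gradient_Ckc[OF V open_UNIV C])
  also have "\<dots> = - (LINT x|lebesgue. ?q x)" using i2 by (simp add: sum_negf Bochner_Integration.integral_sum)
  finally have e: "(LINT x|lebesgue. ?p x) = - (LINT x|lebesgue. ?q x)" .
  have "AE y in lebesgue. ?p (kelvin y) / of_real (norm y ^ 4) = V (kelvin y) * grad \<phi> y $ i"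
    using AE_lebesgue_neq[of 0] by eventually_elim (simp add: norm_kelvin power_one_over)
  from LINT_cong_AE[OF this] kelvin_substitution(2)[OF ip]
  have p: "(LINT y|lebesgue. V (kelvin y) * grad \<phi> y $ i) = (LINT x|lebesgue. ?p x)" by simp
  have "AE y in lebesgue. ?q (kelvin y) / of_real (norm y ^ 4) = kpush G y $ i * \<phi> y"
    using AE_lebesgue_neq[of 0]
    by eventually_elim (simp add: X_def kpush_def kd_kelvin sum_distrib_left sum_distrib_right sum_divide_distrib mult_ac)
  from LINT_cong_AE[OF this] kelvin_substitution(2)[OF iq]
  have q: "(LINT y|lebesgue. kpush G y $ i * \<phi> y) = (LINT x|lebesgue. ?q x)" by simp
  show ?thesis unfolding p q by (rule e)
qed

text \<open>The dual computation, tested with \<open>kpull \<phi>\<close>. That function has compact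
  support because \<open>\<phi>\<close> vanishes near the origin.\<close>

lemma kelvin_weak_div:
  assumes G: "L1_loc UNIV G" and f: "L1_loc UNIV f" and w: "\<And>\<psi>. Ckc 1 UNIV \<psi> \<Longrightarrow> (LINT x|lebesgue. cdot (G x) (grad \<psi> x)) = - (LINT x|lebesgue. f x * \<psi> x)"
    and \<phi>: "test_function UNIV \<phi>" "s > 0" "\<And>x. norm x < s \<Longrightarrow> \<phi> x = 0"
  shows "(LINT y|lebesgue. cdot (kpush G y) (grad \<phi> y)) = - (LINT y|lebesgue. f (kelvin y) / of_real (norm y ^ 4) * \<phi> y)"
proof -
  let ?\<psi> = "kpull \<phi>"
  have z: "?\<psi> x = 0" if "x \<notin> cball 0 (1/s)" for x
  proof -
    have "norm x > 1 / s" using that by simp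
    moreover then have "x \<noteq> 0" using \<phi>(2) by auto
    ultimately have "norm (kelvin x) < s" unfolding norm_kelvin using \<phi>(2) by (simp add: field_simps)
    then show ?thesis by (simp add: kpull_def \<phi>(3))
  qed
  have "Ck (Suc 1) ?\<psi>" using Ck_2_kpull[OF \<phi>(1)] by (simp only: Suc_1)
  then have "Ck 1 ?\<psi>" by (rule Ck_SucD)
  then have C: "Ckc 1 UNIV ?\<psi>" unfolding Ckc_def using z compact_cball by blast
  have i1: "integrable lebesgue (\<lambda>x. G x $ j * grad ?\<psi> x $ j)" for j
    by (rule Ckc_1E[OF C]) (rule L1_loc_integrable_mult[OF L1_loc_component[OF G]], auto)
  have i2: "integrable lebesgue (\<lambda>x. f x * ?\<psi> x)"
    by (rule Ckc_1E[OF C]) (rule L1_loc_integrable_mult[OF f], auto)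
  note ip = cdot_integrable[of lebesgue G "grad ?\<psi>", OF i1]
  have "AE y in lebesgue. cdot (G (kelvin y)) (grad ?\<psi> (kelvin y)) / of_real (norm y ^ 4) = cdot (kpush G y) (grad \<phi> y)"
    using AE_lebesgue_neq[of 0]
  proof eventually_elim
    case (elim y)
    then have k: "kelvin y \<noteq> 0" by simp
    show ?case using elim unfolding cdot_def grad_kpull[OF k \<phi>(1)] kelvin_kelvin
      by (simp add: kd_kelvin kpush_def sum_2 field_simps)
  qed
  from LINT_cong_AE[OF this] kelvin_substitution(2)[OF ip]
  have p: "(LINT y|lebesgue. cdot (kpush G y) (grad \<phi> y)) = (LINT x|lebesgue. cdot (G x) (grad ?\<psi> x))" by simp
  have "AE y in lebesgue. f (kelvin y) * ?\<psi> (kelvin y) / of_real (norm y ^ 4) = f (kelvin y) / of_real (norm y ^ 4) * \<phi> y"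
    using AE_lebesgue_neq[of 0] by eventually_elim (simp add: kpull_def)
  from LINT_cong_AE[OF this] kelvin_substitution(2)[OF i2]
  have q: "(LINT y|lebesgue. f (kelvin y) / of_real (norm y ^ 4) * \<phi> y) = (LINT x|lebesgue. f x * ?\<psi> x)" by simp
  show ?thesis unfolding p q by (rule w[OF C])
qed

section \<open>Mollified and dilated zero extensions from the disk\<close>

lemma L2_disk_support_integrable:
  fixes g :: "real^'n \<Rightarrow> complex"
  assumes "L2 UNIV g" "\<And>x. x \<notin> ball 0 1 \<Longrightarrow> g x = 0"
  shows "integrable lebesgue g"
proof -
  have "integrable lebesgue (\<lambda>x. indicator (ball 0 1) x *\<^sub>R g x)"
    by (rule L2_ball_integrable[OF L2_subset[OF assms(1)]]) auto
  moreover have "(\<lambda>x. indicator (ball 0 1) x *\<^sub>R g x) = g" using assms(2) by (auto simp: indicator_def fun_eq_iff)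
  ultimately show ?thesis by simp
qed

lemma mol_zero:
  fixes g :: "real^'n \<Rightarrow> complex"
  assumes "integrable lebesgue g" "s > 0" "\<And>x. x \<notin> ball 0 1 \<Longrightarrow> g x = 0" "norm x > 1 + s"
  shows "mol s g x = 0"
proof -
  have "norm (g (x - s *\<^sub>R z) - 0) \<le> 0" if "norm z \<le> 1" for z
  proof -
    have "s * norm z \<le> s" using that assms(2) by simp
    moreover have "norm x - s * norm z \<le> norm (x - s *\<^sub>R z)" using norm_triangle_ineq2[of x "s *\<^sub>R z"] assms(2) by simp
    ultimately have "norm (x - s *\<^sub>R z) > 1" using assms(4) by linarith
    then show ?thesis using assms(3) by simp
  qed
  then have "norm (mol s g x - 0) \<le> 0" using assms(2) by (intro norm_mol_le[OF assms(1)]) auto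
  then show ?thesis by simp
qed

lemma test_function_mol_affine:
  fixes g :: "real^'n \<Rightarrow> complex"
  assumes g: "integrable lebesgue g" "\<And>x. x \<notin> ball 0 1 \<Longrightarrow> g x = 0" and s: "s > 0" and c: "c > 0" and D: "cball 0 ((1 + s) / c) \<subseteq> D"
  shows "test_function D (\<lambda>x. mol s g (c *\<^sub>R x))"
  unfolding test_function_iff
proof (intro conjI allI exI[of _ "cball 0 ((1 + s) / c)"] impI D)
  have "test_function UNIV (mol s g)"
  proof (rule test_function_mol[OF g(1) s compact_cball[of 0 "1 + s"] subset_UNIV])
    fix x z :: "real^'n" assume x: "x \<notin> cball 0 (1 + s)" "norm z \<le> 1"
    have "s * norm z \<le> s" using x(2) s by simp
    moreover have "norm x - s * norm z \<le> norm (x - s *\<^sub>R z)" using norm_triangle_ineq2[of x "s *\<^sub>R z"] s by simp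
    moreover have "norm x > 1 + s" using x(1) by simp
    ultimately have "norm (x - s *\<^sub>R z) > 1" by linarith
    then show "g (x - s *\<^sub>R z) = 0" using g(2) by simp
  qed
  then have "Ck k (mol s g)" for k unfolding test_function_def by blast
  from Ck_affine[OF this, of _ c 0] show "Ck k (\<lambda>x. mol s g (c *\<^sub>R x))" for k by simp
  fix x :: "real^'n" assume "x \<notin> cball 0 ((1 + s) / c)"
  then have "(1 + s) / c < norm x" by simp
  then have "norm (c *\<^sub>R x) > 1 + s" unfolding pos_divide_less_eq[OF c] using c by (simp add: mult.commute)
  with g s show "mol s g (c *\<^sub>R x) = 0" by (intro mol_zero) auto
qed simp

text \<open>The scalar \<open>b\<close> accounts for the chain rule: with \<open>b = c\<close> the
  statement concerns gradients of dilated mollifications, with \<open>b = 1\<close> the functions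
  themselves.\<close>

lemma scaled_mol_L2_tendsto:
  fixes g :: "real^'n \<Rightarrow> complex" and b c s :: "nat \<Rightarrow> real"
  assumes g: "L2 UNIV g" "\<And>x. x \<notin> ball 0 1 \<Longrightarrow> g x = 0"
    and b: "b \<longlonglongrightarrow> 1" and c: "c \<longlonglongrightarrow> 1" "\<And>n. c n > 0" and s: "s \<longlonglongrightarrow> 0" "\<And>n. s n > 0"
  shows "\<And>n. (\<lambda>x. of_real (b n) * mol (s n) g (c n *\<^sub>R x) - g x) \<in> borel_measurable lebesgue"
    "\<And>n. integrable lebesgue (\<lambda>x. (norm (of_real (b n) * mol (s n) g (c n *\<^sub>R x) - g x))\<^sup>2)"
    "(\<lambda>n. LINT x|lebesgue. (norm (of_real (b n) * mol (s n) g (c n *\<^sub>R x) - g x))\<^sup>2) \<longlonglongrightarrow> 0"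
proof -
  have gm: "g \<in> borel_measurable lebesgue" "integrable lebesgue (\<lambda>x. (norm (g x))\<^sup>2)" using g(1) unfolding L2_UNIV_iff by auto
  have gi: "integrable lebesgue g" by (rule L2_disk_support_integrable[OF g])
  define m where "m n x = mol (s n) g (c n *\<^sub>R x)" for n x
  have T: "test_function UNIV (m n)" for n
    unfolding m_def[abs_def] by (rule test_function_mol_affine[OF gi g(2) s(2) c(2) subset_UNIV])
  have mm: "m n \<in> borel_measurable lebesgue" for n by (rule continuous_lebesgue_measurable[OF test_function_continuous[OF T]])
  have mi: "integrable lebesgue (\<lambda>x. (norm (m n x))\<^sup>2)" for n
  proof -
    obtain K where K: "compact K" "\<And>x. x \<notin> K \<Longrightarrow> m n x = 0" using test_functionE[OF T] by metis
    show ?thesis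
      by (rule compact_support_integrable[OF continuous_on_power[OF continuous_on_norm[OF test_function_continuous[OF T]]] K(1)])
        (simp add: K(2))
  qed
  have m1: "integrable lebesgue (\<lambda>x. (norm (m n x - g x))\<^sup>2)" for n
  proof (rule Bochner_Integration.integrable_bound)
    show "integrable lebesgue (\<lambda>x. 2 * (norm (m n x))\<^sup>2 + 2 * (norm (g x))\<^sup>2)" using mi gm by simp
    show "AE x in lebesgue. norm ((norm (m n x - g x))\<^sup>2) \<le> norm (2 * (norm (m n x))\<^sup>2 + 2 * (norm (g x))\<^sup>2)"
      using norm_add_power2_le[of "m n _" "- g _"] by simp
  qed (use mm gm in measurable)
  let ?d = "\<lambda>n x. of_real (b n) * m n x - g x"
  have bd: "(norm (?d n x))\<^sup>2 \<le> 2 * (b n)\<^sup>2 * (norm (m n x - g x))\<^sup>2 + 2 * (b n - 1)\<^sup>2 * (norm (g x))\<^sup>2" for n x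
  proof -
    have "?d n x = of_real (b n) * (m n x - g x) + of_real (b n - 1) * g x" by (simp add: algebra_simps)
    then show ?thesis using norm_add_power2_le[of "of_real (b n) * (m n x - g x)" "of_real (b n - 1) * g x"]
      by (simp add: norm_mult power_mult_distrib del: of_real_diff)
  qed
  have bi: "integrable lebesgue (\<lambda>x. 2 * (b n)\<^sup>2 * (norm (m n x - g x))\<^sup>2 + 2 * (b n - 1)\<^sup>2 * (norm (g x))\<^sup>2)" for n
    using m1 gm(2) by (intro Bochner_Integration.integrable_add integrable_mult_right) auto
  have dm: "?d n \<in> borel_measurable lebesgue" for n using mm gm by measurable
  have di: "integrable lebesgue (\<lambda>x. (norm (?d n x))\<^sup>2)" for n
    by (rule Bochner_Integration.integrable_bound[OF bi[of n]]) (use dm bd in \<open>auto intro: order_trans[OF _ abs_ge_self]\<close>)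
  have cn: "c n \<noteq> 0" for n using c(2)[of n] by simp
  have lim: "(\<lambda>n. LINT x|lebesgue. (norm (m n x - g x))\<^sup>2) \<longlonglongrightarrow> 0"
    unfolding m_def by (rule mol_tendsto[OF gi gm(2) _ c(1) cn s]) simp
  let ?u = "\<lambda>n. 2 * (b n)\<^sup>2 * (LINT x|lebesgue. (norm (m n x - g x))\<^sup>2) + 2 * (b n - 1)\<^sup>2 * (LINT x|lebesgue. (norm (g x))\<^sup>2)"
  have "(\<lambda>n. LINT x|lebesgue. (norm (?d n x))\<^sup>2) \<longlonglongrightarrow> 0"
  proof (rule tendsto_sandwich[OF _ _ tendsto_const])
    show "eventually (\<lambda>n. 0 \<le> (LINT x|lebesgue. (norm (?d n x))\<^sup>2)) sequentially" by simp
    have "(LINT x|lebesgue. (norm (?d n x))\<^sup>2) \<le> ?u n" for n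
      using integral_mono[OF di[of n] bi[of n] bd] m1[of n] gm(2) by simp
    then show "eventually (\<lambda>n. (LINT x|lebesgue. (norm (?d n x))\<^sup>2) \<le> ?u n) sequentially"
      by simp
    have "?u \<longlonglongrightarrow> 2 * 1\<^sup>2 * 0 + 2 * (1 - 1)\<^sup>2 * (LINT x|lebesgue. (norm (g x))\<^sup>2)"
      by (intro tendsto_intros b lim)
    then show "?u \<longlonglongrightarrow> 0"
      by simp
  qed
  with dm di show "\<And>n. (\<lambda>x. of_real (b n) * mol (s n) g (c n *\<^sub>R x) - g x) \<in> borel_measurable lebesgue"
    "\<And>n. integrable lebesgue (\<lambda>x. (norm (of_real (b n) * mol (s n) g (c n *\<^sub>R x) - g x))\<^sup>2)"
    "(\<lambda>n. LINT x|lebesgue. (norm (of_real (b n) * mol (s n) g (c n *\<^sub>R x) - g x))\<^sup>2) \<longlonglongrightarrow> 0"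
    unfolding m_def by blast+
qed

text \<open>The offset 3 gives scales of at most 1/3, so that the dilation factors 1 - 2s stay
  positive.\<close>

lemma radii:
  defines "s \<equiv> \<lambda>n. 1 / real (n + 3)"
  shows "s \<longlonglongrightarrow> 0" "\<And>n. s n > 0" "\<And>n. s n < 1/2" "(\<lambda>n. 1 + 2 * s n) \<longlonglongrightarrow> 1" "(\<lambda>n. 1 - 2 * s n) \<longlonglongrightarrow> 1"
proof -
  show s: "s \<longlonglongrightarrow> 0" unfolding s_def by (rule LIMSEQ_ignore_initial_segment[OF lim_const_over_n])
  show "s n > 0" "s n < 1/2" for n by (auto simp: s_def)
  have "(\<lambda>n. 1 + 2 * s n) \<longlonglongrightarrow> 1 + 2 * 0" "(\<lambda>n. 1 - 2 * s n) \<longlonglongrightarrow> 1 - 2 * 0" by (intro tendsto_intros s)+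
  then show "(\<lambda>n. 1 + 2 * s n) \<longlonglongrightarrow> 1" "(\<lambda>n. 1 - 2 * s n) \<longlonglongrightarrow> 1" by simp_all
qed

lemma grad_scaled_mol:
  fixes u :: "real^'n \<Rightarrow> complex"
  assumes w: "has_weak_gradient D u G" and D: "open D"
    and int: "integrable lebesgue (\<lambda>x. indicator D x *\<^sub>R u x)" "integrable lebesgue (\<lambda>x. indicator D x *\<^sub>R (G x $ i))"
    and s: "s > 0" "cball (c *\<^sub>R x) s \<subseteq> D" and T: "test_function UNIV (mol s (\<lambda>x. indicator D x *\<^sub>R u x))"
  shows "grad (\<lambda>x. mol s (\<lambda>x. indicator D x *\<^sub>R u x) (c *\<^sub>R x)) x $ i = of_real c * mol s (\<lambda>x. indicator D x *\<^sub>R (G x $ i)) (c *\<^sub>R x)"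
proof -
  have "mol s (\<lambda>x. indicator D x *\<^sub>R u x) differentiable (at (c *\<^sub>R x + 0))"
    using T unfolding test_function_def by (metis Ck.simps(2))
  from grad_affine[OF this] show ?thesis using grad_mol[OF w D int s] by simp
qed

text \<open>Dilations move the support of the mollified zero extension into the disk.\<close>

lemma zero_extension_H1_0:
  fixes w :: "real^2 \<Rightarrow> complex"
  assumes w: "L2 UNIV w" and G: "L2 UNIV G" and wg: "has_weak_gradient UNIV w G"
    and z: "\<And>x. x \<notin> ball 0 1 \<Longrightarrow> w x = 0" "\<And>x. x \<notin> ball 0 1 \<Longrightarrow> G x = 0"
  shows "H1_0 (ball 0 1) w" "AE x\<in>ball 0 1 in lebesgue. wgrad (ball 0 1) w x = G x"
proof -
  let ?W = "wgrad (ball 0 1) w" and ?M = "lebesgue_on (ball 0 (1::real)) :: (real^2) measure"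
  have wgB: "has_weak_gradient (ball 0 1) w G" by (rule has_weak_gradient_subset[OF wg]) auto
  show ae: "AE x\<in>ball 0 1 in lebesgue. ?W x = G x" by (rule wgrad_eq[OF wgB open_ball])
  have "L2 (ball 0 1) G" by (rule L2_subset[OF G]) auto
  then have "L2 (ball 0 1) ?W" by (rule L2_cong_AE) (use ae in \<open>auto elim: eventually_mono\<close>)
  moreover have "L2 (ball 0 1) w" by (rule L2_subset[OF w]) auto
  ultimately have H1: "H1 (ball 0 1) w" using wgB unfolding H1_def weakly_differentiable_def by blast
  have Gi: "L2 UNIV (\<lambda>x. G x $ i)" "\<And>x. x \<notin> ball 0 1 \<Longrightarrow> G x $ i = 0" for i using L2_component[OF G] z(2) by auto
  note int = L2_disk_support_integrable
  define s where "s n = 1 / real (n + 3)" for n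
  note R = radii[folded s_def]
  define c where "c n = 1 + 2 * s n" for n
  have c: "c \<longlonglongrightarrow> 1" "\<And>n. c n > 0" using R(4) R(2) unfolding c_def by (auto intro: add_pos_pos)
  define \<phi> where "\<phi> n x = mol (s n) w (c n *\<^sub>R x)" for n x
  have T: "test_function (ball 0 1) (\<phi> n)" for n
    unfolding \<phi>_def[abs_def]
  proof (rule test_function_mol_affine[OF int[OF w z(1)] z(1) R(2) c(2)])
    \<comment> \<open>Mollification enlarges the support to radius 1 + s, and the dilation by 1 + 2s
      brings it back strictly inside the disk.\<close>
    have "(1 + s n) / c n < 1" using c(2)[of n] R(2)[of n] by (simp add: c_def)
    then show "cball 0 ((1 + s n) / c n) \<subseteq> ball 0 1" by auto
  qed
  have T1: "test_function UNIV (mol (s n) w)" for n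
    using test_function_mol_affine[OF int[OF w z(1)] z(1) R(2)[of n] zero_less_one subset_UNIV] by simp
  have g: "grad (\<phi> n) x $ i = of_real (c n) * mol (s n) (\<lambda>x. G x $ i) (c n *\<^sub>R x)" for n x i
    using grad_scaled_mol[OF wg open_UNIV, of i "s n" "c n" x] int[OF w z(1)] int[OF Gi] R(2) T1 unfolding \<phi>_def[abs_def] by simp
  note L0 = scaled_mol_L2_tendsto[OF w z(1) tendsto_const c R(1,2)]
  note Li = scaled_mol_L2_tendsto[OF Gi c(1) c R(1,2)]
  have "(\<lambda>n. LINT x|?M. (norm (\<phi> n x - w x))\<^sup>2) \<longlonglongrightarrow> 0"
  proof -
    have "(LINT x|?M. (norm (\<phi> n x - w x))\<^sup>2) = (LINT x|lebesgue. (norm (\<phi> n x - w x))\<^sup>2)" for n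
    proof (rule LINT_lebesgue_on_eq)
      fix x :: "real^2" assume x: "x \<notin> ball 0 1"
      obtain K where "K \<subseteq> ball 0 1" "\<And>x. x \<notin> K \<Longrightarrow> \<phi> n x = 0" using test_functionE[OF T] by metis
      then have "\<phi> n x = 0" using x by blast
      then show "(norm (\<phi> n x - w x))\<^sup>2 = 0" using z(1)[OF x] by simp
    qed simp
    then show ?thesis using L0(3) unfolding \<phi>_def by simp
  qed
  moreover have "(\<lambda>n. LINT x|?M. (norm (grad (\<phi> n) x - ?W x))\<^sup>2) \<longlonglongrightarrow> 0"
  proof (rule tendsto_sandwich[OF _ _ tendsto_const])
    let ?e = "\<lambda>i n x. (norm (of_real (c n) * mol (s n) (\<lambda>x. G x $ i) (c n *\<^sub>R x) - G x $ i))\<^sup>2"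
    show "eventually (\<lambda>n. 0 \<le> (LINT x|?M. (norm (grad (\<phi> n) x - ?W x))\<^sup>2)) sequentially" by simp
    show "eventually (\<lambda>n. (LINT x|?M. (norm (grad (\<phi> n) x - ?W x))\<^sup>2) \<le> (\<Sum>i\<in>UNIV. LINT x|lebesgue. ?e i n x)) sequentially"
    proof (intro always_eventually allI)
      fix n
      have S: "integrable lebesgue (\<lambda>x. \<Sum>i\<in>UNIV. ?e i n x)" using Li(2) by (intro Bochner_Integration.integrable_sum)
      have "(LINT x|?M. (norm (grad (\<phi> n) x - ?W x))\<^sup>2) = (LINT x|lebesgue. indicator (ball 0 1) x *\<^sub>R (norm (grad (\<phi> n) x - ?W x))\<^sup>2)"
        by (subst integral_restrict_space) auto
      also have "\<dots> = (LINT x|lebesgue. indicator (ball 0 1) x *\<^sub>R (\<Sum>i\<in>UNIV. ?e i n x))"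
      proof (rule LINT_cong_AE)
        show "AE x in lebesgue. indicator (ball 0 1) x *\<^sub>R (norm (grad (\<phi> n) x - ?W x))\<^sup>2 = indicator (ball 0 1) x *\<^sub>R (\<Sum>i\<in>UNIV. ?e i n x)"
          using ae by eventually_elim (auto simp: indicator_def norm_vec_power2 g)
      qed
      also have "\<dots> \<le> (LINT x|lebesgue. (\<Sum>i\<in>UNIV. ?e i n x))"
        by (rule integral_mono[OF integrable_mult_indicator[OF _ S] S]) (auto simp: indicator_def sum_nonneg)
      also have "\<dots> = (\<Sum>i\<in>UNIV. LINT x|lebesgue. ?e i n x)" by (rule Bochner_Integration.integral_sum[OF Li(2)])
      finally show "(LINT x|?M. (norm (grad (\<phi> n) x - ?W x))\<^sup>2) \<le> (\<Sum>i\<in>UNIV. LINT x|lebesgue. ?e i n x)" .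
    qed
    have "(\<lambda>n. \<Sum>i\<in>UNIV. LINT x|lebesgue. ?e i n x) \<longlonglongrightarrow> (\<Sum>i\<in>(UNIV::2 set). 0)" by (intro tendsto_sum Li(3))
    then show "(\<lambda>n. \<Sum>i\<in>UNIV. LINT x|lebesgue. ?e i n x) \<longlonglongrightarrow> 0" by simp
  qed
  ultimately show "H1_0 (ball 0 1) w" unfolding H1_0_def using H1 T by blast
qed

text \<open>A function in H1 of the disk is approximated there by global test functions: it is
  extended by 0, mollified, and dilated outwards. The divergence identity holds for these on the
  plane, while \<open>G\<close> and \<open>h\<close> see only the disk, so the limit is the zero
  normal trace.\<close>

lemma zero_extension_normal_trace:
  fixes h :: "real^2 \<Rightarrow> complex"
  assumes G: "L2 UNIV G" "\<And>x. x \<notin> ball 0 1 \<Longrightarrow> G x = 0" and h: "L2 UNIV h" "AE x in lebesgue. x \<notin> ball 0 1 \<longrightarrow> h x = 0"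
    and div: "\<And>\<phi>. test_function UNIV \<phi> \<Longrightarrow> (LINT x|lebesgue. cdot (G x) (grad \<phi> x)) = - (LINT x|lebesgue. h x * \<phi> x)"
    and W: "AE x\<in>ball 0 1 in lebesgue. W x = G x"
  shows "weak_div (ball 0 1) W h" "normal_trace_0 (ball 0 1) W h"
proof -
  have Gi: "(\<lambda>x. G x $ i) \<in> borel_measurable lebesgue" "integrable lebesgue (\<lambda>x. (norm (G x $ i))\<^sup>2)" for i
    using L2_component[OF G(1), of i] unfolding L2_UNIV_iff by auto
  have hm: "h \<in> borel_measurable lebesgue" "integrable lebesgue (\<lambda>x. (norm (h x))\<^sup>2)" using h(1) unfolding L2_UNIV_iff by auto
  show "weak_div (ball 0 1) W h"
    unfolding weak_div_def LINT_ball
  proof (intro allI impI)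
    fix \<phi> :: "real^2 \<Rightarrow> complex" assume \<phi>: "test_function (ball 0 1) \<phi>"
    have 1: "AE x in lebesgue. indicator (ball 0 1) x *\<^sub>R cdot (W x) (grad \<phi> x) = cdot (G x) (grad \<phi> x)"
      using W by eventually_elim (auto simp: indicator_def G(2) cdot_def)
    have 2: "AE x in lebesgue. indicator (ball 0 1) x *\<^sub>R (h x * \<phi> x) = h x * \<phi> x"
      using h(2) by eventually_elim (auto simp: indicator_def)
    show "(LINT x|lebesgue. indicator (ball 0 1) x *\<^sub>R cdot (W x) (grad \<phi> x)) = - (LINT x|lebesgue. indicator (ball 0 1) x *\<^sub>R (h x * \<phi> x))"
      unfolding LINT_cong_AE[OF 1] LINT_cong_AE[OF 2] by (rule div[OF test_function_subset[OF \<phi> subset_UNIV]])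
  qed
  show "normal_trace_0 (ball 0 1) W h"
    unfolding normal_trace_0_def LINT_ball
  proof (intro allI impI)
    fix \<phi> :: "real^2 \<Rightarrow> complex" assume "H1 (ball 0 1) \<phi>"
    let ?H = "wgrad (ball 0 1) \<phi>"
    have \<phi>: "L2 (ball 0 1) \<phi>" "L2 (ball 0 1) ?H" and wg: "has_weak_gradient (ball 0 1) \<phi> ?H"
      using \<open>H1 (ball 0 1) \<phi>\<close> wgrad_works unfolding H1_def weakly_differentiable_def by blast+
    define p where "p x = indicator (ball 0 1) x *\<^sub>R \<phi> x" for x
    define q where "q i x = indicator (ball 0 1) x *\<^sub>R (?H x $ i)" for i x
    have z: "x \<notin> ball 0 1 \<Longrightarrow> p x = 0" "x \<notin> ball 0 1 \<Longrightarrow> q i x = 0" for x i by (auto simp: p_def q_def)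
    have ext: "L2 UNIV (\<lambda>x. indicator (ball 0 1) x *\<^sub>R u x)" if "L2 (ball 0 1) u" for u :: "real^2 \<Rightarrow> complex"
    proof -
      have "indicator (ball 0 1) x * (norm (u x))\<^sup>2 = (norm (indicator (ball 0 1) x *\<^sub>R u x))\<^sup>2" for x by (simp add: indicator_def)
      then show ?thesis using that unfolding L2_iff[OF lmeasurable_ball[THEN fmeasurableD]] L2_UNIV_iff by simp
    qed
    have p: "L2 UNIV p" unfolding p_def[abs_def] by (rule ext[OF \<phi>(1)])
    have q: "L2 UNIV (q i)" for i unfolding q_def[abs_def] by (rule ext[OF L2_component[OF \<phi>(2)]]) simp
    have pm: "p \<in> borel_measurable lebesgue" "integrable lebesgue (\<lambda>x. (norm (p x))\<^sup>2)" using p unfolding L2_UNIV_iff by auto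
    have qm: "q i \<in> borel_measurable lebesgue" "integrable lebesgue (\<lambda>x. (norm (q i x))\<^sup>2)" for i using q unfolding L2_UNIV_iff by auto
    have ip: "integrable lebesgue p" unfolding p_def[abs_def] by (rule L2_ball_integrable[OF \<phi>(1)])
    have iq: "integrable lebesgue (q i)" for i unfolding q_def[abs_def] by (rule L2_ball_integrable[OF L2_component[OF \<phi>(2)]]) simp
    define s where "s n = 1 / real (n + 3)" for n
    note R = radii[folded s_def]
    \<comment> \<open>With factor 1 - 2s the mollification at a point of the disk averages over
      points of norm at most 1 - s, so the jump of the zero extension is never seen and the gradient
      formula holds in the whole disk.\<close>
    define c where "c n = 1 - 2 * s n" for n
    have c: "c \<longlonglongrightarrow> 1" "c n > 0" for n using R(5) R(3)[of n] unfolding c_def by auto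
    define \<psi> where "\<psi> n x = mol (s n) p (c n *\<^sub>R x)" for n x
    have T: "test_function UNIV (\<psi> n)" for n
      unfolding \<psi>_def[abs_def] by (rule test_function_mol_affine[OF ip z(1) R(2) c(2) subset_UNIV])
    have T1: "test_function UNIV (mol (s n) p)" for n
      using test_function_mol_affine[OF ip z(1) R(2)[of n] zero_less_one subset_UNIV] by simp
    have g: "grad (\<psi> n) x $ i = of_real (c n) * mol (s n) (q i) (c n *\<^sub>R x)" if "x \<in> ball 0 1" for n x i
      unfolding \<psi>_def[abs_def] p_def[abs_def] q_def[abs_def]
    proof (rule grad_scaled_mol[OF wg open_ball ip[unfolded p_def[abs_def]] iq[unfolded q_def[abs_def]] R(2) _ T1[unfolded p_def[abs_def]]])
      show "cball (c n *\<^sub>R x) (s n) \<subseteq> ball 0 1"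
      proof
        fix y assume "y \<in> cball (c n *\<^sub>R x) (s n)"
        then have "norm y \<le> norm (c n *\<^sub>R x) + s n" using norm_triangle_sub[of y "c n *\<^sub>R x"] by (simp add: dist_norm norm_minus_commute)
        moreover have "norm (c n *\<^sub>R x) \<le> c n" using that c(2)[of n] by (simp add: mult_le_cancel_left1)
        ultimately show "y \<in> ball 0 1" using R(2)[of n] by (simp add: c_def)
      qed
    qed
    note Lp = scaled_mol_L2_tendsto[OF p z(1) tendsto_const c R(1,2)]
    note Lq = scaled_mol_L2_tendsto[OF q z(2) c(1) c R(1,2)]
    let ?d = "\<lambda>i n x. of_real (c n) * mol (s n) (q i) (c n *\<^sub>R x) - q i x" and ?e = "\<lambda>n x. of_real 1 * mol (s n) p (c n *\<^sub>R x) - p x"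
    note Pq = L2_product_tendsto_0[OF Lq Gi]
    note Pp = L2_product_tendsto_0[OF Lp hm]
    have iqG: "integrable lebesgue (\<lambda>x. q i x * G x $ i)" for i by (rule L2_mult_integrable[OF qm Gi])
    have iph: "integrable lebesgue (\<lambda>x. p x * h x)" by (rule L2_mult_integrable[OF pm hm])
    have E: "(\<Sum>i\<in>UNIV. (LINT x|lebesgue. ?d i n x * G x $ i) + (LINT x|lebesgue. q i x * G x $ i))
      = - ((LINT x|lebesgue. ?e n x * h x) + (LINT x|lebesgue. p x * h x))" for n
    proof -
      have e: "cdot (G x) (grad (\<psi> n) x) = (\<Sum>i\<in>UNIV. ?d i n x * G x $ i + q i x * G x $ i)" for x
        by (cases "x \<in> ball 0 1") (auto simp: cdot_def g G(2) algebra_simps simp del: mem_ball)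
      have e2: "h x * \<psi> n x = ?e n x * h x + p x * h x" for x by (simp add: \<psi>_def algebra_simps)
      show ?thesis using div[OF T[of n]] unfolding e e2
        using Pq(1) iqG Pp(1) iph by (simp add: Bochner_Integration.integral_sum)
    qed
    have "(\<lambda>n. \<Sum>i\<in>UNIV. (LINT x|lebesgue. ?d i n x * G x $ i) + (LINT x|lebesgue. q i x * G x $ i))
      \<longlonglongrightarrow> (\<Sum>i\<in>UNIV. 0 + (LINT x|lebesgue. q i x * G x $ i))"
      by (intro tendsto_sum tendsto_add tendsto_const Pq(2))
    moreover have "(\<lambda>n. - ((LINT x|lebesgue. ?e n x * h x) + (LINT x|lebesgue. p x * h x))) \<longlonglongrightarrow> - (0 + (LINT x|lebesgue. p x * h x))"
      by (intro tendsto_minus tendsto_add tendsto_const Pp(2))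
    ultimately have lim: "(\<Sum>i\<in>UNIV. LINT x|lebesgue. q i x * G x $ i) = - (LINT x|lebesgue. p x * h x)"
      unfolding E by (simp add: LIMSEQ_unique)
    have "AE x in lebesgue. indicator (ball 0 1) x *\<^sub>R (cdot (W x) (?H x) + h x * \<phi> x) = (\<Sum>i\<in>UNIV. q i x * G x $ i) + p x * h x"
      using W by eventually_elim (auto simp: indicator_def q_def p_def cdot_def mult.commute)
    from LINT_cong_AE[OF this]
    show "(LINT x|lebesgue. indicator (ball 0 1) x *\<^sub>R (cdot (W x) (?H x) + h x * \<phi> x)) = 0"
      using lim iqG iph by (simp add: Bochner_Integration.integral_sum)
  qed
qed

lemma L1_loc_imp_borel_measurable:
  fixes u :: "real^'n \<Rightarrow> complex"
  assumes "L1_loc UNIV u" shows "u \<in> borel_measurable lebesgue"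
proof (rule borel_measurable_LIMSEQ_metric)
  show "(\<lambda>x. indicator (cball 0 (real n)) x *\<^sub>R u x) \<in> borel_measurable lebesgue" for n
    using assms compact_cball unfolding L1_loc_def set_integrable_def by (intro borel_measurable_integrable) blast
  fix x :: "real^'n"
  obtain N where "norm x \<le> real N" using real_arch_simple by blast
  then have "eventually (\<lambda>n. indicator (cball 0 (real n)) x *\<^sub>R u x = u x) sequentially"
    unfolding eventually_sequentially by (intro exI[of _ N]) (auto simp: indicator_def)
  then show "(\<lambda>n. indicator (cball 0 (real n)) x *\<^sub>R u x) \<longlonglongrightarrow> u x" by (rule tendsto_eventually)
qed

text \<open>Three regions: for |y| > 1 the difference is 0; where \<open>kelvin y\<close> is beyond
  \<open>R\<close> it is bounded, and the disk has finite area; on the rest |y|^-4 is at least 1, so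
  the substitution formula dominates.\<close>

lemma kelvin_pull_L2:
  fixes V :: "real^2 \<Rightarrow> complex"
  assumes V: "V \<in> borel_measurable lebesgue" "\<And>K. compact K \<Longrightarrow> L2 K V" "tends_to_0_at_infinity V"
    and c: "AE x in lebesgue. norm x < 1 \<longrightarrow> V x = c"
  shows "L2 UNIV (\<lambda>y. V (kelvin y) - c)"
proof -
  have "\<exists>R. AE x in lebesgue. norm x > R \<longrightarrow> norm (V x) < 1" using V(3) zero_less_one unfolding tends_to_0_at_infinity_def by blast
  then obtain R where R: "AE x in lebesgue. norm x > R \<longrightarrow> norm (V x) < 1" by blast
  define h where "h x = indicator (cball 0 R) x * (norm (V x - c))\<^sup>2" for x
  have b: "integrable lebesgue (\<lambda>x. indicator S x * k)" if "S \<in> lmeasurable" for S :: "(real^2) set" and k :: real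
    using that by (intro integrable_mult_left) (auto simp: integrable_real_indicator fmeasurable_def)
  have "(\<lambda>x. (norm (V x - c))\<^sup>2) \<in> borel_measurable lebesgue" using V(1) by measurable
  then have hm: "h \<in> borel_measurable lebesgue" unfolding h_def[abs_def]
    by (intro borel_measurable_times borel_measurable_indicator) auto
  have h: "integrable lebesgue h"
  proof (rule Bochner_Integration.integrable_bound[OF _ hm])
    have "integrable lebesgue (\<lambda>x. indicator (cball 0 R) x * (norm (V x))\<^sup>2)"
      using V(2)[OF compact_cball[of 0 R]] by (simp add: L2_iff)
    then show "integrable lebesgue (\<lambda>x. 2 * (indicator (cball 0 R) x * (norm (V x))\<^sup>2) + indicator (cball 0 R) x * (2 * (norm c)\<^sup>2))"
      by (intro Bochner_Integration.integrable_add integrable_mult_right b) auto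
    show "AE x in lebesgue. norm (h x) \<le> norm (2 * (indicator (cball 0 R) x * (norm (V x))\<^sup>2) + indicator (cball 0 R) x * (2 * (norm c)\<^sup>2))"
      using norm_add_power2_le[of "V _" "- c"] by (auto simp: h_def indicator_def)
  qed
  have int: "integrable lebesgue (\<lambda>y. h (kelvin y) / norm y ^ 4 + indicator (ball 0 1) y * (1 + norm c)\<^sup>2)"
    by (intro Bochner_Integration.integrable_add b integrable_kelvin_real h) simp
  have m: "(\<lambda>y. V (kelvin y) - c) \<in> borel_measurable lebesgue" using borel_measurable_kelvin[OF V(1)] by auto
  have "integrable lebesgue (\<lambda>y. (norm (V (kelvin y) - c))\<^sup>2)"
  proof (rule Bochner_Integration.integrable_bound[OF int])
    show "AE y in lebesgue. norm ((norm (V (kelvin y) - c))\<^sup>2) \<le> norm (h (kelvin y) / norm y ^ 4 + indicator (ball 0 1) y * (1 + norm c)\<^sup>2)"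
      using AE_kelvin[OF R] AE_kelvin[OF c] AE_lebesgue_neq[of 0] AE_norm_neq_1
    proof eventually_elim
      case (elim y)
      have h0: "0 \<le> h (kelvin y) / norm y ^ 4" by (simp add: h_def)
      consider "norm y > 1" | "norm y < 1" "norm (kelvin y) > R" | "norm y < 1" "norm (kelvin y) \<le> R" using elim(4) by linarith
      then have "(norm (V (kelvin y) - c))\<^sup>2 \<le> h (kelvin y) / norm y ^ 4 + indicator (ball 0 1) y * (1 + norm c)\<^sup>2"
      proof cases
        case 1
        then have "V (kelvin y) = c" using elim(2) norm_kelvin_less_1[of y] by simp
        then show ?thesis using h0 by simp
      next
        case 2
        then have "norm (V (kelvin y)) < 1" using elim(1) by simp
        then have "norm (V (kelvin y) - c) \<le> 1 + norm c" using norm_triangle_ineq4[of "V (kelvin y)" c] by linarith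
        then have "(norm (V (kelvin y) - c))\<^sup>2 \<le> (1 + norm c)\<^sup>2" by (rule power_mono) simp
        moreover have i: "indicator (ball 0 1) y = (1::real)" using 2 by simp
        ultimately show ?thesis unfolding i using h0 by linarith
      next
        case 3
        have "norm y ^ 4 \<le> 1" "norm y ^ 4 > 0" using 3 elim(3) by (auto simp: power_le_one)
        then have "h (kelvin y) * 1 \<le> h (kelvin y) * (1 / norm y ^ 4)" by (intro mult_left_mono) (auto simp: h_def)
        then have "h (kelvin y) \<le> h (kelvin y) / norm y ^ 4" by simp
        moreover have "h (kelvin y) = (norm (V (kelvin y) - c))\<^sup>2" using 3 by (simp add: h_def)
        moreover have "0 \<le> indicator (ball 0 1) y * (1 + norm c)\<^sup>2" by simp
        ultimately show ?thesis by linarith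
      qed
      then show ?case by simp
    qed
  qed (use m in measurable)
  with m show ?thesis unfolding L2_UNIV_iff by blast
qed

text \<open>The square carries |y|^-8. One factor |y|^-4 is the Jacobian, and the other is at most
  R^4 wherever the function does not vanish.\<close>

lemma kelvin_push_L2:
  fixes f :: "real^2 \<Rightarrow> complex"
  assumes f: "L2 UNIV f" "AE x in lebesgue. norm x > R \<longrightarrow> f x = 0"
  shows "L2 UNIV (\<lambda>y. f (kelvin y) / of_real (norm y ^ 4))"
proof -
  have fm: "f \<in> borel_measurable lebesgue" "integrable lebesgue (\<lambda>x. (norm (f x))\<^sup>2)" using f(1) unfolding L2_UNIV_iff by auto
  have nm: "(\<lambda>y::real^2. complex_of_real (norm y ^ 4)) \<in> borel_measurable lebesgue"
    by (intro continuous_lebesgue_measurable continuous_intros)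
  have m: "(\<lambda>y. f (kelvin y) / of_real (norm y ^ 4)) \<in> borel_measurable lebesgue"
    using borel_measurable_kelvin[OF fm(1)] nm by measurable
  have int: "integrable lebesgue (\<lambda>y. R ^ 4 * ((norm (f (kelvin y)))\<^sup>2 / norm y ^ 4))"
    by (rule integrable_mult_right[OF integrable_kelvin_real[OF fm(2)]])
  have "integrable lebesgue (\<lambda>y. (norm (f (kelvin y) / of_real (norm y ^ 4)))\<^sup>2)"
  proof (rule Bochner_Integration.integrable_bound[OF int])
    show "AE y in lebesgue. norm ((norm (f (kelvin y) / of_real (norm y ^ 4)))\<^sup>2) \<le> norm (R ^ 4 * ((norm (f (kelvin y)))\<^sup>2 / norm y ^ 4))"
      using AE_kelvin[OF f(2)] AE_lebesgue_neq[of 0]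
    proof eventually_elim
      case (elim y)
      show ?case
      proof (cases "1 / norm y > R")
        case True
        then show ?thesis using elim(1) by (simp add: norm_kelvin)
      next
        case False
        have "(1 / norm y) ^ 4 \<le> R ^ 4" using False by (intro power_mono) auto
        then have "(1 / norm y) ^ 4 * ((norm (f (kelvin y)))\<^sup>2 / norm y ^ 4) \<le> R ^ 4 * ((norm (f (kelvin y)))\<^sup>2 / norm y ^ 4)"
          by (rule mult_right_mono) simp
        moreover have "(norm (f (kelvin y) / of_real (norm y ^ 4)))\<^sup>2 = (1 / norm y) ^ 4 * ((norm (f (kelvin y)))\<^sup>2 / norm y ^ 4)"
          by (simp add: norm_divide norm_power power_divide power2_eq_square)
        ultimately show ?thesis by simp
      qed
    qed
  qed (use m in measurable)
  with m show ?thesis unfolding L2_UNIV_iff by blast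
qed

lemma has_weak_gradient_const:
  fixes D :: "(real^'n) set"
  assumes "open D" shows "has_weak_gradient D (\<lambda>x. c) (\<lambda>x. 0)"
  by (rule has_weak_gradient_C1[OF assms has_grad_const]) simp

section \<open>Constructing a Cauchy solution\<close>

text \<open>Constancy in the disk makes V composed with \<open>kelvin\<close>, minus
  \<open>c\<close>, vanish outside the disk. Its gradient and divergence equations hold on the whole
  plane, so restricting them to the disk produces both zero boundary conditions.\<close>

lemma compatible_if_constant_in_disk:
  assumes f: "L2 UNIV f" "AE x in lebesgue. norm x < 1 \<longrightarrow> f x = 0" "AE x in lebesgue. norm x > R \<longrightarrow> f x = 0"
    and V: "has_weak_gradient UNIV V G" "L2 UNIV G" "\<And>K. compact K \<Longrightarrow> L2 K V" "tends_to_0_at_infinity V"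
    and eq: "\<And>\<phi>. test_function UNIV \<phi> \<Longrightarrow> (LINT x|lebesgue. V x * lap \<phi> x) = (LINT x|lebesgue. f x * \<phi> x)"
    and c: "AE x in lebesgue. norm x < 1 \<longrightarrow> V x = c"
  shows "compatible f"
proof -
  have Lf: "L1_loc UNIV f" by (rule L2_imp_L1_loc[OF f(1)]) simp
  have LV: "L1_loc UNIV V" "L1_loc UNIV G" using V(1) unfolding has_weak_gradient_def by blast+
  have "weak_div UNIV G f"
    unfolding weak_div_def lebesgue_on_UNIV_eq
  proof (intro allI impI)
    fix \<phi> :: "real^2 \<Rightarrow> complex" assume \<phi>: "test_function UNIV \<phi>"
    show "(LINT x|lebesgue. cdot (G x) (grad \<phi> x)) = - (LINT x|lebesgue. f x * \<phi> x)"
      unfolding eq[OF \<phi>, symmetric] weak_gradient_lap[OF V(1) open_UNIV \<phi>] by simp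
  qed
  note div = weak_div_Ckc[OF this LV(2) Lf open_UNIV]
  let ?w = "\<lambda>y. V (kelvin y) - c" and ?h = "\<lambda>y. f (kelvin y) / of_real (norm y ^ 4)"
  have w2: "L2 UNIV ?w" by (rule kelvin_pull_L2[OF L1_loc_imp_borel_measurable[OF LV(1)] V(3,4) c])
  have G2: "L2 UNIV (kpush G)" by (rule L2_kpush[OF V(2)])
  have h2: "L2 UNIV ?h" by (rule kelvin_push_L2[OF f(1,3)])
  have Vc: "has_weak_gradient UNIV (\<lambda>x. V x - c) G"
    using has_weak_gradient_lincomb[OF V(1) has_weak_gradient_const[OF open_UNIV, of c] open_UNIV, of 1 "-1"] by simp
  have Lw: "L1_loc UNIV ?w" "L1_loc UNIV (kpush G)" "L1_loc UNIV ?h"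
    by (rule L2_imp_L1_loc[OF w2], simp) (rule L2_imp_L1_loc[OF G2] L2_imp_L1_loc[OF h2], simp)+
  have wg: "has_weak_gradient UNIV ?w (kpush G)"
  proof (rule has_weak_gradientI[OF open_UNIV Lw(1,2)])
    fix \<phi> :: "real^2 \<Rightarrow> complex" and i assume \<phi>: "test_function UNIV \<phi>"
    \<comment> \<open>The weak derivative in direction \<open>i\<close> is the weak divergence of
      the field with the function in slot \<open>i\<close>; thus the same extension lemma across the
      origin serves for the gradient and for the divergence.\<close>
    define a :: "real^2 \<Rightarrow> complex^2" where "a y = (\<chi> j. if j = i then ?w y else 0)" for y
    have ca: "cdot (a y) (grad \<psi> y) = ?w y * grad \<psi> y $ i" for y \<psi>
      unfolding cdot_def a_def by (simp add: if_distrib[of "\<lambda>t. t * _"] cong: if_cong)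
    have "L2 UNIV (\<lambda>y. a y $ j)" for j
      unfolding a_def vec_lambda_beta by (cases "j = i") (use w2 in \<open>auto simp: L2_UNIV_iff\<close>)
    then have a: "L2 UNIV a" by (rule L2_componentwise) simp
    have "(LINT y|lebesgue. cdot (a y) (grad \<phi> y)) = - (LINT y|lebesgue. kpush G y $ i * \<phi> y)"
      by (rule weak_div_across_origin[OF a L1_loc_component[OF Lw(2)] _ \<phi>])
        (simp only: ca, rule kelvin_weak_gradient[OF Vc]; assumption)
    then show "(LINT y|lebesgue. ?w y * grad \<phi> y $ i) = - (LINT y|lebesgue. kpush G y $ i * \<phi> y)" unfolding ca .
  qed
  have wd: "(LINT y|lebesgue. cdot (kpush G y) (grad \<phi> y)) = - (LINT y|lebesgue. ?h y * \<phi> y)" if "test_function UNIV \<phi>" for \<phi>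
    by (rule weak_div_across_origin[OF G2 Lw(3) _ that]) (rule kelvin_weak_div[OF LV(2) Lf div]; assumption)
  have w0: "AE y in lebesgue. y \<notin> ball 0 1 \<longrightarrow> ?w y = 0"
    using AE_kelvin[OF c] AE_norm_neq_1 by eventually_elim (auto simp: norm_kelvin_less_1 not_less le_less)
  \<comment> \<open>Outside the disk the function is 0, so uniqueness of weak gradients makes the
    transported field vanish there as well.\<close>
  have "has_weak_gradient (- cball 0 1) ?w (kpush G)"
    by (rule has_weak_gradient_subset[OF wg open_UNIV]) (auto simp: open_Compl)
  moreover have "has_weak_gradient (- cball 0 1) ?w (\<lambda>y. 0)"
    by (rule has_weak_gradient_cong_AE[OF has_weak_gradient_const[of _ 0]])
      (use w0 in \<open>auto simp: open_Compl elim: eventually_mono\<close>)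
  ultimately have "AE y in lebesgue. y \<in> - cball 0 1 \<longrightarrow> kpush G y = 0"
    by (rule weak_gradient_unique) (simp add: open_Compl)
  then have G0: "AE y in lebesgue. y \<notin> ball 0 1 \<longrightarrow> kpush G y = 0"
    using AE_norm_neq_1 by eventually_elim auto
  have h0: "AE y in lebesgue. ?h y = kelvin_push f y"
    using AE_kelvin[OF f(2)] AE_norm_neq_1
  proof eventually_elim
    case (elim y)
    show ?case
    proof (cases "norm y \<le> 1")
      case False
      then show ?thesis using elim(1) norm_kelvin_less_1[of y] by (simp add: kelvin_push_eq)
    qed (simp add: kelvin_push_eq)
  qed
  define w where "w y = indicator (ball 0 1) y *\<^sub>R ?w y" for y
  define H where "H y = indicator (ball 0 1) y *\<^sub>R kpush G y" for y
  have aw: "AE y in lebesgue. ?w y = w y" using w0 by eventually_elim (auto simp: w_def indicator_def)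
  have aH: "AE y in lebesgue. kpush G y = H y" using G0 by eventually_elim (auto simp: H_def indicator_def)
  have w: "L2 UNIV w" by (rule L2_cong_AE[OF w2]) (use aw in auto)
  have H: "L2 UNIV H" by (rule L2_cong_AE[OF G2]) (use aH in auto)
  have h: "L2 UNIV (kelvin_push f)" by (rule L2_cong_AE[OF h2]) (use h0 in auto)
  have wH: "has_weak_gradient UNIV w H" by (rule has_weak_gradient_cong_AE[OF wg open_UNIV]) (use aw aH in auto)
  have z: "y \<notin> ball 0 1 \<Longrightarrow> w y = 0" "y \<notin> ball 0 1 \<Longrightarrow> H y = 0" for y by (auto simp: w_def H_def)
  have hz: "AE y in lebesgue. y \<notin> ball 0 1 \<longrightarrow> kelvin_push f y = 0"
    using AE_norm_neq_1 by eventually_elim (auto simp: kelvin_push_eq)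
  have dH: "(LINT y|lebesgue. cdot (H y) (grad \<phi> y)) = - (LINT y|lebesgue. kelvin_push f y * \<phi> y)" if "test_function UNIV \<phi>" for \<phi>
  proof -
    have 1: "AE y in lebesgue. cdot (H y) (grad \<phi> y) = cdot (kpush G y) (grad \<phi> y)" using aH by eventually_elim simp
    have 2: "AE y in lebesgue. kelvin_push f y * \<phi> y = ?h y * \<phi> y" using h0 by eventually_elim simp
    show ?thesis unfolding LINT_cong_AE[OF 1] LINT_cong_AE[OF 2] by (rule wd[OF that])
  qed
  have H1_0: "H1_0 (ball 0 1) w" by (rule zero_extension_H1_0(1)[OF w H wH z])
  have W: "AE x\<in>ball 0 1 in lebesgue. wgrad (ball 0 1) w x = H x" by (rule zero_extension_H1_0(2)[OF w H wH z])
  have "cauchy_solution f w"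
    unfolding cauchy_solution_def
  proof (intro conjI H1_0)
    show "H1 (ball 0 1) w" using H1_0 unfolding H1_0_def by blast
    show "weak_div (ball 0 1) (wgrad (ball 0 1) w) (kelvin_push f)"
      by (rule zero_extension_normal_trace(1)[OF H z(2) h hz dH W])
    show "normal_trace_0 (ball 0 1) (wgrad (ball 0 1) w) (kelvin_push f)"
      by (rule zero_extension_normal_trace(2)[OF H z(2) h hz dH W])
  qed
  then show ?thesis unfolding compatible_def by blast
qed

section \<open>Vanishing of the limit gradient on an open set\<close>

lemma AE_open_ex:
  fixes A :: "'a::euclidean_space set"
  assumes "open A" "A \<noteq> {}" "AE x in lebesgue. P x" shows "\<exists>x\<in>A. P x"
proof (rule ccontr)
  assume n: "\<not> (\<exists>x\<in>A. P x)"
  have "AE x in lebesgue. x \<notin> A" using assms(3) by eventually_elim (use n in blast)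
  then have "negligible A" unfolding negligible_iff_null_sets using assms(1) by (subst AE_iff_null_sets) auto
  then show False using open_not_negligible[OF assms(1,2)] by simp
qed

lemma AE_const_continuous:
  fixes v :: "'a::euclidean_space \<Rightarrow> complex"
  assumes A: "open A" and v: "continuous_on UNIV v" and ae: "AE x\<in>A in lebesgue. v x = k" and x: "x \<in> A"
  shows "v x = k"
proof (rule ccontr)
  assume "v x \<noteq> k"
  have "open (v -` (- {k}))" by (rule open_vimage[OF _ v]) auto
  then have "open (A \<inter> v -` (- {k}))" using A by blast
  moreover have "A \<inter> v -` (- {k}) \<noteq> {}" using x \<open>v x \<noteq> k\<close> by blast
  ultimately have "\<exists>y\<in>A \<inter> v -` (- {k}). y \<in> A \<longrightarrow> v y = k" by (rule AE_open_ex[OF _ _ ae])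
  then show False by blast
qed

text \<open>Smooth representatives exist only on balls strictly inside the disk, so for each point a
  ball is taken that also contains a point of \<open>A\<close>; unique continuation of the gradient
  works there, and the local statements are glued.\<close>

lemma weakly_harmonic_constant:
  fixes V :: "real^2 \<Rightarrow> complex"
  assumes V: "weakly_harmonic (ball 0 1) V" and A: "open A" "A \<noteq> {}" "A \<subseteq> ball 0 1" and k: "AE x\<in>A in lebesgue. V x = k"
  shows "AE x\<in>ball 0 1 in lebesgue. V x = k"
proof (rule AE_local)
  fix a :: "real^2" assume a: "a \<in> ball 0 1"
  obtain x0 where x0: "x0 \<in> A" using A(2) by blast
  \<comment> \<open>Halfway between 1 and the larger of the two norms, which leaves room for the
    mollification radius.\<close>
  define r where "r = (1 + max (norm a) (norm x0)) / 2"
  have "norm x0 < 1" "norm a < 1" using x0 A(3) a by auto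
  then have r: "r < 1" "norm a < r" "norm x0 < r" "0 < r" unfolding r_def by (auto simp: max_def intro: add_pos_nonneg)
  have sub: "cball 0 ((1 + r) / 2) \<subseteq> (ball 0 1 :: (real^2) set)" "r < (1 + r) / 2" using r by auto
  obtain v where v: "test_function UNIV v" "AE x\<in>ball 0 r in lebesgue. V x = v x" "\<And>x. x \<in> ball 0 r \<Longrightarrow> lap v x = 0"
    "\<And>x i j. grad (\<lambda>y. grad v y $ i) x $ j = grad (\<lambda>y. grad v y $ j) x $ i"
    by (rule weyl_representative[OF V sub(1) r(4) sub(2)]) blast
  let ?A = "A \<inter> ball 0 r"
  have o: "open ?A" using A(1) by blast
  have vk: "v x = k" if "x \<in> ?A" for x
  proof (rule AE_const_continuous[OF o test_function_continuous[OF v(1)] _ that])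
    show "AE x\<in>?A in lebesgue. v x = k" using v(2) k by eventually_elim auto
  qed
  have g0: "grad v x = 0" if "x \<in> ?A" for x
    by (rule grad_eqI[OF has_grad_transform_open[OF has_grad_const o that]]) (simp add: vk)
  have x0A: "x0 \<in> ?A" "x0 \<in> ball 0 r" using x0 r by auto
  have g: "grad v x = 0" if "x \<in> ball 0 r" for x
    by (rule harmonic_unique_continuation[OF v(1,3,4) o _ _ g0 that]) (use x0A in auto)
  have d: "v differentiable (at x)" for x using v(1) unfolding test_function_def by (metis Ck.simps(2))
  have "v x = k" if "x \<in> ball 0 r" for x
    using grad_zero_imp_constant[OF g d that] grad_zero_imp_constant[OF g d x0A(2)] vk[OF x0A(1)] by simp
  then have "AE x\<in>ball 0 r in lebesgue. V x = k" using v(2) by (auto elim: eventually_mono)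
  then show "\<exists>U. open U \<and> a \<in> U \<and> (AE x\<in>U in lebesgue. V x = k)" using r(2) by (intro exI[of _ "ball 0 r"]) auto
qed

text \<open>A function with zero weak gradient is weakly harmonic, so Weyl's lemma provides a smooth
  representative, whose classical gradient is 0 by uniqueness and continuity.\<close>

lemma weak_gradient_0_imp_constant:
  fixes u :: "real^2 \<Rightarrow> complex"
  assumes w: "has_weak_gradient (ball a \<rho>) u (\<lambda>x. 0)" and \<rho>: "\<rho> > 0"
  obtains k where "AE x\<in>ball a (\<rho>/2) in lebesgue. u x = k"
proof -
  have "weakly_harmonic (ball a \<rho>) u" by (rule weakly_harmonicI[OF w]) (auto simp: cdot_def)
  moreover have "cball a (2 * \<rho> / 3) \<subseteq> ball a \<rho>" using \<rho> by auto
  ultimately obtain v where v: "test_function UNIV v" "AE x\<in>ball a (\<rho>/2) in lebesgue. u x = v x"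
    by (rule weyl_representative[where R' = "\<rho>/2"]) (use \<rho> in auto)
  have "has_weak_gradient (ball a (\<rho>/2)) u (\<lambda>x. 0)"
    by (rule has_weak_gradient_subset[OF w]) (use \<rho> in auto)
  then have 0: "has_weak_gradient (ball a (\<rho>/2)) v (\<lambda>x. 0)"
    by (rule has_weak_gradient_cong_AE) (use v(2) in auto)
  have cg: "continuous_on UNIV (\<lambda>x. grad v x $ i)" for i by (rule test_function_continuous[OF test_function_grad[OF v(1)]])
  have "has_weak_gradient (ball a (\<rho>/2)) v (grad v)"
    by (rule has_weak_gradient_C1[OF open_ball test_function_has_grad[OF v(1)] continuous_on_subset[OF cg subset_UNIV]])
  then have ae: "AE x\<in>ball a (\<rho>/2) in lebesgue. grad v x = 0" by (rule weak_gradient_unique[OF _ 0 open_ball])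
  have g: "grad v x = 0" if "x \<in> ball a (\<rho>/2)" for x
  proof -
    have "grad v x $ i = 0" for i
      by (rule AE_const_continuous[OF open_ball cg _ that]) (use ae in \<open>auto elim: eventually_mono\<close>)
    then show ?thesis by (simp add: vec_eq_iff)
  qed
  have d: "v differentiable (at x)" for x using v(1) unfolding test_function_def by (metis Ck.simps(2))
  have "v x = v a" if "x \<in> ball a (\<rho>/2)" for x by (rule grad_zero_imp_constant[OF g d that])
  then have "AE x\<in>ball a (\<rho>/2) in lebesgue. u x = v a" using v(2) by (auto elim: eventually_mono)
  then show ?thesis by (rule that)
qed

text \<open>Outside the disk the reflected function is the Kelvin transform of \<open>V\<close>, so that a vanishing
  gradient there is carried over to an open subset of the disk.\<close>

lemma reflect_gradient_vanishes:
  fixes V :: "real^2 \<Rightarrow> complex"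
  assumes V: "weakly_harmonic (ball 0 1) V" "has_value_at V 0 c" and K: "has_weak_gradient UNIV (\<lambda>x. reflect V x - c) G"
    and A: "open A" "A \<noteq> {}" "AE x\<in>A in lebesgue. G x = 0"
  shows "AE x in lebesgue. norm x < 1 \<longrightarrow> V x = c"
proof -
  \<comment> \<open>The open set may cross the circle. A point off the circle has a small ball lying
    entirely on one side.\<close>
  obtain a where a: "a \<in> A" "norm a \<noteq> 1" using AE_open_ex[OF A(1,2) AE_norm_neq_1] by blast
  let ?S = "A \<inter> (if norm a < 1 then ball 0 1 else - cball 0 1)"
  have "open ?S" "a \<in> ?S" using A(1) a by (auto simp: open_Compl)
  then obtain \<rho> where \<rho>: "\<rho> > 0" "ball a \<rho> \<subseteq> ?S" using open_contains_ball by blast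
  have 1: "has_weak_gradient (ball a \<rho>) (\<lambda>x. reflect V x - c) G" by (rule has_weak_gradient_subset[OF K]) auto
  have 2: "AE x in lebesgue. x \<in> ball a \<rho> \<longrightarrow> G x = 0" using A(3) by eventually_elim (use \<rho>(2) in blast)
  have "has_weak_gradient (ball a \<rho>) (\<lambda>x. reflect V x - c) (\<lambda>x. 0)"
    by (rule has_weak_gradient_cong_AE[OF 1 open_ball _ 2]) simp
  then obtain k where k: "AE x\<in>ball a (\<rho>/2) in lebesgue. reflect V x - c = k"
    using \<rho>(1) by (rule weak_gradient_0_imp_constant) (rule that)
  have "ball a (\<rho>/2) \<subseteq> ball a \<rho>" using \<rho>(1) by (intro subset_ball) simp
  then have sub: "ball a (\<rho>/2) \<subseteq> ?S" using \<rho>(2) by blast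
  have "\<exists>B. open B \<and> B \<noteq> {} \<and> B \<subseteq> ball 0 1 \<and> (AE x\<in>B in lebesgue. V x = c + k)"
  proof (cases "norm a < 1")
    case True
    then have s: "ball a (\<rho>/2) \<subseteq> ball 0 1" using sub by auto
    have "AE x\<in>ball a (\<rho>/2) in lebesgue. V x = c + k"
      using k
    proof eventually_elim
      case (elim x)
      show ?case
      proof
        assume x: "x \<in> ball a (\<rho>/2)"
        then have "norm x < 1" using s by auto
        with elim x show "V x = c + k" by (simp add: reflect_simps algebra_simps)
      qed
    qed
    then show ?thesis using s \<rho>(1) by (intro exI[of _ "ball a (\<rho>/2)"]) auto
  next
    case False
    let ?B = "- {0} \<inter> kelvin -` ball a (\<rho>/2)"
    have s: "norm x > 1" if "x \<in> ball a (\<rho>/2)" for x using sub that False by auto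
    have B1: "open ?B" by (rule continuous_open_preimage[OF continuous_on_kelvin]) auto
    have B2: "kelvin a \<in> ?B" using \<rho>(1) s[of a] by auto
    have n: "norm x < 1" if "x \<in> ?B" for x
      using norm_kelvin_less_1[of "kelvin x"] s[of "kelvin x"] that by simp
    have B4: "AE x\<in>?B in lebesgue. V x = c + k"
      using AE_kelvin[OF k]
    proof eventually_elim
      case (elim x)
      show ?case
      proof
        assume x: "x \<in> ?B"
        then have "reflect V (kelvin x) = V x" using s[of "kelvin x"] by (simp add: reflect_simps)
        with elim x show "V x = c + k" by (simp add: algebra_simps)
      qed
    qed
    have "?B \<noteq> {}" using B2 by blast
    moreover have "?B \<subseteq> ball 0 1"
    proof
      fix x assume "x \<in> ?B"
      then show "x \<in> ball 0 1" unfolding mem_ball dist_0_norm by (rule n)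
    qed
    ultimately show ?thesis using B1 B4 by (intro exI[of _ ?B] conjI)
  qed
  then obtain B where B: "open B" "B \<noteq> {}" "B \<subseteq> ball 0 1" "AE x\<in>B in lebesgue. V x = c + k" by blast
  have V1: "AE x\<in>ball 0 1 in lebesgue. V x = c + k" by (rule weakly_harmonic_constant[OF V(1) B])
  then have "has_value_at V 0 (c + k)"
    unfolding has_value_at_def by (intro exI[of _ 1] conjI exI[of _ "\<lambda>x. c + k"]) auto
  \<comment> \<open>The constant is pinned down at the origin, where \<open>V\<close> has the value
    \<open>c\<close>.\<close>
  then have "c + k = c" by (rule has_value_at_unique) (rule V(2))
  then show ?thesis using V1 by simp
qed

section \<open>Asymptotics of the energy\<close>

lemma norm_smult_vec: "norm (a *s v) = norm a * norm (v :: complex^'n)"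
proof -
  have "(norm (a *s v))\<^sup>2 = (norm a * norm v)\<^sup>2"
    unfolding norm_vec_power2 power_mult_distrib by (simp add: norm_mult power_mult_distrib sum_distrib_left)
  then show ?thesis by (rule power2_eq_imp_eq) auto
qed

lemma smult_measurable:
  fixes P :: "real^'n \<Rightarrow> complex^'m"
  assumes "P \<in> borel_measurable lebesgue" shows "(\<lambda>x. a *s P x) \<in> borel_measurable lebesgue"
proof -
  have "linear (\<lambda>v :: complex^'m. a *s v)" by (intro linearI) (auto simp: vec_eq_iff algebra_simps)
  then have "continuous_on UNIV (\<lambda>v :: complex^'m. a *s v)" by (simp add: linear_continuous_on linear_conv_bounded_linear)
  from borel_measurable_continuous_on[OF this assms] show ?thesis .
qed

text \<open>After multiplication by delta the gradients are P times delta plus Q times a factor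
  tending to -2i. All bounds come from the triangle inequality in squared form, so neither limit is
  computed.\<close>

lemma energy_limits:
  fixes P Q :: "real^2 \<Rightarrow> complex^2"
  assumes P: "L2 UNIV P" and Q: "L2 UNIV Q" and A: "open A"
    and W: "\<And>\<delta>. 0 < \<delta> \<Longrightarrow> \<delta> < 1 \<Longrightarrow> AE x in lebesgue. wgrad UNIV (u \<delta>) x = P x + (2 / (\<i> * of_real \<delta>) - 1) *s Q x"
    and nz: "\<not> (AE x\<in>A in lebesgue. Q x = 0)"
  defines "F \<equiv> \<lambda>\<delta>. ennreal (\<delta>\<^sup>2) * energy A (u \<delta>)"
  shows "0 < Liminf (at_right 0) F" "Liminf (at_right 0) F \<le> Limsup (at_right 0) F" "Limsup (at_right 0) F < \<infinity>"
proof -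
  let ?S = "\<lambda>\<delta> x. P x + (2 / (\<i> * of_real \<delta>) - 1) *s Q x"
  have Pm: "P \<in> borel_measurable lebesgue" "integrable lebesgue (\<lambda>x. (norm (P x))\<^sup>2)" using P unfolding L2_UNIV_iff by auto
  have Qm: "Q \<in> borel_measurable lebesgue" "integrable lebesgue (\<lambda>x. (norm (Q x))\<^sup>2)" using Q unfolding L2_UNIV_iff by auto
  have As: "A \<in> sets lebesgue" using A by auto
  \<comment> \<open>Delta times the gradient: delta (2 / (i delta) - 1) is -2i - delta, which
    removes the singular coefficient.\<close>
  define R where "R \<delta> x = of_real \<delta> *s P x + (- (2 * \<i>) - of_real \<delta>) *s Q x" for \<delta> :: real and x
  define E where "E \<delta> = (LINT x|lebesgue. indicator A x *\<^sub>R (norm (R \<delta> x))\<^sup>2)" for \<delta>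
  have Rm: "R \<delta> \<in> borel_measurable lebesgue" for \<delta>
    unfolding R_def[abs_def] by (intro borel_measurable_add smult_measurable Pm Qm)
  \<comment> \<open>For delta below 1 the coefficient of \<open>Q\<close> has norm at most 3;
    squaring and doubling gives 18.\<close>
  have Rb: "(norm (R \<delta> x))\<^sup>2 \<le> 2 * (norm (P x))\<^sup>2 + 18 * (norm (Q x))\<^sup>2" if "0 < \<delta>" "\<delta> < 1" for \<delta> x
  proof -
    have "norm (- (2 * \<i>) - of_real \<delta>) \<le> norm (- (2 * \<i>)) + norm (complex_of_real \<delta>)" by (rule norm_triangle_ineq4)
    also have "\<dots> \<le> 3" using that by (simp add: norm_mult)
    finally have 1: "norm (- (2 * \<i>) - of_real \<delta>) * norm (Q x) \<le> 3 * norm (Q x)" by (rule mult_right_mono) simp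
    have "\<delta> * norm (P x) \<le> 1 * norm (P x)" using that by (intro mult_right_mono) auto
    then have 2: "norm (complex_of_real \<delta>) * norm (P x) \<le> norm (P x)" using that by simp
    have "(norm (R \<delta> x))\<^sup>2 \<le> 2 * (norm (complex_of_real \<delta>) * norm (P x))\<^sup>2 + 2 * (norm (- (2 * \<i>) - of_real \<delta>) * norm (Q x))\<^sup>2"
      unfolding R_def norm_smult_vec[symmetric] by (rule norm_add_power2_le)
    also have "\<dots> \<le> 2 * (norm (P x))\<^sup>2 + 2 * (3 * norm (Q x))\<^sup>2"
      by (intro add_mono mult_left_mono power_mono 1 2) auto
    finally show ?thesis by (simp add: power_mult_distrib)
  qed
  have Bi: "integrable lebesgue (\<lambda>x. 2 * (norm (P x))\<^sup>2 + 18 * (norm (Q x))\<^sup>2)" using Pm Qm by simp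
  have Ri: "integrable lebesgue (\<lambda>x. (norm (R \<delta> x))\<^sup>2)" if "0 < \<delta>" "\<delta> < 1" for \<delta>
  proof (rule Bochner_Integration.integrable_bound[OF Bi])
    show "(\<lambda>x. (norm (R \<delta> x))\<^sup>2) \<in> borel_measurable lebesgue" using Rm by measurable
    show "AE x in lebesgue. norm ((norm (R \<delta> x))\<^sup>2) \<le> norm (2 * (norm (P x))\<^sup>2 + 18 * (norm (Q x))\<^sup>2)"
      using Rb[OF that] by simp
  qed
  note Ai = integrable_mult_indicator[OF As]
  have FE: "F \<delta> = ennreal (E \<delta>)" if d: "0 < \<delta>" "\<delta> < 1" for \<delta>
  proof -
    have m: "(\<lambda>x. ennreal ((norm (?S \<delta> x))\<^sup>2) * indicator A x) \<in> borel_measurable lebesgue"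
    proof -
      have "(\<lambda>x. ?S \<delta> x) \<in> borel_measurable lebesgue"
        by (intro borel_measurable_add smult_measurable Pm Qm)
      then show ?thesis using As by measurable
    qed
    have "energy A (u \<delta>) = (\<integral>\<^sup>+x. ennreal ((norm (?S \<delta> x))\<^sup>2) * indicator A x \<partial>lebesgue)"
      unfolding energy_def by (rule nn_integral_cong_AE) (use W[OF d] in \<open>auto elim: eventually_mono\<close>)
    then have "F \<delta> = (\<integral>\<^sup>+x. ennreal (\<delta>\<^sup>2) * (ennreal ((norm (?S \<delta> x))\<^sup>2) * indicator A x) \<partial>lebesgue)"
      unfolding F_def using nn_integral_cmult[OF m] by simp
    also have "\<dots> = (\<integral>\<^sup>+x. ennreal (indicator A x *\<^sub>R (norm (R \<delta> x))\<^sup>2) \<partial>lebesgue)"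
    proof (rule nn_integral_cong)
      fix x
      have "of_real \<delta> * (2 / (\<i> * of_real \<delta>) - 1) = - (2 * \<i>) - complex_of_real \<delta>"
        using d by (simp add: field_simps)
      then have "R \<delta> x = of_real \<delta> *s (?S \<delta> x)"
        unfolding R_def by (simp only: vector_add_ldistrib vector_smult_assoc)
      then have "(norm (R \<delta> x))\<^sup>2 = \<delta>\<^sup>2 * (norm (?S \<delta> x))\<^sup>2"
        by (simp only: norm_smult_vec power_mult_distrib norm_of_real power2_abs)
      then show "ennreal (\<delta>\<^sup>2) * (ennreal ((norm (?S \<delta> x))\<^sup>2) * indicator A x) = ennreal (indicator A x *\<^sub>R (norm (R \<delta> x))\<^sup>2)"
        by (simp add: indicator_def ennreal_mult)
    qed
    also have "\<dots> = ennreal (E \<delta>)" unfolding E_def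
      by (rule nn_integral_eq_integral[OF Ai[OF Ri[OF d]]]) simp
    finally show ?thesis .
  qed
  have near: "eventually (\<lambda>\<delta>::real. 0 < \<delta> \<and> \<delta> < t) (at_right 0)" if "t > 0" for t
    using eventually_at_right[of 0 t] that by (intro eventually_conj eventually_at_right_less) (auto simp: eventually_at_right_field)
  show "Limsup (at_right 0) F < \<infinity>"
  proof -
    let ?M = "LINT x|lebesgue. 2 * (norm (P x))\<^sup>2 + 18 * (norm (Q x))\<^sup>2"
    have "eventually (\<lambda>\<delta>. F \<delta> \<le> ennreal ?M) (at_right 0)"
      using near[of 1, OF zero_less_one]
    proof eventually_elim
      case (elim \<delta>)
      then have d: "0 < \<delta>" "\<delta> < 1" by auto
      have "E \<delta> \<le> ?M" unfolding E_def
      proof (rule integral_mono[OF Ai[OF Ri[OF d]] Bi])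
        show "indicator A x *\<^sub>R (norm (R \<delta> x))\<^sup>2 \<le> 2 * (norm (P x))\<^sup>2 + 18 * (norm (Q x))\<^sup>2" for x
          using Rb[OF d, of x] by (auto simp: indicator_def)
      qed
      then show ?case unfolding FE[OF d] by (rule ennreal_leI)
    qed
    then have "Limsup (at_right 0) F \<le> ennreal ?M" by (rule Limsup_bounded)
    then show ?thesis by (rule le_less_trans) simp
  qed
  show "Liminf (at_right 0) F \<le> Limsup (at_right 0) F" by (rule Liminf_le_Limsup) simp
  show "0 < Liminf (at_right 0) F"
  proof -
    define e where "e = (LINT x|lebesgue. indicator A x *\<^sub>R (norm (Q x))\<^sup>2)"
    define D where "D = (LINT x|lebesgue. (norm (P x - Q x))\<^sup>2)"
    have "e \<noteq> 0"
    proof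
      assume "e = 0"
      then have "AE x in lebesgue. indicator A x *\<^sub>R (norm (Q x))\<^sup>2 = 0"
        unfolding e_def using integral_nonneg_eq_0_iff_AE[OF Ai[OF Qm(2)]] by simp
      then have "AE x\<in>A in lebesgue. Q x = 0" by eventually_elim auto
      with nz show False by simp
    qed
    moreover have "e \<ge> 0" unfolding e_def by simp
    ultimately have e: "e > 0" by simp
    have D0: "D \<ge> 0" unfolding D_def by simp
    have Di: "integrable lebesgue (\<lambda>x. (norm (P x - Q x))\<^sup>2)"
    proof (rule Bochner_Integration.integrable_bound)
      show "integrable lebesgue (\<lambda>x. 2 * (norm (P x))\<^sup>2 + 2 * (norm (Q x))\<^sup>2)" using Pm Qm by simp
      show "(\<lambda>x. (norm (P x - Q x))\<^sup>2) \<in> borel_measurable lebesgue" using Pm Qm by measurable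
      show "AE x in lebesgue. norm ((norm (P x - Q x))\<^sup>2) \<le> norm (2 * (norm (P x))\<^sup>2 + 2 * (norm (Q x))\<^sup>2)"
        using norm_add_power2_le[of "P _" "- Q _"] by simp
    qed
    \<comment> \<open>Chosen so that delta^2 D is at most \<open>e\<close> for delta below
      \<open>t\<close>; the 1 avoids a zero denominator.\<close>
    define t where "t = min 1 (e / (D + 1))"
    have t: "t > 0" unfolding t_def using e D0 by simp
    have "eventually (\<lambda>\<delta>. ennreal e \<le> F \<delta>) (at_right 0)"
      using near[OF t]
    proof eventually_elim
      case (elim \<delta>)
      then have d: "0 < \<delta>" "\<delta> < 1" "\<delta> < e / (D + 1)" by (auto simp: t_def)
      have "4 * e = (LINT x|lebesgue. indicator A x *\<^sub>R (4 * (norm (Q x))\<^sup>2))"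
        unfolding e_def by (subst integral_mult_right_zero[symmetric]) (simp add: mult.left_commute)
      also have "\<dots> \<le> (LINT x|lebesgue. 2 * (indicator A x *\<^sub>R (norm (R \<delta> x))\<^sup>2) + 2 * \<delta>\<^sup>2 * (norm (P x - Q x))\<^sup>2)"
      proof (rule integral_mono)
        show "integrable lebesgue (\<lambda>x. indicator A x *\<^sub>R (4 * (norm (Q x))\<^sup>2))" by (rule Ai[OF integrable_mult_right[OF Qm(2)]])
        show "integrable lebesgue (\<lambda>x. 2 * (indicator A x *\<^sub>R (norm (R \<delta> x))\<^sup>2) + 2 * \<delta>\<^sup>2 * (norm (P x - Q x))\<^sup>2)"
          by (intro Bochner_Integration.integrable_add integrable_mult_right Ai Ri d Di)
        fix x
        \<comment> \<open>Solving the definition of \<open>R\<close> for \<open>Q\<close> gives 4e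
          at most 2E + 2 delta^2 D, hence E at least e for small delta.\<close>
        have "(2 * \<i>) *s Q x = - R \<delta> x + of_real \<delta> *s (P x - Q x)" by (simp add: R_def vec_eq_iff algebra_simps)
        then have "(norm ((2 * \<i>) *s Q x))\<^sup>2 \<le> 2 * (norm (- R \<delta> x))\<^sup>2 + 2 * (norm (of_real \<delta> *s (P x - Q x)))\<^sup>2"
          by (simp only: norm_add_power2_le)
        then have "4 * (norm (Q x))\<^sup>2 \<le> 2 * (norm (R \<delta> x))\<^sup>2 + 2 * \<delta>\<^sup>2 * (norm (P x - Q x))\<^sup>2"
          by (simp only: norm_smult_vec norm_minus_cancel norm_of_real power_mult_distrib power2_abs norm_mult norm_ii) (simp add: mult.assoc)
        then show "indicator A x *\<^sub>R (4 * (norm (Q x))\<^sup>2) \<le> 2 * (indicator A x *\<^sub>R (norm (R \<delta> x))\<^sup>2) + 2 * \<delta>\<^sup>2 * (norm (P x - Q x))\<^sup>2"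
          by (simp add: indicator_def)
      qed
      also have "\<dots> = 2 * E \<delta> + 2 * \<delta>\<^sup>2 * D" unfolding E_def D_def
        using Ai[OF Ri[OF d(1,2)]] Di by (subst Bochner_Integration.integral_add) auto
      finally have 4: "4 * e \<le> 2 * E \<delta> + 2 * \<delta>\<^sup>2 * D" .
      have "\<delta>\<^sup>2 * D \<le> \<delta> * D" using d D0 by (intro mult_right_mono) (auto simp: power2_eq_square mult_le_cancel_left1)
      also have "\<dots> \<le> \<delta> * (D + 1)" using d by simp
      also have "\<dots> \<le> e" using d(3) D0 by (simp add: pos_less_divide_eq)
      finally have "e \<le> E \<delta>" using 4 by linarith
      then show ?case unfolding FE[OF d(1,2)] by (rule ennreal_leI)
    qed
    then have le: "ennreal e \<le> Liminf (at_right 0) F" by (rule Liminf_bounded)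
    have "0 < ennreal e" using e by simp
    then show ?thesis using le by (rule less_le_trans)
  qed
qed

lemma L2_cmult:
  fixes u :: "real^'n \<Rightarrow> complex"
  assumes "L2 D u" shows "L2 D (\<lambda>x. a * u x)"
  using assms unfolding L2_def by (auto simp: norm_mult power_mult_distrib)

lemma L2_lincomb:
  fixes u v :: "real^'n \<Rightarrow> complex"
  assumes "L2 D u" "L2 D v" shows "L2 D (\<lambda>x. a * u x + b * v x)"
  using L2_diff[OF L2_cmult[OF assms(1), of a] L2_cmult[OF assms(2), of "- b"]] by simp

lemma L2_smult_lincomb:
  fixes G H :: "real^'n \<Rightarrow> complex^'m"
  assumes "L2 UNIV G" "L2 UNIV H" shows "L2 UNIV (\<lambda>x. a *s G x + b *s H x)"
  by (rule L2_componentwise) (auto intro!: L2_lincomb L2_component assms)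

text \<open>\<open>V\<close> and its reflection minus \<open>c\<close> are recovered from the
  solutions at delta = 1/2 and delta = 1/4, so their weak gradients are square integrable because
  those of the solutions are.\<close>

lemma not_compatible_case:
  assumes f: "L2 UNIV f" "AE x in lebesgue. norm x < 1 \<longrightarrow> f x = 0" "AE x in lebesgue. norm x > R \<longrightarrow> f x = 0"
    and sol: "\<And>\<delta>. 0 < \<delta> \<Longrightarrow> \<delta> < 1 \<Longrightarrow> is_solution \<delta> f (u \<delta>)" and nc: "\<not> compatible f"
    and A: "open A" "A \<noteq> {}"
  defines "F \<equiv> \<lambda>\<delta>. ennreal (\<delta>\<^sup>2) * energy A (u \<delta>)"
  shows "0 < Liminf (at_right 0) F \<and> Liminf (at_right 0) F \<le> Limsup (at_right 0) F \<and> Limsup (at_right 0) F < \<infinity>"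
proof -
  have Lf: "L1_loc UNIV f" by (rule L2_imp_L1_loc[OF f(1)]) simp
  obtain V c where V: "L1_loc UNIV V" "tends_to_0_at_infinity V" "has_value_at V 0 c"
    "\<And>\<phi>. test_function UNIV \<phi> \<Longrightarrow> (LINT x|lebesgue. V x * lap \<phi> x) = (LINT x|lebesgue. f x * \<phi> x)"
    "\<And>\<delta>. 0 < \<delta> \<Longrightarrow> \<delta> < 1 \<Longrightarrow> AE x in lebesgue. u \<delta> x = V x + (2 / (\<i> * of_real \<delta>) - 1) * (reflect V x - c)"
    using solutions_representation[OF Lf f(2) sol] by blast
  \<comment> \<open>The coefficient 2 / (i delta) - 1 is -4i - 1 at 1/2 and -8i - 1 at 1/4. The
    difference of the two solutions is therefore 4i times \<open>?K\<close>.\<close>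
  let ?K = "\<lambda>x. reflect V x - c" and ?u = "u (1/2)" and ?v = "u (1/4)"
  have s: "is_solution (1/2) f ?u" "is_solution (1/4) f ?v" by (rule sol, simp, simp)+
  have a: "AE x in lebesgue. ?u x = V x + (- 4 * \<i> - 1) * ?K x" "AE x in lebesgue. ?v x = V x + (- 8 * \<i> - 1) * ?K x"
    using V(5)[of "1/2"] V(5)[of "1/4"] by (auto simp: field_simps)
  have aK: "AE x in lebesgue. (1 / (4 * \<i>)) * ?u x + (- (1 / (4 * \<i>))) * ?v x = ?K x"
    using a
  proof eventually_elim
    case (elim x)
    have "?u x - ?v x = 4 * \<i> * ?K x" unfolding elim by (simp add: algebra_simps)
    moreover have "(1 / (4 * \<i>)) * ?u x + (- (1 / (4 * \<i>))) * ?v x = (1 / (4 * \<i>)) * (?u x - ?v x)"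
      by (simp only: right_diff_distrib mult_minus_left add_uminus_conv_diff)
    ultimately show ?case by simp
  qed
  have aV: "AE x in lebesgue. 1 * ?u x + (4 * \<i> + 1) * ?K x = V x"
    using a(1) by eventually_elim (simp add: algebra_simps)
  note S1 = solution_facts[OF s(1) Lf] and S2 = solution_facts[OF s(2) Lf]
  define Q where "Q x = (1 / (4 * \<i>)) *s wgrad UNIV ?u x + (- (1 / (4 * \<i>))) *s wgrad UNIV ?v x" for x
  define P where "P x = 1 *s wgrad UNIV ?u x + (4 * \<i> + 1) *s Q x" for x
  have W: "L2 UNIV (wgrad UNIV ?u)" "L2 UNIV (wgrad UNIV ?v)" "has_weak_gradient UNIV ?u (wgrad UNIV ?u)" "has_weak_gradient UNIV ?v (wgrad UNIV ?v)"
    using S1(1,2) S2(1,2) by auto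
  have Q: "L2 UNIV Q" unfolding Q_def[abs_def] by (rule L2_smult_lincomb[OF W(1,2)])
  have P: "L2 UNIV P" unfolding P_def[abs_def] by (rule L2_smult_lincomb[OF W(1) Q])
  have "has_weak_gradient UNIV (\<lambda>x. (1 / (4 * \<i>)) * ?u x + (- (1 / (4 * \<i>))) * ?v x) Q"
    unfolding Q_def[abs_def] by (rule has_weak_gradient_lincomb[OF W(3,4) open_UNIV])
  then have wK: "has_weak_gradient UNIV ?K Q"
    by (rule has_weak_gradient_cong_AE[OF _ open_UNIV]) (use aK in auto)
  have "has_weak_gradient UNIV (\<lambda>x. 1 * ?u x + (4 * \<i> + 1) * ?K x) P"
    unfolding P_def[abs_def] by (rule has_weak_gradient_lincomb[OF W(3) wK open_UNIV])
  then have wV: "has_weak_gradient UNIV V P"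
    by (rule has_weak_gradient_cong_AE[OF _ open_UNIV]) (use aV in auto)
  have K2: "L2 K V" if "compact K" for K
  proof -
    have "L2 K ?u" "L2 K ?v" using S1(5) S2(5) that by auto
    from L2_lincomb[OF this, of "1 + (4 * \<i> + 1) * (1 / (4 * \<i>))" "(4 * \<i> + 1) * (- (1 / (4 * \<i>)))"]
    show ?thesis
    proof (rule L2_cong_AE)
      show "K \<in> sets lebesgue" using that by (simp add: compact_imp_closed lmeasurable_compact fmeasurableD)
      show "AE x\<in>K in lebesgue. (1 + (4 * \<i> + 1) * (1 / (4 * \<i>))) * ?u x + (4 * \<i> + 1) * (- (1 / (4 * \<i>))) * ?v x = V x"
        using aK aV
      proof eventually_elim
        case (elim x)
        show ?case unfolding elim(2)[symmetric] elim(1)[symmetric] by (simp add: algebra_simps)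
      qed
    qed
  qed
  have wh: "weakly_harmonic (ball 0 1) V"
    unfolding weakly_harmonic_def
  proof (intro conjI allI impI)
    show "L1_loc (ball 0 1) V" using V(1) unfolding L1_loc_def by blast
    fix \<phi> :: "real^2 \<Rightarrow> complex" assume \<phi>: "test_function (ball 0 1) \<phi>"
    obtain K where K: "K \<subseteq> ball 0 1" "\<And>x. x \<notin> K \<Longrightarrow> \<phi> x = 0" using test_functionE[OF \<phi>] by metis
    have "AE x in lebesgue. f x * \<phi> x = 0 * indicator UNIV x"
      using f(2)
    proof eventually_elim
      case (elim x)
      show ?case
      proof (cases "x \<in> K")
        case True
        then have "norm x < 1" using K(1) by auto
        then show ?thesis using elim by simp
      qed (simp add: K(2))
    qed
    from LINT_cong_AE[OF this] show "(LINT x|lebesgue. V x * lap \<phi> x) = 0"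
      unfolding V(4)[OF test_function_subset[OF \<phi> subset_UNIV]] by simp
  qed
  have nz: "\<not> (AE x\<in>A in lebesgue. Q x = 0)"
  proof
    assume "AE x\<in>A in lebesgue. Q x = 0"
    then have c: "AE x in lebesgue. norm x < 1 \<longrightarrow> V x = c" by (rule reflect_gradient_vanishes[OF wh V(3) wK A])
    have "compatible f" by (rule compatible_if_constant_in_disk[OF f wV P K2 V(2,4) c])
    with nc show False by simp
  qed
  have Wd: "AE x in lebesgue. wgrad UNIV (u \<delta>) x = P x + (2 / (\<i> * of_real \<delta>) - 1) *s Q x" if "0 < \<delta>" "\<delta> < 1" for \<delta>
  proof -
    have "has_weak_gradient UNIV (\<lambda>x. 1 * V x + (2 / (\<i> * of_real \<delta>) - 1) * ?K x) (\<lambda>x. 1 *s P x + (2 / (\<i> * of_real \<delta>) - 1) *s Q x)"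
      by (rule has_weak_gradient_lincomb[OF wV wK open_UNIV])
    then have "has_weak_gradient UNIV (u \<delta>) (\<lambda>x. 1 *s P x + (2 / (\<i> * of_real \<delta>) - 1) *s Q x)"
      by (rule has_weak_gradient_cong_AE[OF _ open_UNIV]) (use V(5)[OF that] in \<open>auto elim: eventually_mono\<close>)
    from wgrad_eq[OF this open_UNIV] show ?thesis by simp
  qed
  show ?thesis unfolding F_def using energy_limits[OF P Q A(1) Wd nz] by blast
qed

theorem theorem2:
  fixes f :: "real^2 \<Rightarrow> complex" and u :: "real \<Rightarrow> real^2 \<Rightarrow> complex"
  assumes "L2 UNIV f"
    and "compact (ess_supp f)" and "ess_supp f \<subseteq> - ball 0 1"
    and "(LINT x|lebesgue. f x) = 0"
    and "\<And>\<delta>. 0 < \<delta> \<Longrightarrow> \<delta> < 1 \<Longrightarrow> is_solution \<delta> f (u \<delta>)"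
  shows "(compatible f \<longrightarrow>
            (\<forall>w. cauchy_solution f w \<longrightarrow>
               (\<exists>w0. has_value_at w 0 w0 \<and>
                  (\<forall>\<delta>. 0 < \<delta> \<and> \<delta> < 1 \<longrightarrow>
                     (AE x in lebesgue.
                        u \<delta> x = (if x \<in> ball 0 1 then - w0 else w (kelvin x) - w0)))))) \<and>
         (\<not> compatible f \<longrightarrow>
            (\<forall>A. open A \<and> A \<noteq> {} \<longrightarrow>
               0 < Liminf (at_right 0) (\<lambda>\<delta>. ennreal (\<delta>\<^sup>2) * energy A (u \<delta>)) \<and>
               Liminf (at_right 0) (\<lambda>\<delta>. ennreal (\<delta>\<^sup>2) * energy A (u \<delta>))
                 \<le> Limsup (at_right 0) (\<lambda>\<delta>. ennreal (\<delta>\<^sup>2) * energy A (u \<delta>)) \<and>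
               Limsup (at_right 0) (\<lambda>\<delta>. ennreal (\<delta>\<^sup>2) * energy A (u \<delta>)) < \<infinity>))"
proof -
  have sup: "AE x in lebesgue. x \<notin> ess_supp f \<longrightarrow> f x = 0" by (rule AE_outside_ess_supp)
  obtain R where R: "\<And>x. x \<in> ess_supp f \<Longrightarrow> norm x \<le> R"
    using compact_imp_bounded[OF assms(2)] unfolding bounded_iff by blast
  have f1: "AE x in lebesgue. norm x < 1 \<longrightarrow> f x = 0"
    using sup by eventually_elim (use assms(3) in auto)
  have f2: "AE x in lebesgue. norm x > R \<longrightarrow> f x = 0"
    using sup by eventually_elim (use R in \<open>auto simp: not_le[symmetric]\<close>)
  have L: "L1_loc UNIV f" by (rule L2_imp_L1_loc[OF assms(1)]) simp
  show ?thesis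
  proof (intro conjI[of "_ \<longrightarrow> _" "_ \<longrightarrow> _"] impI allI)
    fix w assume w: "cauchy_solution f w"
    show "\<exists>w0. has_value_at w 0 w0 \<and> (\<forall>\<delta>. 0 < \<delta> \<and> \<delta> < 1 \<longrightarrow>
        (AE x in lebesgue. u \<delta> x = (if x \<in> ball 0 1 then - w0 else w (kelvin x) - w0)))"
      by (rule compatible_case[OF L f1 f2 assms(5) w])
  next
    fix A :: "(real^2) set" assume "\<not> compatible f" "open A \<and> A \<noteq> {}"
    then show "0 < Liminf (at_right 0) (\<lambda>\<delta>. ennreal (\<delta>\<^sup>2) * energy A (u \<delta>)) \<and>
        Liminf (at_right 0) (\<lambda>\<delta>. ennreal (\<delta>\<^sup>2) * energy A (u \<delta>))
          \<le> Limsup (at_right 0) (\<lambda>\<delta>. ennreal (\<delta>\<^sup>2) * energy A (u \<delta>)) \<and>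
        Limsup (at_right 0) (\<lambda>\<delta>. ennreal (\<delta>\<^sup>2) * energy A (u \<delta>)) < \<infinity>"
      using not_compatible_case[OF assms(1) f1 f2 assms(5)] by blast
  qed
qed

end
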